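(* Let $K$ be an algebraically closed field of characteristic $p>0$. Let $f\in\mathfrak m^2\subset K[[x]]$ be a univariate formal power series, where $\mathfrak m=\langle x\rangle$, such that its Milnor number $\mu:=\mu(f)$ is finite. Then $$\mathcal R\text{-}\mathrm{mod}(f)=[\mu/p],$$ the integer part of $\mu/p$. In particular, $f$ is right simple if and only if $\mu<p$, and then $f\sim_r x^{\mu+1}$.
   Context: Notation for $K[[\mathbf x]]=K[[x_1,\dots,x_n]]$ (here $n=1$), with maximal ideal $\mathfrak m$. The Milnor number is $\mu(f)=\dim_K K[[\mathbf x]]/j(f)$, with $j(f)$ the ideal generated by all partial derivatives of $f$. The right group is $\mathcal R=\mathrm{Aut}_K(K[[\mathbf x]])$; $f\sim_r g$ (right equivalent) means $g=\Phi(f)$ for some $\Phi\in\mathcal R$. Let $J_k:=\mathfrak m/\mathfrak m^{k+1}$ (an affine space), $j^k f$ the class of $f\in\mathfrak m$ in $J_k$, and $\mathcal R_k$ the affine algebraic group of $k$-jets $\Phi_k=(j^k\Phi(x_1),\dots,j^k\Phi(x_n))$ of elements $\Phi\in\mathcal R$, acting algebraically on $J_k$ by $\Phi_k\cdot j^kf=j^k(\Phi(f))$. Varieties are separated schemes of finite type over $K$, points are closed points. For an algebraic group $H$ acting on a variety $X$, a Rosenlicht stratification is a finite disjoint decomposition $X=X_1\cup\dots\cup X_s$ into $H$-invariant locally closed subvarieties, $X_i$ open dense in $X\setminus(X_1\cup\dots\cup X_{i-1})$, such that each $X_i$ has a geometric quotient $p_i:X_i\to X_i/H$ which is a variety (it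 always exists). For $U\subset X$ open put $H\text{-}\mathrm{mod}(U)=\max_i\dim p_i(U\cap X_i)$, and for $x\in X$ put $H\text{-}\mathrm{mod}(x)=\min\{H\text{-}\mathrm{mod}(U): U \text{ an open neighbourhood of }x\}$; these are independent of the stratification. A series $g\in\mathfrak m$ is right $k$-determined if every $h\in\mathfrak m$ with $j^kh=j^kg$ satisfies $h\sim_r g$. An integer $k$ is sufficiently large for $f$ w.r.t. $\mathcal R$ if there is a neighbourhood $U$ of $j^kf$ in $J_k$ such that every $g\in\mathfrak m$ with $j^kg\in U$ is right $k$-determined. For $f\in\mathfrak m$ with $\mu(f)<\infty$, the right modality $\mathcal R\text{-}\mathrm{mod}(f)$ is the $\mathcal R_k$-modality of the point $j^kf$ in $J_k$ for $k$ sufficiently large (such $k$ exist and the value is independent of $k$). $f$ is right simple if $\mathcal R\text{-}\mathrm{mod}(f)=0$. *)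

theory Defs
  imports
    "HOL-Analysis.Abstract_Topology"
    "HOL-Computational_Algebra.Computational_Algebra"
    "HOL-Library.Extended_Nat"
begin

section \<open>Varieties\<close>

text \<open>
  Over an algebraically closed field a (reduced) variety is determined by its closed points, its
  Zariski topology and its sheaf of regular functions, so varieties are rendered as spaces with
  functions: \<open>regular X U\<close> is the set of functions that are regular on the open set \<open>U\<close>.
  Functions are total in HOL; their values outside \<open>U\<close> are irrelevant (first clause of
  \<open>sheaf_of_functions\<close>).
\<close>

record ('x, 'k) fun_space =
  topol :: "'x topology"
  regular :: "'x set \<Rightarrow> ('x \<Rightarrow> 'k) set"

abbreviation points :: "('x, 'k) fun_space \<Rightarrow> 'x set" where
  "points X \<equiv> topspace (topol X)"

definition sheaf_of_functions :: "('x, 'k::field) fun_space \<Rightarrow> bool" where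
  "sheaf_of_functions X \<longleftrightarrow>
     (\<forall>U. openin (topol X) U \<longrightarrow>
        (\<forall>\<phi> \<psi>. \<phi> \<in> regular X U \<and> (\<forall>x\<in>U. \<psi> x = \<phi> x) \<longrightarrow> \<psi> \<in> regular X U) \<and>
        (\<forall>\<phi>. \<phi> \<in> regular X U \<longleftrightarrow>
           (\<forall>x\<in>U. \<exists>W. openin (topol X) W \<and> x \<in> W \<and> W \<subseteq> U \<and> \<phi> \<in> regular X W)) \<and>
        (\<forall>c. (\<lambda>x. c) \<in> regular X U) \<and>
        (\<forall>\<phi>\<in>regular X U. \<forall>\<psi>\<in>regular X U.
           (\<lambda>x. \<phi> x + \<psi> x) \<in> regular X U \<and> (\<lambda>x. \<phi> x * \<psi> x) \<in> regular X U))"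

definition is_morphism ::
    "('x, 'k) fun_space \<Rightarrow> ('y, 'k) fun_space \<Rightarrow> ('x \<Rightarrow> 'y) \<Rightarrow> bool" where
  "is_morphism X Y p \<longleftrightarrow>
     continuous_map (topol X) (topol Y) p \<and>
     (\<forall>V. openin (topol Y) V \<longrightarrow>
        (\<forall>\<phi>\<in>regular Y V. \<phi> \<circ> p \<in> regular X {x \<in> points X. p x \<in> V}))"

definition isomorphic_spaces :: "('x, 'k) fun_space \<Rightarrow> ('y, 'k) fun_space \<Rightarrow> bool" where
  "isomorphic_spaces X Y \<longleftrightarrow>
     (\<exists>p q. is_morphism X Y p \<and> is_morphism Y X q \<and>
        (\<forall>x\<in>points X. q (p x) = x) \<and> (\<forall>y\<in>points Y. p (q y) = y))"

text \<open>The structure induced on a locally closed subset \<open>A\<close> (for closed \<open>A\<close>: the reduced one).\<close>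

definition induced_space :: "('x, 'k) fun_space \<Rightarrow> 'x set \<Rightarrow> ('x, 'k) fun_space" where
  "induced_space X A =
     \<lparr>topol = subtopology (topol X) A,
      regular = (\<lambda>U. {\<phi>. \<forall>a\<in>U. \<exists>W. openin (topol X) W \<and> a \<in> W \<and> W \<inter> A \<subseteq> U \<and>
                      (\<exists>\<psi>\<in>regular X W. \<forall>w\<in>W \<inter> A. \<phi> w = \<psi> w)})\<rparr>"

text \<open>Affine space with coordinates indexed by a finite set \<open>I\<close> of natural numbers: its points
  are the vectors supported in \<open>I\<close>.\<close>

inductive_set polyfun :: "nat set \<Rightarrow> ((nat \<Rightarrow> 'k::field) \<Rightarrow> 'k) set" for I :: "nat set" where
  const: "(\<lambda>v. c) \<in> polyfun I"
| coord: "i \<in> I \<Longrightarrow> (\<lambda>v. v i) \<in> polyfun I"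
| add: "\<phi> \<in> polyfun I \<Longrightarrow> \<psi> \<in> polyfun I \<Longrightarrow> (\<lambda>v. \<phi> v + \<psi> v) \<in> polyfun I"
| mult: "\<phi> \<in> polyfun I \<Longrightarrow> \<psi> \<in> polyfun I \<Longrightarrow> (\<lambda>v. \<phi> v * \<psi> v) \<in> polyfun I"

definition affine_points :: "nat set \<Rightarrow> (nat \<Rightarrow> 'k::field) set" where
  "affine_points I = {v. \<forall>i. i \<notin> I \<longrightarrow> v i = 0}"

definition zariski :: "nat set \<Rightarrow> (nat \<Rightarrow> 'k::field) topology" where
  "zariski I = topology_generated_by {{v \<in> affine_points I. q v \<noteq> 0} | q. q \<in> polyfun I}"

definition affine_space :: "nat set \<Rightarrow> (nat \<Rightarrow> 'k::field, 'k) fun_space" where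
  "affine_space I =
     \<lparr>topol = zariski I,
      regular = (\<lambda>U. {\<phi>. \<forall>a\<in>U. \<exists>W. openin (zariski I) W \<and> a \<in> W \<and> W \<subseteq> U \<and>
                      (\<exists>q\<in>polyfun I. \<exists>r\<in>polyfun I. \<forall>w\<in>W. r w \<noteq> 0 \<and> \<phi> w = q w / r w)})\<rparr>"

definition affine_variety :: "('x, 'k::field) fun_space \<Rightarrow> bool" where
  "affine_variety X \<longleftrightarrow>
     (\<exists>n Z. closedin (zariski {..<n}) Z \<and> isomorphic_spaces X (induced_space (affine_space {..<n}) Z))"

text \<open>The Zariski topology of the product \<open>X \<times> Y\<close>: its basic open sets are the loci in
  \<open>U \<times> V\<close> where an element of \<open>regular X U \<otimes> regular Y V\<close> does not vanish.\<close>

definition product_zariski ::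
    "('x, 'k::field) fun_space \<Rightarrow> ('y, 'k) fun_space \<Rightarrow> ('x \<times> 'y) topology" where
  "product_zariski X Y = topology_generated_by
     {{(a, b). a \<in> U \<and> b \<in> V \<and> (\<Sum>j<n. \<phi> j a * \<psi> j b) \<noteq> 0} | U V n \<phi> \<psi>.
        openin (topol X) U \<and> openin (topol Y) V \<and>
        (\<forall>j<(n::nat). \<phi> j \<in> regular X U \<and> \<psi> j \<in> regular Y V)}"

definition separated :: "('x, 'k::field) fun_space \<Rightarrow> bool" where
  "separated X \<longleftrightarrow> closedin (product_zariski X X) {(x, x) | x. x \<in> points X}"

definition variety :: "('x, 'k::field) fun_space \<Rightarrow> bool" where
  "variety X \<longleftrightarrow>
     sheaf_of_functions X \<and>
     (\<exists>\<V>. finite \<V> \<and> \<Union>\<V> = points X \<and>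
        (\<forall>V\<in>\<V>. openin (topol X) V \<and> affine_variety (induced_space X V))) \<and>
     separated X"

definition locally_closed_in :: "'x topology \<Rightarrow> 'x set \<Rightarrow> bool" where
  "locally_closed_in T A \<longleftrightarrow> (\<exists>U C. openin T U \<and> closedin T C \<and> A = U \<inter> C)"

definition irreducible_closed :: "'x topology \<Rightarrow> 'x set \<Rightarrow> bool" where
  "irreducible_closed T Z \<longleftrightarrow> closedin T Z \<and> Z \<noteq> {} \<and>
     (\<forall>A B. closedin T A \<and> closedin T B \<and> Z = A \<union> B \<longrightarrow> Z = A \<or> Z = B)"

text \<open>Krull dimension of a subset with the induced topology. The empty set gets dimension \<open>0\<close>;
  this does not affect the maxima below, which are taken over families with a nonempty member.\<close>

definition krull_dim :: "'x topology \<Rightarrow> 'x set \<Rightarrow> enat" where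
  "krull_dim T A = Sup {enat n | n. \<exists>Z :: nat \<Rightarrow> 'x set.
     (\<forall>i\<le>n. irreducible_closed (subtopology T A) (Z i)) \<and> (\<forall>i<n. Z i \<subset> Z (Suc i))}"

section \<open>Rosenlicht stratifications and modality\<close>

text \<open>A group acting on \<open>X\<close> is given by the set \<open>H\<close> of its elements and the action
  \<open>act\<close>; the notions below depend on nothing else.\<close>

definition geometric_quotient ::
    "'h set \<Rightarrow> ('h \<Rightarrow> 'x \<Rightarrow> 'x) \<Rightarrow> ('x, 'k::field) fun_space \<Rightarrow> ('y, 'k) fun_space \<Rightarrow> ('x \<Rightarrow> 'y) \<Rightarrow> bool"
  where
  "geometric_quotient H act X Y p \<longleftrightarrow>
     is_morphism X Y p \<and> p ` points X = points Y \<and> open_map (topol X) (topol Y) p \<and>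
     (\<forall>x\<in>points X. \<forall>y\<in>points X. p x = p y \<longleftrightarrow> (\<exists>h\<in>H. y = act h x)) \<and>
     (\<forall>V. openin (topol Y) V \<longrightarrow>
        (\<forall>\<psi>\<in>regular X {x \<in> points X. p x \<in> V}.
           (\<forall>h\<in>H. \<forall>x\<in>points X. p x \<in> V \<longrightarrow> \<psi> (act h x) = \<psi> x) \<longrightarrow>
           (\<exists>\<phi>\<in>regular Y V. \<forall>x\<in>points X. p x \<in> V \<longrightarrow> \<psi> x = \<phi> (p x))))"

text \<open>A stratification is the list of the triples \<open>(X\<^sub>i, X\<^sub>i/H, p\<^sub>i)\<close>.\<close>

type_synonym ('x, 'y, 'k) stratum = "'x set \<times> ('y, 'k) fun_space \<times> ('x \<Rightarrow> 'y)"

definition rosenlicht_stratification ::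
    "'h set \<Rightarrow> ('h \<Rightarrow> 'x \<Rightarrow> 'x) \<Rightarrow> ('x, 'k::field) fun_space \<Rightarrow> ('x, 'y, 'k) stratum list \<Rightarrow> bool"
  where
  "rosenlicht_stratification H act X S \<longleftrightarrow>
     (\<Union>(A, Y, p)\<in>set S. A) = points X \<and>
     (\<forall>i<length S. \<forall>j<length S. i \<noteq> j \<longrightarrow> fst (S ! i) \<inter> fst (S ! j) = {}) \<and>
     (\<forall>i<length S. case S ! i of (A, Y, p) \<Rightarrow>
        (let R = points X - (\<Union>j<i. fst (S ! j)) in
           (\<forall>h\<in>H. \<forall>x\<in>A. act h x \<in> A) \<and>
           locally_closed_in (topol X) A \<and>
           openin (subtopology (topol X) R) A \<and>
           subtopology (topol X) R closure_of A = R \<and>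
           variety Y \<and> geometric_quotient H act (induced_space X A) Y p))"

definition modality_open_wrt ::
    "('x, 'y, 'k) stratum list \<Rightarrow> 'x set \<Rightarrow> enat" where
  "modality_open_wrt S U = (SUP (A, Y, p)\<in>set S. krull_dim (topol Y) (p ` (U \<inter> A)))"

definition modality_point_wrt ::
    "('x, 'k) fun_space \<Rightarrow> ('x, 'y, 'k) stratum list \<Rightarrow> 'x \<Rightarrow> enat" where
  "modality_point_wrt X S x =
     (INF U\<in>{U. openin (topol X) U \<and> x \<in> U}. modality_open_wrt S U)"

text \<open>The common value for all Rosenlicht stratifications. Since the points of a geometric quotient
  correspond to the orbits, it is no restriction to take them from the type \<open>'x set\<close>.\<close>

definition modality ::
    "'h set \<Rightarrow> ('h \<Rightarrow> 'x \<Rightarrow> 'x) \<Rightarrow> ('x, 'k::field) fun_space \<Rightarrow> 'x \<Rightarrow> enat" where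
  "modality H act X x =
     (THE d. \<exists>S :: ('x, 'x set, 'k) stratum list.
        rosenlicht_stratification H act X S \<and> d = modality_point_wrt X S x)"

section \<open>Right equivalence of univariate power series\<close>

text \<open>The condition \<open>f \<in> \<mm>\<^sup>k\<close> is written \<open>fps_X ^ k dvd f\<close>.\<close>

definition right_group :: "('k::field fps \<Rightarrow> 'k fps) set" where
  "right_group = {\<Phi>. bij \<Phi> \<and> (\<forall>g h. \<Phi> (g + h) = \<Phi> g + \<Phi> h) \<and>
     (\<forall>g h. \<Phi> (g * h) = \<Phi> g * \<Phi> h) \<and> (\<forall>c. \<Phi> (fps_const c) = fps_const c)}"

definition right_equivalent :: "'k::field fps \<Rightarrow> 'k fps \<Rightarrow> bool" where
  "right_equivalent f g \<longleftrightarrow> (\<exists>\<Phi>\<in>right_group. g = \<Phi> f)"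

definition jacobian_ideal :: "'k::field fps \<Rightarrow> 'k fps set" where
  "jacobian_ideal f = {h * fps_deriv f | h. True}"

text \<open>The residue classes of the elements of \<open>B\<close> form a \<open>K\<close>-basis of \<open>K[[x]] / W\<close>.\<close>

definition basis_modulo :: "'k::field fps set \<Rightarrow> 'k fps set \<Rightarrow> bool" where
  "basis_modulo W B \<longleftrightarrow> finite B \<and>
     (\<forall>h. \<exists>!c. (\<forall>b. b \<notin> B \<longrightarrow> c b = 0) \<and> h - (\<Sum>b\<in>B. fps_const (c b) * b) \<in> W)"

text \<open>The infimum is that of a singleton if \<open>K[[x]] / j(f)\<close> is finite-dimensional, and \<open>\<infinity>\<close> otherwise.\<close>

definition milnor_number :: "'k::field fps \<Rightarrow> enat" where
  "milnor_number f = Inf {enat (card B) | B. basis_modulo (jacobian_ideal f) B}"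

text \<open>The class of \<open>f\<close> in \<open>J\<^sub>k = \<mm> / \<mm>\<^sup>k\<^sup>+\<^sup>1\<close> is identified with its coefficients of
  \<open>x, \<dots>, x\<^sup>k\<close>, so \<open>J\<^sub>k\<close> is the affine space with coordinates \<open>1, \<dots>, k\<close>.\<close>

definition jet :: "nat \<Rightarrow> 'k::field fps \<Rightarrow> nat \<Rightarrow> 'k" where
  "jet k f = (\<lambda>i. if i \<in> {1..k} then fps_nth f i else 0)"

definition jet_space :: "nat \<Rightarrow> (nat \<Rightarrow> 'k::field, 'k) fun_space" where
  "jet_space k = affine_space {1..k}"

definition jet_group :: "nat \<Rightarrow> (nat \<Rightarrow> 'k::field) set" where
  "jet_group k = {jet k (\<Phi> fps_X) | \<Phi>. \<Phi> \<in> right_group}"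

text \<open>The action \<open>\<Phi>\<^sub>k \<cdot> j\<^sup>k h = j\<^sup>k (\<Phi> h)\<close>, which does not depend on the representatives.\<close>

definition jet_action :: "nat \<Rightarrow> (nat \<Rightarrow> 'k::field) \<Rightarrow> (nat \<Rightarrow> 'k) \<Rightarrow> nat \<Rightarrow> 'k" where
  "jet_action k a v = (THE w. \<exists>\<Phi>\<in>right_group. \<exists>h. fps_X dvd h \<and>
     jet k (\<Phi> fps_X) = a \<and> jet k h = v \<and> w = jet k (\<Phi> h))"

definition right_determined :: "nat \<Rightarrow> 'k::field fps \<Rightarrow> bool" where
  "right_determined k g \<longleftrightarrow>
     (\<forall>h. fps_X dvd h \<and> jet k h = jet k g \<longrightarrow> right_equivalent h g)"

definition sufficiently_large :: "nat \<Rightarrow> 'k::field fps \<Rightarrow> bool" where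
  "sufficiently_large k f \<longleftrightarrow>
     (\<exists>U. openin (topol (jet_space k)) U \<and> jet k f \<in> U \<and>
        (\<forall>g. fps_X dvd g \<and> jet k g \<in> U \<longrightarrow> right_determined k g))"

text \<open>The common value for all sufficiently large \<open>k\<close>; meaningful for series in \<open>\<mm>\<close> with finite
  Milnor number.\<close>

definition right_modality :: "'k::field fps \<Rightarrow> enat" where
  "right_modality f =
     (THE d. \<exists>k. sufficiently_large k f \<and>
        d = modality (jet_group k) (jet_action k) (jet_space k) (jet k f))"

definition right_simple :: "'k::field fps \<Rightarrow> bool" where
  "right_simple f \<longleftrightarrow> right_modality f = 0"

end

theory Submission
  imports Defs "HOL-Algebra.Exponent"
begin

text \<open>
  The jets \<open>v\<close> of series whose derivative has order at least \<open>m\<close> are given by \<open>i v\<^sub>i = 0\<close> for \<open>i \<le> m\<close>;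
  they form an invariant linear space \<open>L\<^sub>m\<close> with the coordinates \<open>i > m\<close> and the \<open>[m/p]\<close> multiples of
  \<open>p\<close> up to \<open>m\<close>. A Rosenlicht stratification exists since the jet group, a torus extended by
  successive additive groups of shears \<open>x + t x\<^sup>e\<close>, has a rational cross-section on every closed
  invariant set: for a shear, take the zeros of a regular function of least positive degree \<open>p\<^sup>s\<close> in \<open>t\<close>.

  Upper bound: if the derivative of \<open>g\<close> has order exactly \<open>m\<close>, the curves \<open>g(x + s \<eta>)\<close> move the
  coefficients of index larger than \<open>m\<close> in all directions. Hence independent functions on the quotient
  are independent together with these coordinates, and there are at most \<open>[m/p]\<close> of them. Near \<open>f\<close>
  only \<open>m \<le> \<mu>\<close> occurs.

  Lower bound: if \<open>v \<in> L\<^sub>\<mu>\<close>, \<open>v\<^sub>p \<noteq> 0\<close> and \<open>e (p - 1) < \<mu>\<close>, then a change of \<open>x\<close> in order \<open>e\<close> first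
  affects the coefficient of index \<open>e p\<close>, by \<open>v\<^sub>p\<close> times a \<open>p\<close>-th power. So one can normalise \<open>v\<^sub>p\<close> to \<open>1\<close> and
  these coefficients to \<open>0\<close>, and then the coefficients of index \<open>j > \<mu>\<close> with \<open>j (p - 1) < \<mu> p\<close> and
  \<open>p \<nmid> j\<close> are invariants. There are at least \<open>[\<mu>/p]\<close> of them, and varying them one after the other
  gives a chain of irreducible closed sets in the quotient.
\<close>

section \<open>Polynomial functions\<close>

text \<open>The \<open>THE\<close> in \<open>modality\<close> and in \<open>right_modality\<close>
  forces statements about every choice: both bounds are proved for arbitrary stratifications with
  arbitrary quotients, and every sufficiently large \<open>k\<close> is shown to be large enough for
  them. The constructed stratification only shows that a value exists. The parameter that moves a
  jet onto the slice of a shear solves an equation of degree p^s, possibly inseparable, so it is no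
  rational function of the jet. Coordinates restricted to the slice are rational all the same: p^s
  divides every degree in \<open>t\<close>, and division by the slice function leaves invariants.
  Origin of the bound j (p - 1) < mu p: a change x + h with h of order e alters g through g' h from
  index mu + e on, and through v_p h^p from index e p on. The second effect comes first while e (p -
  1) < mu, and the normalisation uses it up. The least e with e (p - 1) >= mu alters nothing below
  mu + e, and j < mu + e for this e means j (p - 1) < mu p.\<close>

lemma infinite_UNIV_alg_closed: "infinite (UNIV :: 'k::alg_closed_field set)"
proof
  assume fin: "finite (UNIV :: 'k set)"
  \<comment> \<open>Over a finite field this polynomial would take the value 1 everywhere, although
    its degree is positive.\<close>
  define q :: "'k poly" where "q = (\<Prod>a\<in>UNIV. [:-a, 1:]) + 1"
  have deg: "degree (\<Prod>a\<in>(UNIV::'k set). [:-a, 1:]) = card (UNIV :: 'k set)"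
    by (subst degree_prod_sum_eq) auto
  have "card (UNIV :: 'k set) > 0"
    using fin by (simp add: card_gt_0_iff)
  hence "degree q = card (UNIV :: 'k set)"
    unfolding q_def by (subst degree_add_eq_left) (simp_all add: deg)
  with \<open>card (UNIV :: 'k set) > 0\<close> obtain x where "poly q x = 0"
    using alg_closed_imp_poly_has_root[of q] by auto
  moreover have "poly q x = 1"
    unfolding q_def using fin by (simp add: poly_prod prod_zero_iff)
  ultimately show False by simp
qed

lemma poly_eq_infinite:
  fixes p q :: "'k::idom poly"
  assumes "infinite T" and "\<And>t. t \<in> T \<Longrightarrow> poly p t = poly q t"
  shows "p = q"
proof (rule ccontr)
  assume "p \<noteq> q"
  hence "finite {t. poly (p - q) t = 0}" by (intro poly_roots_finite) simp
  moreover have "T \<subseteq> {t. poly (p - q) t = 0}" using assms by auto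
  ultimately show False using assms finite_subset by blast
qed

lemma poly_eq_cofinite:
  fixes p q :: "'k::alg_closed_field poly"
  assumes "finite E" and "\<And>t. t \<notin> E \<Longrightarrow> poly p t = poly q t"
  shows "p = q"
  using poly_eq_infinite[of "-E" p q] assms infinite_UNIV_alg_closed
  by (metis ComplD Diff_infinite_finite Compl_eq_Diff_UNIV)

section \<open>Algebras of functions and one-parameter polynomial families\<close>

text \<open>The common frame for polynomial functions, functions regular off a hypersurface,
  invariants and root functions: polynomial substitution is proved once for all of them.\<close>

definition fun_algebra :: "('x \<Rightarrow> 'k::comm_ring_1) set \<Rightarrow> bool" where
  "fun_algebra A \<longleftrightarrow> (\<forall>c. (\<lambda>_. c) \<in> A) \<and>
     (\<forall>f\<in>A. \<forall>g\<in>A. (\<lambda>x. f x + g x) \<in> A \<and> (\<lambda>x. f x * g x) \<in> A)"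

lemma
  assumes "fun_algebra A"
  shows fun_algebra_const: "(\<lambda>_. c) \<in> A"
    and fun_algebra_add: "f \<in> A \<Longrightarrow> g \<in> A \<Longrightarrow> (\<lambda>x. f x + g x) \<in> A"
    and fun_algebra_mult: "f \<in> A \<Longrightarrow> g \<in> A \<Longrightarrow> (\<lambda>x. f x * g x) \<in> A"
  using assms by (auto simp: fun_algebra_def)

lemma fun_algebra_cmult: "fun_algebra A \<Longrightarrow> f \<in> A \<Longrightarrow> (\<lambda>x. c * f x) \<in> A"
  using fun_algebra_mult[of A "\<lambda>_. c" f] fun_algebra_const[of A c] by simp

lemma fun_algebra_diff:
  assumes "fun_algebra A" "f \<in> A" "g \<in> A" shows "(\<lambda>x. f x - g x) \<in> A"
  using fun_algebra_add[OF assms(1,2) fun_algebra_cmult[OF assms(1,3), of "-1"]] by simp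

lemma fun_algebra_sum:
  assumes "fun_algebra A" "\<And>i. i \<in> S \<Longrightarrow> f i \<in> A" shows "(\<lambda>x. \<Sum>i\<in>S. f i x) \<in> A"
  using assms(2)
  by (induction S rule: infinite_finite_induct)
     (auto intro: fun_algebra_const[OF assms(1)] fun_algebra_add[OF assms(1)])

lemma fun_algebra_prod:
  assumes "fun_algebra A" "\<And>i. i \<in> S \<Longrightarrow> f i \<in> A" shows "(\<lambda>x. \<Prod>i\<in>S. f i x) \<in> A"
  using assms(2)
  by (induction S rule: infinite_finite_induct)
     (auto intro: fun_algebra_const[OF assms(1)] fun_algebra_mult[OF assms(1)])

lemma fun_algebra_power: "fun_algebra A \<Longrightarrow> f \<in> A \<Longrightarrow> (\<lambda>x. f x ^ n) \<in> A"
  by (induction n) (auto intro: fun_algebra_const fun_algebra_mult)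

lemma fun_algebra_polyfun: "fun_algebra (polyfun I)"
  by (auto simp: fun_algebra_def intro: polyfun.intros)

lemma fun_algebra_UNIV: "fun_algebra UNIV"
  by (simp add: fun_algebra_def)

lemmas polyfun_diff = fun_algebra_diff[OF fun_algebra_polyfun]
  and polyfun_sum = fun_algebra_sum[OF fun_algebra_polyfun]
  and polyfun_prod = fun_algebra_prod[OF fun_algebra_polyfun]
  and polyfun_power = fun_algebra_power[OF fun_algebra_polyfun]
  and polyfun_cmult = fun_algebra_cmult[OF fun_algebra_polyfun]

lemma polyfun_subst:
  assumes "fun_algebra A" and "q \<in> polyfun I" and "\<And>i. i \<in> I \<Longrightarrow> F i \<in> A"
  shows "(\<lambda>x. q (\<lambda>i. F i x)) \<in> A"
  using assms(2)
  by induction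
     (auto intro: assms(3) fun_algebra_const[OF assms(1)] fun_algebra_add[OF assms(1)]
       fun_algebra_mult[OF assms(1)])

lemma polyfun_mono: "I \<subseteq> J \<Longrightarrow> q \<in> polyfun I \<Longrightarrow> q \<in> polyfun J"
  using polyfun_subst[OF fun_algebra_polyfun, of q I "\<lambda>i v. v i" J]
  by (auto intro: polyfun.coord)

lemma polyfun_cong:
  assumes "q \<in> polyfun I" and "\<And>i. i \<in> I \<Longrightarrow> v i = w i"
  shows "q v = q w"
  using assms(1) by induction (auto simp: assms(2))

text \<open>The polynomial ring \<open>A[t]\<close>, its elements read as families of polynomials.
  The uniform degree bound makes each coefficient a fixed linear combination of finitely many
  values.\<close>

definition poly_family :: "('x \<Rightarrow> 'k::comm_ring_1) set \<Rightarrow> ('x \<Rightarrow> 'k poly) set" where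
  "poly_family A = {F. (\<exists>n. \<forall>x. degree (F x) \<le> n) \<and> (\<forall>i. (\<lambda>x. coeff (F x) i) \<in> A)}"

lemma poly_family_coeff: "F \<in> poly_family A \<Longrightarrow> (\<lambda>x. coeff (F x) i) \<in> A"
  by (simp add: poly_family_def)

lemma poly_family_degree:
  assumes "F \<in> poly_family A" obtains n where "\<And>x. degree (F x) \<le> n"
  using assms by (auto simp: poly_family_def)

lemma fun_algebra_poly_family:
  assumes "fun_algebra A" shows "fun_algebra (poly_family A)"
  unfolding fun_algebra_def
proof (intro conjI allI ballI)
  fix c :: "'b poly"
  show "(\<lambda>_. c) \<in> poly_family A"
    using fun_algebra_const[OF assms] by (auto simp: poly_family_def)
next
  fix F G assume F: "F \<in> poly_family A" and G: "G \<in> poly_family A"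
  from F obtain n where n: "\<And>x. degree (F x) \<le> n" by (rule poly_family_degree) auto
  from G obtain m where m: "\<And>x. degree (G x) \<le> m" by (rule poly_family_degree) auto
  have "degree (F x + G x) \<le> max n m" for x
    using n[of x] m[of x] by (intro degree_add_le) auto
  moreover have "(\<lambda>x. coeff (F x + G x) i) \<in> A" for i
    using fun_algebra_add[OF assms poly_family_coeff[OF F, of i] poly_family_coeff[OF G, of i]]
    by simp
  ultimately show "(\<lambda>x. F x + G x) \<in> poly_family A" by (auto simp: poly_family_def)
  have "degree (F x * G x) \<le> n + m" for x
    using degree_mult_le[of "F x" "G x"] n[of x] m[of x] by linarith
  moreover have "(\<lambda>x. coeff (F x * G x) i) \<in> A" for i
    unfolding coeff_mult
    by (intro fun_algebra_sum[OF assms] fun_algebra_mult[OF assms] poly_family_coeff F G)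
  ultimately show "(\<lambda>x. F x * G x) \<in> poly_family A" by (auto simp: poly_family_def)
qed

lemma polyfun_poly_family:
  assumes A: "fun_algebra A" and q: "q \<in> polyfun I" and F: "\<And>i. i \<in> I \<Longrightarrow> F i \<in> poly_family A"
  obtains G where "G \<in> poly_family A" "\<And>x t. poly (G x) t = q (\<lambda>i. poly (F i x) t)"
proof -
  note PA = fun_algebra_poly_family[OF A]
  have "\<exists>G\<in>poly_family A. \<forall>x t. poly (G x) t = q (\<lambda>i. poly (F i x) t)"
    using q
  proof induction
    case (const c)
    show ?case by (rule bexI[OF _ fun_algebra_const[OF PA, of "[:c:]"]]) simp
  next
    case (coord i)
    then show ?case by (intro bexI[OF _ F[of i]]) auto
  next
    case (add \<phi> \<psi>)
    then obtain G H where "G \<in> poly_family A" "H \<in> poly_family A"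
      "\<forall>x t. poly (G x) t = \<phi> (\<lambda>i. poly (F i x) t)" "\<forall>x t. poly (H x) t = \<psi> (\<lambda>i. poly (F i x) t)"
      by blast
    then show ?case by (intro bexI[OF _ fun_algebra_add[OF PA, of G H]]) auto
  next
    case (mult \<phi> \<psi>)
    then obtain G H where "G \<in> poly_family A" "H \<in> poly_family A"
      "\<forall>x t. poly (G x) t = \<phi> (\<lambda>i. poly (F i x) t)" "\<forall>x t. poly (H x) t = \<psi> (\<lambda>i. poly (F i x) t)"
      by blast
    then show ?case by (intro bexI[OF _ fun_algebra_mult[OF PA, of G H]]) auto
  qed
  then show ?thesis using that by blast
qed

lemma polyfun_along_curve:
  assumes "q \<in> polyfun I"
  obtains p where "\<And>s. poly p s = q (\<lambda>i. poly (c i) s)"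
proof -
  have "(\<lambda>_. c i) \<in> poly_family UNIV" for i by (auto simp: poly_family_def)
  from polyfun_poly_family[OF fun_algebra_UNIV assms, of "\<lambda>i _. c i", OF this]
  show ?thesis using that by metis
qed

text \<open>Regroups a polynomial by powers of coordinate \<open>j\<close>: in the proof
  \<open>c\<close> puts the formal variable in place of this coordinate and constants in place of
  the others.\<close>

lemma polyfun_insert_decomp:
  assumes "q \<in> polyfun (insert j I)"
  obtains F where "F \<in> poly_family (polyfun I)" "\<And>v. poly (F v) (v j) = q v"
proof -
  define c where "c = (\<lambda>i v. if i = j then [:0, 1:] else [:(v::nat \<Rightarrow> 'a) i:])"
  have cP: "c i \<in> poly_family (polyfun I)" if "i \<in> insert j I" for i
  proof (cases "i = j")
    case True
    then have "c i = (\<lambda>_. [:0,1:])" by (auto simp: c_def)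
    then show ?thesis
      using fun_algebra_const[OF fun_algebra_poly_family[OF fun_algebra_polyfun]] by metis
  next
    case False
    then have "c i = (\<lambda>v. [:v i:])" by (auto simp: c_def)
    moreover have "(\<lambda>v. coeff [:v i:] n) \<in> polyfun I" for n
    proof (cases n)
      case 0
      then show ?thesis using that False by (auto intro: polyfun.coord)
    next
      case (Suc m)
      then show ?thesis by (simp add: polyfun.const)
    qed
    ultimately show ?thesis by (auto simp: poly_family_def)
  qed
  obtain G where G: "G \<in> poly_family (polyfun I)" "\<And>v t. poly (G v) t = q (\<lambda>i. poly (c i v) t)"
    by (rule polyfun_poly_family[OF fun_algebra_polyfun assms, where F = c]) (use cP in auto)
  have "(\<lambda>i. poly (c i v) (v j)) = v" for v by (auto simp: c_def)
  then show ?thesis using that[of G] G by simp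
qed

section \<open>The Zariski topology\<close>

text \<open>The generating sets, by definition a subbasis, already form a basis: the product of two
  polynomials cuts out the intersection of their non-vanishing loci.\<close>

lemma openin_zariski_iff:
  "openin (zariski I) W \<longleftrightarrow>
     W \<subseteq> affine_points I \<and>
     (\<forall>v\<in>W. \<exists>q\<in>polyfun I. q v \<noteq> (0::'k::field) \<and> {w \<in> affine_points I. q w \<noteq> 0} \<subseteq> W)"
  (is "_ \<longleftrightarrow> ?R W")
proof
  define B where "B = {{v \<in> affine_points I. q v \<noteq> (0::'k)} | q. q \<in> polyfun I}"
  assume "openin (zariski I) W"
  hence "generate_topology_on B W"
    by (simp add: zariski_def openin_topology_generated_by_iff B_def)
  then show "?R W"
  proof induction
    case Empty
    then show ?case by simp
  next
    case (Int a b)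
    show ?case
    proof (intro conjI ballI)
      show "a \<inter> b \<subseteq> affine_points I" using Int by auto
      fix v assume v: "v \<in> a \<inter> b"
      from Int v obtain q where q: "q \<in> polyfun I" "q v \<noteq> 0" "{w \<in> affine_points I. q w \<noteq> 0} \<subseteq> a"
        by blast
      from Int v obtain r where r: "r \<in> polyfun I" "r v \<noteq> 0" "{w \<in> affine_points I. r w \<noteq> 0} \<subseteq> b"
        by blast
      have "{w \<in> affine_points I. q w * r w \<noteq> 0} \<subseteq> a \<inter> b"
        using q(3) r(3) by auto
      moreover have "q v * r v \<noteq> 0" using q r by simp
      ultimately show "\<exists>q\<in>polyfun I. q v \<noteq> 0 \<and> {w \<in> affine_points I. q w \<noteq> 0} \<subseteq> a \<inter> b"
        using polyfun.mult[OF q(1) r(1)] by (intro bexI[of _ "\<lambda>v. q v * r v"] conjI)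
    qed
  next
    case (UN K)
    show ?case
    proof (intro conjI ballI)
      show "\<Union>K \<subseteq> affine_points I" using UN by auto
      fix v assume "v \<in> \<Union>K"
      then obtain a where a: "a \<in> K" "v \<in> a" by blast
      with UN obtain q where "q \<in> polyfun I" "q v \<noteq> 0" "{w \<in> affine_points I. q w \<noteq> 0} \<subseteq> a"
        by meson
      with a(1) show "\<exists>q\<in>polyfun I. q v \<noteq> 0 \<and> {w \<in> affine_points I. q w \<noteq> 0} \<subseteq> \<Union>K"
        by (intro bexI[of _ q]) auto
    qed
  next
    case (Basis s)
    then obtain q where "q \<in> polyfun I" "s = {v \<in> affine_points I. q v \<noteq> 0}"
      unfolding B_def by blast
    then show ?case by (intro conjI ballI bexI[of _ q]) auto
  qed
next
  assume R: "?R W"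
  define B where "B = {{v \<in> affine_points I. q v \<noteq> (0::'k)} | q. q \<in> polyfun I}"
  have "W = \<Union>{b \<in> B. b \<subseteq> W}"
  proof
    show "W \<subseteq> \<Union>{b \<in> B. b \<subseteq> W}"
    proof
      fix v assume v: "v \<in> W"
      with R obtain q where "q \<in> polyfun I" "q v \<noteq> 0" "{w \<in> affine_points I. q w \<noteq> 0} \<subseteq> W"
        by meson
      moreover have "v \<in> affine_points I" using v R by auto
      ultimately show "v \<in> \<Union>{b \<in> B. b \<subseteq> W}" unfolding B_def by blast
    qed
  qed auto
  moreover have "openin (zariski I) (\<Union>{b \<in> B. b \<subseteq> W})"
    unfolding zariski_def B_def[symmetric]
    by (rule openin_Union) (auto intro: topology_generated_by_Basis)
  ultimately show "openin (zariski I) W" by simp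
qed

lemma topspace_zariski [simp]: "topspace (zariski I) = (affine_points I :: (nat \<Rightarrow> 'k::field) set)"
proof -
  have "openin (zariski I) (affine_points I :: (nat \<Rightarrow> 'k) set)"
    unfolding openin_zariski_iff by (auto intro!: bexI[of _ "\<lambda>_. 1"] polyfun.const)
  then have "affine_points I \<subseteq> topspace (zariski I :: (nat \<Rightarrow> 'k) topology)"
    by (rule openin_subset)
  moreover have "topspace (zariski I) \<subseteq> (affine_points I :: (nat \<Rightarrow> 'k) set)"
    using openin_topspace[of "zariski I :: (nat \<Rightarrow> 'k) topology"] unfolding openin_zariski_iff by blast
  ultimately show ?thesis by blast
qed

lemma openin_zariski_nonzero:
  "q \<in> polyfun I \<Longrightarrow> openin (zariski I) {v \<in> affine_points I. q v \<noteq> (0::'k::field)}"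
  unfolding zariski_def by (rule topology_generated_by_Basis) blast

lemma closedin_zariski_zero:
  assumes "q \<in> polyfun I" shows "closedin (zariski I) {v \<in> affine_points I. q v = (0::'k::field)}"
proof -
  have "affine_points I - {v \<in> affine_points I. q v = 0} = {v \<in> affine_points I. q v \<noteq> (0::'k)}" by auto
  then show ?thesis using openin_zariski_nonzero[OF assms] unfolding closedin_def by auto
qed

lemma openin_zariskiE:
  assumes "openin (zariski I) W" "v \<in> W"
  obtains q where "q \<in> polyfun I" "q v \<noteq> (0::'k::field)" "{w \<in> affine_points I. q w \<noteq> 0} \<subseteq> W"
  using assms unfolding openin_zariski_iff by meson

lemma closedin_zariski_subset:
  "closedin (zariski I) Z \<Longrightarrow> Z \<subseteq> (affine_points I :: (nat \<Rightarrow> 'k::field) set)"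
  by (drule closedin_subset) simp

lemma closedin_zariski_separate:
  assumes Z: "closedin (zariski I) Z" and v: "v \<in> affine_points I" "v \<notin> Z"
  obtains q where "q \<in> polyfun I" "q v \<noteq> (0::'k::field)" "\<And>w. w \<in> Z \<Longrightarrow> q w = 0"
proof -
  have "openin (zariski I) (affine_points I - Z)" using Z by (simp add: closedin_def)
  then obtain q where q: "q \<in> polyfun I" "q v \<noteq> 0" "{w \<in> affine_points I. q w \<noteq> 0} \<subseteq> affine_points I - Z"
    by (rule openin_zariskiE) (use v in auto)
  then show ?thesis using that[of q] closedin_zariski_subset[OF Z] by auto
qed

text \<open>Irreducibility of a polynomial curve: the two restrictions are nonzero polynomials in
  the parameter, so together with \<open>E\<close> only finitely many parameters are
  excluded.\<close>

lemma open_meet_on_curve: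
  fixes c :: "nat \<Rightarrow> 'k::alg_closed_field poly"
  assumes U: "openin (zariski I) U" and V: "openin (zariski I) V"
    and c: "\<And>s. (\<lambda>i. poly (c i) s) \<in> affine_points I"
    and a: "(\<lambda>i. poly (c i) a) \<in> U" and b: "(\<lambda>i. poly (c i) b) \<in> V" and E: "finite E"
  obtains s where "(\<lambda>i. poly (c i) s) \<in> U" "(\<lambda>i. poly (c i) s) \<in> V" "s \<notin> E"
proof -
  obtain q where q: "q \<in> polyfun I" "q (\<lambda>i. poly (c i) a) \<noteq> 0" "{w \<in> affine_points I. q w \<noteq> 0} \<subseteq> U"
    using U a by (rule openin_zariskiE)
  obtain r where r: "r \<in> polyfun I" "r (\<lambda>i. poly (c i) b) \<noteq> 0" "{w \<in> affine_points I. r w \<noteq> 0} \<subseteq> V"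
    using V b by (rule openin_zariskiE)
  obtain f where f: "\<And>s. poly f s = q (\<lambda>i. poly (c i) s)" using polyfun_along_curve[OF q(1)] by blast
  obtain g where g: "\<And>s. poly g s = r (\<lambda>i. poly (c i) s)" using polyfun_along_curve[OF r(1)] by blast
  have "f * g \<noteq> 0" using q(2) r(2) f g by (metis no_zero_divisors poly_0)
  then have "finite ({s. poly (f * g) s = 0} \<union> E)" using poly_roots_finite E by blast
  then obtain s where "s \<notin> {s. poly (f * g) s = 0} \<union> E"
    using infinite_UNIV_alg_closed by (metis ex_new_if_finite)
  then have "poly f s \<noteq> 0" "poly g s \<noteq> 0" "s \<notin> E" by auto
  then show ?thesis using that[of s] q(3) r(3) f g c by (simp add: subset_iff)
qed

lemma continuous_map_zariskiI:
  fixes F :: "'x \<Rightarrow> nat \<Rightarrow> 'k::field"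
  assumes F: "\<And>x. x \<in> topspace T \<Longrightarrow> F x \<in> affine_points J"
    and q: "\<And>q. q \<in> polyfun J \<Longrightarrow> openin T {x \<in> topspace T. q (F x) \<noteq> 0}"
  shows "continuous_map T (zariski J) F"
  unfolding continuous_map_def
proof (intro conjI allI impI)
  show "F \<in> topspace T \<rightarrow> topspace (zariski J)" using F by auto
  fix W :: "(nat \<Rightarrow> 'k) set" assume W: "openin (zariski J) W"
  let ?R = "{{x \<in> topspace T. q (F x) \<noteq> 0} | q. q \<in> polyfun J \<and> {w \<in> affine_points J. q w \<noteq> 0} \<subseteq> W}"
  have "{x \<in> topspace T. F x \<in> W} = \<Union>?R"
  proof
    show "{x \<in> topspace T. F x \<in> W} \<subseteq> \<Union>?R"
    proof
      fix x assume x: "x \<in> {x \<in> topspace T. F x \<in> W}"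
      then have "F x \<in> W" by simp
      with W obtain q where "q \<in> polyfun J" "q (F x) \<noteq> 0" "{w \<in> affine_points J. q w \<noteq> 0} \<subseteq> W"
        by (rule openin_zariskiE)
      with x show "x \<in> \<Union>?R" by blast
    qed
    show "\<Union>?R \<subseteq> {x \<in> topspace T. F x \<in> W}" using F by blast
  qed
  moreover have "openin T (\<Union>?R)" using q by (intro openin_Union) blast
  ultimately show "openin T {x \<in> topspace T. F x \<in> W}" by simp
qed

declare One_nat_def [simp del]

lemma X_power_dvd_iff: "fps_X ^ n dvd f \<longleftrightarrow> (\<forall>i<n. f $ i = (0::'k::field))"
proof
  assume "fps_X ^ n dvd f"
  then show "\<forall>i<n. f $ i = 0" by (auto simp: dvd_def fps_X_power_mult_nth)
next
  assume "\<forall>i<n. f $ i = 0"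
  then have "f = fps_X ^ n * fps_shift n f" by (auto simp: fps_eq_iff fps_X_power_mult_nth)
  then show "fps_X ^ n dvd f" by (rule dvdI)
qed

lemma X_dvd_iff: "fps_X dvd f \<longleftrightarrow> f $ 0 = (0::'k::field)"
  using X_power_dvd_iff[of 1 f] by simp

section \<open>Composition of power series and jets\<close>

definition agree :: "nat \<Rightarrow> 'k::comm_ring_1 fps \<Rightarrow> 'k fps \<Rightarrow> bool" where
  "agree n f g \<longleftrightarrow> (\<forall>i<n. f $ i = g $ i)"

lemma agree_refl [simp]: "agree n f f"
  and agree_sym: "agree n f g \<Longrightarrow> agree n g f"
  and agree_trans: "agree n f g \<Longrightarrow> agree n g h \<Longrightarrow> agree n f h"
  and agree_mono: "agree n f g \<Longrightarrow> m \<le> n \<Longrightarrow> agree m f g"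
  by (auto simp: agree_def)

lemma agree_add: "agree n f g \<Longrightarrow> agree n f' g' \<Longrightarrow> agree n (f + f') (g + g')"
  by (auto simp: agree_def)

lemma agree_diff: "agree n f g \<Longrightarrow> agree n f' g' \<Longrightarrow> agree n (f - f') (g - g')"
  by (auto simp: agree_def)

lemma agree_mult: "agree n f g \<Longrightarrow> agree n f' g' \<Longrightarrow> agree n (f * f') (g * g')"
  by (auto simp: agree_def fps_mult_nth intro!: sum.cong)

lemma agree_power: "agree n f g \<Longrightarrow> agree n (f ^ m) (g ^ m)"
  by (induction m) (auto intro: agree_mult)

lemma agree_compose:
  assumes "agree n f g" "agree n \<phi> \<psi>" shows "agree n (f oo \<phi>) (g oo \<psi>)"
  unfolding agree_def
proof (intro allI impI)
  fix i assume i: "i < n"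
  have "(\<phi> ^ j) $ i = (\<psi> ^ j) $ i" for j
    using agree_power[OF assms(2), of j] i by (simp add: agree_def)
  then show "(f oo \<phi>) $ i = (g oo \<psi>) $ i"
    using assms(1) i by (auto simp: fps_compose_nth agree_def intro!: sum.cong)
qed

lemma agree_iff_dvd: "agree n f g \<longleftrightarrow> fps_X ^ n dvd (f - g :: 'k::field fps)"
  by (auto simp: X_power_dvd_iff agree_def)

text \<open>These are the images of x under the automorphisms of K[[x]], as
  \<open>right_group_subst\<close> and \<open>right_group_imp_subst\<close> show.\<close>

definition coord_change :: "'k::field fps \<Rightarrow> bool" where
  "coord_change \<phi> \<longleftrightarrow> \<phi> $ 0 = 0 \<and> \<phi> $ 1 \<noteq> 0"

lemma coord_changeD: "coord_change \<phi> \<Longrightarrow> \<phi> $ 0 = 0" "coord_change \<phi> \<Longrightarrow> \<phi> $ 1 \<noteq> 0"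
  by (auto simp: coord_change_def)

lemma compose_nth_1: "\<psi> $ 0 = 0 \<Longrightarrow> (\<phi> oo \<psi>) $ 1 = \<phi> $ 1 * \<psi> $ (1::nat)"
  by (simp add: fps_compose_nth One_nat_def)

lemma coord_change_compose: "coord_change \<phi> \<Longrightarrow> coord_change \<psi> \<Longrightarrow> coord_change (\<phi> oo \<psi>)"
  using compose_nth_1[of \<psi> \<phi>] by (simp add: coord_change_def)

lemma coord_change_X [simp]: "coord_change fps_X"
  by (simp add: coord_change_def)

lemma coord_change_scale [simp]: "coord_change (fps_const u * fps_X) \<longleftrightarrow> u \<noteq> 0"
  by (simp add: coord_change_def)

lemma coord_change_inverse:
  assumes "coord_change \<phi>"
  obtains \<psi> where "coord_change \<psi>" "\<phi> oo \<psi> = fps_X" "\<psi> oo \<phi> = fps_X"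
proof -
  have [simp]: "fps_inv \<phi> $ 0 = 0" by (simp add: fps_inv_def)
  have 1: "\<phi> oo fps_inv \<phi> = fps_X" "fps_inv \<phi> oo \<phi> = fps_X"
    using assms by (simp_all add: fps_inv fps_inv_right coord_change_def)
  have "\<phi> $ 1 * fps_inv \<phi> $ 1 = 1"
    using compose_nth_1[of "fps_inv \<phi>" \<phi>] 1 by simp
  then have "coord_change (fps_inv \<phi>)" by (auto simp: coord_change_def)
  then show ?thesis using 1 that by blast
qed

text \<open>For n at least 2 these form the filtration of the unipotent part of the group; each step
  is an additive group represented by the shears of order n.\<close>

definition tangent :: "nat \<Rightarrow> 'k::field fps \<Rightarrow> bool" where
  "tangent n \<phi> \<longleftrightarrow> agree n \<phi> fps_X"

lemma tangent_nth: "tangent n \<phi> \<Longrightarrow> i < n \<Longrightarrow> \<phi> $ i = (if i = 1 then 1 else 0)"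
  by (auto simp: tangent_def agree_def fps_X_def)

lemma tangent_coord_change: "tangent n \<phi> \<Longrightarrow> n \<ge> 2 \<Longrightarrow> coord_change \<phi>"
  by (simp add: coord_change_def tangent_nth)

lemma tangent_mono: "tangent n \<phi> \<Longrightarrow> m \<le> n \<Longrightarrow> tangent m \<phi>"
  unfolding tangent_def by (rule agree_mono)

lemma tangent_X [simp]: "tangent n fps_X"
  by (simp add: tangent_def)

lemma tangent_compose: "tangent n \<phi> \<Longrightarrow> tangent n \<psi> \<Longrightarrow> n \<ge> 2 \<Longrightarrow> tangent n (\<phi> oo \<psi>)"
  using agree_compose[of n \<phi> fps_X \<psi> \<psi>] tangent_nth[of n \<psi> 0]
  unfolding tangent_def by (auto intro: agree_trans simp: fps_X_fps_compose_startby0)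

text \<open>Composing with the inverse of \<open>\<psi>\<close> turns congruence modulo x^n into
  tangency: congruent coordinate changes lie in one coset of \<open>tangent n\<close>. All
  commutation rules for shears and scalings are instances.\<close>

lemma agree_factor:
  assumes "agree n \<phi> \<psi>" "coord_change \<phi>" "coord_change \<psi>"
  obtains \<theta> where "tangent n \<theta>" "coord_change \<theta>" "\<phi> = \<psi> oo \<theta>"
proof -
  from assms(3) obtain \<psi>' where i: "coord_change \<psi>'" "\<psi> oo \<psi>' = fps_X" "\<psi>' oo \<psi> = fps_X"
    by (rule coord_change_inverse)
  have "agree n (\<psi>' oo \<phi>) (\<psi>' oo \<psi>)" using assms(1) by (intro agree_compose) auto
  then have "tangent n (\<psi>' oo \<phi>)" by (simp add: tangent_def i)
  moreover have "\<psi> oo (\<psi>' oo \<phi>) = \<phi>"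
    using fps_compose_assoc[of \<phi> \<psi>' \<psi>] assms i
    by (simp add: coord_change_def fps_X_fps_compose_startby0)
  moreover have "coord_change (\<psi>' oo \<phi>)" using i assms by (intro coord_change_compose)
  ultimately show ?thesis using that[of "\<psi>' oo \<phi>"] by simp
qed

text \<open>The jet action with the series \<open>\<phi>\<close> itself in place of its jet, which
  keeps composition and inverses available; \<open>jet_action_eq\<close> identifies the two.\<close>

definition jet_subst :: "nat \<Rightarrow> 'k::field fps \<Rightarrow> (nat \<Rightarrow> 'k) \<Rightarrow> nat \<Rightarrow> 'k" where
  "jet_subst k \<phi> v = jet k (Abs_fps v oo \<phi>)"

lemma jet_nth: "i \<in> {1..k} \<Longrightarrow> jet k h i = h $ i"
  by (simp add: jet_def)

lemma jet_in_points [simp]: "jet k h \<in> affine_points {1..k}"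
  by (auto simp: jet_def affine_points_def)

lemma jet_subst_in_points [simp]: "jet_subst k \<phi> v \<in> affine_points {1..k}"
  by (simp add: jet_subst_def)

lemma affine_points_0: "v \<in> affine_points {1..k} \<Longrightarrow> v 0 = 0"
  by (simp add: affine_points_def)

lemma jet_Abs_fps: "v \<in> affine_points {1..k} \<Longrightarrow> jet k (Abs_fps v) = v"
  by (auto simp: jet_def affine_points_def fun_eq_iff)

lemma jet_eq_iff:
  "g $ 0 = 0 \<Longrightarrow> h $ 0 = 0 \<Longrightarrow> jet k g = jet k h \<longleftrightarrow> agree (Suc k) g h"
  by (auto simp: jet_def agree_def fun_eq_iff less_Suc_eq_le) (metis atLeastAtMost_iff One_nat_def Suc_leI not_gr_zero)

lemma agree_Abs_fps_jet: "h $ 0 = 0 \<Longrightarrow> agree (Suc k) (Abs_fps (jet k h)) h"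
  using jet_eq_iff[of "Abs_fps (jet k h)" h k] jet_Abs_fps[OF jet_in_points, of k h]
  by (simp add: affine_points_0[OF jet_in_points])

lemma jet_subst_jet:
  assumes "h $ 0 = 0" "\<phi> $ 0 = 0"
  shows "jet_subst k \<phi> (jet k h) = jet k (h oo \<phi>)"
proof -
  have "agree (Suc k) (Abs_fps (jet k h) oo \<phi>) (h oo \<phi>)"
    by (intro agree_compose agree_Abs_fps_jet assms agree_refl)
  then show ?thesis unfolding jet_subst_def
    by (subst jet_eq_iff) (auto simp: jet_def assms)
qed

lemma jet_subst_cong:
  assumes "v \<in> affine_points {1..k}" "agree (Suc k) \<phi> \<psi>"
  shows "jet_subst k \<phi> v = jet_subst k \<psi> v"
  unfolding jet_subst_def using assms
  by (subst jet_eq_iff) (auto simp: affine_points_0 intro: agree_compose)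

text \<open>Substitution is contravariant, hence the reversed order of the two series.\<close>

lemma jet_subst_compose:
  assumes "v \<in> affine_points {1..k}" "\<phi> $ 0 = 0" "\<psi> $ 0 = 0"
  shows "jet_subst k \<phi> (jet_subst k \<psi> v) = jet_subst k (\<psi> oo \<phi>) v"
proof -
  have "jet_subst k \<phi> (jet k (Abs_fps v oo \<psi>)) = jet k ((Abs_fps v oo \<psi>) oo \<phi>)"
    using assms by (intro jet_subst_jet) (auto simp: affine_points_0)
  then show ?thesis unfolding jet_subst_def
    by (simp add: fps_compose_assoc assms)
qed

lemma jet_subst_X [simp]: "v \<in> affine_points {1..k} \<Longrightarrow> jet_subst k fps_X v = v"
  by (simp add: jet_subst_def jet_Abs_fps)

lemma jet_subst_nth:
  "i \<in> {1..k} \<Longrightarrow> jet_subst k \<phi> v i = (\<Sum>j=0..i. v j * (\<phi> ^ j) $ i)"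
  by (simp add: jet_subst_def jet_nth fps_compose_nth)

lemma jet_subst_outside: "i \<notin> {1..k} \<Longrightarrow> jet_subst k \<phi> v i = 0"
  by (auto simp: jet_subst_def jet_def)

lemma jet_subst_scale:
  assumes "v \<in> affine_points {1..k}"
  shows "jet_subst k (fps_const u * fps_X) v = (\<lambda>i. u ^ i * v i)"
proof
  fix i
  have p: "(fps_const u * fps_X) ^ j = fps_const (u ^ j) * fps_X ^ j" for j
    by (simp add: power_mult_distrib fps_const_power)
  show "jet_subst k (fps_const u * fps_X) v i = u ^ i * v i"
  proof (cases "i \<in> {1..k}")
    case True
    then have "jet_subst k (fps_const u * fps_X) v i = (\<Sum>j=0..i. if j = i then v j * u ^ j else 0)"
      unfolding jet_subst_nth[OF True] p by (intro sum.cong) (auto simp: fps_X_power_nth)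
    then show ?thesis by simp
  next
    case False
    then show ?thesis using assms by (simp add: jet_subst_outside affine_points_def)
  qed
qed

definition jet_orbit :: "nat \<Rightarrow> (nat \<Rightarrow> 'k::field) \<Rightarrow> (nat \<Rightarrow> 'k) set" where
  "jet_orbit k v = {jet_subst k \<phi> v | \<phi>. coord_change \<phi>}"

definition jet_invariant :: "nat \<Rightarrow> (nat \<Rightarrow> 'k::field) set \<Rightarrow> bool" where
  "jet_invariant k A \<longleftrightarrow> A \<subseteq> affine_points {1..k} \<and> (\<forall>v\<in>A. \<forall>\<phi>. coord_change \<phi> \<longrightarrow> jet_subst k \<phi> v \<in> A)"

lemma jet_invariantD:
  "jet_invariant k A \<Longrightarrow> v \<in> A \<Longrightarrow> coord_change \<phi> \<Longrightarrow> jet_subst k \<phi> v \<in> A"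
  "jet_invariant k A \<Longrightarrow> v \<in> A \<Longrightarrow> v \<in> affine_points {1..k}"
  by (auto simp: jet_invariant_def)

lemma jet_orbit_refl: "v \<in> affine_points {1..k} \<Longrightarrow> v \<in> jet_orbit k v"
  unfolding jet_orbit_def using jet_subst_X[of v k] coord_change_X by (metis (mono_tags, lifting) mem_Collect_eq)

lemma jet_orbit_sym:
  assumes "v \<in> affine_points {1..k}" "w \<in> jet_orbit k v" shows "v \<in> jet_orbit k w"
proof -
  from assms(2) obtain \<phi> where \<phi>: "coord_change \<phi>" "w = jet_subst k \<phi> v"
    by (auto simp: jet_orbit_def)
  from \<phi>(1) obtain \<psi> where \<psi>: "coord_change \<psi>" "\<phi> oo \<psi> = fps_X" by (rule coord_change_inverse)
  have "jet_subst k \<psi> w = v"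
    using \<phi> \<psi> assms(1) by (simp add: jet_subst_compose coord_changeD)
  then show ?thesis using \<psi> by (auto simp: jet_orbit_def)
qed

lemma jet_orbit_trans:
  assumes "v \<in> affine_points {1..k}" "w \<in> jet_orbit k v" "z \<in> jet_orbit k w"
  shows "z \<in> jet_orbit k v"
proof -
  from assms(2) obtain \<phi> where \<phi>: "coord_change \<phi>" "w = jet_subst k \<phi> v"
    by (auto simp: jet_orbit_def)
  from assms(3) obtain \<psi> where \<psi>: "coord_change \<psi>" "z = jet_subst k \<psi> w"
    by (auto simp: jet_orbit_def)
  have "z = jet_subst k (\<phi> oo \<psi>) v"
    using \<phi> \<psi> assms(1) by (simp add: jet_subst_compose coord_changeD)
  then show ?thesis using coord_change_compose[OF \<phi>(1) \<psi>(1)] by (auto simp: jet_orbit_def)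
qed

lemma jet_invariant_Diff: "jet_invariant k A \<Longrightarrow> jet_invariant k B \<Longrightarrow> jet_invariant k (A - B)"
  unfolding jet_invariant_def
proof (intro conjI ballI allI impI)
  assume A: "A \<subseteq> affine_points {1..k} \<and> (\<forall>v\<in>A. \<forall>\<phi>. coord_change \<phi> \<longrightarrow> jet_subst k \<phi> v \<in> A)"
     and B: "B \<subseteq> affine_points {1..k} \<and> (\<forall>v\<in>B. \<forall>\<phi>. coord_change \<phi> \<longrightarrow> jet_subst k \<phi> v \<in> B)"
  show "A - B \<subseteq> affine_points {1..k}" using A by auto
  fix v and \<phi> :: "'a fps" assume v: "v \<in> A - B" and \<phi>: "coord_change \<phi>"
  from \<phi> obtain \<psi> where \<psi>: "coord_change \<psi>" "\<phi> oo \<psi> = fps_X" by (rule coord_change_inverse)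
  have "jet_subst k \<psi> (jet_subst k \<phi> v) = v"
    using \<phi> \<psi> v A by (subst jet_subst_compose) (auto simp: coord_changeD)
  then show "jet_subst k \<phi> v \<in> A - B" using v A B \<phi> \<psi>(1) by (metis Diff_iff)
qed

lemma jet_invariant_Un: "jet_invariant k A \<Longrightarrow> jet_invariant k B \<Longrightarrow> jet_invariant k (A \<union> B)"
  by (auto simp: jet_invariant_def)

lemma jet_invariant_points: "jet_invariant k (affine_points {1..k})"
  by (auto simp: jet_invariant_def)

subsection \<open>The right group consists of the substitutions\<close>

lemma right_group_subst:
  assumes "coord_change \<phi>"
  shows "(\<lambda>h. h oo \<phi>) \<in> right_group"
proof -
  from assms obtain \<psi> where i: "coord_change \<psi>" "\<phi> oo \<psi> = fps_X" "\<psi> oo \<phi> = fps_X"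
    by (rule coord_change_inverse)
  have "bij (\<lambda>h. h oo \<phi>)"
  proof (rule bij_betw_byWitness[where f' = "\<lambda>h. h oo \<psi>"])
    show "\<forall>h\<in>UNIV. (h oo \<phi>) oo \<psi> = h"
      using i assms by (simp add: fps_compose_assoc[symmetric] coord_changeD)
    show "\<forall>h\<in>UNIV. (h oo \<psi>) oo \<phi> = h"
      using i assms by (simp add: fps_compose_assoc[symmetric] coord_changeD)
  qed auto
  then show ?thesis
    using assms by (simp add: right_group_def fps_compose_add_distrib fps_compose_mult_distrib coord_changeD)
qed

text \<open>Continuity is not assumed but proved. The image of x is a non-unit like x itself;
  peeling off constant terms, h = h(0) + x g, then shows that the automorphism and the substitution
  agree modulo every power of x. Surjectivity gives the nonzero linear coefficient.\<close>

lemma right_group_imp_subst: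
  fixes \<Phi> :: "'k::field fps \<Rightarrow> 'k fps"
  assumes "\<Phi> \<in> right_group"
  shows "coord_change (\<Phi> fps_X)" and "\<Phi> = (\<lambda>h. h oo \<Phi> fps_X)"
proof -
  have bij: "bij \<Phi>" and add: "\<And>g h. \<Phi> (g + h) = \<Phi> g + \<Phi> h"
    and mult: "\<And>g h. \<Phi> (g * h) = \<Phi> g * \<Phi> h" and const: "\<And>c. \<Phi> (fps_const c) = fps_const c"
    using assms by (auto simp: right_group_def)
  let ?x = "\<Phi> fps_X"
  have one: "\<Phi> 1 = 1" and zero: "\<Phi> 0 = 0" using const[of 1] const[of 0] by simp_all
  have x0: "?x $ 0 = 0"
  proof (rule ccontr)
    assume "?x $ 0 \<noteq> 0"
    then have "?x * inverse ?x = 1" by (simp add: inverse_mult_eq_1')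
    moreover obtain y where "\<Phi> y = inverse ?x" using bij by (metis bij_pointE)
    ultimately have "\<Phi> (fps_X * y) = \<Phi> 1" by (simp add: mult one)
    then have "fps_X * y = 1" using bij by (simp add: bij_def inj_eq)
    then have "(fps_X * y) $ 0 = 1 $ 0" by (rule arg_cong)
    then show False by simp
  qed
  have pow: "\<Phi> (h ^ n) = \<Phi> h ^ n" for h n by (induction n) (auto simp: one mult)
  have agree: "agree n (\<Phi> h) (h oo ?x)" for n h
  proof (induction n arbitrary: h)
    case 0
    then show ?case by (simp add: agree_def)
  next
    case (Suc n)
    define g where "g = fps_shift 1 h"
    have h: "h = fps_const (h $ 0) + fps_X * g"
      by (auto simp: fps_eq_iff g_def)
    have 1: "\<Phi> h = fps_const (h $ 0) + ?x * \<Phi> g"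
      by (subst h) (simp add: add mult const)
    have 2: "h oo ?x = fps_const (h $ 0) + ?x * (g oo ?x)"
      by (subst h) (simp add: fps_compose_add_distrib fps_compose_mult_distrib x0 fps_X_fps_compose_startby0)
    have "agree (Suc n) (?x * \<Phi> g) (?x * (g oo ?x))"
      unfolding agree_def
    proof (intro allI impI)
      fix i assume i: "i < Suc n"
      show "(?x * \<Phi> g) $ i = (?x * (g oo ?x)) $ i"
        unfolding fps_mult_nth
      proof (rule sum.cong)
        fix j assume j: "j \<in> {0..i}"
        show "?x $ j * \<Phi> g $ (i - j) = ?x $ j * (g oo ?x) $ (i - j)"
          using Suc[of g] i j x0 by (cases "j = 0") (auto simp: agree_def)
      qed auto
    qed
    then show ?case unfolding 1 2 by (intro agree_add agree_refl)
  qed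
  show eq: "\<Phi> = (\<lambda>h. h oo ?x)"
    using agree by (auto simp: fun_eq_iff fps_eq_iff agree_def) 
  have "?x $ 1 \<noteq> 0"
  proof
    assume x1: "?x $ 1 = 0"
    obtain y where "\<Phi> y = fps_X" using bij by (metis bij_pointE)
    then have "(y oo ?x) $ 1 = fps_X $ 1" using eq by (metis (no_types))
    then show False using compose_nth_1[of ?x y] x0 x1 by simp
  qed
  with x0 show "coord_change ?x" by (simp add: coord_change_def)
qed

lemma right_equivalent_iff: "right_equivalent f g \<longleftrightarrow> (\<exists>\<phi>. coord_change \<phi> \<and> g = f oo \<phi>)"
  unfolding right_equivalent_def using right_group_subst right_group_imp_subst by metis

lemma right_equivalent_sym:
  assumes "right_equivalent f g" shows "right_equivalent g f"
proof -
  obtain \<phi> where \<phi>: "coord_change \<phi>" "g = f oo \<phi>" using assms right_equivalent_iff by blast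
  from \<phi>(1) obtain \<psi> where i: "coord_change \<psi>" "\<phi> oo \<psi> = fps_X" by (rule coord_change_inverse)
  have "g oo \<psi> = f" using \<phi> i by (simp add: fps_compose_assoc[symmetric] coord_changeD)
  then show ?thesis using i right_equivalent_iff by blast
qed

lemma jet_action_eq:
  assumes \<phi>: "coord_change \<phi>" and v: "v \<in> affine_points {1..k}"
  shows "jet_action k (jet k \<phi>) v = jet_subst k \<phi> v"
  unfolding jet_action_def
proof (rule the_equality)
  have "fps_X dvd Abs_fps v"
    using v by (simp add: affine_points_0 X_dvd_iff)
  then show "\<exists>\<Phi>\<in>right_group. \<exists>h. fps_X dvd h \<and> jet k (\<Phi> fps_X) = jet k \<phi> \<and> jet k h = v \<and>
      jet_subst k \<phi> v = jet k (\<Phi> h)"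
    using right_group_subst[OF \<phi>] \<phi> v
    by (intro bexI[of _ "\<lambda>h. h oo \<phi>"] exI[of _ "Abs_fps v"])
       (auto simp: fps_X_fps_compose_startby0 coord_changeD jet_Abs_fps jet_subst_def)
next
  fix w assume "\<exists>\<Phi>\<in>right_group. \<exists>h. fps_X dvd h \<and> jet k (\<Phi> fps_X) = jet k \<phi> \<and> jet k h = v \<and> w = jet k (\<Phi> h)"
  then obtain \<Phi> h where \<Phi>: "\<Phi> \<in> right_group" and h: "fps_X dvd h" "jet k h = v"
    and x: "jet k (\<Phi> fps_X) = jet k \<phi>" and w: "w = jet k (\<Phi> h)" by blast
  let ?\<psi> = "\<Phi> fps_X"
  have \<psi>: "coord_change ?\<psi>" and eq: "\<Phi> h = h oo ?\<psi>"
    using right_group_imp_subst[OF \<Phi>] by metis+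
  have h0: "h $ 0 = 0" using h by (simp add: X_dvd_iff)
  have "agree (Suc k) ?\<psi> \<phi>" using x \<psi> \<phi> by (subst (asm) jet_eq_iff) (auto simp: coord_changeD)
  then have "jet_subst k ?\<psi> v = jet_subst k \<phi> v" by (rule jet_subst_cong[OF v])
  moreover have "w = jet_subst k ?\<psi> v"
    using jet_subst_jet[OF h0, of ?\<psi> k] h \<psi> by (simp add: w eq coord_changeD)
  ultimately show "w = jet_subst k \<phi> v" by simp
qed

lemma jet_group_eq: "jet_group k = {jet k \<phi> | \<phi>. coord_change \<phi>}"
proof -
  have "\<exists>\<Phi>\<in>right_group. \<Phi> fps_X = \<phi>" if "coord_change \<phi>" for \<phi> :: "'k::field fps"
    using right_group_subst[OF that] that
    by (intro bexI[of _ "\<lambda>h. h oo \<phi>"]) (auto simp: fps_X_fps_compose_startby0 coord_changeD)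
  then show ?thesis unfolding jet_group_def using right_group_imp_subst(1) by blast
qed

lemma jet_group_orbit_iff:
  assumes "v \<in> affine_points {1..k}"
  shows "(\<exists>h\<in>jet_group k. w = jet_action k h v) \<longleftrightarrow> w \<in> jet_orbit k v"
  using assms by (auto simp: jet_group_eq jet_orbit_def jet_action_eq)

lemma jet_group_ball_iff:
  assumes "v \<in> affine_points {1..k}"
  shows "(\<forall>h\<in>jet_group k. Q (jet_action k h v)) \<longleftrightarrow> (\<forall>\<phi>. coord_change \<phi> \<longrightarrow> Q (jet_subst k \<phi> v))"
  using assms by (auto simp: jet_group_eq jet_action_eq)

subsection \<open>Polynomial dependence on parameters\<close>

lemma power_nth_poly:
  "\<exists>q. \<forall>t. poly q t = ((\<psi> + fps_const t * \<eta>) ^ n) $ (i::nat)" for \<psi> \<eta> :: "'k::comm_ring_1 fps"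
proof (induction n arbitrary: i)
  case 0
  show ?case by (rule exI[of _ "[:1 $ i:]"]) simp
next
  case (Suc n)
  then obtain q where q: "\<And>i t. poly (q i) t = ((\<psi> + fps_const t * \<eta>) ^ n) $ i" by metis
  have "poly (\<Sum>j=0..i. [:\<psi> $ j, \<eta> $ j:] * q (i - j)) t = ((\<psi> + fps_const t * \<eta>) ^ Suc n) $ i" for t
    unfolding power_Suc fps_mult_nth[of "\<psi> + fps_const t * \<eta>"]
    by (simp add: poly_sum q distrib_right mult.assoc)
  then show ?case by blast
qed

text \<open>One statement for all families in use: shears (\<open>\<psi>\<close> = x), scalings
  (\<open>\<psi>\<close> = 0, \<open>\<eta>\<close> = x), a single coordinate change
  (\<open>\<eta>\<close> = 0) and the curves x + t \<open>\<eta>\<close> in an orbit.\<close>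

lemma jet_subst_poly_family:
  obtains F :: "nat \<Rightarrow> (nat \<Rightarrow> 'k::field) \<Rightarrow> 'k poly"
  where "\<And>i. F i \<in> poly_family (polyfun {1..k})"
    and "\<And>i v t. v \<in> affine_points {1..k} \<Longrightarrow>
           poly (F i v) t = jet_subst k (\<psi> + fps_const t * \<eta>) v i"
proof -
  obtain q where q: "\<And>n i t. poly (q n i) t = ((\<psi> + fps_const t * \<eta>) ^ n) $ i"
    using power_nth_poly[of \<psi> \<eta>] by metis
  define F where "F = (\<lambda>i v. if i \<in> {1..k} then \<Sum>j\<in>{1..i}. smult ((v::nat\<Rightarrow>'k) j) (q j i) else 0)"
  have pf: "fun_algebra (poly_family (polyfun {1..k} :: ((nat \<Rightarrow> 'k) \<Rightarrow> 'k) set))"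
    by (intro fun_algebra_poly_family fun_algebra_polyfun)
  have "F i \<in> poly_family (polyfun {1..k})" for i
  proof (cases "i \<in> {1..k}")
    case True
    have "(\<lambda>v::nat\<Rightarrow>'k. smult (v j) (q j i)) \<in> poly_family (polyfun {1..k})" if "j \<in> {1..i}" for j
      unfolding poly_family_def using that True
      by (auto intro!: exI[of _ "degree (q j i)"] polyfun.intros degree_smult_le)
    then have "(\<lambda>v. \<Sum>j\<in>{1..i}. smult (v j) (q j i)) \<in> poly_family (polyfun {1..k})"
      by (intro fun_algebra_sum[OF pf]) auto
    then show ?thesis using True by (simp add: F_def)
  next
    case False
    then have "F i = (\<lambda>_. 0)" by (auto simp: F_def)
    then show ?thesis using fun_algebra_const[OF pf] by metis
  qed
  moreover have "poly (F i v) t = jet_subst k (\<psi> + fps_const t * \<eta>) v i"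
    if v: "v \<in> affine_points {1..k}" for i v t
  proof (cases "i \<in> {1..k}")
    case True
    have "poly (F i v) t = (\<Sum>j\<in>{1..i}. v j * ((\<psi> + fps_const t * \<eta>) ^ j) $ i)"
      using True by (simp add: F_def poly_sum q)
    also have "\<dots> = (\<Sum>j=0..i. v j * ((\<psi> + fps_const t * \<eta>) ^ j) $ i)"
      using affine_points_0[OF v] by (intro sum.mono_neutral_left) (auto simp: not_le)
    finally show ?thesis by (simp add: jet_subst_nth[OF True])
  next
    case False
    then have "F i v = 0" unfolding F_def by (rule if_not_P)
    then show ?thesis using False by (simp add: jet_subst_outside)
  qed
  ultimately show ?thesis by (rule that)
qed

lemma polyfun_jet_subst_family:
  assumes "q \<in> polyfun {1..k}"
  obtains G where "G \<in> poly_family (polyfun {1..k})"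
    and "\<And>v t. v \<in> affine_points {1..k} \<Longrightarrow>
           poly (G v) t = q (jet_subst k (\<psi> + fps_const t * \<eta>) v)"
proof -
  obtain F where F: "\<And>i. F i \<in> poly_family (polyfun {1..k})"
     "\<And>i v t. v \<in> affine_points {1..k} \<Longrightarrow> poly (F i v) t = jet_subst k (\<psi> + fps_const t * \<eta>) v i"
    by (rule jet_subst_poly_family[of k \<psi> \<eta>]) blast
  obtain G where "G \<in> poly_family (polyfun {1..k})" "\<And>v t. poly (G v) t = q (\<lambda>i. poly (F i v) t)"
    by (rule polyfun_poly_family[OF fun_algebra_polyfun assms, where F = F]) (use F in auto)
  then show ?thesis using that[of G] F(2) by simp
qed

lemma polyfun_jet_subst:
  assumes "q \<in> polyfun {1..k}"
  obtains r where "r \<in> polyfun {1..k}"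
    and "\<And>v. v \<in> affine_points {1..k} \<Longrightarrow> r v = q (jet_subst k \<phi> v)"
proof -
  obtain G where G: "G \<in> poly_family (polyfun {1..k})"
    "\<And>v t. v \<in> affine_points {1..k} \<Longrightarrow> poly (G v) t = q (jet_subst k (\<phi> + fps_const t * 0) v)"
    by (rule polyfun_jet_subst_family[OF assms, of \<phi> 0]) blast
  show ?thesis
    by (rule that[OF poly_family_coeff[OF G(1), of 0]]) (use G(2)[of _ 0] in \<open>simp add: poly_0_coeff_0\<close>)
qed

section \<open>Actions of the additive group\<close>

text \<open>The valuation formula for these binomial coefficients known from the combinatorial proof
  of Sylow's theorem, in the case of valuation zero.\<close>

lemma prime_not_dvd_choose_power:
  assumes "prime p" "\<not> p dvd (m'::nat)"
  shows "\<not> p dvd ((p ^ s * m') choose (p ^ s))"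
proof -
  have "m' > 0" using assms(2) by (intro Nat.gr0I) auto
  have pos: "p ^ s > 0" using assms(1) by (simp add: prime_gt_0_nat)
  have le: "p ^ s \<le> p ^ s * m'" using \<open>m' > 0\<close> by simp
  have "multiplicity p ((p ^ s * m') choose (p ^ s)) = multiplicity p m'"
    using const_p_fac[OF \<open>m' > 0\<close> assms(1)] .
  also have "\<dots> = 0" using assms(2) by (rule not_dvd_imp_multiplicity_0)
  finally show ?thesis
    using multiplicity_eq_zero_iff[of "(p ^ s * m') choose (p ^ s)" p] binomial_eq_0_iff[of "p ^ s * m'" "p ^ s"] le assms(1)
    by (auto simp: prime_nat_iff)
qed

lemma coeff_mult_top:
  assumes "degree p \<le> m" "degree q \<le> n"
  shows "coeff (p * q) (m + n) = coeff p m * coeff q n"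
proof -
  have "coeff (p * q) (m + n) = (\<Sum>i\<le>m+n. if i = m then coeff p m * coeff q n else 0)"
    unfolding coeff_mult
  proof (intro sum.cong refl)
    fix i assume "i \<in> {..m + n}"
    show "coeff p i * coeff q (m + n - i) = (if i = m then coeff p m * coeff q n else 0)"
      using assms by (cases i m rule: linorder_cases) (auto simp: coeff_eq_0)
  qed
  then show ?thesis by simp
qed

lemma degree_power_bound: "degree p \<le> m \<Longrightarrow> degree (p ^ n) \<le> m * n"
  using degree_power_le[of p n] by (metis le_trans mult_le_mono1)

lemma coeff_power_top:
  assumes "degree p \<le> m"
  shows "coeff (p ^ n) (m * n) = coeff p m ^ n"
  by (induction n) (use coeff_mult_top[OF assms degree_power_bound[OF assms]] in auto)

text \<open>The additive law \<open>E t \<circ> E s = E (s + t)\<close> is required only as far as \<open>A\<close> can see it.\<close>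

locale additive_action =
  fixes Z :: "'x set" and E :: "'k::alg_closed_field \<Rightarrow> 'x \<Rightarrow> 'x" and A :: "('x \<Rightarrow> 'k) set"
  assumes alg: "fun_algebra A"
    and A_cong: "\<And>f g. f \<in> A \<Longrightarrow> (\<And>v. v \<in> Z \<Longrightarrow> f v = g v) \<Longrightarrow> g \<in> A"
    and E_in: "\<And>t v. v \<in> Z \<Longrightarrow> E t v \<in> Z"
    and E_zero: "\<And>b v. b \<in> A \<Longrightarrow> v \<in> Z \<Longrightarrow> b (E 0 v) = b v"
    and E_add: "\<And>b v s t. b \<in> A \<Longrightarrow> v \<in> Z \<Longrightarrow> b (E t (E s v)) = b (E (s + t) v)"
    and E_poly: "\<And>b. b \<in> A \<Longrightarrow> \<exists>G\<in>poly_family A. \<forall>v\<in>Z. \<forall>t. poly (G v) t = b (E t v)"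
begin

text \<open>The expansion of \<open>b\<close> along the orbit of \<open>v\<close>, that is, the
  co-action of the additive group. Its coefficients are the Hasse derivatives of \<open>b\<close>
  along the action.\<close>

definition T :: "('x \<Rightarrow> 'k) \<Rightarrow> 'x \<Rightarrow> 'k poly" where
  "T b v = (THE q. \<forall>t. poly q t = b (E t v))"

lemma T_eqI: "(\<And>t. poly q t = b (E t v)) \<Longrightarrow> T b v = q"
  unfolding T_def
  by (rule the_equality) (auto intro!: poly_eq_infinite[OF infinite_UNIV_alg_closed])

lemma T_poly:
  assumes "b \<in> A" "v \<in> Z" shows "poly (T b v) t = b (E t v)"
proof -
  obtain G where "\<forall>v\<in>Z. \<forall>t. poly (G v) t = b (E t v)" using E_poly[OF assms(1)] by blast
  then show ?thesis using T_eqI[of "G v" b v] assms(2) by auto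
qed

lemma T_coeff_in: assumes "b \<in> A" shows "(\<lambda>v. coeff (T b v) i) \<in> A"
proof -
  obtain G where G: "G \<in> poly_family A" "\<forall>v\<in>Z. \<forall>t. poly (G v) t = b (E t v)"
    using E_poly[OF assms] by blast
  show ?thesis
    by (rule A_cong[OF poly_family_coeff[OF G(1), of i]]) (use T_eqI G(2) in metis)
qed

lemma T_bound: assumes "b \<in> A" shows "\<exists>n. \<forall>v\<in>Z. degree (T b v) \<le> n"
proof -
  obtain G where G: "G \<in> poly_family A" "\<forall>v\<in>Z. \<forall>t. poly (G v) t = b (E t v)"
    using E_poly[OF assms] by blast
  obtain n where "\<And>v. degree (G v) \<le> n" using poly_family_degree[OF G(1)] by blast
  then show ?thesis using T_eqI G(2) by metis
qed

lemma T_zero: "b \<in> A \<Longrightarrow> v \<in> Z \<Longrightarrow> coeff (T b v) 0 = b v"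
  using T_poly[of b v 0] E_zero[of b v] by (simp add: poly_0_coeff_0)

definition inv :: "('x \<Rightarrow> 'k) \<Rightarrow> bool" where
  "inv b \<longleftrightarrow> (\<forall>v\<in>Z. \<forall>t. b (E t v) = b v)"

lemma invD: "inv b \<Longrightarrow> v \<in> Z \<Longrightarrow> b (E t v) = b v"
  by (simp add: inv_def)

lemma T_inv: "inv b \<Longrightarrow> v \<in> Z \<Longrightarrow> T b v = [:b v:]"
  by (rule T_eqI) (simp add: inv_def)

lemma inv_iff: "b \<in> A \<Longrightarrow> inv b \<longleftrightarrow> (\<forall>v\<in>Z. degree (T b v) = 0)"
proof
  assume b: "b \<in> A" and "\<forall>v\<in>Z. degree (T b v) = 0"
  then show "inv b" unfolding inv_def
    by (metis T_poly T_zero b degree_0_id poly_pCons poly_0 mult_zero_right add_0_right)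
qed (simp add: T_inv)

lemma T_translate:
  assumes "b \<in> A" "v \<in> Z" "degree (T b v) \<le> m"
  shows "T b (E t v) = (\<Sum>l\<le>m. smult (coeff (T b v) l) ([:t, 1:] ^ l))"
proof (rule T_eqI)
  fix x
  have "b (E x (E t v)) = poly (T b v) (t + x)"
    using assms by (simp add: E_add T_poly)
  also have "\<dots> = (\<Sum>l\<le>m. coeff (T b v) l * (t + x) ^ l)"
    unfolding poly_altdef using assms(3) by (intro sum.mono_neutral_left) (auto simp: coeff_eq_0)
  finally show "poly (\<Sum>l\<le>m. smult (coeff (T b v) l) ([:t, 1:] ^ l)) x = b (E x (E t v))"
    by (simp add: poly_sum poly_power)
qed

text \<open>The composition rule of Hasse derivatives: D_i D_j is the binomial coefficient of i + j
  over j times D_(i+j).\<close>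

lemma T_coeff:
  assumes "b \<in> A" "v \<in> Z" "degree (T b v) \<le> m"
  shows "T (\<lambda>v. coeff (T b v) j) v =
           (\<Sum>l\<le>m. monom (of_nat (l choose j) * coeff (T b v) l) (l - j))"
proof (rule T_eqI)
  fix t :: 'k
  have c: "coeff ([:t, 1:] ^ l) j = of_nat (l choose j) * t ^ (l - j)" for l
  proof (cases "j \<le> l")
    case True
    then show ?thesis by (simp add: coeff_linear_poly_power)
  next
    case False
    moreover have "degree ([:t, 1:] ^ l) = l" by (rule degree_linear_power)
    ultimately show ?thesis by (simp add: coeff_eq_0 binomial_eq_0)
  qed
  show "poly (\<Sum>l\<le>m. monom (of_nat (l choose j) * coeff (T b v) l) (l - j)) t = coeff (T b (E t v)) j"
    by (simp add: T_translate[OF assms] coeff_sum poly_sum poly_monom c mult.commute mult.left_commute)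
qed

lemma inv_top_coeff:
  assumes b: "b \<in> A" and deg: "\<And>v. v \<in> Z \<Longrightarrow> degree (T b v) \<le> m"
  shows "inv (\<lambda>v. coeff (T b v) m)"
  unfolding inv_iff[OF T_coeff_in[OF b]]
proof
  fix v assume v: "v \<in> Z"
  have "T (\<lambda>v. coeff (T b v) m) v = (\<Sum>l\<le>m. if l = m then [:coeff (T b v) m:] else 0)"
    unfolding T_coeff[OF b v deg[OF v]]
    by (intro sum.cong) (auto simp: monom_0 binomial_eq_0)
  then show "degree (T (\<lambda>v. coeff (T b v) m) v) = 0" by simp
qed

text \<open>The degree of an element of \<open>A\<close> is its largest degree in \<open>t\<close>
  over \<open>Z\<close>; \<open>n\<close> is the least positive degree that occurs. Minimality is
  phrased through the vanishing of the coefficient at every smaller candidate degree.\<close>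

definition minimal_degree :: "nat \<Rightarrow> bool" where
  "minimal_degree n \<longleftrightarrow> n > 0 \<and>
     (\<exists>a\<in>A. (\<forall>v\<in>Z. degree (T a v) \<le> n) \<and> (\<exists>v\<in>Z. coeff (T a v) n \<noteq> 0)) \<and>
     (\<forall>a\<in>A. \<forall>m. 0 < m \<and> m < n \<and> (\<forall>v\<in>Z. degree (T a v) \<le> m) \<longrightarrow> (\<forall>v\<in>Z. coeff (T a v) m = 0))"

lemma minimal_degree_exists:
  assumes "b \<in> A" "\<not> inv b"
  obtains n where "minimal_degree n"
proof -
  define Q where "Q n \<longleftrightarrow> n > 0 \<and> (\<exists>a\<in>A. (\<forall>v\<in>Z. degree (T a v) \<le> n) \<and> (\<exists>v\<in>Z. coeff (T a v) n \<noteq> 0))" for n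
  obtain N where N: "\<forall>v\<in>Z. degree (T b v) \<le> N" using T_bound[OF assms(1)] by blast
  define M where "M = Max ((\<lambda>v. degree (T b v)) ` Z)"
  have fin: "finite ((\<lambda>v. degree (T b v)) ` Z)"
    unfolding finite_nat_set_iff_bounded_le using N by blast
  obtain w where w: "w \<in> Z" "degree (T b w) \<noteq> 0" using assms inv_iff[of b] by auto
  have le: "degree (T b v) \<le> M" if "v \<in> Z" for v unfolding M_def using fin that by (intro Max_ge imageI)
  have "M \<in> (\<lambda>v. degree (T b v)) ` Z" unfolding M_def using fin w by (intro Max_in) auto
  then obtain v where v: "v \<in> Z" "degree (T b v) = M" by blast
  have "M > 0" using le[OF w(1)] w(2) by simp
  then have "coeff (T b v) M \<noteq> 0" using v by (metis leading_coeff_0_iff degree_0 less_irrefl)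
  then have "Q M" unfolding Q_def using \<open>M > 0\<close> assms(1) le v by blast
  then have 1: "Q (LEAST n. Q n)" by (rule LeastI)
  have 2: "\<not> Q m" if "m < (LEAST n. Q n)" for m using not_less_Least[OF that] .
  have "minimal_degree (LEAST n. Q n)"
    unfolding minimal_degree_def
  proof (intro conjI ballI allI impI)
    show "0 < (LEAST n. Q n)"
      and "\<exists>a\<in>A. (\<forall>v\<in>Z. degree (T a v) \<le> (LEAST n. Q n)) \<and> (\<exists>v\<in>Z. coeff (T a v) (LEAST n. Q n) \<noteq> 0)"
      using 1 unfolding Q_def[of "LEAST n. Q n"] by simp_all
    fix a m v
    assume a: "a \<in> A" "v \<in> Z" and m: "0 < m \<and> m < (LEAST n. Q n) \<and> (\<forall>v\<in>Z. degree (T a v) \<le> m)"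
    show "coeff (T a v) m = 0"
    proof (rule ccontr)
      assume "coeff (T a v) m \<noteq> 0"
      then have "Q m" unfolding Q_def using a m by (intro conjI bexI[of _ a] bexI[of _ v]) auto
      then show False using 2[of m] m by blast
    qed
  qed
  then show ?thesis by (rule that)
qed

text \<open>For \<open>m = p\<^sup>s m'\<close> with \<open>p \<nmid> m'\<close> the binomial coefficient of \<open>m\<close> over \<open>p\<^sup>s\<close> is prime to \<open>p\<close>, so
  an element of degree \<open>m\<close> has a derivative of order \<open>m - p\<^sup>s\<close> and degree \<open>p\<^sup>s\<close>.\<close>

lemma minimal_degree_dvd:
  assumes p: "CHAR('k) = p" "prime p" and n: "minimal_degree n"
    and b: "b \<in> A" and deg: "\<And>v. v \<in> Z \<Longrightarrow> degree (T b v) \<le> m"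
    and m: "m > 0" "v0 \<in> Z" "coeff (T b v0) m \<noteq> 0"
  shows "n dvd m"
proof -
  have key: "n \<le> p ^ multiplicity p m'"
    if b: "b \<in> A" and deg: "\<And>v. v \<in> Z \<Longrightarrow> degree (T b v) \<le> m'"
      and m: "m' > 0" "v0 \<in> Z" "coeff (T b v0) m' \<noteq> 0" for b m' v0
  proof (rule ccontr)
    define s where "s = multiplicity p m'"
    assume "\<not> n \<le> p ^ multiplicity p m'"
    then have lt: "p ^ s < n" by (simp add: s_def)
    obtain m1 where m1: "m' = p ^ s * m1" "\<not> p dvd m1"
      unfolding s_def using multiplicity_decompose'[of m' p] m(1) p(2)
      by (metis not_prime_unit gr_implies_not0)
    have "m1 > 0" using m1(2) by (intro Nat.gr0I) auto
    have le: "p ^ s \<le> m'" using m1 \<open>m1 > 0\<close> by simp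
    define D where "D = (\<lambda>v. coeff (T b v) (m' - p ^ s))"
    have D: "D \<in> A" unfolding D_def by (rule T_coeff_in[OF b])
    have TD: "T D v = (\<Sum>l\<le>m'. monom (of_nat (l choose (m' - p ^ s)) * coeff (T b v) l) (l - (m' - p ^ s)))"
      if "v \<in> Z" for v unfolding D_def by (rule T_coeff[OF b that deg[OF that]])
    have degD: "degree (T D v) \<le> p ^ s" if "v \<in> Z" for v
      unfolding TD[OF that]
      by (intro degree_sum_le) (auto intro!: order_trans[OF degree_monom_le] simp: le)
    have "coeff (T D v0) (p ^ s) = (\<Sum>l\<le>m'. if l = m' then of_nat (m' choose (m' - p ^ s)) * coeff (T b v0) m' else 0)"
      unfolding TD[OF m(2)] coeff_sum
    proof (intro sum.cong refl)
      fix l assume "l \<in> {..m'}"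
      moreover have "0 < p ^ s" using p(2) by (simp add: prime_gt_0_nat)
      moreover have "l - (m' - r) = r \<longleftrightarrow> l = m'" if "0 < r" "r \<le> m'" "l \<le> m'" for r
        using that by arith
      ultimately have "l - (m' - p ^ s) = p ^ s \<longleftrightarrow> l = m'" using le by simp
      then show "coeff (monom (of_nat (l choose (m' - p ^ s)) * coeff (T b v0) l) (l - (m' - p ^ s))) (p ^ s) =
        (if l = m' then of_nat (m' choose (m' - p ^ s)) * coeff (T b v0) m' else 0)"
        by simp
    qed
    also have "\<dots> = of_nat (m' choose p ^ s) * coeff (T b v0) m'"
      using le binomial_symmetric[OF le] by simp
    also have "\<dots> \<noteq> 0"
      using prime_not_dvd_choose_power[OF p(2) m1(2), of s] m(3) m1(1)
      by (simp add: of_nat_eq_0_iff_char_dvd p(1))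
    finally have "coeff (T D v0) (p ^ s) \<noteq> 0" .
    moreover have "0 < p ^ s" using p(2) by (simp add: prime_gt_0_nat)
    ultimately show False
      using n D degD lt m(2) unfolding minimal_degree_def by blast
  qed
  obtain a v where a: "a \<in> A" "\<And>v. v \<in> Z \<Longrightarrow> degree (T a v) \<le> n" "v \<in> Z" "coeff (T a v) n \<noteq> 0" and "n > 0"
    using n unfolding minimal_degree_def by blast
  \<comment> \<open>Applied to an element of degree \<open>n\<close> itself, the estimate shows that
    \<open>n\<close> is a power of p; applied to \<open>b\<close>, it shows that this power divides
    \<open>m\<close>.\<close>
  have "n \<le> p ^ multiplicity p n" by (rule key[OF a(1,2) \<open>n > 0\<close> a(3,4)])
  moreover have "p ^ multiplicity p n \<le> n" using \<open>n > 0\<close> by (intro dvd_imp_le multiplicity_dvd)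
  ultimately have n_eq: "n = p ^ multiplicity p n" by simp
  have "n \<le> p ^ multiplicity p m" by (rule key[OF b deg m])
  then have "p ^ multiplicity p n \<le> p ^ multiplicity p m" using n_eq by simp
  then have "multiplicity p n \<le> multiplicity p m"
    using power_increasing_iff[OF prime_gt_1_nat[OF p(2)]] by blast
  then have "n dvd p ^ multiplicity p m" using n_eq le_imp_power_dvd[of _ _ p] by metis
  then show ?thesis using multiplicity_dvd dvd_trans by blast
qed

text \<open>Division by \<open>a\<close>, with the invariant leading coefficient \<open>C\<close>
  inverted. As \<open>n\<close> divides the degree of \<open>b\<close>, a multiple of a power of
  \<open>a\<close> cancels the leading term; this multiple vanishes on the slice a = 0, and the
  process ends at degree zero with an invariant.\<close>

lemma slice:
  assumes p: "CHAR('k) = p" "prime p" and n: "minimal_degree n"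
    and a: "a \<in> A" and dega: "\<And>v. v \<in> Z \<Longrightarrow> degree (T a v) \<le> n"
    and b: "b \<in> A"
  obtains M B where "B \<in> A" "inv B"
    "\<And>v. v \<in> Z \<Longrightarrow> a v = 0 \<Longrightarrow> coeff (T a v) n ^ M * b v = B v"
proof -
  define C where "C = (\<lambda>v. coeff (T a v) n)"
  have C: "C \<in> A" "inv C" unfolding C_def by (auto intro!: T_coeff_in[OF a] inv_top_coeff[OF a] dega)
  have main: "\<exists>M B. B \<in> A \<and> inv B \<and> (\<forall>v\<in>Z. a v = 0 \<longrightarrow> C v ^ M * b v = B v)"
    if "b \<in> A" "\<forall>v\<in>Z. degree (T b v) \<le> m" for b m
    using that
  proof (induction m arbitrary: b rule: less_induct)
    case (less m)
    note b = less.prems(1)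
    show ?case
    proof (cases "m = 0")
      case True
      then have "inv b" using less.prems inv_iff by simp
      then show ?thesis using b by (intro exI[of _ 0] exI[of _ b]) simp
    next
      case m0: False
      show ?thesis
      proof (cases "\<forall>v\<in>Z. coeff (T b v) m = 0")
        case True
        have "degree (T b v) \<le> m - 1" if "v \<in> Z" for v
        proof (rule degree_le, intro allI impI)
          fix i assume "i > m - 1"
          then show "coeff (T b v) i = 0"
            using True that less.prems(2) m0 by (cases "i = m") (auto simp: coeff_eq_0)
        qed
        then show ?thesis using less.IH[of "m - 1" b] m0 b by simp
      next
        case False
        define D where "D = (\<lambda>v. coeff (T b v) m)"
        have D: "D \<in> A" "inv D" unfolding D_def
          using b less.prems(2) by (auto intro!: T_coeff_in inv_top_coeff)
        from False obtain v0 where "v0 \<in> Z" "coeff (T b v0) m \<noteq> 0" by blast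
        then have "n dvd m" using minimal_degree_dvd[OF p n b, of m v0] less.prems(2) m0 by simp
        then obtain j where j: "m = n * j" by (elim dvdE)
        then have "j > 0" using m0 by (intro Nat.gr0I) auto
        \<comment> \<open>Both products have leading coefficient \<open>C v ^ j * D v\<close> in
          degree \<open>m = n * j\<close>, so the difference has smaller degree.\<close>
        define b' where "b' = (\<lambda>v. C v ^ j * b v - D v * a v ^ j)"
        have b'A: "b' \<in> A" unfolding b'_def
          by (intro fun_algebra_diff[OF alg] fun_algebra_mult[OF alg] fun_algebra_power[OF alg] C D a b)
        have Tb': "T b' v = smult (C v ^ j) (T b v) - smult (D v) (T a v ^ j)" if v: "v \<in> Z" for v
        proof (rule T_eqI)
          fix t
          show "poly (smult (C v ^ j) (T b v) - smult (D v) (T a v ^ j)) t = b' (E t v)"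
            unfolding b'_def using invD[OF C(2) v] invD[OF D(2) v]
            by (simp add: T_poly[OF b v] T_poly[OF a v])
        qed
        have "degree (T b' v) \<le> m - 1" if v: "v \<in> Z" for v
        proof (rule degree_le, intro allI impI)
          fix i assume i: "i > m - 1"
          have d: "degree (T a v ^ j) \<le> m" unfolding j by (rule degree_power_bound[OF dega[OF v]])
          show "coeff (T b' v) i = 0"
          proof (cases "i = m")
            case True
            have "coeff (T a v ^ j) m = C v ^ j"
              unfolding j C_def by (rule coeff_power_top[OF dega[OF v]])
            then show ?thesis by (simp add: Tb'[OF v] True D_def)
          next
            case False
            then have "i > m" using i by simp
            then have "coeff (T b v) i = 0" "coeff (T a v ^ j) i = 0"
              using less.prems(2) v d by (auto intro!: coeff_eq_0 elim: le_less_trans)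
            then show ?thesis by (simp add: Tb'[OF v])
          qed
        qed
        then obtain M B where MB: "B \<in> A" "inv B" "\<forall>v\<in>Z. a v = 0 \<longrightarrow> C v ^ M * b' v = B v"
          using less.IH[of "m - 1" b'] b'A m0 by auto
        have "\<forall>v\<in>Z. a v = 0 \<longrightarrow> C v ^ (M + j) * b v = B v"
          using MB(3) \<open>j > 0\<close> unfolding b'_def by (auto simp: power_add power_0_left mult.assoc)
        then show ?thesis using MB by blast
      qed
    qed
  qed
  obtain N where "\<forall>v\<in>Z. degree (T b v) \<le> N" using T_bound[OF b] by blast
  then obtain M B where "B \<in> A" "inv B" "\<forall>v\<in>Z. a v = 0 \<longrightarrow> C v ^ M * b v = B v"
    using main[OF b, of N] by blast
  then show ?thesis using that[of B M] by (simp add: C_def)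
qed

end

section \<open>Semi-invariant functions\<close>

text \<open>Lagrange interpolation: \<open>c t\<close> is the coefficient of index \<open>i\<close>
  of the basis polynomial at \<open>t\<close>.\<close>

lemma poly_coeff_interpolation:
  fixes S :: "'k::field set"
  assumes "finite S"
  obtains c where "\<And>p. degree p < card S \<Longrightarrow> coeff p i = (\<Sum>t\<in>S. c t * poly p t)"
proof -
  define l :: "'k \<Rightarrow> 'k poly" where "l t = (\<Prod>s\<in>S-{t}. smult (inverse (t - s)) [:-s, 1:])" for t
  have val: "poly (l t) s = (if s = t then 1 else 0)" if "s \<in> S" "t \<in> S" for s t
  proof (cases "s = t")
    case True
    have "poly (smult (inverse (t - r)) [:-r, 1:]) t = 1" if "r \<in> S - {t}" for r
    proof -
      have "poly [:-r, 1:] t = t - r" by simp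
      then show ?thesis using that by (simp only: poly_smult) (rule left_inverse, auto)
    qed
    then show ?thesis using True by (simp add: l_def poly_prod)
  next
    case False
    then have "s \<in> S - {t}" using that by auto
    then have "(\<Prod>r\<in>S-{t}. poly (smult (inverse (t - r)) [:-r, 1:]) s) = 0"
      using assms by (intro prod_zero) (auto intro!: bexI[of _ s])
    then show ?thesis using False by (simp add: l_def poly_prod)
  qed
  have deg: "degree (l t) < card S" if "t \<in> S" for t
  proof -
    have "degree (l t) \<le> sum (degree \<circ> (\<lambda>s. smult (inverse (t - s)) [:-s, 1:])) (S - {t})"
      unfolding l_def by (rule degree_prod_sum_le) (use assms in simp)
    also have "\<dots> \<le> sum (\<lambda>_. 1) (S - {t})"
      unfolding o_def by (intro sum_mono order_trans[OF degree_smult_le]) simp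
    also have "\<dots> < card S" using that assms card_gt_0_iff[of S] by (auto simp: card_Diff_singleton)
    finally show ?thesis .
  qed
  have "p = (\<Sum>t\<in>S. smult (poly p t) (l t))" if "degree p < card S" for p
  proof (rule poly_eqI_degree[of S])
    fix s assume "s \<in> S"
    then have "poly (\<Sum>t\<in>S. smult (poly p t) (l t)) s = (\<Sum>t\<in>S. if t = s then poly p s else 0)"
      unfolding poly_sum by (intro sum.cong) (auto simp: val)
    then show "poly p s = poly (\<Sum>t\<in>S. smult (poly p t) (l t)) s"
      using assms \<open>s \<in> S\<close> by simp
  next
    have "card S > 0" using that by linarith
    have "degree (l t) \<le> card S - 1" if "t \<in> S" for t using deg[OF that] by linarith
    then have "degree (\<Sum>t\<in>S. smult (poly p t) (l t)) \<le> card S - 1"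
      by (intro degree_sum_le assms order_trans[OF degree_smult_le])
    then show "degree (\<Sum>t\<in>S. smult (poly p t) (l t)) < card S"
      using \<open>card S > 0\<close> by linarith
  qed (use that in auto)
  then have "coeff p i = (\<Sum>t\<in>S. coeff (l t) i * poly p t)" if "degree p < card S" for p
    using that by (metis (no_types, lifting) coeff_smult coeff_sum mult.commute sum.cong)
  then show ?thesis by (rule that)
qed

section \<open>Shears and the filtration of the group of coordinate changes\<close>

abbreviation shear :: "nat \<Rightarrow> 'k::field \<Rightarrow> 'k fps" where
  "shear e t \<equiv> fps_X + fps_const t * fps_X ^ e"

lemma shear_tangent: "e \<ge> 2 \<Longrightarrow> tangent e (shear e t)"
  by (auto simp: tangent_def agree_def fps_X_power_nth)

lemma shear_coord_change [simp]: "e \<ge> 2 \<Longrightarrow> coord_change (shear e t)"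
  using tangent_coord_change[OF shear_tangent] .

lemma shear_nth_0 [simp]: "e \<ge> 2 \<Longrightarrow> shear e t $ 0 = 0"
  by (simp add: fps_X_power_nth)

text \<open>The e-th power of x + t x^e is x^e modulo x^(e+1), so the parameters of shears of one
  order add up to this precision.\<close>

lemma shear_compose_agree:
  assumes "e \<ge> 2" shows "agree (Suc e) (shear e s oo shear e t) (shear e (s + t))"
proof -
  have 1: "shear e t $ 1 = 1" using assms tangent_nth[OF shear_tangent, of e 1 t] by simp
  have "shear e t ^ e $ i = fps_X ^ e $ i" if "i < Suc e" for i
    using that startsby_zero_power_prefix[of "shear e t" e] startsby_zero_power_nth_same[of "shear e t" e] assms 1
    by (cases "i = e") (auto simp: fps_X_power_nth)
  then have "agree (Suc e) (shear e t ^ e) (fps_X ^ e)" by (simp add: agree_def)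
  then have "agree (Suc e) (shear e t + fps_const s * shear e t ^ e) (shear e t + fps_const s * fps_X ^ e)"
    by (intro agree_add agree_mult agree_refl)
  moreover have "shear e s oo shear e t = shear e t + fps_const s * shear e t ^ e"
    using assms
    by (simp only: fps_compose_add_distrib fps_compose_mult_distrib[OF shear_nth_0]
        fps_compose_power[OF shear_nth_0, symmetric] fps_X_fps_compose_startby0[OF shear_nth_0] fps_const_compose)
  moreover have "shear e t + fps_const s * fps_X ^ e = shear e (s + t)"
    by (simp add: algebra_simps flip: fps_const_add)
  ultimately show ?thesis by simp
qed

lemma tangent_shear_commute:
  assumes "tangent (Suc e) \<phi>" "e \<ge> 2"
  obtains \<theta> where "tangent (Suc e) \<theta>" "\<phi> oo shear e t = shear e t oo \<theta>"
proof -
  have "agree (Suc e) (\<phi> oo shear e t) (fps_X oo shear e t)"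
    using assms by (intro agree_compose) (auto simp: tangent_def)
  then have "agree (Suc e) (\<phi> oo shear e t) (shear e t)"
    using assms by (simp add: fps_X_fps_compose_startby0)
  then show ?thesis
    by (rule agree_factor)
       (use assms that tangent_coord_change[OF assms(1)] in \<open>auto intro!: coord_change_compose\<close>)
qed

lemma shear_compose_factor:
  assumes "e \<ge> 2"
  obtains \<theta> where "tangent (Suc e) \<theta>" "shear e s oo shear e t = shear e (s + t) oo \<theta>"
  by (rule agree_factor[OF shear_compose_agree[OF assms, of s t]])
     (use assms that in \<open>auto intro: coord_change_compose\<close>)

lemma tangent_shear_factor:
  assumes "tangent e \<phi>" "e \<ge> 2"
  obtains \<theta> where "tangent (Suc e) \<theta>" "\<phi> = shear e (\<phi> $ e) oo \<theta>"
proof -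
  have "agree (Suc e) \<phi> (shear e (\<phi> $ e))"
    using assms by (auto simp: agree_def less_Suc_eq tangent_nth fps_X_power_nth)
  then show ?thesis
    by (rule agree_factor) (use assms that tangent_coord_change in auto)
qed

lemma tangent_scale_commute:
  assumes "tangent 2 \<phi>" "u \<noteq> 0"
  obtains \<theta> where "tangent 2 \<theta>" "\<phi> oo (fps_const u * fps_X) = (fps_const u * fps_X) oo \<theta>"
proof -
  have "agree 2 (\<phi> oo (fps_const u * fps_X)) (fps_X oo (fps_const u * fps_X))"
    using assms by (intro agree_compose) (auto simp: tangent_def)
  then have "agree 2 (\<phi> oo (fps_const u * fps_X)) (fps_const u * fps_X)"
    by (simp add: fps_X_fps_compose_startby0)
  then show ?thesis
    by (rule agree_factor)
       (use assms that tangent_coord_change[OF assms(1)] in \<open>auto intro!: coord_change_compose\<close>)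
qed

lemma coord_change_scale_factor:
  assumes "coord_change \<phi>"
  obtains \<theta> where "tangent 2 \<theta>" "\<phi> = (fps_const (\<phi> $ 1) * fps_X) oo \<theta>"
proof -
  have "agree 2 \<phi> (fps_const (\<phi> $ 1) * fps_X)"
    using assms by (auto simp: agree_def coord_change_def less_2_cases_iff One_nat_def)
  then show ?thesis
    by (rule agree_factor) (use assms that in \<open>auto simp: coord_change_def\<close>)
qed

definition tangent_invariant ::
    "nat \<Rightarrow> nat \<Rightarrow> (nat \<Rightarrow> 'k::field) set \<Rightarrow> ((nat \<Rightarrow> 'k) \<Rightarrow> 'a) \<Rightarrow> bool" where
  "tangent_invariant k e Z b \<longleftrightarrow> (\<forall>v\<in>Z. \<forall>\<phi>. tangent e \<phi> \<longrightarrow> b (jet_subst k \<phi> v) = b v)"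

lemma tangent_invariantD:
  "tangent_invariant k e Z b \<Longrightarrow> v \<in> Z \<Longrightarrow> tangent e \<phi> \<Longrightarrow> b (jet_subst k \<phi> v) = b v"
  by (simp add: tangent_invariant_def)

text \<open>For a function that does not see changes tangent to order e + 1, the changes tangent to
  order e act as the additive group, with the coefficient of index e as parameter. Each rule comes
  from a factorisation into a shear followed by a tangent series.\<close>

lemma
  assumes Z: "jet_invariant k Z" and e: "e \<ge> 2" and b: "tangent_invariant k (Suc e) Z b" and v: "v \<in> Z"
  shows shear_tangent_invariant:
      "tangent (Suc e) \<phi> \<Longrightarrow> b (jet_subst k (shear e t) (jet_subst k \<phi> v)) = b (jet_subst k (shear e t) v)"
    and shear_shear_invariant:
      "b (jet_subst k (shear e t) (jet_subst k (shear e s) v)) = b (jet_subst k (shear e (s + t)) v)"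
    and tangent_shear_invariant:
      "tangent e \<phi> \<Longrightarrow> b (jet_subst k \<phi> v) = b (jet_subst k (shear e (\<phi> $ e)) v)"
proof -
  have vp: "v \<in> affine_points {1..k}" using jet_invariantD(2)[OF Z v] .
  have shear_in: "jet_subst k (shear e t) v \<in> Z" for t
    using e by (intro jet_invariantD(1)[OF Z v]) simp
  have factor: "b (jet_subst k \<phi> v) = b (jet_subst k (shear e t) v)"
    if \<theta>: "tangent (Suc e) \<theta>" and eq: "\<phi> = shear e t oo \<theta>" for \<phi> \<theta> t
  proof -
    have "\<theta> $ 0 = 0" using tangent_nth[OF \<theta>, of 0] by simp
    then have "jet_subst k \<phi> v = jet_subst k \<theta> (jet_subst k (shear e t) v)"
      unfolding eq using vp e by (intro jet_subst_compose[symmetric]) auto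
    then show ?thesis using tangent_invariantD[OF b shear_in \<theta>] by simp
  qed
  {
    assume \<phi>: "tangent (Suc e) \<phi>"
    obtain \<theta> where \<theta>: "tangent (Suc e) \<theta>" "\<phi> oo shear e t = shear e t oo \<theta>"
      using \<phi> e by (rule tangent_shear_commute)
    have "jet_subst k (shear e t) (jet_subst k \<phi> v) = jet_subst k (\<phi> oo shear e t) v"
      using vp e tangent_nth[OF \<phi>, of 0] by (intro jet_subst_compose) auto
    then show "b (jet_subst k (shear e t) (jet_subst k \<phi> v)) = b (jet_subst k (shear e t) v)"
      using factor[OF \<theta>] by simp
  next
    obtain \<theta> where \<theta>: "tangent (Suc e) \<theta>" "shear e s oo shear e t = shear e (s + t) oo \<theta>"
      using e by (rule shear_compose_factor)
    have "jet_subst k (shear e t) (jet_subst k (shear e s) v) = jet_subst k (shear e s oo shear e t) v"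
      using vp e by (intro jet_subst_compose) auto
    then show "b (jet_subst k (shear e t) (jet_subst k (shear e s) v)) = b (jet_subst k (shear e (s + t)) v)"
      using factor[OF \<theta>] by simp
  next
    assume "tangent e \<phi>"
    then obtain \<theta> where "tangent (Suc e) \<theta>" "\<phi> = shear e (\<phi> $ e) oo \<theta>"
      using e by (rule tangent_shear_factor)
    then show "b (jet_subst k \<phi> v) = b (jet_subst k (shear e (\<phi> $ e)) v)" by (rule factor)
  }
qed

text \<open>The non-vanishing locus of such a function is invariant under the whole group, which is
  what strata cut out by one function require.\<close>

definition semi_invariant :: "nat \<Rightarrow> (nat \<Rightarrow> 'k::field) set \<Rightarrow> ((nat \<Rightarrow> 'k) \<Rightarrow> 'k) \<Rightarrow> nat \<Rightarrow> bool" where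
  "semi_invariant k Z c w \<longleftrightarrow>
     (\<forall>v\<in>Z. \<forall>\<phi>. coord_change \<phi> \<longrightarrow> c (jet_subst k \<phi> v) = (\<phi> $ 1) ^ w * c v)"

lemma semi_invariantD:
  "semi_invariant k Z c w \<Longrightarrow> v \<in> Z \<Longrightarrow> coord_change \<phi> \<Longrightarrow> c (jet_subst k \<phi> v) = (\<phi> $ 1) ^ w * c v"
  by (simp add: semi_invariant_def)

text \<open>A stable subspace contains a semi-invariant: pass to leading coefficients for the shears of
  order \<open>k, k - 1, \<dots>, 2\<close> and then to a homogeneous component for the scalings.\<close>

lemma stable_subspace_coeff:
  fixes M :: "((nat \<Rightarrow> 'k::alg_closed_field) \<Rightarrow> 'k) set"
  assumes lin: "fun_algebra P" "\<And>f g a. f \<in> M \<Longrightarrow> g \<in> M \<Longrightarrow> (\<lambda>v. a * f v + g v) \<in> M"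
    and zero: "(\<lambda>_. 0) \<in> M"
    and cong: "\<And>f g. f \<in> M \<Longrightarrow> g \<in> P \<Longrightarrow> (\<And>v. v \<in> Z \<Longrightarrow> f v = g v) \<Longrightarrow> g \<in> M"
    and G: "G \<in> poly_family P" and E: "finite E"
    and val: "\<And>t. t \<notin> E \<Longrightarrow> (\<lambda>v. poly (G v) t) \<in> M"
  shows "(\<lambda>v. coeff (G v) i) \<in> M"
proof -
  obtain n where n: "\<And>v. degree (G v) \<le> n" using poly_family_degree[OF G] by blast
  \<comment> \<open>Membership is known only for parameters outside \<open>E\<close>; any n + 1 of
    them determine all coefficients linearly.\<close>
  have "infinite (- E)" using E infinite_UNIV_alg_closed[where 'k='k] by (simp add: Compl_eq_Diff_UNIV Diff_infinite_finite)
  then obtain S where S: "S \<subseteq> - E" "finite S" "card S = Suc n" using infinite_arbitrarily_large by metis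
  obtain c where c: "\<And>p. degree p < card S \<Longrightarrow> coeff p i = (\<Sum>t\<in>S. c t * poly p t)"
    using poly_coeff_interpolation[OF S(2)] by blast
  have "(\<lambda>v. \<Sum>t\<in>S'. c t * poly (G v) t) \<in> M" if "S' \<subseteq> S" for S'
    using finite_subset[OF that S(2)] that
  proof (induction S')
    case empty
    then show ?case using zero by simp
  next
    case (insert t S')
    then have "(\<lambda>v. poly (G v) t) \<in> M" using S(1) val by blast
    then show ?case using insert lin(2)[of "\<lambda>v. poly (G v) t" "\<lambda>v. \<Sum>t\<in>S'. c t * poly (G v) t" "c t"]
      by auto
  qed
  moreover have "(\<Sum>t\<in>S. c t * poly (G v) t) = coeff (G v) i" for v
    using c[of "G v"] n[of v] S(3) by simp
  ultimately show ?thesis by (metis (no_types, lifting) ext order_refl)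
qed

text \<open>The tangent part of \<open>\<phi>\<close> is moved past the scaling to a place where
  \<open>g\<close> does not see it, so only the product of the two scale factors remains. The
  parameter 0 gives no coordinate change; it is reached because two polynomials that agree elsewhere
  are equal.\<close>

lemma scale_family_translate:
  fixes G :: "(nat \<Rightarrow> 'k::alg_closed_field) \<Rightarrow> 'k poly"
  assumes Z: "jet_invariant k Z" and g: "tangent_invariant k 2 Z g"
    and G: "\<And>v t. v \<in> Z \<Longrightarrow> poly (G v) t = g (jet_subst k (fps_const t * fps_X) v)"
    and v: "v \<in> Z" and \<phi>: "coord_change \<phi>"
  shows "G (jet_subst k \<phi> v) = pcompose (G v) [:0, \<phi> $ 1:]"
proof (rule poly_eq_cofinite[of "{0}"])
  define u where "u = \<phi> $ 1"
  have u: "u \<noteq> 0" using \<phi> by (simp add: u_def coord_changeD)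
  have vp: "v \<in> affine_points {1..k}" using jet_invariantD(2)[OF Z v] .
  obtain \<theta> where \<theta>: "tangent 2 \<theta>" "\<phi> = (fps_const u * fps_X) oo \<theta>"
    unfolding u_def by (rule coord_change_scale_factor[OF \<phi>])
  fix t :: 'k assume t: "t \<notin> {0}"
  obtain \<theta>' where \<theta>': "tangent 2 \<theta>'" "\<theta> oo (fps_const t * fps_X) = (fps_const t * fps_X) oo \<theta>'"
    using \<theta>(1) t tangent_scale_commute[of \<theta> t] by auto
  have z: "\<phi> $ 0 = 0" "\<theta> $ 0 = 0" "\<theta>' $ 0 = 0"
    using \<phi> tangent_nth[OF \<theta>(1), of 0] tangent_nth[OF \<theta>'(1), of 0] by (auto simp: coord_changeD)
  have "\<phi> oo (fps_const t * fps_X) = (fps_const u * fps_X) oo (\<theta> oo (fps_const t * fps_X))"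
    unfolding \<theta>(2) using z by (intro fps_compose_assoc[symmetric]) auto
  also have "\<dots> = ((fps_const u * fps_X) oo (fps_const t * fps_X)) oo \<theta>'"
    unfolding \<theta>'(2) using z by (intro fps_compose_assoc) auto
  also have "(fps_const u * fps_X) oo (fps_const t * fps_X) = fps_const (u * t) * fps_X"
    by (subst fps_compose_mult_distrib) (auto simp: fps_X_fps_compose_startby0 mult.assoc[symmetric])
  finally have eq: "\<phi> oo (fps_const t * fps_X) = (fps_const (u * t) * fps_X) oo \<theta>'" .
  have "poly (G (jet_subst k \<phi> v)) t = g (jet_subst k (fps_const t * fps_X) (jet_subst k \<phi> v))"
    using G[OF jet_invariantD(1)[OF Z v \<phi>]] .
  also have "\<dots> = g (jet_subst k (\<phi> oo (fps_const t * fps_X)) v)"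
    using vp z by (subst jet_subst_compose) auto
  also have "\<dots> = g (jet_subst k \<theta>' (jet_subst k (fps_const (u * t) * fps_X) v))"
    unfolding eq using vp z by (subst jet_subst_compose) auto
  also have "\<dots> = g (jet_subst k (fps_const (u * t) * fps_X) v)"
    using u t by (intro tangent_invariantD[OF g _ \<theta>'(1)] jet_invariantD(1)[OF Z v]) simp
  also have "\<dots> = poly (pcompose (G v) [:0, \<phi> $ 1:]) t"
    using G[OF v, of "u * t"] by (simp add: poly_pcompose mult.commute u_def)
  finally show "poly (G (jet_subst k \<phi> v)) t = poly (pcompose (G v) [:0, \<phi> $ 1:]) t" .
qed simp

text \<open>Stability refers to functions on \<open>Z\<close>: every polynomial that coincides on
  \<open>Z\<close> with a translate of an element of \<open>M\<close> must lie in \<open>M\<close>.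
  Thus \<open>M\<close> is determined by its restrictions to \<open>Z\<close>.\<close>

locale stable_subspace =
  fixes k :: nat and Z :: "(nat \<Rightarrow> 'k::alg_closed_field) set" and M :: "((nat \<Rightarrow> 'k) \<Rightarrow> 'k) set"
  assumes Z: "jet_invariant k Z" and M_poly: "M \<subseteq> polyfun {1..k}"
    and M_zero: "(\<lambda>_. 0) \<in> M"
    and M_lin: "\<And>f g a. f \<in> M \<Longrightarrow> g \<in> M \<Longrightarrow> (\<lambda>v. a * f v + g v) \<in> M"
    and M_stable: "\<And>f g \<phi>. f \<in> M \<Longrightarrow> g \<in> polyfun {1..k} \<Longrightarrow> coord_change \<phi> \<Longrightarrow>
        (\<And>v. v \<in> Z \<Longrightarrow> g v = f (jet_subst k \<phi> v)) \<Longrightarrow> g \<in> M"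
begin

lemma M_cong:
  assumes "f \<in> M" "g \<in> polyfun {1..k}" "\<And>v. v \<in> Z \<Longrightarrow> f v = g v" shows "g \<in> M"
  by (rule M_stable[OF assms(1,2) coord_change_X]) (use assms(3) jet_invariantD(2)[OF Z] in auto)

lemma coeff_in_M:
  assumes f: "f \<in> M" and G: "G \<in> poly_family (polyfun {1..k})" and E: "finite E"
    and \<phi>: "\<And>t. t \<notin> E \<Longrightarrow> coord_change (\<phi> t)"
    and val: "\<And>v t. v \<in> Z \<Longrightarrow> t \<notin> E \<Longrightarrow> poly (G v) t = f (jet_subst k (\<phi> t) v)"
  shows "(\<lambda>v. coeff (G v) i) \<in> M"
proof (rule stable_subspace_coeff[OF fun_algebra_polyfun[of "{1..k}"] M_lin M_zero M_cong G E])
  fix t assume t: "t \<notin> E"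
  obtain n where n: "\<And>v. degree (G v) \<le> n" using poly_family_degree[OF G] by blast
  have "(\<lambda>v. \<Sum>i\<le>n. coeff (G v) i * t ^ i) \<in> polyfun {1..k}"
    by (intro polyfun_sum polyfun.mult poly_family_coeff[OF G] polyfun.const)
  moreover have "(\<Sum>i\<le>n. coeff (G v) i * t ^ i) = poly (G v) t" for v
    unfolding poly_altdef using n[of v] by (intro sum.mono_neutral_right) (auto simp: coeff_eq_0)
  ultimately have "(\<lambda>v. poly (G v) t) \<in> polyfun {1..k}" by simp
  then show "(\<lambda>v. poly (G v) t) \<in> M"
    by (rule M_stable[OF f _ \<phi>[OF t]]) (use val t in auto)
qed

text \<open>Translation by a shear replaces t by s + t in the expansion of \<open>f\<close>, which
  leaves its top coefficient unchanged. The top degree is taken over all of \<open>Z\<close>, so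
  points of smaller degree contribute zero.\<close>

lemma leading_coefficient:
  assumes e: "e \<ge> 2" and f: "f \<in> M" "tangent_invariant k (Suc e) Z f" and nz: "v0 \<in> Z" "f v0 \<noteq> 0"
  obtains g where "g \<in> M" "tangent_invariant k e Z g" "\<exists>v\<in>Z. g v \<noteq> 0"
proof -
  have vp: "v \<in> affine_points {1..k}" if "v \<in> Z" for v using jet_invariantD(2)[OF Z that] .
  obtain G where G: "G \<in> poly_family (polyfun {1..k})"
    "\<And>v t. v \<in> affine_points {1..k} \<Longrightarrow> poly (G v) t = f (jet_subst k (shear e t) v)"
    by (rule polyfun_jet_subst_family[of f k fps_X "fps_X ^ e"]) (use f(1) M_poly in auto)
  obtain N where N: "\<And>v. degree (G v) \<le> N" using poly_family_degree[OF G(1)] by blast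
  have fin: "finite {n. \<exists>v\<in>Z. coeff (G v) n \<noteq> 0}"
  proof (rule finite_subset)
    show "{n. \<exists>v\<in>Z. coeff (G v) n \<noteq> 0} \<subseteq> {..N}"
      using N le_degree by (force intro: order_trans)
  qed simp
  have "poly (G v0) 0 = f v0" using G(2)[OF vp[OF nz(1)], of 0] vp[OF nz(1)] by simp
  then have "coeff (G v0) 0 \<noteq> 0" using nz by (simp add: poly_0_coeff_0)
  then have "0 \<in> {n. \<exists>v\<in>Z. coeff (G v) n \<noteq> 0}" using nz(1) by blast
  then have ne: "{n. \<exists>v\<in>Z. coeff (G v) n \<noteq> 0} \<noteq> {}" by blast
  define n where "n = Max {n. \<exists>v\<in>Z. coeff (G v) n \<noteq> 0}"
  have n: "\<exists>v\<in>Z. coeff (G v) n \<noteq> 0" using Max_in[OF fin ne] by (simp add: n_def)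
  have n_max: "degree (G v) \<le> n" if "v \<in> Z" for v
    unfolding n_def using that fin by (intro degree_le allI impI) (metis (mono_tags, lifting) Max_ge leD mem_Collect_eq)
  define g where "g = (\<lambda>v. coeff (G v) n)"
  have gM: "g \<in> M" unfolding g_def
    by (rule coeff_in_M[OF f(1) G(1), of "{}" "shear e"]) (use e G(2) vp in auto)
  have sh_in: "jet_subst k (shear e t) v \<in> Z" if "v \<in> Z" for v t
    using e by (intro jet_invariantD(1)[OF Z that]) simp
  have t1: "G (jet_subst k \<theta> v) = G v" if v: "v \<in> Z" and \<theta>: "tangent (Suc e) \<theta>" for v \<theta>
  proof (rule poly_eq_cofinite[of "{}"])
    fix t
    show "poly (G (jet_subst k \<theta> v)) t = poly (G v) t"
      using shear_tangent_invariant[OF Z e f(2) v \<theta>, of t] vp[OF v] by (simp add: G(2))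
  qed simp
  have t2: "g (jet_subst k (shear e s) v) = g v" if v: "v \<in> Z" for v s
  proof -
    have "G (jet_subst k (shear e s) v) = pcompose (G v) [:s, 1:]"
    proof (rule poly_eq_cofinite[of "{}"])
      fix t
      show "poly (G (jet_subst k (shear e s) v)) t = poly (pcompose (G v) [:s, 1:]) t"
        using shear_shear_invariant[OF Z e f(2) v, of t s] vp[OF v] by (simp add: G(2) poly_pcompose)
    qed simp
    moreover have "coeff (pcompose (G v) [:s, 1:]) n = coeff (G v) n"
    proof (cases "degree (G v) = n")
      case True
      have "lead_coeff (pcompose (G v) [:s, 1:]) = lead_coeff (G v)"
        by (subst lead_coeff_comp) simp_all
      moreover have "degree (pcompose (G v) [:s, 1:]) = n" using True by (simp add: degree_pcompose)
      ultimately show ?thesis using True by simp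
    next
      case False
      then have "degree (G v) < n" using n_max[OF v] by simp
      then show ?thesis by (simp add: coeff_eq_0 degree_pcompose)
    qed
    ultimately show ?thesis by (simp add: g_def)
  qed
  have tg: "tangent_invariant k (Suc e) Z g" unfolding tangent_invariant_def g_def using t1 by simp
  have "tangent_invariant k e Z g"
    unfolding tangent_invariant_def
  proof (intro ballI allI impI)
    fix v \<phi> assume v: "v \<in> Z" and \<phi>: "tangent e (\<phi> :: 'k fps)"
    show "g (jet_subst k \<phi> v) = g v"
      using tangent_shear_invariant[OF Z e tg v \<phi>] t2[OF v] by simp
  qed
  then show ?thesis using that[OF gM] n by (simp add: g_def)
qed

lemma tangent_invariant_exists:
  assumes "f \<in> M" "v0 \<in> Z" "f v0 \<noteq> 0"
  obtains g where "g \<in> M" "tangent_invariant k 2 Z g" "\<exists>v\<in>Z. g v \<noteq> 0"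
proof -
  have "2 \<le> e \<longrightarrow> (\<exists>g\<in>M. tangent_invariant k e Z g \<and> (\<exists>v\<in>Z. g v \<noteq> 0))" if "e \<le> max 2 (Suc k)" for e
    using that
  proof (induction rule: inc_induct)
    case base
    \<comment> \<open>Changes tangent to order k + 1 do not move k-jets; the maximum with 2 covers k
      = 0.\<close>
    have "tangent_invariant k (max 2 (Suc k)) Z f"
      unfolding tangent_invariant_def
    proof (intro ballI allI impI)
      fix v \<phi> assume v: "v \<in> Z" and \<phi>: "tangent (max 2 (Suc k)) (\<phi> :: 'k fps)"
      have "agree (Suc k) \<phi> fps_X" using tangent_mono[OF \<phi>, of "Suc k"] by (simp add: tangent_def)
      then have "jet_subst k \<phi> v = jet_subst k fps_X v"
        by (rule jet_subst_cong[OF jet_invariantD(2)[OF Z v]])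
      then show "f (jet_subst k \<phi> v) = f v" using jet_invariantD(2)[OF Z v] by simp
    qed
    then show ?case using assms by blast
  next
    case (step e)
    show ?case
    proof
      assume e: "2 \<le> e"
      then obtain g v where g: "g \<in> M" "tangent_invariant k (Suc e) Z g" "v \<in> Z" "g v \<noteq> 0"
        using step.IH by auto
      obtain g' where "g' \<in> M" "tangent_invariant k e Z g'" "\<exists>v\<in>Z. g' v \<noteq> 0"
        using e g by (rule leading_coefficient)
      then show "\<exists>g\<in>M. tangent_invariant k e Z g \<and> (\<exists>v\<in>Z. g v \<noteq> 0)" by blast
    qed
  qed
  from this[of 2] show ?thesis using that by auto
qed

lemma semi_invariant_exists:
  assumes "f \<in> M" "v0 \<in> Z" "f v0 \<noteq> 0"
  obtains c w where "c \<in> M" "semi_invariant k Z c w" "\<exists>v\<in>Z. c v \<noteq> 0"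
proof -
  have vp: "v \<in> affine_points {1..k}" if "v \<in> Z" for v using jet_invariantD(2)[OF Z that] .
  obtain g v1 where g: "g \<in> M" "tangent_invariant k 2 Z g" "v1 \<in> Z" "g v1 \<noteq> 0"
    using tangent_invariant_exists[OF assms] by blast
  obtain G where G: "G \<in> poly_family (polyfun {1..k})"
    "\<And>v t. v \<in> affine_points {1..k} \<Longrightarrow> poly (G v) t = g (jet_subst k (0 + fps_const t * fps_X) v)"
    by (rule polyfun_jet_subst_family[of g k 0 fps_X]) (use g(1) M_poly in auto)
  have G': "poly (G v) t = g (jet_subst k (fps_const t * fps_X) v)" if "v \<in> Z" for v t
    using G(2)[OF vp[OF that]] by simp
  have "poly (G v1) 1 = g v1" using G'[OF g(3), of 1] vp[OF g(3)] by simp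
  then have "G v1 \<noteq> 0" using g by auto
  then obtain w where w: "coeff (G v1) w \<noteq> 0" by (metis leading_coeff_0_iff)
  define c where "c = (\<lambda>v. coeff (G v) w)"
  have cM: "c \<in> M" unfolding c_def
    by (rule coeff_in_M[OF g(1) G(1), of "{0}" "\<lambda>t. fps_const t * fps_X"]) (use G' in auto)
  have "semi_invariant k Z c w"
    unfolding semi_invariant_def
  proof (intro ballI allI impI)
    fix v \<phi> assume v: "v \<in> Z" and \<phi>: "coord_change (\<phi> :: 'k fps)"
    define u where "u = \<phi> $ 1"
    have "G (jet_subst k \<phi> v) = pcompose (G v) [:0, u:]"
      unfolding u_def by (rule scale_family_translate[OF Z g(2) G' v \<phi>])
    moreover have "coeff (pcompose (G v) [:0, u:]) w = u ^ w * coeff (G v) w"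
      by (rule coeff_pcompose_linear)
    ultimately show "c (jet_subst k \<phi> v) = (\<phi> $ 1) ^ w * c v"
      by (simp add: c_def u_def)
  qed
  then show ?thesis using that[OF cM] w g(3) by (auto simp: c_def)
qed

end

section \<open>Cross-sections of the jet group action\<close>

text \<open>The localisation of the ring of functions on \<open>R\<close> at \<open>c\<close>. Only
  values at points of \<open>R\<close> with \<open>c\<close> nonzero are constrained.\<close>

definition regular_off :: "nat \<Rightarrow> (nat \<Rightarrow> 'k::field) set \<Rightarrow> ((nat \<Rightarrow> 'k) \<Rightarrow> 'k) \<Rightarrow> ((nat \<Rightarrow> 'k) \<Rightarrow> 'k) set" where
  "regular_off k R c = {b. \<exists>N. \<exists>q\<in>polyfun {1..k}. \<forall>v\<in>R. c v \<noteq> 0 \<longrightarrow> b v * c v ^ N = q v}"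

lemma regular_offI:
  "q \<in> polyfun {1..k} \<Longrightarrow> (\<And>v. v \<in> R \<Longrightarrow> c v \<noteq> 0 \<Longrightarrow> b v * c v ^ N = q v) \<Longrightarrow> b \<in> regular_off k R c"
  unfolding regular_off_def by blast

lemma regular_offE:
  assumes "b \<in> regular_off k R c"
  obtains q N where "q \<in> polyfun {1..k}" "\<And>v. v \<in> R \<Longrightarrow> c v \<noteq> 0 \<Longrightarrow> b v * c v ^ N = q v"
  using assms unfolding regular_off_def by blast

lemma regular_off_poly: "q \<in> polyfun {1..k} \<Longrightarrow> q \<in> regular_off k R c"
  by (rule regular_offI[where N = 0]) auto

lemma regular_off_cong:
  assumes "b \<in> regular_off k R c" "\<And>v. v \<in> R \<Longrightarrow> c v \<noteq> 0 \<Longrightarrow> b v = b' v"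
  shows "b' \<in> regular_off k R c"
proof -
  from assms(1) obtain q N where q: "q \<in> polyfun {1..k}" "\<And>v. v \<in> R \<Longrightarrow> c v \<noteq> 0 \<Longrightarrow> b v * c v ^ N = q v"
    by (rule regular_offE) blast
  show ?thesis by (rule regular_offI[OF q(1), where N = N]) (use assms(2) q(2) in simp)
qed

lemma fun_algebra_regular_off:
  assumes c: "c \<in> polyfun {1..k}"
  shows "fun_algebra (regular_off k R c)"
  unfolding fun_algebra_def
proof (intro conjI allI ballI)
  show "(\<lambda>_. a) \<in> regular_off k R c" for a by (intro regular_off_poly polyfun.const)
  fix f g assume f: "f \<in> regular_off k R c" and g: "g \<in> regular_off k R c"
  from f obtain q N where q: "q \<in> polyfun {1..k}" "\<And>v. v \<in> R \<Longrightarrow> c v \<noteq> 0 \<Longrightarrow> f v * c v ^ N = q v"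
    by (rule regular_offE) blast
  from g obtain r M where r: "r \<in> polyfun {1..k}" "\<And>v. v \<in> R \<Longrightarrow> c v \<noteq> 0 \<Longrightarrow> g v * c v ^ M = r v"
    by (rule regular_offE) blast
  show "(\<lambda>v. f v + g v) \<in> regular_off k R c"
  proof (rule regular_offI[where N = "N + M" and q = "\<lambda>v. q v * c v ^ M + r v * c v ^ N"])
    show "(\<lambda>v. q v * c v ^ M + r v * c v ^ N) \<in> polyfun {1..k}"
      by (intro polyfun.add polyfun.mult polyfun_power q r c)
  qed (simp add: q(2)[symmetric] r(2)[symmetric] power_add algebra_simps)
  show "(\<lambda>v. f v * g v) \<in> regular_off k R c"
  proof (rule regular_offI[where N = "N + M" and q = "\<lambda>v. q v * r v"])
    show "(\<lambda>v. q v * r v) \<in> polyfun {1..k}" by (intro polyfun.mult q r)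
  qed (simp add: q(2)[symmetric] r(2)[symmetric] power_add algebra_simps)
qed

lemma regular_off_inverse: "(\<lambda>v. inverse (c v)) \<in> regular_off k R c"
  by (rule regular_offI[where N = 1 and q = "\<lambda>_. 1"]) (auto intro: polyfun.const)

lemma regular_off_mult_left:
  assumes b: "b \<in> regular_off k R c" and d: "d \<in> polyfun {1..k}"
  shows "b \<in> regular_off k R (\<lambda>v. c v * d v)"
proof -
  from b obtain q N where q: "q \<in> polyfun {1..k}" "\<And>v. v \<in> R \<Longrightarrow> c v \<noteq> 0 \<Longrightarrow> b v * c v ^ N = q v"
    by (rule regular_offE) blast
  show ?thesis
    by (rule regular_offI[where N = N and q = "\<lambda>v. q v * d v ^ N"])
       (auto intro!: polyfun.mult polyfun_power q(1) d simp: q(2)[symmetric] power_mult_distrib mult.assoc)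
qed

lemma regular_off_inverse_right:
  assumes "c \<in> polyfun {1..k}"
  shows "(\<lambda>v. inverse (d v)) \<in> regular_off k R (\<lambda>v. c v * d v)"
  by (rule regular_offI[where N = 1 and q = c]) (use assms in auto)

text \<open>A regular choice of one point in each orbit of the subgroup \<open>tangent e\<close> on
  the locus where \<open>c\<close> is nonzero. For e > k the identity will do; for e = 2 the
  unipotent part of the group is exhausted.\<close>

definition partial_section ::
    "nat \<Rightarrow> (nat \<Rightarrow> 'k::field) set \<Rightarrow> ((nat \<Rightarrow> 'k) \<Rightarrow> 'k) \<Rightarrow> nat \<Rightarrow> ((nat \<Rightarrow> 'k) \<Rightarrow> nat \<Rightarrow> 'k) \<Rightarrow> bool" where
  "partial_section k R c e \<pi> \<longleftrightarrow>
     (\<forall>v\<in>R. c v \<noteq> 0 \<longrightarrow> (\<exists>\<phi>. tangent e \<phi> \<and> \<pi> v = jet_subst k \<phi> v)) \<and>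
     (\<forall>i. tangent_invariant k e {v \<in> R. c v \<noteq> 0} (\<lambda>v. \<pi> v i)) \<and>
     (\<forall>i. (\<lambda>v. \<pi> v i) \<in> regular_off k R c)"

lemma semi_invariant_nonzero_invariant:
  assumes R: "jet_invariant k R" and c: "semi_invariant k R c w"
  shows "jet_invariant k {v \<in> R. c v \<noteq> 0}"
  using jet_invariantD[OF R] semi_invariantD[OF c]
  by (auto simp: jet_invariant_def coord_changeD)

lemma semi_invariant_mult:
  assumes "semi_invariant k R c w" "semi_invariant k {v \<in> R. c v \<noteq> 0} d w'"
  shows "semi_invariant k R (\<lambda>v. c v * d v) (w + w')"
  unfolding semi_invariant_def
proof (intro ballI allI impI)
  fix v \<phi> assume v: "v \<in> R" and \<phi>: "coord_change (\<phi> :: 'a fps)"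
  show "c (jet_subst k \<phi> v) * d (jet_subst k \<phi> v) = (\<phi> $ 1) ^ (w + w') * (c v * d v)"
  proof (cases "c v = 0")
    case True
    then show ?thesis using semi_invariantD[OF assms(1) v \<phi>] by simp
  next
    case False
    then show ?thesis using semi_invariantD[OF assms(1) v \<phi>] semi_invariantD[OF assms(2) _ \<phi>, of v] v
      by (simp add: power_add)
  qed
qed

text \<open>Conjugation by \<open>\<phi>\<close> multiplies the parameter of a shear by a power of
  the linear coefficient u: modulo x^(e+1) both sides are \<open>\<phi>\<close> + t u^e x^e.\<close>

lemma shear_compose_coord_change:
  assumes \<phi>: "coord_change \<phi>" and e: "e \<ge> 2"
  shows "agree (Suc e) (shear e t oo \<phi>) (\<phi> oo shear e (t * (\<phi> $ 1) ^ (e - 1)))"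
proof -
  define u where "u = \<phi> $ 1"
  define s where "s = t * u ^ (e - 1)"
  have \<phi>0: "\<phi> $ 0 = 0" using \<phi> by (simp add: coord_changeD)
  have pow: "(\<phi> ^ e) $ i = (if i = e then u ^ e else 0)" if "i < Suc e" for i
    using that startsby_zero_power_prefix[OF \<phi>0, of e] startsby_zero_power_nth_same[OF \<phi>0, of e]
    by (cases "i = e") (auto simp: u_def)
  have lhs: "shear e t oo \<phi> = \<phi> + fps_const t * \<phi> ^ e"
    by (simp only: fps_compose_add_distrib fps_compose_mult_distrib[OF \<phi>0]
        fps_compose_power[OF \<phi>0, symmetric] fps_X_fps_compose_startby0[OF \<phi>0] fps_const_compose)
  have shpow: "(shear e s ^ j) $ i = (if i = j then 1 else 0) + (if j = 1 \<and> i = e then s else 0)"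
    if "i < Suc e" for i j
  proof (cases "j = 0 \<or> j = 1")
    case True
    then show ?thesis using e by (auto simp: fps_X_power_nth)
  next
    case False
    then obtain j' where j: "j = Suc j'" "j' \<ge> 1" by (cases j) auto
    \<comment> \<open>An n-th power of the shear first differs from x^n at index e + n - 1, which
      exceeds e for n at least 2.\<close>
    have j2: "(shear e s ^ n) $ i = (fps_X ^ n) $ i" if "i < e + n - 1" "n \<ge> 1" for n i
      using that(2,1)
    proof (induction n arbitrary: i rule: nat_induct_at_least)
      case base
      then show ?case by (auto simp: fps_X_power_nth)
    next
      case (Suc n)
      have "shear e s ^ Suc n = fps_X * shear e s ^ n + fps_const s * (fps_X ^ e * shear e s ^ n)"
        by (simp only: power_Suc distrib_right mult.assoc)
      then have "(shear e s ^ Suc n) $ i = (fps_X * shear e s ^ n) $ i + s * (fps_X ^ e * shear e s ^ n) $ i"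
        by (simp only: fps_add_nth fps_mult_left_const_nth)
      moreover have "(fps_X ^ e * shear e s ^ n) $ i = 0"
      proof (cases "i < e")
        case True
        then show ?thesis by (simp add: fps_X_power_mult_nth)
      next
        case False
        have "shear e s $ 0 = 0" using e by simp
        then have "(shear e s ^ n) $ (i - e) = 0"
          using startsby_zero_power_prefix[of "shear e s" n] Suc.prems False by auto
        then show ?thesis using False by (simp add: fps_X_power_mult_nth)
      qed
      moreover have "(fps_X * shear e s ^ n) $ i = (fps_X * fps_X ^ n) $ i"
        using Suc.IH[of "i - 1"] Suc.prems Suc.hyps by (cases "i = 0") auto
      ultimately show ?case by (simp only: power_Suc mult_zero_right add_0_right)
    qed
    have "(shear e s ^ j) $ i = (fps_X ^ j) $ i" using that j by (intro j2) auto
    then show ?thesis using False by (simp add: fps_X_power_nth)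
  qed
  show ?thesis
    unfolding agree_def lhs u_def[symmetric] s_def[symmetric]
  proof (intro allI impI)
    fix i assume i: "i < Suc e"
    have "(\<phi> oo shear e s) $ i = (\<Sum>j=0..i. (if j = i then \<phi> $ i else 0) + (if j = 1 then (if i = e then \<phi> $ 1 * s else 0) else 0))"
      unfolding fps_compose_nth by (intro sum.cong refl) (auto simp: shpow[OF i] algebra_simps)
    also have "\<dots> = \<phi> $ i + (if i = e then u * s else 0)"
      using e by (simp add: sum.distrib u_def)
    also have "u * s = t * u ^ e" using e by (cases e) (auto simp: s_def)
    finally show "(\<phi> + fps_const t * \<phi> ^ e) $ i = (\<phi> oo shear e s) $ i"
      using pow[OF i] by simp
  qed
qed

text \<open>The subgroup \<open>tangent e\<close> is normal in the group of coordinate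
  changes.\<close>

lemma tangent_invariant_translate:
  assumes Z: "jet_invariant k Z" and e: "e \<ge> 2" and b: "tangent_invariant k e Z b" and \<phi>: "coord_change \<phi>"
  shows "tangent_invariant k e Z (\<lambda>v. b (jet_subst k \<phi> v))"
  unfolding tangent_invariant_def
proof (intro ballI allI impI)
  fix v \<theta> assume v: "v \<in> Z" and \<theta>: "tangent e (\<theta> :: 'a fps)"
  have \<theta>c: "coord_change \<theta>" by (rule tangent_coord_change[OF \<theta> e])
  have "agree e (\<theta> oo \<phi>) (fps_X oo \<phi>)" using \<theta> by (intro agree_compose) (auto simp: tangent_def)
  then have "agree e (\<theta> oo \<phi>) \<phi>" using \<phi> by (simp add: fps_X_fps_compose_startby0 coord_changeD)
  then obtain \<theta>' where \<theta>': "tangent e \<theta>'" "\<theta> oo \<phi> = \<phi> oo \<theta>'"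
    by (rule agree_factor) (use \<phi> \<theta>c coord_change_compose in auto)
  have z: "v \<in> affine_points {1..k}" "\<theta>' $ 0 = 0" "\<theta> $ 0 = 0" "\<phi> $ 0 = 0"
    using v jet_invariantD(2)[OF Z] tangent_coord_change[OF \<theta>'(1) e] \<theta>c \<phi> by (auto simp: coord_changeD)
  have "jet_subst k \<phi> (jet_subst k \<theta> v) = jet_subst k \<theta>' (jet_subst k \<phi> v)"
    using z by (simp add: jet_subst_compose \<theta>'(2))
  then show "b (jet_subst k \<phi> (jet_subst k \<theta> v)) = b (jet_subst k \<phi> v)"
    using tangent_invariantD[OF b jet_invariantD(1)[OF Z v \<phi>] \<theta>'(1)] by simp
qed

text \<open>As \<open>c\<close> is semi-invariant, a translate has the same denominators up to a
  scalar.\<close>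

lemma regular_off_translate:
  assumes R: "jet_invariant k R" and c: "semi_invariant k R c w" and b: "b \<in> regular_off k R c"
    and \<phi>: "coord_change \<phi>"
  shows "(\<lambda>v. b (jet_subst k \<phi> v)) \<in> regular_off k R c"
proof -
  from b obtain q N where q: "q \<in> polyfun {1..k}" "\<And>v. v \<in> R \<Longrightarrow> c v \<noteq> 0 \<Longrightarrow> b v * c v ^ N = q v"
    by (rule regular_offE) blast
  obtain r where r: "r \<in> polyfun {1..k}" "\<And>v. v \<in> affine_points {1..k} \<Longrightarrow> r v = q (jet_subst k \<phi> v)"
    by (rule polyfun_jet_subst[OF q(1), of \<phi>]) blast
  show ?thesis
  proof (rule regular_offI[where N = N and q = "\<lambda>v. inverse ((\<phi> $ 1) ^ (w * N)) * r v"])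
    show "(\<lambda>v. inverse ((\<phi> $ 1) ^ (w * N)) * r v) \<in> polyfun {1..k}" by (rule polyfun_cmult[OF r(1)])
    fix v assume v: "v \<in> R" "c v \<noteq> 0"
    have c': "c (jet_subst k \<phi> v) = (\<phi> $ 1) ^ w * c v" using semi_invariantD[OF c v(1) \<phi>] .
    have "r v = b (jet_subst k \<phi> v) * ((\<phi> $ 1) ^ w * c v) ^ N"
      using r(2)[OF jet_invariantD(2)[OF R v(1)]] q(2)[OF jet_invariantD(1)[OF R v(1) \<phi>]] c' v \<phi>
      by (simp add: coord_changeD)
    then show "b (jet_subst k \<phi> v) * c v ^ N = inverse ((\<phi> $ 1) ^ (w * N)) * r v"
      using \<phi> by (simp add: coord_changeD power_mult_distrib power_mult[symmetric] field_simps)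
  qed
qed

text \<open>The shears of order e act additively on the algebra \<open>A\<close> of functions
  regular off \<open>c\<close> that ignore tangency of order e + 1. Unless the action on
  \<open>A\<close> is trivial, some \<open>a\<close> in \<open>A\<close> has minimal degree in the
  parameter, and its top coefficient can be chosen semi-invariant up to a power of \<open>c\<close>.
  Where that coefficient is nonzero every jet can be moved onto a = 0, and \<open>slice\<close>
  makes the composition with the old section regular and independent of the root chosen.\<close>

lemma partial_section_step:
  fixes c :: "(nat \<Rightarrow> 'k::alg_closed_field) \<Rightarrow> 'k"
  assumes p: "CHAR('k) = p" "prime p"
    and e: "e \<ge> 2" and R: "jet_invariant k R" and c: "c \<in> polyfun {1..k}" "semi_invariant k R c w"
    and nz: "\<exists>v\<in>R. c v \<noteq> 0" and \<pi>: "partial_section k R c (Suc e) \<pi>"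
  obtains d w' \<pi>' where "d \<in> polyfun {1..k}" "semi_invariant k R (\<lambda>v. c v * d v) w'"
    "\<exists>v\<in>R. c v * d v \<noteq> 0" "partial_section k R (\<lambda>v. c v * d v) e \<pi>'"
proof -
  define Z where "Z = {v \<in> R. c v \<noteq> 0}"
  have Z: "jet_invariant k Z" unfolding Z_def by (rule semi_invariant_nonzero_invariant[OF R c(2)])
  have vp: "v \<in> affine_points {1..k}" if "v \<in> Z" for v using jet_invariantD(2)[OF Z that] .
  have ZR: "v \<in> R" "c v \<noteq> 0" if "v \<in> Z" for v using that by (auto simp: Z_def)
  let ?E = "\<lambda>t. jet_subst k (shear e t)"
  have E_in: "?E t v \<in> Z" if "v \<in> Z" for t v using e by (intro jet_invariantD(1)[OF Z that]) simp
  have cE: "c (?E t v) = c v" if "v \<in> Z" for t v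
    using semi_invariantD[OF c(2) ZR(1)[OF that] shear_coord_change[OF e]] tangent_nth[OF shear_tangent[OF e], of 1 t] e
    by simp
  define A where "A = {b \<in> regular_off k R c. tangent_invariant k (Suc e) Z b}"
  have A_inv: "tangent_invariant k (Suc e) Z b" if "b \<in> A" for b using that by (simp add: A_def)
  note ro = fun_algebra_regular_off[OF c(1)]
  interpret additive_action Z ?E A
  proof
    show "fun_algebra A"
      unfolding fun_algebra_def A_def tangent_invariant_def
      by (auto intro: fun_algebra_const[OF ro] fun_algebra_add[OF ro] fun_algebra_mult[OF ro])
    show "g \<in> A" if "f \<in> A" "\<And>v. v \<in> Z \<Longrightarrow> f v = g v" for f g
    proof -
      have "g \<in> regular_off k R c"
        by (rule regular_off_cong[of f]) (use that in \<open>auto simp: A_def Z_def\<close>)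
      moreover have "tangent_invariant k (Suc e) Z g"
        unfolding tangent_invariant_def
      proof (intro ballI allI impI)
        fix v \<phi> assume v: "v \<in> Z" and \<phi>: "tangent (Suc e) (\<phi>::'k fps)"
        have "jet_subst k \<phi> v \<in> Z"
          using e by (intro jet_invariantD(1)[OF Z v] tangent_coord_change[OF \<phi>]) simp
        then show "g (jet_subst k \<phi> v) = g v"
          using tangent_invariantD[OF A_inv[OF that(1)] v \<phi>] that(2) v by simp
      qed
      ultimately show ?thesis by (simp add: A_def)
    qed
    show "b (?E 0 v) = b v" if "v \<in> Z" for b :: "(nat \<Rightarrow> 'k) \<Rightarrow> 'k" and v using vp[OF that] by simp
    show "b (?E t (?E s v)) = b (?E (s + t) v)" if "b \<in> A" "v \<in> Z" for b v s t
      by (rule shear_shear_invariant[OF Z e A_inv[OF that(1)] that(2)])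
    show "\<exists>G\<in>poly_family A. \<forall>v\<in>Z. \<forall>t. poly (G v) t = b (?E t v)" if b: "b \<in> A" for b
    proof -
      from b have "b \<in> regular_off k R c" by (simp add: A_def)
      then obtain q N where q: "q \<in> polyfun {1..k}" "\<And>v. v \<in> R \<Longrightarrow> c v \<noteq> 0 \<Longrightarrow> b v * c v ^ N = q v"
        by (rule regular_offE) blast
      obtain G where G: "G \<in> poly_family (polyfun {1..k})"
        "\<And>v t. v \<in> affine_points {1..k} \<Longrightarrow> poly (G v) t = q (?E t v)"
        by (rule polyfun_jet_subst_family[OF q(1), of fps_X "fps_X ^ e"]) blast
      define G' where "G' = (\<lambda>v. smult (inverse (c v) ^ N) (G v))"
      have val: "poly (G' v) t = b (?E t v)" if v: "v \<in> Z" for v t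
      proof -
        have "poly (G' v) t = inverse (c v) ^ N * q (?E t v)" by (simp add: G'_def G(2) vp[OF v])
        also have "q (?E t v) = b (?E t v) * c v ^ N"
          using q(2)[of "?E t v"] ZR[OF E_in[OF v]] cE[OF v] by simp
        finally show ?thesis using ZR(2)[OF v] by (simp add: field_simps)
      qed
      obtain n where n: "\<And>v. degree (G v) \<le> n" using poly_family_degree[OF G(1)] by blast
      have "degree (G' v) \<le> n" for v unfolding G'_def using n[of v] degree_smult_le le_trans by blast
      moreover have "(\<lambda>v. coeff (G' v) i) \<in> A" for i
      proof -
        have "(\<lambda>v. inverse (c v) ^ N * coeff (G v) i) \<in> regular_off k R c"
          by (intro fun_algebra_mult[OF ro] fun_algebra_power[OF ro] regular_off_inverse
              regular_off_poly poly_family_coeff[OF G(1)])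
        moreover have "tangent_invariant k (Suc e) Z (\<lambda>v. coeff (G' v) i)"
          unfolding tangent_invariant_def
        proof (intro ballI allI impI)
          fix v \<phi> assume v: "v \<in> Z" and \<phi>: "tangent (Suc e) (\<phi>::'k fps)"
          have \<phi>v: "jet_subst k \<phi> v \<in> Z"
            using e by (intro jet_invariantD(1)[OF Z v] tangent_coord_change[OF \<phi>]) simp
          have "G' (jet_subst k \<phi> v) = G' v"
            by (rule poly_eq_cofinite[of "{}"])
               (simp_all add: val[OF v] val[OF \<phi>v] shear_tangent_invariant[OF Z e A_inv[OF b] v \<phi>])
          then show "coeff (G' (jet_subst k \<phi> v)) i = coeff (G' v) i" by simp
        qed
        ultimately show ?thesis by (simp add: A_def G'_def)
      qed
      ultimately have "G' \<in> poly_family A" by (auto simp: poly_family_def)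
      then show ?thesis using val by blast
    qed
  qed (rule E_in)
  have inv_tangent: "tangent_invariant k e Z b" if "b \<in> A" "inv b" for b
    unfolding tangent_invariant_def
  proof (intro ballI allI impI)
    fix v \<phi> assume v: "v \<in> Z" and \<phi>: "tangent e (\<phi>::'k fps)"
    show "b (jet_subst k \<phi> v) = b v"
      using tangent_shear_invariant[OF Z e A_inv[OF that(1)] v \<phi>] invD[OF that(2) v] by simp
  qed
  have \<pi>A: "(\<lambda>v. \<pi> v i) \<in> A" for i
    using \<pi> by (simp add: A_def partial_section_def Z_def)
  show ?thesis
  proof (cases "\<forall>b\<in>A. inv b")
    case True
    have "partial_section k R c e \<pi>"
      unfolding partial_section_def
    proof (intro conjI allI ballI impI)
      fix v assume "v \<in> R" "c v \<noteq> 0"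
      then obtain \<phi> where "tangent (Suc e) \<phi>" "\<pi> v = jet_subst k \<phi> v"
        using \<pi> unfolding partial_section_def by blast
      then show "\<exists>\<phi>. tangent e \<phi> \<and> \<pi> v = jet_subst k \<phi> v" using tangent_mono by (metis le_SucI order_refl)
    next
      show "tangent_invariant k e {v \<in> R. c v \<noteq> 0} (\<lambda>v. \<pi> v i)" for i
        using inv_tangent[OF \<pi>A] True \<pi>A by (simp add: Z_def)
      show "(\<lambda>v. \<pi> v i) \<in> regular_off k R c" for i using \<pi>A by (simp add: A_def)
    qed
    then show ?thesis
      using that[of "\<lambda>_. 1" w \<pi>] c(2) nz by (simp add: polyfun.const)
  next
    case False
    then obtain b where "b \<in> A" "\<not> inv b" by blast
    then obtain n where n: "minimal_degree n" by (rule minimal_degree_exists)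
    obtain a0 v0 where a0: "a0 \<in> A" "\<forall>v\<in>Z. degree (T a0 v) \<le> n" "v0 \<in> Z" "coeff (T a0 v0) n \<noteq> 0"
      using n unfolding minimal_degree_def by blast
    have "(\<lambda>v. coeff (T a0 v) n) \<in> regular_off k R c"
      using T_coeff_in[OF a0(1), of n] by (simp add: A_def)
    then obtain q0 N where q0: "q0 \<in> polyfun {1..k}"
      "\<And>v. v \<in> R \<Longrightarrow> c v \<noteq> 0 \<Longrightarrow> coeff (T a0 v) n * c v ^ N = q0 v"
      by (rule regular_offE) blast
    \<comment> \<open>Top coefficients of elements of degree at most \<open>n\<close>, made
      polynomial by one fixed power of \<open>c\<close>, so that they form a linear space to which
      the search for semi-invariants applies.\<close>
    define M where "M = {q \<in> polyfun {1..k}. \<exists>a\<in>A. (\<forall>v\<in>Z. degree (T a v) \<le> n) \<and>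
                          (\<forall>v\<in>Z. q v = coeff (T a v) n * c v ^ N)}"
    have T_lin: "T (\<lambda>v. x * a v + b v) v = smult x (T a v) + T b v" if "a \<in> A" "b \<in> A" "v \<in> Z" for x a b v
      by (rule T_eqI) (simp add: T_poly that)
    interpret M: stable_subspace k Z M
    proof
      show "jet_invariant k Z" by (rule Z)
      show "M \<subseteq> polyfun {1..k}" by (auto simp: M_def)
      have "T (\<lambda>_. 0) v = 0" for v by (rule T_eqI) simp
      then show "(\<lambda>_. 0) \<in> M"
        unfolding M_def using fun_algebra_const[OF alg, of 0]
        by (auto intro!: polyfun.const bexI[of _ "\<lambda>_. 0"])
      show "(\<lambda>v. x * f v + g v) \<in> M" if "f \<in> M" "g \<in> M" for f g x
      proof -
        from that obtain a b where a: "a \<in> A" "\<forall>v\<in>Z. degree (T a v) \<le> n" "\<forall>v\<in>Z. f v = coeff (T a v) n * c v ^ N"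
          and b: "b \<in> A" "\<forall>v\<in>Z. degree (T b v) \<le> n" "\<forall>v\<in>Z. g v = coeff (T b v) n * c v ^ N"
          and fg: "f \<in> polyfun {1..k}" "g \<in> polyfun {1..k}"
          unfolding M_def by blast
        have "(\<lambda>v. x * a v + b v) \<in> A" using fun_algebra_add[OF alg fun_algebra_cmult[OF alg a(1)] b(1)] .
        moreover have "degree (T (\<lambda>v. x * a v + b v) v) \<le> n" if "v \<in> Z" for v
          unfolding T_lin[OF a(1) b(1) that]
          using a(2) b(2) that by (intro degree_add_le order_trans[OF degree_smult_le]) auto
        moreover have "x * f v + g v = coeff (T (\<lambda>v. x * a v + b v) v) n * c v ^ N" if "v \<in> Z" for v
          unfolding T_lin[OF a(1) b(1) that] using a(3) b(3) that by (simp add: algebra_simps)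
        moreover have "(\<lambda>v. x * f v + g v) \<in> polyfun {1..k}" using fg by (intro polyfun.add polyfun_cmult)
        ultimately show ?thesis unfolding M_def by blast
      qed
      show "g \<in> M" if "f \<in> M" and g: "g \<in> polyfun {1..k}" and \<phi>: "coord_change \<phi>"
        and gf: "\<And>v. v \<in> Z \<Longrightarrow> g v = f (jet_subst k \<phi> v)" for f g \<phi>
      proof -
        from that obtain a where a: "a \<in> A" "\<forall>v\<in>Z. degree (T a v) \<le> n" "\<forall>v\<in>Z. f v = coeff (T a v) n * c v ^ N"
          unfolding M_def by blast
        define u where "u = \<phi> $ 1"
        have u: "u \<noteq> 0" using \<phi> by (simp add: u_def coord_changeD)
        define a' where "a' = (\<lambda>v. a (jet_subst k \<phi> v))"
        have a'A: "a' \<in> A"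
          unfolding a'_def A_def
          using tangent_invariant_translate[OF Z _ A_inv[OF a(1)] \<phi>] regular_off_translate[OF R c(2) _ \<phi>, of a] a(1) e
          by (simp add: A_def)
        have Ta': "T a' v = pcompose (T a (jet_subst k \<phi> v)) [:0, u ^ (e - 1):]" if v: "v \<in> Z" for v
        proof (rule T_eqI)
          fix t
          define s where "s = t * u ^ (e - 1)"
          have \<phi>v: "jet_subst k \<phi> v \<in> Z" by (rule jet_invariantD(1)[OF Z v \<phi>])
          have "agree (Suc e) (shear e t oo \<phi>) (\<phi> oo shear e s)"
            unfolding s_def u_def by (rule shear_compose_coord_change[OF \<phi> e])
          then obtain \<theta> where \<theta>: "tangent (Suc e) \<theta>" "shear e t oo \<phi> = (\<phi> oo shear e s) oo \<theta>"
            by (rule agree_factor) (use \<phi> e in \<open>auto intro!: coord_change_compose\<close>)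
          have z: "\<theta> $ 0 = 0" "\<phi> $ 0 = 0" "(\<phi> oo shear e s) $ 0 = 0"
            using tangent_nth[OF \<theta>(1), of 0] \<phi> by (auto simp: coord_changeD)
          have "jet_subst k \<phi> (?E t v) = jet_subst k \<theta> (?E s (jet_subst k \<phi> v))"
            using z e vp[OF v] by (simp add: jet_subst_compose \<theta>(2))
          then have "a' (?E t v) = a (?E s (jet_subst k \<phi> v))"
            unfolding a'_def using tangent_invariantD[OF A_inv[OF a(1)] E_in[OF \<phi>v] \<theta>(1)] by simp
          then show "poly (pcompose (T a (jet_subst k \<phi> v)) [:0, u ^ (e - 1):]) t = a' (?E t v)"
            by (simp add: poly_pcompose T_poly[OF a(1) \<phi>v] s_def mult.commute)
        qed
        \<comment> \<open>This scalar compensates for two effects of the translation: the factor on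
          \<open>c v ^ N\<close> and the rescaling of the shear parameter, felt with power
          \<open>n\<close> in the top coefficient.\<close>
        define x where "x = (u ^ w) ^ N * inverse ((u ^ (e - 1)) ^ n)"
        have T0: "T (\<lambda>v. x * a' v) v = smult x (T a' v)" if "v \<in> Z" for v
          by (rule T_eqI) (simp add: T_poly a'A that)
        have xA: "(\<lambda>v. x * a' v) \<in> A" by (rule fun_algebra_cmult[OF alg a'A])
        have "degree (T (\<lambda>v. x * a' v) v) \<le> n" if "v \<in> Z" for v
        proof -
          have "degree (T a' v) \<le> degree (T a (jet_subst k \<phi> v)) * 1"
            unfolding Ta'[OF that] degree_pcompose by (intro mult_le_mono2) simp
          also have "\<dots> \<le> n" using a(2) jet_invariantD(1)[OF Z that \<phi>] by simp
          finally show ?thesis unfolding T0[OF that] using degree_smult_le le_trans by blast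
        qed
        moreover have "g v = coeff (T (\<lambda>v. x * a' v) v) n * c v ^ N" if v: "v \<in> Z" for v
        proof -
          have "g v = coeff (T a (jet_subst k \<phi> v)) n * (u ^ w * c v) ^ N"
            using gf[OF v] a(3) jet_invariantD(1)[OF Z v \<phi>] semi_invariantD[OF c(2) ZR(1)[OF v] \<phi>]
            by (simp add: u_def)
          moreover have "coeff (T (\<lambda>v. x * a' v) v) n = x * ((u ^ (e - 1)) ^ n * coeff (T a (jet_subst k \<phi> v)) n)"
            unfolding T0[OF v] Ta'[OF v] by (simp add: coeff_pcompose_linear)
          moreover have "x * ((u ^ (e - 1)) ^ n * y) = (u ^ w) ^ N * y" for y
            using u by (simp add: x_def)
          ultimately show ?thesis by (simp add: power_mult_distrib)
        qed
        ultimately show ?thesis unfolding M_def using xA g by blast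
      qed
    qed
    have "q0 \<in> M" unfolding M_def using q0 a0 ZR by (intro CollectI conjI bexI[of _ a0]) auto
    moreover have "q0 v0 \<noteq> 0" using q0(2)[of v0] ZR[OF a0(3)] a0(4) by auto
    ultimately obtain d w1 where d: "d \<in> M" "semi_invariant k Z d w1" "\<exists>v\<in>Z. d v \<noteq> 0"
      using M.semi_invariant_exists a0(3) by metis
    then obtain a where a: "a \<in> A" "\<forall>v\<in>Z. degree (T a v) \<le> n" "\<forall>v\<in>Z. d v = coeff (T a v) n * c v ^ N"
      and dP: "d \<in> polyfun {1..k}" unfolding M_def by blast
    define C where "C = (\<lambda>v. coeff (T a v) n)"
    have C: "C \<in> A" "inv C" unfolding C_def using a by (auto intro: T_coeff_in inv_top_coeff)
    have "n > 0" using n by (simp add: minimal_degree_def)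
    define Z' where "Z' = {v \<in> R. c v * d v \<noteq> 0}"
    have Z'Z: "v \<in> Z" "C v \<noteq> 0" "d v \<noteq> 0" if "v \<in> Z'" for v
      using that a(3) by (auto simp: Z'_def Z_def C_def)
    have sd: "semi_invariant k R (\<lambda>v. c v * d v) (w + w1)"
      using semi_invariant_mult[OF c(2)] d(2) by (simp add: Z_def)
    have Z': "jet_invariant k Z'" unfolding Z'_def by (rule semi_invariant_nonzero_invariant[OF R sd])
    \<comment> \<open>An arbitrary root, not a regular function of \<open>v\<close>; it enters only
      through values of invariants at the moved point.\<close>
    define \<tau> where "\<tau> v = (SOME t. poly (T a v) t = 0)" for v
    have \<tau>: "a (?E (\<tau> v) v) = 0" if v: "v \<in> Z'" for v
    proof -
      have "degree (T a v) > 0"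
        using Z'Z(2)[OF v] \<open>n > 0\<close> le_degree[of "T a v" n] by (simp add: C_def)
      then have "poly (T a v) (\<tau> v) = 0"
        unfolding \<tau>_def by (intro someI_ex[of "\<lambda>t. poly (T a v) t = 0"] alg_closed_imp_poly_has_root)
      then show ?thesis using T_poly[OF a(1) Z'Z(1)[OF v]] by simp
    qed
    define \<pi>' where "\<pi>' v = \<pi> (?E (\<tau> v) v)" for v
    \<comment> \<open>Applied to each coordinate of the old section: on the slice it is a quotient
      of invariants, whose values at \<open>v\<close> and at the moved point coincide.\<close>
    have "\<exists>M B. B \<in> A \<and> inv B \<and> (\<forall>v\<in>Z. a v = 0 \<longrightarrow> C v ^ M * \<pi> v i = B v)" for i
      by (rule slice[OF p n a(1) _ \<pi>A[of i]]) (use a(2) in \<open>auto simp: C_def\<close>)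
    then obtain m B where B: "\<And>i. B i \<in> A" "\<And>i. inv (B i)"
      "\<And>i v. v \<in> Z \<Longrightarrow> a v = 0 \<Longrightarrow> C v ^ m i * \<pi> v i = B i v" by metis
    have \<pi>'_eq: "\<pi>' v i = B i v * inverse (C v) ^ m i" if v: "v \<in> Z'" for v i
      using B(3)[OF E_in[OF Z'Z(1)[OF v]] \<tau>[OF v], of i] Z'Z(2)[OF v]
        invD[OF C(2) Z'Z(1)[OF v]] invD[OF B(2) Z'Z(1)[OF v]]
      by (simp add: \<pi>'_def field_simps)
    have ps: "partial_section k R (\<lambda>v. c v * d v) e \<pi>'"
      unfolding partial_section_def
    proof (intro conjI allI ballI impI)
      fix v assume "v \<in> R" "c v * d v \<noteq> 0"
      then have v: "v \<in> Z'" by (simp add: Z'_def)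
      have Ev: "?E (\<tau> v) v \<in> Z" by (rule E_in[OF Z'Z(1)[OF v]])
      then obtain \<phi> where \<phi>: "tangent (Suc e) \<phi>" "\<pi>' v = jet_subst k \<phi> (?E (\<tau> v) v)"
        using \<pi> unfolding partial_section_def \<pi>'_def Z_def by blast
      have "\<phi> $ 0 = 0" using tangent_nth[OF \<phi>(1), of 0] by simp
      then have "\<pi>' v = jet_subst k (shear e (\<tau> v) oo \<phi>) v"
        unfolding \<phi>(2) using e vp[OF Z'Z(1)[OF v]] by (intro jet_subst_compose) auto
      moreover have "tangent e (shear e (\<tau> v) oo \<phi>)"
        using e by (intro tangent_compose shear_tangent tangent_mono[OF \<phi>(1)]) auto
      ultimately show "\<exists>\<phi>. tangent e \<phi> \<and> \<pi>' v = jet_subst k \<phi> v" by blast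
    next
      fix i
      show "tangent_invariant k e {v \<in> R. c v * d v \<noteq> 0} (\<lambda>v. \<pi>' v i)"
        unfolding tangent_invariant_def Z'_def[symmetric]
      proof (intro ballI allI impI)
        fix v \<phi> assume v: "v \<in> Z'" and \<phi>: "tangent e (\<phi>::'k fps)"
        have "jet_subst k \<phi> v \<in> Z'" using e by (intro jet_invariantD(1)[OF Z' v] tangent_coord_change[OF \<phi>])
        then show "\<pi>' (jet_subst k \<phi> v) i = \<pi>' v i"
          using tangent_invariantD[OF inv_tangent[OF C] Z'Z(1)[OF v] \<phi>]
            tangent_invariantD[OF inv_tangent[OF B(1,2)] Z'Z(1)[OF v] \<phi>]
          by (simp add: \<pi>'_eq v)
      qed
      have cd: "(\<lambda>v. c v * d v) \<in> polyfun {1..k}" by (intro polyfun.mult c dP)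
      note ro' = fun_algebra_regular_off[OF cd, of R]
      have "(\<lambda>v. B i v * (c v ^ N * inverse (d v)) ^ m i) \<in> regular_off k R (\<lambda>v. c v * d v)"
        using B(1)[of i]
        by (intro fun_algebra_mult[OF ro'] fun_algebra_power[OF ro'] regular_off_mult_left[OF _ dP]
            regular_off_inverse_right[OF c(1)]) (auto simp: A_def intro: regular_off_poly c(1))
      then show "(\<lambda>v. \<pi>' v i) \<in> regular_off k R (\<lambda>v. c v * d v)"
      proof (rule regular_off_cong)
        fix v assume "v \<in> R" "c v * d v \<noteq> 0"
        then have v: "v \<in> Z'" by (simp add: Z'_def)
        have "c v ^ N * inverse (d v) = inverse (C v)"
          using a(3) Z'Z[OF v] ZR(2)[OF Z'Z(1)[OF v]] by (simp add: C_def field_simps)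
        then show "B i v * (c v ^ N * inverse (d v)) ^ m i = \<pi>' v i" by (simp add: \<pi>'_eq[OF v])
      qed
    qed
    have "\<exists>v\<in>R. c v * d v \<noteq> 0" using d(3) ZR by auto
    then show ?thesis using that[OF dP sd _ ps] by blast
  qed
qed

definition jet_section ::
    "nat \<Rightarrow> (nat \<Rightarrow> 'k::field) set \<Rightarrow> ((nat \<Rightarrow> 'k) \<Rightarrow> 'k) \<Rightarrow> ((nat \<Rightarrow> 'k) \<Rightarrow> nat \<Rightarrow> 'k) \<Rightarrow> bool" where
  "jet_section k R c \<pi> \<longleftrightarrow>
     (\<forall>v\<in>R. c v \<noteq> 0 \<longrightarrow> \<pi> v \<in> jet_orbit k v) \<and>
     (\<forall>v\<in>R. c v \<noteq> 0 \<longrightarrow> (\<forall>\<phi>. coord_change \<phi> \<longrightarrow> \<pi> (jet_subst k \<phi> v) = \<pi> v)) \<and>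
     (\<forall>i. (\<lambda>v. \<pi> v i) \<in> regular_off k R c)"

lemma partial_section_start:
  assumes R: "jet_invariant k R"
  shows "partial_section k R c (Suc (max 1 k)) (\<lambda>v. v)"
  unfolding partial_section_def
proof (intro conjI allI ballI impI)
  fix v assume v: "v \<in> R"
  show "\<exists>\<phi>. tangent (Suc (max 1 k)) \<phi> \<and> v = jet_subst k \<phi> v"
    using jet_invariantD(2)[OF R v] by (intro exI[of _ fps_X]) simp
next
  fix i
  show "tangent_invariant k (Suc (max 1 k)) {v \<in> R. c v \<noteq> 0} (\<lambda>v. v i)"
    unfolding tangent_invariant_def
  proof (intro ballI allI impI)
    fix v \<phi> assume "v \<in> {v \<in> R. c v \<noteq> 0}" and \<phi>: "tangent (Suc (max 1 k)) (\<phi> :: 'a fps)"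
    then have v: "v \<in> affine_points {1..k}" using jet_invariantD(2)[OF R] by blast
    have "agree (Suc k) \<phi> fps_X" using tangent_mono[OF \<phi>, of "Suc k"] by (simp add: tangent_def)
    then show "jet_subst k \<phi> v i = v i" using jet_subst_cong[OF v] v by simp
  qed
  show "(\<lambda>v. v i) \<in> regular_off k R c"
  proof (cases "i \<in> {1..k}")
    case True
    then show ?thesis by (intro regular_off_poly polyfun.coord)
  next
    case False
    have "(\<lambda>_. 0) \<in> regular_off k R c" by (intro regular_off_poly polyfun.const)
    then show ?thesis
      by (rule regular_off_cong) (use False jet_invariantD(2)[OF R] in \<open>auto simp: affine_points_def\<close>)
  qed
qed

text \<open>Descending induction on the order of tangency. Each step multiplies the denominator by a
  further factor and thus shrinks the locus to a smaller nonempty invariant open set.\<close>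

lemma unipotent_section:
  fixes c :: "(nat \<Rightarrow> 'k::alg_closed_field) \<Rightarrow> 'k"
  assumes p: "CHAR('k) = p" "prime p" and R: "jet_invariant k R"
    and c: "c \<in> polyfun {1..k}" "semi_invariant k R c w" and nz: "\<exists>v\<in>R. c v \<noteq> 0"
  obtains d w' \<pi> where "d \<in> polyfun {1..k}" "semi_invariant k R (\<lambda>v. c v * d v) w'"
    "\<exists>v\<in>R. c v * d v \<noteq> 0" "partial_section k R (\<lambda>v. c v * d v) 2 \<pi>"
proof -
  have "e \<ge> 1 \<longrightarrow> (\<exists>d w' \<pi>. d \<in> polyfun {1..k} \<and> semi_invariant k R (\<lambda>v. c v * d v) w' \<and>
    (\<exists>v\<in>R. c v * d v \<noteq> 0) \<and> partial_section k R (\<lambda>v. c v * d v) (Suc e) \<pi>)" if "e \<le> max 1 k" for e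
    using that
  proof (induction rule: inc_induct)
    case base
    have "partial_section k R (\<lambda>v. c v * 1) (Suc (max 1 k)) (\<lambda>v. v)" by (rule partial_section_start[OF R])
    then show ?case using c nz
      by (intro impI exI[of _ "\<lambda>_. 1"] exI[of _ w] exI[of _ "\<lambda>v. v"]) (auto intro: polyfun.const)
  next
    case (step e)
    show ?case
    proof
      assume e: "e \<ge> 1"
      then obtain d w' \<pi> where d: "d \<in> polyfun {1..k}" "semi_invariant k R (\<lambda>v. c v * d v) w'"
        "\<exists>v\<in>R. c v * d v \<noteq> 0" "partial_section k R (\<lambda>v. c v * d v) (Suc (Suc e)) \<pi>"
        using step.IH by auto
      have cd: "(\<lambda>v. c v * d v) \<in> polyfun {1..k}" by (intro polyfun.mult c d)
      obtain d' w'' \<pi>' where d': "d' \<in> polyfun {1..k}" "semi_invariant k R (\<lambda>v. (c v * d v) * d' v) w''"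
        "\<exists>v\<in>R. (c v * d v) * d' v \<noteq> 0" "partial_section k R (\<lambda>v. (c v * d v) * d' v) (Suc e) \<pi>'"
        by (rule partial_section_step[OF p _ R cd d(2-4)]) (use e in auto)
      have "(\<lambda>v. d v * d' v) \<in> polyfun {1..k}" by (intro polyfun.mult d d')
      then show "\<exists>d w' \<pi>. d \<in> polyfun {1..k} \<and> semi_invariant k R (\<lambda>v. c v * d v) w' \<and>
        (\<exists>v\<in>R. c v * d v \<noteq> 0) \<and> partial_section k R (\<lambda>v. c v * d v) (Suc e) \<pi>"
        using d'(2-4) by (intro exI[of _ "\<lambda>v. d v * d' v"] exI[of _ w''] exI[of _ \<pi>']) (simp add: mult.assoc)
    qed
  qed
  from this[of 1] show ?thesis using that by (auto simp: numeral_2_eq_2 One_nat_def)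
qed

section \<open>Units of given weight and sections for the scalings\<close>

definition unit_weight ::
    "nat \<Rightarrow> (nat \<Rightarrow> 'k::field) set \<Rightarrow> ((nat \<Rightarrow> 'k) \<Rightarrow> 'k) set \<Rightarrow> ((nat \<Rightarrow> 'k) \<Rightarrow> 'k) \<Rightarrow> nat \<Rightarrow> bool" where
  "unit_weight k Z A g e \<longleftrightarrow> g \<in> A \<and> (\<lambda>v. inverse (g v)) \<in> A \<and> (\<forall>v\<in>Z. g v \<noteq> 0) \<and> semi_invariant k Z g e"

text \<open>A Bezout relation among the weights becomes a product of a power of \<open>g\<close> and
  an inverse power of \<open>h\<close>; hence units are required.\<close>

lemma unit_weight_gcd:
  assumes A: "fun_algebra A" and g: "unit_weight k Z A g a" and h: "unit_weight k Z A h b"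
  shows "\<exists>f. unit_weight k Z A f (gcd a b)"
proof (cases "a = 0")
  case True
  then show ?thesis using h by auto
next
  case False
  then obtain x y where xy: "a * x = b * y + gcd a b" using bezout_nat by blast
  define f where "f = (\<lambda>v. g v ^ x * inverse (h v) ^ y)"
  have "f \<in> A" unfolding f_def
    using g h by (intro fun_algebra_mult[OF A] fun_algebra_power[OF A]) (auto simp: unit_weight_def)
  moreover have "(\<lambda>v. inverse (g v) ^ x * h v ^ y) \<in> A"
    using g h by (intro fun_algebra_mult[OF A] fun_algebra_power[OF A]) (auto simp: unit_weight_def)
  then have "(\<lambda>v. inverse (f v)) \<in> A" by (simp add: f_def power_inverse)
  moreover have "\<forall>v\<in>Z. f v \<noteq> 0" using g h by (simp add: f_def unit_weight_def)
  moreover have "semi_invariant k Z f (gcd a b)"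
    unfolding semi_invariant_def
  proof (intro ballI allI impI)
    fix v \<phi> assume v: "v \<in> Z" and \<phi>: "coord_change (\<phi> :: 'a fps)"
    define u where "u = \<phi> $ 1"
    have u: "u \<noteq> 0" using \<phi> by (simp add: u_def coord_changeD)
    have "f (jet_subst k \<phi> v) = (u ^ a) ^ x * inverse (u ^ b) ^ y * f v"
      using g h v \<phi> by (simp add: f_def unit_weight_def semi_invariant_def u_def power_mult_distrib inverse_mult_distrib mult_ac)
    also have "(u ^ a) ^ x * inverse (u ^ b) ^ y = u ^ gcd a b"
      using u by (simp add: power_mult[symmetric] xy power_add power_inverse)
    finally show "f (jet_subst k \<phi> v) = (\<phi> $ 1) ^ gcd a b * f v" by (simp add: u_def)
  qed
  ultimately show ?thesis unfolding unit_weight_def by blast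
qed

lemma unit_weight_common:
  assumes A: "fun_algebra A" and fin: "finite W"
    and W: "\<And>e. e \<in> W \<Longrightarrow> \<exists>g. unit_weight k Z A g e"
  shows "\<exists>f e. unit_weight k Z A f e \<and> (\<forall>a\<in>W. e dvd a)"
  using fin W
proof induction
  case empty
  have "unit_weight k Z A (\<lambda>_. 1) 0"
    using fun_algebra_const[OF A, of 1] by (simp add: unit_weight_def semi_invariant_def)
  then show ?case by blast
next
  case (insert b W)
  then obtain f e where fe: "unit_weight k Z A f e" "\<forall>a\<in>W. e dvd a" by auto
  obtain h where "unit_weight k Z A h b" using insert.prems by blast
  from unit_weight_gcd[OF A fe(1) this] obtain f' where f': "unit_weight k Z A f' (gcd e b)" by blast
  have "\<forall>a\<in>insert b W. gcd e b dvd a" using fe(2) by (auto intro: dvd_trans[OF gcd_dvd1])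
  with f' show ?case by blast
qed

lemma semi_invariant_prod:
  assumes "\<And>s. s \<in> S \<Longrightarrow> semi_invariant k Z (g s) (w s)"
  shows "semi_invariant k Z (\<lambda>v. \<Prod>s\<in>S. g s v) (\<Sum>s\<in>S. w s)"
proof (cases "finite S")
  case True
  then show ?thesis using assms
    by (induction S) (auto simp: semi_invariant_def power_add mult_ac)
next
  case False
  then show ?thesis by (simp add: semi_invariant_def)
qed

lemma semi_invariant_subset: "semi_invariant k Z g w \<Longrightarrow> Z' \<subseteq> Z \<Longrightarrow> semi_invariant k Z' g w"
  by (auto simp: semi_invariant_def)

text \<open>On the locus where as many as possible of the homogeneous components of the coordinates of
  \<open>\<pi>\<close> do not vanish, the remaining components vanish identically, and the orbits of the scalings
  are normalised by means of a unit whose weight divides all occurring weights.\<close>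

lemma torus_section:
  fixes c :: "(nat \<Rightarrow> 'k::alg_closed_field) \<Rightarrow> 'k"
  assumes R: "jet_invariant k R" and c: "c \<in> polyfun {1..k}" "semi_invariant k R c w"
    and nz: "\<exists>v\<in>R. c v \<noteq> 0" and \<pi>: "partial_section k R c 2 \<pi>"
  obtains d w' \<pi>' where "d \<in> polyfun {1..k}" "semi_invariant k R (\<lambda>v. c v * d v) w'"
    "\<exists>v\<in>R. c v * d v \<noteq> 0" "jet_section k R (\<lambda>v. c v * d v) \<pi>'"
proof -
  define Z where "Z = {v \<in> R. c v \<noteq> 0}"
  have Z: "jet_invariant k Z" unfolding Z_def by (rule semi_invariant_nonzero_invariant[OF R c(2)])
  have vp: "v \<in> affine_points {1..k}" if "v \<in> Z" for v using jet_invariantD(2)[OF Z that] .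
  have ZR: "v \<in> R" "c v \<noteq> 0" if "v \<in> Z" for v using that by (auto simp: Z_def)
  have "\<exists>N q. q \<in> polyfun {1..k} \<and> (\<forall>v\<in>Z. \<pi> v i * c v ^ N = q v)" for i
  proof -
    have "(\<lambda>v. \<pi> v i) \<in> regular_off k R c" using \<pi> by (simp add: partial_section_def)
    then show ?thesis by (rule regular_offE) (auto simp: Z_def)
  qed
  then obtain N q where q: "\<And>i. q i \<in> polyfun {1..k}" "\<And>i v. v \<in> Z \<Longrightarrow> \<pi> v i * c v ^ N i = q i v"
    by metis
  have "\<exists>G\<in>poly_family (polyfun {1..k}). \<forall>v\<in>affine_points {1..k}. \<forall>t. poly (G v) t = q i (jet_subst k (0 + fps_const t * fps_X) v)" for i
    by (rule polyfun_jet_subst_family[OF q(1)[of i], of 0 fps_X]) blast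
  then obtain G where G: "\<And>i. G i \<in> poly_family (polyfun {1..k})"
    and G_val: "\<And>i v t. v \<in> Z \<Longrightarrow> poly (G i v) t = q i (jet_subst k (fps_const t * fps_X) v)"
    using vp by (metis add_0)
  have tq: "tangent_invariant k 2 Z (q i)" for i
    unfolding tangent_invariant_def
  proof (intro ballI allI impI)
    fix v \<phi> assume v: "v \<in> Z" and \<phi>: "tangent 2 (\<phi> :: 'k fps)"
    have \<phi>c: "coord_change \<phi>" by (rule tangent_coord_change[OF \<phi>]) simp
    have "tangent_invariant k 2 Z (\<lambda>v. \<pi> v i)" using \<pi> by (simp add: partial_section_def Z_def)
    then have "\<pi> (jet_subst k \<phi> v) i = \<pi> v i" using v \<phi> by (simp add: tangent_invariant_def)
    moreover have "c (jet_subst k \<phi> v) = c v"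
      using semi_invariantD[OF c(2) ZR(1)[OF v] \<phi>c] tangent_nth[OF \<phi>, of 1] by simp
    ultimately show "q i (jet_subst k \<phi> v) = q i v"
      using q(2)[OF v, of i] q(2)[OF jet_invariantD(1)[OF Z v \<phi>c], of i] by simp
  qed
  have weight: "semi_invariant k Z (\<lambda>v. coeff (G i v) j) j" for i j
    unfolding semi_invariant_def
  proof (intro ballI allI impI)
    fix v \<phi> assume v: "v \<in> Z" and \<phi>: "coord_change (\<phi> :: 'k fps)"
    show "coeff (G i (jet_subst k \<phi> v)) j = (\<phi> $ 1) ^ j * coeff (G i v) j"
      using scale_family_translate[where G = "G i", OF Z tq G_val v \<phi>] by (simp add: coeff_pcompose_linear)
  qed
  have "\<exists>n. \<forall>v. degree (G i v) \<le> n" for i by (rule poly_family_degree[OF G[of i]]) blast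
  then obtain n where n: "\<And>i v. degree (G i v) \<le> n i" by metis
  \<comment> \<open>A pair (i, j) stands for the component of weight j of the numerator of
    coordinate i.\<close>
  define J where "J = (SIGMA i:{1..k}. {..n i})"
  have J: "finite J" by (simp add: J_def)
  define supp where "supp v = {s \<in> J. coeff (G (fst s) v) (snd s) \<noteq> 0}" for v
  have supp_le: "card (supp v) \<le> card J" for v unfolding supp_def by (intro card_mono J) auto
  define m where "m = Max (card ` supp ` Z)"
  have fin: "finite (card ` supp ` Z)" unfolding finite_nat_set_iff_bounded_le using supp_le by blast
  have "Z \<noteq> {}" using nz by (auto simp: Z_def)
  then have "m \<in> card ` supp ` Z" unfolding m_def using fin by (intro Max_in) auto
  then obtain v0 where v0: "v0 \<in> Z" "card (supp v0) = m" by auto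
  have m_max: "card (supp v) \<le> card (supp v0)" if "v \<in> Z" for v
    unfolding v0(2) m_def using that by (intro Max_ge[OF fin] imageI)
  define S where "S = supp v0"
  have S: "finite S" "S \<subseteq> J" using J by (auto simp: S_def supp_def)
  define Q where "Q s v = coeff (G (fst s) v) (snd s)" for s v
  have Q: "Q s \<in> polyfun {1..k}" for s unfolding Q_def by (rule poly_family_coeff[OF G])
  have wQ: "semi_invariant k Z (Q s) (snd s)" for s unfolding Q_def by (rule weight)
  define d where "d v = (\<Prod>s\<in>S. Q s v)" for v
  have d: "d \<in> polyfun {1..k}" unfolding d_def by (intro polyfun_prod Q)
  have cd: "(\<lambda>v. c v * d v) \<in> polyfun {1..k}" by (intro polyfun.mult c d)
  have sd: "semi_invariant k R (\<lambda>v. c v * d v) (w + (\<Sum>s\<in>S. snd s))"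
  proof (rule semi_invariant_mult[OF c(2)])
    have "semi_invariant k Z d (\<Sum>s\<in>S. snd s)" unfolding d_def by (intro semi_invariant_prod wQ)
    then show "semi_invariant k {v \<in> R. c v \<noteq> 0} d (\<Sum>s\<in>S. snd s)" by (simp add: Z_def)
  qed
  have "d v0 \<noteq> 0" unfolding d_def using S(1) by (auto simp: S_def supp_def Q_def)
  then have nz': "\<exists>v\<in>R. c v * d v \<noteq> 0" using ZR[OF v0(1)] by auto
  define Z' where "Z' = {v \<in> R. c v * d v \<noteq> 0}"
  have Z': "jet_invariant k Z'" unfolding Z'_def by (rule semi_invariant_nonzero_invariant[OF R sd])
  have Z'Z: "Z' \<subseteq> Z" by (auto simp: Z'_def Z_def)
  have Q_ne: "Q s v \<noteq> 0" if "v \<in> Z'" "s \<in> S" for s v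
    using that S(1) by (auto simp: Z'_def d_def)
  have Q_zero: "Q s v = 0" if v: "v \<in> Z'" and s: "s \<in> J - S" for s v
  proof -
    \<comment> \<open>No component in \<open>S\<close> vanishes at \<open>v\<close>, and by
      maximality of \<open>S\<close> no further one can be nonzero there.\<close>
    have "S \<subseteq> supp v" using Q_ne[OF v] S(2) by (auto simp: supp_def Q_def)
    moreover have "finite (supp v)" using J by (simp add: supp_def)
    ultimately have "S = supp v"
      using m_max[of v] v Z'Z by (intro card_seteq) (auto simp: S_def)
    then show ?thesis using s by (auto simp: supp_def Q_def)
  qed
  let ?A = "regular_off k R (\<lambda>v. c v * d v)"
  note ro = fun_algebra_regular_off[OF cd, of R]
  have uc: "unit_weight k Z' ?A c w"
    using semi_invariant_subset[OF c(2), of Z'] c(1) d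
    by (auto simp: unit_weight_def Z'_def intro: regular_off_poly regular_off_mult_left[OF regular_off_inverse])
  have uQ: "unit_weight k Z' ?A (Q s) (snd s)" if s: "s \<in> S" for s
    unfolding unit_weight_def
  proof (intro conjI)
    have "(\<lambda>v. c v * (\<Prod>s\<in>S-{s}. Q s v)) \<in> polyfun {1..k}" by (intro polyfun.mult c polyfun_prod Q)
    then have "(\<lambda>v. inverse (Q s v)) \<in> regular_off k R (\<lambda>v. (c v * (\<Prod>s\<in>S-{s}. Q s v)) * Q s v)"
      by (rule regular_off_inverse_right)
    moreover have "(c v * (\<Prod>s\<in>S-{s}. Q s v)) * Q s v = c v * d v" for v
      unfolding d_def using S(1) s by (simp add: prod.remove[of S s] mult_ac)
    ultimately show "(\<lambda>v. inverse (Q s v)) \<in> ?A" by simp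
    show "Q s \<in> ?A" by (rule regular_off_poly[OF Q])
    show "\<forall>v\<in>Z'. Q s v \<noteq> 0" using Q_ne s by blast
    show "semi_invariant k Z' (Q s) (snd s)" by (rule semi_invariant_subset[OF wQ Z'Z])
  qed
  have "\<exists>f e. unit_weight k Z' ?A f e \<and> (\<forall>a\<in>insert w (snd ` S). e dvd a)"
    by (rule unit_weight_common[OF ro]) (use S uc uQ in auto)
  then obtain \<tau> e where \<tau>: "unit_weight k Z' ?A \<tau> e" and e: "e dvd w" "\<And>s. s \<in> S \<Longrightarrow> e dvd snd s"
    by auto
  have \<tau>0: "\<tau> v \<noteq> 0" if "v \<in> Z'" for v using \<tau> that by (simp add: unit_weight_def)
  \<comment> \<open>The scaling factor is an e-th root of 1 / \<open>\<tau> v\<close>, so its powers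
    with exponent divisible by e are rational in \<open>\<tau> v\<close>. If e = 0, all occurring
    weights vanish and the factor 1 will do.\<close>
  have "\<exists>u. u \<noteq> 0 \<and> (\<forall>j. e dvd j \<longrightarrow> u ^ j = inverse (\<tau> v) ^ (j div e))" if v: "v \<in> Z'" for v
  proof (cases "e = 0")
    case True
    then show ?thesis by (intro exI[of _ 1]) simp
  next
    case False
    then obtain u where u: "u ^ e = inverse (\<tau> v)" using nth_root_exists[of e "inverse (\<tau> v)"] by auto
    have "u \<noteq> 0" using u \<tau>0[OF v] False by (auto simp: power_0_left)
    moreover have "u ^ j = inverse (\<tau> v) ^ (j div e)" if "e dvd j" for j
      using that False unfolding u[symmetric] by (auto simp: power_mult[symmetric])
    ultimately show ?thesis by blast
  qed
  then obtain u where u: "\<And>v. v \<in> Z' \<Longrightarrow> u v \<noteq> 0"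
    "\<And>v j. v \<in> Z' \<Longrightarrow> e dvd j \<Longrightarrow> u v ^ j = inverse (\<tau> v) ^ (j div e)" by metis
  define \<pi>' where "\<pi>' v = \<pi> (jet_subst k (fps_const (u v) * fps_X) v)" for v
  \<comment> \<open>The coordinates after scaling. Only exponents divisible by e contribute, so the
    choice of the root disappears and the formula is regular.\<close>
  define P where "P i v = (\<Sum>j\<le>n i. Q (i, j) v * inverse (\<tau> v) ^ (j div e)) * (\<tau> v ^ (w div e) * inverse (c v)) ^ N i" for i v
  have scaled_in: "jet_subst k (fps_const (u v) * fps_X) v \<in> Z'" if "v \<in> Z'" for v
    using u(1)[OF that] by (intro jet_invariantD(1)[OF Z' that]) simp
  have \<pi>'_eq: "\<pi>' v i = P i v" if v: "v \<in> Z'" and i: "i \<in> {1..k}" for v i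
  proof -
    let ?v = "jet_subst k (fps_const (u v) * fps_X) v"
    have vZ: "v \<in> Z" using v Z'Z by blast
    have cv: "c ?v = u v ^ w * c v"
      using semi_invariantD[OF c(2) ZR(1)[OF vZ], of "fps_const (u v) * fps_X"] u(1)[OF v] by simp
    have "\<pi>' v i * c ?v ^ N i = poly (G i v) (u v)"
      using q(2)[of ?v i] scaled_in[OF v] Z'Z G_val[OF vZ] by (auto simp: \<pi>'_def)
    also have "\<dots> = (\<Sum>j\<le>n i. coeff (G i v) j * u v ^ j)"
      unfolding poly_altdef using n[of i v] by (intro sum.mono_neutral_left) (auto simp: coeff_eq_0)
    also have "\<dots> = (\<Sum>j\<le>n i. Q (i, j) v * inverse (\<tau> v) ^ (j div e))"
    proof (intro sum.cong refl)
      fix j assume "j \<in> {..n i}"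
      then have J': "(i, j) \<in> J" using i by (simp add: J_def)
      show "coeff (G i v) j * u v ^ j = Q (i, j) v * inverse (\<tau> v) ^ (j div e)"
      proof (cases "(i, j) \<in> S")
        case True
        then show ?thesis using u(2)[OF v] e(2)[OF True] by (simp add: Q_def)
      next
        case False
        then have "Q (i, j) v = 0" using Q_zero[OF v] J' by blast
        then show ?thesis by (simp add: Q_def)
      qed
    qed
    finally have *: "\<pi>' v i * (u v ^ w * c v) ^ N i = (\<Sum>j\<le>n i. Q (i, j) v * inverse (\<tau> v) ^ (j div e))"
      by (simp add: cv)
    have "(u v ^ w * c v) * (\<tau> v ^ (w div e) * inverse (c v)) = 1"
      using u(2)[OF v e(1)] ZR(2)[OF vZ] \<tau>0[OF v] by (simp add: field_simps)
    then have "(u v ^ w * c v) ^ N i * (\<tau> v ^ (w div e) * inverse (c v)) ^ N i = 1"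
      unfolding power_mult_distrib[symmetric] by simp
    then have "\<pi>' v i = \<pi>' v i * (u v ^ w * c v) ^ N i * (\<tau> v ^ (w div e) * inverse (c v)) ^ N i"
      by (simp add: mult.assoc)
    then show ?thesis unfolding * P_def .
  qed
  have \<pi>'_out: "\<pi>' v i = 0" if v: "v \<in> Z'" and i: "i \<notin> {1..k}" for v i
  proof -
    have "jet_subst k (fps_const (u v) * fps_X) v \<in> Z" using scaled_in[OF v] Z'Z by blast
    then obtain \<phi> where "\<pi>' v = jet_subst k \<phi> (jet_subst k (fps_const (u v) * fps_X) v)"
      using \<pi> unfolding partial_section_def \<pi>'_def Z_def by blast
    then show ?thesis using jet_subst_outside[OF i] by simp
  qed
  have P_inv: "P i (jet_subst k \<phi> v) = P i v" if v: "v \<in> Z'" and \<phi>: "coord_change \<phi>" and i: "i \<in> {1..k}" for i v \<phi>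
  proof -
    define x where "x = \<phi> $ 1"
    have x: "x \<noteq> 0" using \<phi> by (simp add: x_def coord_changeD)
    have vZ: "v \<in> Z" using v Z'Z by blast
    have \<tau>x: "\<tau> (jet_subst k \<phi> v) = x ^ e * \<tau> v"
      using \<tau> v \<phi> by (simp add: unit_weight_def semi_invariant_def x_def)
    have pw: "(x ^ e) ^ (j div e) = x ^ j" if "e dvd j" for j
      using that by (simp add: power_mult[symmetric])
    have "Q (i, j) (jet_subst k \<phi> v) * inverse (x ^ e * \<tau> v) ^ (j div e) = Q (i, j) v * inverse (\<tau> v) ^ (j div e)"
      if "j \<le> n i" for j
    proof (cases "(i, j) \<in> S")
      case True
      have "Q (i, j) (jet_subst k \<phi> v) * inverse (x ^ e * \<tau> v) ^ (j div e)
          = (x ^ j * inverse ((x ^ e) ^ (j div e))) * (Q (i, j) v * inverse (\<tau> v) ^ (j div e))"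
        using semi_invariantD[OF wQ vZ \<phi>, of "(i, j)"]
        by (simp add: x_def power_mult_distrib inverse_mult_distrib power_inverse)
      then show ?thesis using pw[of j] e(2)[OF True] x by simp
    next
      case False
      then have "Q (i, j) v = 0" using Q_zero[OF v] that i by (auto simp: J_def)
      then show ?thesis using semi_invariantD[OF wQ vZ \<phi>, of "(i, j)"] by simp
    qed
    then have "(\<Sum>j\<le>n i. Q (i, j) (jet_subst k \<phi> v) * inverse (x ^ e * \<tau> v) ^ (j div e)) =
        (\<Sum>j\<le>n i. Q (i, j) v * inverse (\<tau> v) ^ (j div e))"
      by (intro sum.cong refl) (simp only: atMost_iff)
    moreover have "(x ^ e * \<tau> v) ^ (w div e) * inverse (x ^ w * c v) = \<tau> v ^ (w div e) * inverse (c v)"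
      using pw[OF e(1)] x by (simp add: power_mult_distrib inverse_mult_distrib)
    ultimately show ?thesis
      unfolding P_def \<tau>x semi_invariantD[OF c(2) ZR(1)[OF vZ] \<phi>] x_def[symmetric] by (simp only:)
  qed
  have P_reg: "P i \<in> ?A" for i
    unfolding P_def
    using \<tau> uc
    by (intro fun_algebra_mult[OF ro] fun_algebra_power[OF ro] fun_algebra_sum[OF ro])
       (auto simp: unit_weight_def intro: regular_off_poly Q)
  have "jet_section k R (\<lambda>v. c v * d v) \<pi>'"
    unfolding jet_section_def
  proof (intro conjI allI ballI impI)
    fix v assume "v \<in> R" "c v * d v \<noteq> 0"
    then have v: "v \<in> Z'" by (simp add: Z'_def)
    then have vZ: "v \<in> Z" using Z'Z by blast
    let ?v = "jet_subst k (fps_const (u v) * fps_X) v"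
    have "?v \<in> Z" using scaled_in[OF v] Z'Z by blast
    then obtain \<phi> where \<phi>: "tangent 2 \<phi>" "\<pi>' v = jet_subst k \<phi> ?v"
      using \<pi> unfolding partial_section_def \<pi>'_def Z_def by blast
    have "?v \<in> jet_orbit k v" unfolding jet_orbit_def using u(1)[OF v] by (auto intro!: exI[of _ "fps_const (u v) * fps_X"])
    moreover have "\<pi>' v \<in> jet_orbit k ?v"
      unfolding jet_orbit_def using \<phi> tangent_coord_change[OF \<phi>(1)] by auto
    ultimately show "\<pi>' v \<in> jet_orbit k v" using jet_orbit_trans[OF vp[OF vZ]] by blast
    fix \<phi> :: "'k fps" assume \<phi>: "coord_change \<phi>"
    have \<phi>v: "jet_subst k \<phi> v \<in> Z'" by (rule jet_invariantD(1)[OF Z' v \<phi>])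
    show "\<pi>' (jet_subst k \<phi> v) = \<pi>' v"
    proof
      fix i
      show "\<pi>' (jet_subst k \<phi> v) i = \<pi>' v i"
        using \<pi>'_eq[OF v, of i] \<pi>'_eq[OF \<phi>v, of i] P_inv[OF v \<phi>, of i] \<pi>'_out[OF v, of i] \<pi>'_out[OF \<phi>v, of i]
        by metis
    qed
  next
    fix i
    show "(\<lambda>v. \<pi>' v i) \<in> ?A"
    proof (cases "i \<in> {1..k}")
      case True
      show ?thesis by (rule regular_off_cong[OF P_reg[of i]]) (use \<pi>'_eq True in \<open>auto simp: Z'_def\<close>)
    next
      case False
      show ?thesis by (rule regular_off_cong[OF regular_off_poly[OF polyfun.const[of 0]]])
          (use \<pi>'_out False in \<open>auto simp: Z'_def\<close>)
    qed
  qed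
  then show ?thesis using that[OF d sd nz'] by blast
qed

text \<open>The polynomials vanishing on the invariant set \<open>F\<close> form a stable space,
  nonzero on \<open>R\<close>, hence contain a semi-invariant. Starting from it keeps the new locus
  disjoint from \<open>F\<close>, the closure of what has already been treated.\<close>

theorem generic_section:
  fixes R F :: "(nat \<Rightarrow> 'k::alg_closed_field) set"
  assumes p: "CHAR('k) = p" "prime p"
    and R: "jet_invariant k R" and F: "jet_invariant k F" "closedin (zariski {1..k}) F" "F \<subset> R"
  obtains c w \<pi> where "c \<in> polyfun {1..k}" "semi_invariant k R c w" "\<exists>v\<in>R. c v \<noteq> 0"
    "\<And>v. v \<in> F \<Longrightarrow> c v = 0" "jet_section k R c \<pi>"
proof -
  define M where "M = {q \<in> polyfun {1..k}. \<forall>v\<in>F. q v = (0::'k)}"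
  interpret stable_subspace k R M
  proof
    show "jet_invariant k R" by (rule R)
    show "M \<subseteq> polyfun {1..k}" by (auto simp: M_def)
    show "(\<lambda>_. 0) \<in> M" by (auto simp: M_def intro: polyfun.const)
    show "(\<lambda>v. a * f v + g v) \<in> M" if "f \<in> M" "g \<in> M" for f g a
      using that by (auto simp: M_def intro: polyfun.add polyfun_cmult)
    show "g \<in> M" if "f \<in> M" "g \<in> polyfun {1..k}" "coord_change \<phi>"
      "\<And>v. v \<in> R \<Longrightarrow> g v = f (jet_subst k \<phi> v)" for f g \<phi>
      using that jet_invariantD(1)[OF F(1)] F(3) by (auto simp: M_def)
  qed
  from F(3) obtain v0 where v0: "v0 \<in> R" "v0 \<notin> F" by blast
  obtain f where "f \<in> polyfun {1..k}" "f v0 \<noteq> 0" "\<And>w. w \<in> F \<Longrightarrow> f w = 0"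
    using closedin_zariski_separate[OF F(2) jet_invariantD(2)[OF R v0(1)] v0(2)] by blast
  then have "f \<in> M" "f v0 \<noteq> 0" by (auto simp: M_def)
  then obtain c0 w0 where c0: "c0 \<in> M" "semi_invariant k R c0 w0" "\<exists>v\<in>R. c0 v \<noteq> 0"
    using semi_invariant_exists[OF _ v0(1)] by blast
  then have c0P: "c0 \<in> polyfun {1..k}" by (simp add: M_def)
  obtain d1 w1 \<pi>1 where 1: "d1 \<in> polyfun {1..k}" "semi_invariant k R (\<lambda>v. c0 v * d1 v) w1"
    "\<exists>v\<in>R. c0 v * d1 v \<noteq> 0" "partial_section k R (\<lambda>v. c0 v * d1 v) 2 \<pi>1"
    by (rule unipotent_section[OF p R c0P c0(2,3)])
  have c1P: "(\<lambda>v. c0 v * d1 v) \<in> polyfun {1..k}" by (intro polyfun.mult c0P 1)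
  obtain d2 w2 \<pi>2 where 2: "d2 \<in> polyfun {1..k}" "semi_invariant k R (\<lambda>v. (c0 v * d1 v) * d2 v) w2"
    "\<exists>v\<in>R. (c0 v * d1 v) * d2 v \<noteq> 0" "jet_section k R (\<lambda>v. (c0 v * d1 v) * d2 v) \<pi>2"
    by (rule torus_section[OF R c1P 1(2-4)])
  have "(\<lambda>v. (c0 v * d1 v) * d2 v) \<in> polyfun {1..k}" by (intro polyfun.mult c0P 1 2)
  then show ?thesis
    by (rule that[OF _ 2(2,3) _ 2(4)]) (use c0(1) in \<open>auto simp: M_def\<close>)
qed

section \<open>The Zariski topology is Noetherian\<close>

text \<open>The ideal of \<open>S\<close> generated by the first \<open>n\<close> members of the
  sequence \<open>f\<close>.\<close>

definition combinations :: "('x \<Rightarrow> 'k::comm_ring_1) set \<Rightarrow> (nat \<Rightarrow> 'x \<Rightarrow> 'k) \<Rightarrow> nat \<Rightarrow> ('x \<Rightarrow> 'k) set" where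
  "combinations S f n = {h. \<exists>g. (\<forall>i. g i \<in> S) \<and> h = (\<lambda>v. \<Sum>i<n. g i v * f i v)}"

lemma combinations_cong: "(\<And>i. i < n \<Longrightarrow> f i = f' i) \<Longrightarrow> combinations S f n = combinations S f' n"
  unfolding combinations_def by (intro Collect_cong ex_cong1 conj_cong refl) auto

lemma combinations_zero: "fun_algebra S \<Longrightarrow> (\<lambda>_. 0) \<in> combinations S f n"
  unfolding combinations_def using fun_algebra_const[of S 0] by (auto intro!: exI[of _ "\<lambda>_ _. 0"])

lemma combinations_add:
  assumes S: "fun_algebra S" and "h \<in> combinations S f n" "h' \<in> combinations S f n"
  shows "(\<lambda>v. h v + h' v) \<in> combinations S f n"
proof -
  from assms obtain g g' where "\<And>i. g i \<in> S" "h = (\<lambda>v. \<Sum>i<n. g i v * f i v)"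
    "\<And>i. g' i \<in> S" "h' = (\<lambda>v. \<Sum>i<n. g' i v * f i v)" unfolding combinations_def by blast
  then show ?thesis unfolding combinations_def
    by (auto intro!: exI[of _ "\<lambda>i v. g i v + g' i v"] fun_algebra_add[OF S] simp: sum.distrib distrib_right)
qed

lemma combinations_mult:
  assumes S: "fun_algebra S" and "h \<in> combinations S f n" "a \<in> S"
  shows "(\<lambda>v. a v * h v) \<in> combinations S f n"
proof -
  from assms obtain g where "\<And>i. g i \<in> S" "h = (\<lambda>v. \<Sum>i<n. g i v * f i v)" unfolding combinations_def by blast
  then show ?thesis unfolding combinations_def
    using assms(3) by (auto intro!: exI[of _ "\<lambda>i v. a v * g i v"] fun_algebra_mult[OF S] simp: sum_distrib_left mult.assoc)
qed

lemma combinations_sum: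
  assumes S: "fun_algebra S" and "\<And>i. i \<in> T \<Longrightarrow> h i \<in> combinations S f n"
  shows "(\<lambda>v. \<Sum>i\<in>T. h i v) \<in> combinations S f n"
  using assms(2) by (induction T rule: infinite_finite_induct)
    (auto intro: combinations_zero[OF S] combinations_add[OF S])

lemma combinations_base:
  assumes S: "fun_algebra S" and "i < n" shows "f i \<in> combinations S f n"
  unfolding combinations_def
  using fun_algebra_const[OF S, of 0] fun_algebra_const[OF S, of 1] assms(2)
  by (auto intro!: exI[of _ "\<lambda>j _. if j = i then 1 else 0"] simp: if_distrib[of "\<lambda>x. x * _"] cong: if_cong)

lemma combinations_mono:
  assumes S: "fun_algebra S" and "n \<le> m" shows "combinations S f n \<subseteq> combinations S f m"
proof
  fix h assume "h \<in> combinations S f n"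
  then obtain g where "\<And>i. g i \<in> S" "h = (\<lambda>v. \<Sum>i<n. g i v * f i v)" unfolding combinations_def by blast
  moreover have "(\<lambda>v. \<Sum>i<n. g i v * f i v) \<in> combinations S f m"
    using calculation(1) assms(2)
    by (intro combinations_sum[OF S] combinations_mult[OF S combinations_base[OF S]]) auto
  ultimately show "h \<in> combinations S f m" by simp
qed

text \<open>The ascending chain condition in terms of sequences: some member lies in the ideal
  generated by its predecessors.\<close>

definition noetherian :: "('x \<Rightarrow> 'k::comm_ring_1) set \<Rightarrow> bool" where
  "noetherian S \<longleftrightarrow> (\<forall>f. (\<forall>i. f i \<in> S) \<longrightarrow> (\<exists>N. f N \<in> combinations S f N))"

text \<open>Hilbert's basis theorem: in a strictly increasing chain of ideals choose elements of least
  degree in the new variable, and apply the hypothesis to their leading coefficients.\<close>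

lemma noetherian_insert:
  assumes noeth: "noetherian (polyfun I :: ((nat \<Rightarrow> 'k::field) \<Rightarrow> 'k) set)"
  shows "noetherian (polyfun (insert j I) :: ((nat \<Rightarrow> 'k) \<Rightarrow> 'k) set)"
  unfolding noetherian_def
proof (intro allI impI, rule ccontr)
  let ?S = "polyfun (insert j I) :: ((nat \<Rightarrow> 'k) \<Rightarrow> 'k) set"
  have S: "fun_algebra ?S" by (rule fun_algebra_polyfun)
  fix f :: "nat \<Rightarrow> (nat \<Rightarrow> 'k) \<Rightarrow> 'k"
  assume fS: "\<forall>i. f i \<in> ?S" and no: "\<nexists>N. f N \<in> combinations ?S f N"
  define J where "J = (\<Union>n. combinations ?S f n)"
  have JS: "h \<in> ?S" if "h \<in> J" for h
    using that fS unfolding J_def combinations_def by (auto intro!: polyfun_sum polyfun.mult)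
  \<comment> \<open>A function may have several presentations as a polynomial in \<open>v j\<close>;
    its degree is the least one available.\<close>
  define dg where "dg h d \<longleftrightarrow> (\<exists>F\<in>poly_family (polyfun I). (\<forall>v. degree (F v) \<le> d) \<and> (\<forall>v. poly (F v) (v j) = h v))"
    for h :: "(nat \<Rightarrow> 'k) \<Rightarrow> 'k" and d
  define deg where "deg h = (LEAST d. dg h d)" for h
  have dg: "dg h (deg h)" if h: "h \<in> ?S" for h
  proof -
    obtain F where F: "F \<in> poly_family (polyfun I)" "\<And>v. poly (F v) (v j) = h v"
      by (rule polyfun_insert_decomp[OF h]) blast
    obtain n where "\<forall>v. degree (F v) \<le> n" using poly_family_degree[OF F(1)] by blast
    then have "dg h n" unfolding dg_def using F by blast
    then show ?thesis unfolding deg_def by (rule LeastI)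
  qed
  define Q where "Q h n r \<longleftrightarrow> r \<in> J \<and> r \<notin> combinations ?S h n \<and>
      (\<forall>x\<in>J. x \<notin> combinations ?S h n \<longrightarrow> deg r \<le> deg x)" for h n r
  have step: "\<exists>r. Q h n r" if h: "\<forall>m<n. Q h m (h m)" for h n
  proof -
    have "\<not> J \<subseteq> combinations ?S h n"
    proof
      assume sub: "J \<subseteq> combinations ?S h n"
      have "\<exists>M. \<forall>m<n. h m \<in> combinations ?S f M"
        using h
      proof (induction n)
        case (Suc n)
        then obtain M where M: "\<forall>m<n. h m \<in> combinations ?S f M" by auto
        have "h n \<in> J" using Suc.prems by (simp add: Q_def)
        then obtain M' where "h n \<in> combinations ?S f M'" by (auto simp: J_def)
        then have "h m \<in> combinations ?S f (max M M')" if "m < Suc n" for m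
          using M that combinations_mono[OF S, of M "max M M'" f] combinations_mono[OF S, of M' "max M M'" f]
          by (cases "m = n") auto
        then show ?case by blast
      qed simp
      then obtain M where M: "\<forall>m<n. h m \<in> combinations ?S f M" by blast
      have "combinations ?S h n \<subseteq> combinations ?S f M"
      proof
        fix x assume "x \<in> combinations ?S h n"
        then obtain g where "\<And>i. g i \<in> ?S" "x = (\<lambda>v. \<Sum>i<n. g i v * h i v)" unfolding combinations_def by blast
        then show "x \<in> combinations ?S f M"
          using M by (auto intro!: combinations_sum[OF S] combinations_mult[OF S])
      qed
      moreover have "f M \<in> J" using combinations_base[OF S, of M "Suc M" f] by (auto simp: J_def)
      ultimately show False using sub no by blast
    qed
    then have ne: "\<exists>x. x \<in> J \<and> x \<notin> combinations ?S h n" by blast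
    obtain r where "r \<in> J \<and> r \<notin> combinations ?S h n"
      "\<And>x. x \<in> J \<and> x \<notin> combinations ?S h n \<Longrightarrow> deg r \<le> deg x"
      using ex_has_least_nat[of "\<lambda>x. x \<in> J \<and> x \<notin> combinations ?S h n" _ deg] ne by metis
    then show ?thesis unfolding Q_def by blast
  qed
  have cong: "Q h n r = Q h' n r" if "\<And>m. m < n \<Longrightarrow> h m = h' m" for h h' n r
    unfolding Q_def using combinations_cong[of n h h' ?S] that by simp
  obtain h where h: "\<And>n. Q h n (h n)"
    using dependent_wellorder_choice[of Q] cong step by metis
  have hJ: "h n \<in> J" for n using h by (simp add: Q_def)
  have hS: "h n \<in> ?S" for n using JS[OF hJ] .
  have "\<exists>F. F \<in> poly_family (polyfun I) \<and> (\<forall>v. degree (F v) \<le> deg (h n)) \<and> (\<forall>v. poly (F v) (v j) = h n v)" for n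
    using dg[OF hS[of n]] unfolding dg_def by blast
  then obtain F where F: "\<And>n. F n \<in> poly_family (polyfun I)" "\<And>n v. degree (F n v) \<le> deg (h n)"
    "\<And>n v. poly (F n v) (v j) = h n v" by metis
  define s where "s n v = coeff (F n v) (deg (h n))" for n v
  have "s n \<in> polyfun I" for n unfolding s_def by (rule poly_family_coeff[OF F(1)])
  then obtain N where "s N \<in> combinations (polyfun I) s N" using noeth unfolding noetherian_def by blast
  then obtain g where g: "\<And>i. g i \<in> polyfun I" "\<And>v. s N v = (\<Sum>i<N. g i v * s i v)"
    unfolding combinations_def by (auto dest: fun_cong)
  have mono: "deg (h i) \<le> deg (h N)" if "i < N" for i
  proof -
    have "h N \<notin> combinations ?S h i"
      using h[of N] combinations_mono[OF S, of i N h] that by (auto simp: Q_def)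
    then show ?thesis using h[of i] hJ[of N] by (simp add: Q_def)
  qed
  define d where "d = deg (h N)"
  \<comment> \<open>A relation among leading coefficients lifts to a combination of smaller degree:
    multiplication by powers of \<open>v j\<close> aligns the leading terms, which is possible
    because the degrees do not decrease along the sequence.\<close>
  define F' where "F' v = F N v - (\<Sum>i<N. smult (g i v) (monom 1 (d - deg (h i)) * F i v))" for v
  define h' where "h' v = h N v - (\<Sum>i<N. g i v * v j ^ (d - deg (h i)) * h i v)" for v
  have h'_eq: "poly (F' v) (v j) = h' v" for v
    by (simp add: F'_def h'_def F(3) poly_sum poly_monom mult.assoc)
  have gS: "(\<lambda>v. g i v * v j ^ m) \<in> ?S" for i m
    by (intro polyfun.mult polyfun_power polyfun.coord polyfun_mono[OF _ g(1)]) auto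
  have comb: "(\<lambda>v. \<Sum>i<N. g i v * v j ^ (d - deg (h i)) * h i v) \<in> combinations ?S h N"
    unfolding combinations_def by (auto intro!: exI[of _ "\<lambda>i v. g i v * v j ^ (d - deg (h i))"] gS)
  have h'_notin: "h' \<notin> combinations ?S h N"
  proof
    assume "h' \<in> combinations ?S h N"
    from combinations_add[OF S this comb] have "h N \<in> combinations ?S h N" by (simp add: h'_def)
    then show False using h[of N] by (simp add: Q_def)
  qed
  have h'J: "h' \<in> J"
  proof -
    have "\<exists>M. \<forall>i\<le>N. h i \<in> combinations ?S f M"
    proof -
      have "\<forall>i. \<exists>M. h i \<in> combinations ?S f M" using hJ by (auto simp: J_def)
      then obtain M where M: "\<And>i. h i \<in> combinations ?S f (M i)" by metis
      have "h i \<in> combinations ?S f (Max (M ` {..N}))" if "i \<le> N" for i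
        using M[of i] combinations_mono[OF S, of "M i" "Max (M ` {..N})" f] that by auto
      then show ?thesis by blast
    qed
    then obtain M where M: "\<And>i. i \<le> N \<Longrightarrow> h i \<in> combinations ?S f M" by blast
    have "(\<lambda>v. \<Sum>i<N. (g i v * v j ^ (d - deg (h i))) * h i v) \<in> combinations ?S f M"
      by (intro combinations_sum[OF S] combinations_mult[OF S M gS]) auto
    then have "(\<lambda>v. h N v + (- 1) * (\<Sum>i<N. (g i v * v j ^ (d - deg (h i))) * h i v)) \<in> combinations ?S f M"
      by (intro combinations_add[OF S] combinations_mult[OF S] M polyfun.const) auto
    then have "h' \<in> combinations ?S f M" by (simp add: h'_def[abs_def])
    then show ?thesis by (auto simp: J_def)
  qed
  have Fi: "degree (monom 1 (d - deg (h i)) * F i v) \<le> d" if "i < N" for i v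
  proof -
    have "degree (monom (1::'k) (d - deg (h i)) * F i v) \<le> (d - deg (h i)) + deg (h i)"
      by (rule order_trans[OF degree_mult_le]) (intro add_mono degree_monom_le F(2))
    then show ?thesis using mono[OF that] by (simp add: d_def)
  qed
  have F'_deg: "degree (F' v) \<le> d" for v
    unfolding F'_def using F(2)[of N v] Fi
    by (intro degree_diff_le degree_sum_le order_trans[OF degree_smult_le]) (auto simp: d_def)
  have F'_top: "coeff (F' v) d = 0" for v
  proof -
    have "coeff (monom 1 (d - deg (h i)) * F i v) d = s i v" if "i < N" for i
      using mono[OF that] by (simp add: coeff_monom_mult s_def d_def)
    then have "coeff (F' v) d = s N v - (\<Sum>i<N. g i v * s i v)"
      by (simp add: F'_def coeff_sum s_def d_def)
    then show ?thesis using g(2)[of v] by simp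
  qed
  have F'_family: "F' \<in> poly_family (polyfun I)"
  proof -
    have "(\<lambda>v. coeff (monom 1 m * F i v) l) \<in> polyfun I" for i m l
      by (cases "l < m") (simp_all add: coeff_monom_mult polyfun.const poly_family_coeff[OF F(1)])
    then have "(\<lambda>v. coeff (F' v) i) \<in> polyfun I" for i
      unfolding F'_def coeff_diff coeff_sum coeff_smult
      by (intro polyfun_diff polyfun_sum polyfun.mult g(1) poly_family_coeff[OF F(1)])
    then show ?thesis unfolding poly_family_def using F'_deg by blast
  qed
  show False
  proof (cases "d = 0")
    case True
    then have "F' v = 0" for v using F'_deg[of v] F'_top[of v] by (metis degree_0_id le_zero_eq pCons_0_0)
    then have "h' = (\<lambda>_. 0)" using h'_eq by (metis ext poly_0)
    then show False using h'_notin combinations_zero[OF S] by simp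
  next
    case False
    have "degree (F' v) \<le> d - 1" for v
    proof (rule degree_le, intro allI impI)
      fix i assume "i > d - 1"
      then show "coeff (F' v) i = 0"
        using F'_top[of v] F'_deg[of v] False by (cases "i = d") (auto simp: coeff_eq_0)
    qed
    then have "dg h' (d - 1)" unfolding dg_def using F'_family h'_eq by blast
    then have "deg h' \<le> d - 1" unfolding deg_def by (rule Least_le)
    moreover have "d \<le> deg h'" using h[of N] h'J h'_notin by (simp add: Q_def d_def)
    ultimately show False using False by simp
  qed
qed

lemma noetherian_polyfun:
  assumes "finite I" shows "noetherian (polyfun I :: ((nat \<Rightarrow> 'k::field) \<Rightarrow> 'k) set)"
  using assms
proof induction
  case empty
  show ?case
    unfolding noetherian_def
  proof (intro allI impI)
    fix f :: "nat \<Rightarrow> (nat \<Rightarrow> 'k) \<Rightarrow> 'k" assume f: "\<forall>i. f i \<in> polyfun {}"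
    have eq: "f i v = f i (\<lambda>_. 0)" for i v by (rule polyfun_cong[of _ "{}"]) (use f in auto)
    show "\<exists>N. f N \<in> combinations (polyfun {}) f N"
    proof (cases "f 0 (\<lambda>_. 0) = 0")
      case True
      then have "f 0 = (\<lambda>_. 0)" using eq[of 0] by auto
      then show ?thesis by (intro exI[of _ 0]) (simp add: combinations_zero[OF fun_algebra_polyfun])
    next
      case False
      have "f 1 v = (\<Sum>i<1. (f 1 (\<lambda>_. 0) / f 0 (\<lambda>_. 0)) * f i v)" for v
        using False eq[of 1 v] eq[of 0 v] by (simp add: One_nat_def)
      then have "f 1 = (\<lambda>v. \<Sum>i<1. (f 1 (\<lambda>_. 0) / f 0 (\<lambda>_. 0)) * f i v)" by (rule ext)
      then show ?thesis unfolding combinations_def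
        by (intro exI[of _ 1] CollectI exI[of _ "\<lambda>_ _. f 1 (\<lambda>_. 0) / f 0 (\<lambda>_. 0)"]) (auto intro: polyfun.const)
    qed
  qed
next
  case (insert j I)
  then show ?case by (intro noetherian_insert)
qed

text \<open>From a descending chain choose \<open>q i\<close> zero on the next set and nonzero at a
  point \<open>v i\<close> of the current one. A relation expressing \<open>q N\<close> by its
  predecessors would make it vanish at \<open>v N\<close>, since they all vanish there.\<close>

lemma wf_closedin_zariski:
  assumes "finite I"
  shows "wf {(A, B). closedin (zariski I) A \<and> closedin (zariski I) B \<and> A \<subset> (B :: (nat \<Rightarrow> 'k::field) set)}"
  unfolding wf_iff_no_infinite_down_chain
proof
  assume "\<exists>Z :: nat \<Rightarrow> (nat \<Rightarrow> 'k) set. \<forall>i. (Z (Suc i), Z i) \<in> {(A, B). closedin (zariski I) A \<and> closedin (zariski I) B \<and> A \<subset> B}"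
  then obtain Z :: "nat \<Rightarrow> (nat \<Rightarrow> 'k) set" where
    *: "\<forall>i. (Z (Suc i), Z i) \<in> {(A, B). closedin (zariski I) A \<and> closedin (zariski I) B \<and> A \<subset> B}" ..
  have Z: "closedin (zariski I) (Z i)" "Z (Suc i) \<subset> Z i" for i using spec[OF *, of i] by simp_all
  have "\<exists>q v. q \<in> polyfun I \<and> v \<in> Z i \<and> q v \<noteq> 0 \<and> (\<forall>w\<in>Z (Suc i). q w = 0)" for i
  proof -
    obtain v where v: "v \<in> Z i" "v \<notin> Z (Suc i)" using Z(2)[of i] by blast
    then have "v \<in> affine_points I" using closedin_zariski_subset[OF Z(1)[of i]] by blast
    then obtain q where "q \<in> polyfun I" "q v \<noteq> 0" "\<And>w. w \<in> Z (Suc i) \<Longrightarrow> q w = 0"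
      using closedin_zariski_separate[OF Z(1)[of "Suc i"] _ v(2)] by blast
    then show ?thesis using v(1) by blast
  qed
  then obtain q v where q: "\<And>i. q i \<in> polyfun I" "\<And>i. v i \<in> Z i" "\<And>i. q i (v i) \<noteq> 0"
    "\<And>i w. w \<in> Z (Suc i) \<Longrightarrow> q i w = 0" by metis
  obtain N where "q N \<in> combinations (polyfun I) q N"
    using noetherian_polyfun[OF assms] q(1) unfolding noetherian_def by blast
  then obtain g where g: "q N = (\<lambda>v. \<Sum>i<N. g i v * q i v)" unfolding combinations_def by blast
  have anti: "Z j \<subseteq> Z i" if "i \<le> j" for i j
    using that by (induction rule: dec_induct) (use Z(2) in blast)+
  have "q i (v N) = 0" if "i < N" for i
    using q(4)[of "v N" i] q(2)[of N] anti[of "Suc i" N] that by auto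
  then have "q N (v N) = 0" by (subst g) (auto intro: sum.neutral)
  then show False using q(3) by blast
qed

section \<open>Dense strata with a section\<close>

lemma continuous_map_jet_subst:
  fixes \<phi> :: "'k::field fps"
  shows "continuous_map (zariski {1..k}) (zariski {1..k}) (jet_subst k \<phi>)"
proof (rule continuous_map_zariskiI)
  fix q :: "(nat \<Rightarrow> 'k) \<Rightarrow> 'k" assume q: "q \<in> polyfun {1..k}"
  obtain r where r: "r \<in> polyfun {1..k}" "\<And>v. v \<in> affine_points {1..k} \<Longrightarrow> r v = q (jet_subst k \<phi> v)"
    by (rule polyfun_jet_subst[OF q, of \<phi>]) blast
  have "{v \<in> topspace (zariski {1..k}). q (jet_subst k \<phi> v) \<noteq> 0} = {v \<in> affine_points {1..k}. r v \<noteq> 0}"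
    using r(2) by auto
  then show "openin (zariski {1..k}) {v \<in> topspace (zariski {1..k}). q (jet_subst k \<phi> v) \<noteq> 0}"
    using openin_zariski_nonzero[OF r(1)] by simp
qed simp

lemma jet_invariant_closure:
  assumes A: "jet_invariant k A" shows "jet_invariant k (zariski {1..k} closure_of A)"
  unfolding jet_invariant_def
proof (intro conjI ballI allI impI)
  show "zariski {1..k} closure_of A \<subseteq> affine_points {1..k}"
    using closure_of_subset_topspace[of "zariski {1..k}" A] by simp
  fix v \<phi> assume v: "v \<in> zariski {1..k} closure_of A" and \<phi>: "coord_change (\<phi> :: 'a fps)"
  have "jet_subst k \<phi> ` (zariski {1..k} closure_of A) \<subseteq> zariski {1..k} closure_of (jet_subst k \<phi> ` A)"
    by (rule continuous_map_image_closure_subset[OF continuous_map_jet_subst])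
  also have "\<dots> \<subseteq> zariski {1..k} closure_of A"
    using jet_invariantD(1)[OF A _ \<phi>] by (intro closure_of_mono) auto
  finally show "jet_subst k \<phi> v \<in> zariski {1..k} closure_of A" using v by blast
qed

text \<open>The locus is cut out by a single function, so that the image of the section is an affine
  variety.\<close>

definition sectioned :: "nat \<Rightarrow> (nat \<Rightarrow> 'k::field) set \<Rightarrow> (nat \<Rightarrow> 'k) set \<Rightarrow> bool" where
  "sectioned k R A \<longleftrightarrow> jet_invariant k A \<and>
     (\<exists>c\<in>polyfun {1..k}. \<exists>\<pi>. A = {v \<in> R. c v \<noteq> 0} \<and> jet_section k R c \<pi>)"

lemma sectioned_empty: "sectioned k R {}"
  unfolding sectioned_def
proof
  have "jet_section k R (\<lambda>_. 0) (\<lambda>v. v)"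
    by (auto simp: jet_section_def intro!: regular_offI[where q = "\<lambda>_. 0"] polyfun.const)
  then show "\<exists>c\<in>polyfun {1..k}. \<exists>\<pi>. {} = {v \<in> R. c v \<noteq> 0} \<and> jet_section k R c \<pi>"
    by (intro bexI[of _ "\<lambda>_. 0"] exI[of _ "\<lambda>v. v"]) (auto intro: polyfun.const)
qed (simp add: jet_invariant_def)

text \<open>On \<open>R\<close> at each point one of the two functions vanishes, so their sum cuts
  out the disjoint union.\<close>

lemma sectioned_Un:
  assumes A: "sectioned k R A" and B: "sectioned k R B" and disj: "A \<inter> B = {}"
  shows "sectioned k R (A \<union> B)"
proof -
  from A obtain c \<pi> where c: "c \<in> polyfun {1..k}" "A = {v \<in> R. c v \<noteq> 0}" "jet_section k R c \<pi>" and Ai: "jet_invariant k A"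
    unfolding sectioned_def by blast
  from B obtain d \<rho> where d: "d \<in> polyfun {1..k}" "B = {v \<in> R. d v \<noteq> 0}" "jet_section k R d \<rho>" and Bi: "jet_invariant k B"
    unfolding sectioned_def by blast
  have cd0: "c v = 0 \<or> d v = 0" if "v \<in> R" for v using disj c(2) d(2) that by blast
  define \<sigma> where "\<sigma> v = (if c v \<noteq> 0 then \<pi> v else \<rho> v)" for v
  have "c v + d v \<noteq> 0 \<longleftrightarrow> c v \<noteq> 0 \<or> d v \<noteq> 0" if "v \<in> R" for v using cd0[OF that] by auto
  then have eq: "A \<union> B = {v \<in> R. c v + d v \<noteq> 0}" unfolding c(2) d(2) by blast
  have "jet_section k R (\<lambda>v. c v + d v) \<sigma>"
    unfolding jet_section_def
  proof (intro conjI allI ballI impI)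
    fix v assume v: "v \<in> R" "c v + d v \<noteq> 0"
    show "\<sigma> v \<in> jet_orbit k v"
      using c(3) d(3) v cd0[OF v(1)] by (auto simp: \<sigma>_def jet_section_def)
    fix \<phi> :: "'a fps" assume \<phi>: "coord_change \<phi>"
    show "\<sigma> (jet_subst k \<phi> v) = \<sigma> v"
    proof (cases "c v \<noteq> 0")
      case True
      then have "jet_subst k \<phi> v \<in> A" using jet_invariantD(1)[OF Ai _ \<phi>] v c(2) by blast
      then have "c (jet_subst k \<phi> v) \<noteq> 0" by (simp add: c(2))
      then show ?thesis using c(3) v True \<phi> by (simp add: \<sigma>_def jet_section_def)
    next
      case False
      then have "d v \<noteq> 0" using v by auto
      then have "jet_subst k \<phi> v \<in> B" using jet_invariantD(1)[OF Bi _ \<phi>] v d(2) by blast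
      then have "c (jet_subst k \<phi> v) = 0" using cd0[of "jet_subst k \<phi> v"] by (auto simp: d(2))
      then show ?thesis using d(3) v False \<open>d v \<noteq> 0\<close> \<phi> by (simp add: \<sigma>_def jet_section_def)
    qed
  next
    fix i
    have "(\<lambda>v. \<pi> v i) \<in> regular_off k R c" using c(3) by (simp add: jet_section_def)
    then obtain q N where q: "q \<in> polyfun {1..k}" "\<And>v. v \<in> R \<Longrightarrow> c v \<noteq> 0 \<Longrightarrow> \<pi> v i * c v ^ N = q v"
      by (rule regular_offE) blast
    have "(\<lambda>v. \<rho> v i) \<in> regular_off k R d" using d(3) by (simp add: jet_section_def)
    then obtain r M where r: "r \<in> polyfun {1..k}" "\<And>v. v \<in> R \<Longrightarrow> d v \<noteq> 0 \<Longrightarrow> \<rho> v i * d v ^ M = r v"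
      by (rule regular_offE) blast
    \<comment> \<open>The successor in each exponent supplies a factor that vanishes on the other
      part, so a single numerator serves both.\<close>
    show "(\<lambda>v. \<sigma> v i) \<in> regular_off k R (\<lambda>v. c v + d v)"
    proof (rule regular_offI[where N = "Suc (N + M)" and q = "\<lambda>v. q v * c v ^ Suc M + r v * d v ^ Suc N"])
      show "(\<lambda>v. q v * c v ^ Suc M + r v * d v ^ Suc N) \<in> polyfun {1..k}"
        by (intro polyfun.add polyfun.mult polyfun_power q r c d)
      fix v assume v: "v \<in> R" "c v + d v \<noteq> 0"
      show "\<sigma> v i * (c v + d v) ^ Suc (N + M) = q v * c v ^ Suc M + r v * d v ^ Suc N"
      proof (cases "c v \<noteq> 0")
        case True
        then have "d v = 0" using cd0[OF v(1)] by simp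
        then show ?thesis using q(2)[OF v(1) True, symmetric] True by (simp add: \<sigma>_def power_add mult_ac)
      next
        case False
        then have "d v \<noteq> 0" using v by auto
        then show ?thesis using r(2)[OF v(1), symmetric] False by (simp add: \<sigma>_def power_add mult_ac)
      qed
    qed
  qed
  then show ?thesis
    unfolding sectioned_def eq[symmetric] using jet_invariant_Un[OF Ai Bi] eq c(1) d(1)
    by (intro conjI bexI[of _ "\<lambda>v. c v + d v"] exI[of _ \<sigma>]) (auto intro: polyfun.add)
qed

lemma sectioned_openin:
  assumes "sectioned k R A" "R \<subseteq> affine_points {1..k}"
  shows "openin (subtopology (zariski {1..k}) R) A"
proof -
  from assms obtain c where c: "c \<in> polyfun {1..k}" "A = {v \<in> R. c v \<noteq> 0}" unfolding sectioned_def by blast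
  then have "A = {v \<in> affine_points {1..k}. c v \<noteq> 0} \<inter> R" using assms(2) by auto
  then show ?thesis using openin_zariski_nonzero[OF c(1)] openin_subtopology by blast
qed

text \<open>\<open>R\<close> may be reducible, so one locus with a section need not be dense. A
  locus with minimal complement is dense: otherwise a further one, disjoint from its closure, could
  be adjoined.\<close>

lemma dense_sectioned_exists:
  fixes R :: "(nat \<Rightarrow> 'k::alg_closed_field) set"
  assumes p: "CHAR('k) = p" "prime p"
    and R: "jet_invariant k R" "closedin (zariski {1..k}) R"
  obtains A where "sectioned k R A" "subtopology (zariski {1..k}) R closure_of A = R"
proof -
  let ?W = "{(A, B). closedin (zariski {1..k}) A \<and> closedin (zariski {1..k}) B \<and> A \<subset> (B :: (nat \<Rightarrow> 'k) set)}"
  have wf: "wf ?W" by (rule wf_closedin_zariski) simp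
  have Rp: "R \<subseteq> affine_points {1..k}" by (rule closedin_zariski_subset[OF R(2)])
  have closed: "closedin (zariski {1..k}) (R - A)" if "sectioned k R A" for A
    using closedin_diff[OF closedin_topspace sectioned_openin[OF that Rp]] R(2) Rp
    by (auto simp: closedin_closed_subtopology inf_absorb2)
  define C where "C = (\<lambda>A. R - A) ` Collect (sectioned k R)"
  have "R - {} \<in> C" unfolding C_def using sectioned_empty[of k R] by (intro imageI) simp
  then obtain Z where Z: "Z \<in> C" "\<And>y. (y, Z) \<in> ?W \<Longrightarrow> y \<notin> C"
    using wfE_min[OF wf, of "R - {}" C] by (metis (no_types, lifting))
  from Z(1) obtain A where A: "sectioned k R A" "Z = R - A" unfolding C_def by blast
  define F where "F = zariski {1..k} closure_of A"
  have Ai: "jet_invariant k A" and AR: "A \<subseteq> R" using A(1) unfolding sectioned_def by auto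
  have AF: "A \<subseteq> F" unfolding F_def using AR Rp by (intro closure_of_subset) auto
  have FR: "F \<subseteq> R" unfolding F_def by (rule closure_of_minimal[OF AR R(2)])
  have "F = R"
  proof (rule ccontr)
    assume "F \<noteq> R"
    then have F: "jet_invariant k F" "closedin (zariski {1..k}) F" "F \<subset> R"
      using FR jet_invariant_closure[OF Ai] by (auto simp: F_def)
    obtain c w \<pi> where c: "c \<in> polyfun {1..k}" "semi_invariant k R c w" "\<exists>v\<in>R. c v \<noteq> 0"
      "\<And>v. v \<in> F \<Longrightarrow> c v = 0" "jet_section k R c \<pi>"
      using generic_section[OF p R(1) F] by blast
    define B where "B = {v \<in> R. c v \<noteq> 0}"
    have B: "sectioned k R B"
      unfolding sectioned_def B_def using semi_invariant_nonzero_invariant[OF R(1) c(2)] c(1,5) by blast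
    have "A \<inter> B = {}" using AF c(4) by (auto simp: B_def)
    then have AB: "sectioned k R (A \<union> B)" by (rule sectioned_Un[OF A(1) B])
    moreover have "R - (A \<union> B) \<subset> R - A" using c(3) \<open>A \<inter> B = {}\<close> by (auto simp: B_def)
    ultimately have "(R - (A \<union> B), Z) \<in> ?W" using closed[OF AB] closed[OF A(1)] A(2) by blast
    then show False using Z(2)[of "R - (A \<union> B)"] AB by (simp add: C_def)
  qed
  then have "subtopology (zariski {1..k}) R closure_of A = R"
    using AR by (simp add: closure_of_subtopology inf_absorb2 F_def)
  then show ?thesis using that A(1) by blast
qed

section \<open>The section as a geometric quotient\<close>

lemma affine_points_neq:
  assumes "v \<in> affine_points I" "w \<in> affine_points I" "v i \<noteq> w i" shows "i \<in> I"
  by (rule ccontr) (use assms in \<open>simp add: affine_points_def\<close>)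

text \<open>Shrinking the neighbourhood to the locus where some polynomial s is nonzero and
  expanding the fraction by s, the denominator itself describes where the fraction is valid.\<close>

lemma regular_induced_affine_iff:
  fixes B :: "(nat \<Rightarrow> 'k::field) set"
  assumes U: "openin (subtopology (zariski I) B) U"
  shows "\<phi> \<in> regular (induced_space (affine_space I) B) U \<longleftrightarrow>
     (\<forall>a\<in>U. \<exists>q\<in>polyfun I. \<exists>r\<in>polyfun I. r a \<noteq> 0 \<and> (\<forall>w\<in>U. r w \<noteq> 0 \<longrightarrow> \<phi> w = q w / r w))"
proof
  obtain W0 where W0: "openin (zariski I) W0" "U = W0 \<inter> B" using U by (auto simp: openin_subtopology)
  have Up: "U \<subseteq> affine_points I" using openin_subset[OF W0(1)] W0(2) by auto
  {
    assume L: "\<phi> \<in> regular (induced_space (affine_space I) B) U"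
    show "\<forall>a\<in>U. \<exists>q\<in>polyfun I. \<exists>r\<in>polyfun I. r a \<noteq> 0 \<and> (\<forall>w\<in>U. r w \<noteq> 0 \<longrightarrow> \<phi> w = q w / r w)"
    proof
      fix a assume a: "a \<in> U"
      obtain W \<psi> where W: "openin (zariski I) W" "a \<in> W" "W \<inter> B \<subseteq> U"
        and \<psi>: "\<psi> \<in> regular (affine_space I) W" "\<forall>w\<in>W \<inter> B. \<phi> w = \<psi> w"
        using L a by (auto simp: induced_space_def affine_space_def)
      obtain W2 q r where W2: "openin (zariski I) W2" "a \<in> W2" "W2 \<subseteq> W"
        and qr: "q \<in> polyfun I" "r \<in> polyfun I" "\<forall>w\<in>W2. r w \<noteq> 0 \<and> \<psi> w = q w / r w"
        using \<psi>(1) W(2) by (auto simp: affine_space_def)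
      obtain s where s: "s \<in> polyfun I" "s a \<noteq> 0" "{w \<in> affine_points I. s w \<noteq> 0} \<subseteq> W2"
        using W2(1,2) by (rule openin_zariskiE)
      have "\<phi> w = (q w * s w) / (r w * s w)" if w: "w \<in> U" "r w * s w \<noteq> 0" for w
      proof -
        have "w \<in> W2" using w s(3) Up by auto
        moreover have "w \<in> B" using w W0 by blast
        ultimately show ?thesis using \<psi>(2) qr(3) W2(3) w by auto
      qed
      moreover have "r a * s a \<noteq> 0" using qr(3) W2(2) s(2) by simp
      ultimately show "\<exists>q\<in>polyfun I. \<exists>r\<in>polyfun I. r a \<noteq> 0 \<and> (\<forall>w\<in>U. r w \<noteq> 0 \<longrightarrow> \<phi> w = q w / r w)"
        by (intro bexI[OF _ polyfun.mult[OF qr(1) s(1)]] bexI[OF _ polyfun.mult[OF qr(2) s(1)]]) auto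
    qed
  next
    assume R: "\<forall>a\<in>U. \<exists>q\<in>polyfun I. \<exists>r\<in>polyfun I. r a \<noteq> 0 \<and> (\<forall>w\<in>U. r w \<noteq> 0 \<longrightarrow> \<phi> w = q w / r w)"
    have "\<exists>W. openin (zariski I) W \<and> a \<in> W \<and> W \<inter> B \<subseteq> U \<and>
        (\<exists>\<psi>\<in>regular (affine_space I) W. \<forall>w\<in>W \<inter> B. \<phi> w = \<psi> w)" if a: "a \<in> U" for a
    proof -
      obtain q r where qr: "q \<in> polyfun I" "r \<in> polyfun I" "r a \<noteq> 0" "\<forall>w\<in>U. r w \<noteq> 0 \<longrightarrow> \<phi> w = q w / r w"
        using bspec[OF R a] by blast
      define W where "W = W0 \<inter> {v \<in> affine_points I. r v \<noteq> 0}"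
      have W: "openin (zariski I) W" unfolding W_def by (intro openin_Int W0 openin_zariski_nonzero qr)
      have reg: "(\<lambda>w. q w / r w) \<in> regular (affine_space I) W"
        unfolding affine_space_def using W qr(1,2) by (auto simp: W_def)
      have aW: "a \<in> W" using a Up qr(3) W0 by (auto simp: W_def)
      have sub: "W \<inter> B \<subseteq> U" by (auto simp: W_def W0)
      have eq: "\<forall>w\<in>W \<inter> B. \<phi> w = q w / r w" using qr(4) by (auto simp: W_def W0)
      show ?thesis by (intro exI[of _ W] conjI W aW sub bexI[OF _ reg] eq)
    qed
    then show "\<phi> \<in> regular (induced_space (affine_space I) B) U"
      by (simp add: induced_space_def affine_space_def)
  }
qed

text \<open>The points \<open>v\<close> are renamed to \<open>{v}\<close>, as the quotients in the definition of the modality have sets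
  of jets as points.\<close>

definition singleton_space :: "nat \<Rightarrow> (nat \<Rightarrow> 'k::field) set \<Rightarrow> ((nat \<Rightarrow> 'k) set, 'k) fun_space" where
  "singleton_space k B =
     \<lparr>topol = pullback_topology ((\<lambda>v. {v}) ` B) the_elem (zariski {1..k}),
      regular = (\<lambda>V. {\<phi>. \<forall>v. {v} \<in> V \<longrightarrow> (\<exists>q\<in>polyfun {1..k}. \<exists>r\<in>polyfun {1..k}. r v \<noteq> 0 \<and>
                      (\<forall>w. {w} \<in> V \<and> r w \<noteq> 0 \<longrightarrow> \<phi> {w} = q w / r w))})\<rparr>"

lemma openin_singleton_space:
  "openin (topol (singleton_space k B)) V \<longleftrightarrow>
     (\<exists>W. openin (zariski {1..k}) W \<and> V = (\<lambda>v. {v}) ` (W \<inter> B))"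
proof -
  have "the_elem -` W \<inter> (\<lambda>v. {v}) ` B = (\<lambda>v. {v}) ` (W \<inter> B)" for W :: "(nat \<Rightarrow> 'a) set" by auto
  then show ?thesis by (simp add: singleton_space_def openin_pullback_topology)
qed

lemma openin_singleton_spaceE:
  assumes "openin (topol (singleton_space k B)) V" "{v} \<in> V"
  obtains s where "s \<in> polyfun {1..k}" "s v \<noteq> 0" "v \<in> B"
    "\<And>w. w \<in> B \<Longrightarrow> w \<in> affine_points {1..k} \<Longrightarrow> s w \<noteq> 0 \<Longrightarrow> {w} \<in> V"
proof -
  obtain W where W: "openin (zariski {1..k}) W" "V = (\<lambda>v. {v}) ` (W \<inter> B)"
    using assms(1) unfolding openin_singleton_space by blast
  then have "v \<in> W" "v \<in> B" using assms(2) by auto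
  obtain s where "s \<in> polyfun {1..k}" "s v \<noteq> 0" "{w \<in> affine_points {1..k}. s w \<noteq> 0} \<subseteq> W"
    using W(1) \<open>v \<in> W\<close> by (rule openin_zariskiE)
  then show ?thesis using that[of s] \<open>v \<in> B\<close> W(2) by auto
qed

lemma points_singleton_space:
  "B \<subseteq> affine_points {1..k} \<Longrightarrow> points (singleton_space k B) = (\<lambda>v. {v}) ` B"
  by (auto simp: singleton_space_def topspace_pullback_topology)

lemma regular_singleton_spaceI:
  assumes "\<And>v. {v} \<in> V \<Longrightarrow> \<exists>q\<in>polyfun {1..k}. \<exists>r\<in>polyfun {1..k}. r v \<noteq> 0 \<and>
             (\<forall>w. {w} \<in> V \<and> r w \<noteq> 0 \<longrightarrow> \<phi> {w} = q w / r w)"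
  shows "\<phi> \<in> regular (singleton_space k B) V"
  using assms by (simp add: singleton_space_def)

lemma regular_singleton_spaceE:
  assumes "\<phi> \<in> regular (singleton_space k B) V" "{v} \<in> V"
  obtains q r where "q \<in> polyfun {1..k}" "r \<in> polyfun {1..k}" "r v \<noteq> 0"
    "\<forall>w. {w} \<in> V \<and> r w \<noteq> 0 \<longrightarrow> \<phi> {w} = q w / r w"
  using assms unfolding singleton_space_def by (auto simp del: split_paired_Ex)

lemma sheaf_singleton_space:
  fixes B :: "(nat \<Rightarrow> 'k::field) set"
  assumes B: "B \<subseteq> affine_points {1..k}"
  shows "sheaf_of_functions (singleton_space k B)"
  unfolding sheaf_of_functions_def
proof (intro allI impI conjI)
  let ?Y = "singleton_space k B"
  fix U assume U: "openin (topol ?Y) U"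
  have UB: "\<exists>v\<in>B. y = {v}" if "y \<in> U" for y
    using openin_subset[OF U] that points_singleton_space[OF B] by auto
  show "\<psi> \<in> regular ?Y U" if asm: "\<phi> \<in> regular ?Y U \<and> (\<forall>x\<in>U. \<psi> x = \<phi> x)" for \<phi> \<psi>
  proof (rule regular_singleton_spaceI)
    fix v assume v: "{v} \<in> U"
    obtain q r where "q \<in> polyfun {1..k}" "r \<in> polyfun {1..k}" "r v \<noteq> 0"
      "\<forall>w. {w} \<in> U \<and> r w \<noteq> 0 \<longrightarrow> \<phi> {w} = q w / r w"
      by (rule regular_singleton_spaceE[OF conjunct1[OF asm] v]) blast
    then show "\<exists>q\<in>polyfun {1..k}. \<exists>r\<in>polyfun {1..k}. r v \<noteq> 0 \<and> (\<forall>w. {w} \<in> U \<and> r w \<noteq> 0 \<longrightarrow> \<psi> {w} = q w / r w)"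
      using asm by (intro bexI[of _ q] bexI[of _ r]) auto
  qed
  show "\<phi> \<in> regular ?Y U \<longleftrightarrow>
      (\<forall>x\<in>U. \<exists>W. openin (topol ?Y) W \<and> x \<in> W \<and> W \<subseteq> U \<and> \<phi> \<in> regular ?Y W)" for \<phi>
  proof
    assume "\<phi> \<in> regular ?Y U"
    then show "\<forall>x\<in>U. \<exists>W. openin (topol ?Y) W \<and> x \<in> W \<and> W \<subseteq> U \<and> \<phi> \<in> regular ?Y W" using U by blast
  next
    assume L: "\<forall>x\<in>U. \<exists>W. openin (topol ?Y) W \<and> x \<in> W \<and> W \<subseteq> U \<and> \<phi> \<in> regular ?Y W"
    show "\<phi> \<in> regular ?Y U"
    proof (rule regular_singleton_spaceI)
      fix v assume v: "{v} \<in> U"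
      obtain W where W: "openin (topol ?Y) W" "{v} \<in> W" "W \<subseteq> U" "\<phi> \<in> regular ?Y W" using bspec[OF L v] by blast
      obtain q r where qr: "q \<in> polyfun {1..k}" "r \<in> polyfun {1..k}" "r v \<noteq> 0"
        "\<forall>w. {w} \<in> W \<and> r w \<noteq> 0 \<longrightarrow> \<phi> {w} = q w / r w"
        by (rule regular_singleton_spaceE[OF W(4,2)]) blast
      obtain s where s: "s \<in> polyfun {1..k}" "s v \<noteq> 0" "v \<in> B"
        "\<And>w. w \<in> B \<Longrightarrow> w \<in> affine_points {1..k} \<Longrightarrow> s w \<noteq> 0 \<Longrightarrow> {w} \<in> W"
        by (rule openin_singleton_spaceE[OF W(1,2)]) blast
      have "\<phi> {w} = (q w * s w) / (r w * s w)" if w: "{w} \<in> U" "r w * s w \<noteq> 0" for w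
      proof -
        have "w \<in> B" using UB[OF w(1)] by auto
        then have "{w} \<in> W" using s(4)[of w] B w(2) by auto
        then show ?thesis using qr(4) w(2) by auto
      qed
      then show "\<exists>q\<in>polyfun {1..k}. \<exists>r\<in>polyfun {1..k}. r v \<noteq> 0 \<and> (\<forall>w. {w} \<in> U \<and> r w \<noteq> 0 \<longrightarrow> \<phi> {w} = q w / r w)"
        using qr(3) s(2)
        by (intro bexI[OF _ polyfun.mult[OF qr(1) s(1)]] bexI[OF _ polyfun.mult[OF qr(2) s(1)]]) auto
    qed
  qed
  show "(\<lambda>_. c) \<in> regular ?Y U" for c
    by (rule regular_singleton_spaceI, rule bexI[where x = "\<lambda>_. c"], rule bexI[where x = "\<lambda>_. 1"])
       (auto intro: polyfun.const)
  show "\<forall>\<phi>\<in>regular ?Y U. \<forall>\<psi>\<in>regular ?Y U.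
      (\<lambda>x. \<phi> x + \<psi> x) \<in> regular ?Y U \<and> (\<lambda>x. \<phi> x * \<psi> x) \<in> regular ?Y U"
  proof (intro ballI conjI; rule regular_singleton_spaceI)
    fix \<phi> \<psi> v assume \<phi>: "\<phi> \<in> regular ?Y U" and \<psi>: "\<psi> \<in> regular ?Y U" and v: "{v} \<in> U"
    obtain q r where qr: "q \<in> polyfun {1..k}" "r \<in> polyfun {1..k}" "r v \<noteq> 0"
      "\<forall>w. {w} \<in> U \<and> r w \<noteq> 0 \<longrightarrow> \<phi> {w} = q w / r w"
      by (rule regular_singleton_spaceE[OF \<phi> v]) blast
    obtain q' r' where qr': "q' \<in> polyfun {1..k}" "r' \<in> polyfun {1..k}" "r' v \<noteq> 0"
      "\<forall>w. {w} \<in> U \<and> r' w \<noteq> 0 \<longrightarrow> \<psi> {w} = q' w / r' w"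
      by (rule regular_singleton_spaceE[OF \<psi> v]) blast
    note rr = polyfun.mult[OF qr(2) qr'(2)]
    show "\<exists>q\<in>polyfun {1..k}. \<exists>r\<in>polyfun {1..k}. r v \<noteq> 0 \<and>
        (\<forall>w. {w} \<in> U \<and> r w \<noteq> 0 \<longrightarrow> \<phi> {w} + \<psi> {w} = q w / r w)"
      using qr(3,4) qr'(3,4)
      by (intro bexI[OF _ polyfun.add[OF polyfun.mult[OF qr(1) qr'(2)] polyfun.mult[OF qr'(1) qr(2)]]] bexI[OF _ rr])
         (auto simp: add_frac_eq)
    show "\<exists>q\<in>polyfun {1..k}. \<exists>r\<in>polyfun {1..k}. r v \<noteq> 0 \<and>
        (\<forall>w. {w} \<in> U \<and> r w \<noteq> 0 \<longrightarrow> \<phi> {w} * \<psi> {w} = q w / r w)"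
      using qr(3,4) qr'(3,4) by (intro bexI[OF _ polyfun.mult[OF qr(1) qr'(1)]] bexI[OF _ rr]) auto
  qed
qed

text \<open>The complement of the diagonal is the union of the loci where one of the elements x_i
  (x) 1 - 1 (x) x_i does not vanish; \<open>\<phi>\<close> and \<open>\<psi>\<close> in the proof
  spell out this sum of two tensors.\<close>

lemma separated_singleton_space:
  fixes B :: "(nat \<Rightarrow> 'k::field) set"
  assumes B: "B \<subseteq> affine_points {1..k}"
  shows "separated (singleton_space k B)"
proof -
  let ?Y = "singleton_space k B" and ?pts = "(\<lambda>v. {v}) ` B"
  define \<B> where "\<B> = {{(a, b). a \<in> U \<and> b \<in> V \<and> (\<Sum>j<n. \<phi> j a * \<psi> j b) \<noteq> 0} | U V n \<phi> \<psi>.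
        openin (topol ?Y) U \<and> openin (topol ?Y) V \<and>
        (\<forall>j<(n::nat). \<phi> j \<in> regular ?Y U \<and> \<psi> j \<in> regular ?Y V)}"
  have pts: "points ?Y = ?pts" by (rule points_singleton_space[OF B])
  have opn: "openin (topol ?Y) ?pts" using openin_topspace[of "topol ?Y"] by (simp add: pts)
  have creg: "(\<lambda>_. c) \<in> regular ?Y ?pts" for c
    using sheaf_singleton_space[OF B] opn unfolding sheaf_of_functions_def by blast
  have coord: "(\<lambda>y. the_elem y i) \<in> regular ?Y ?pts" if "i \<in> {1..k}" for i
    by (rule regular_singleton_spaceI, rule bexI[where x = "\<lambda>v. v i"], rule bexI[where x = "\<lambda>_. 1"])
       (auto intro: polyfun.const polyfun.coord[OF that])
  have G: "{(a, b). a \<in> ?pts \<and> b \<in> ?pts \<and> the_elem a i - the_elem b i \<noteq> 0} \<in> \<B>" if i: "i \<in> {1..k}" for i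
  proof -
    define \<phi> :: "nat \<Rightarrow> (nat \<Rightarrow> 'k) set \<Rightarrow> 'k" where "\<phi> j = (if j = 0 then (\<lambda>y. the_elem y i) else (\<lambda>_. - 1))" for j
    define \<psi> :: "nat \<Rightarrow> (nat \<Rightarrow> 'k) set \<Rightarrow> 'k" where "\<psi> j = (if j = 0 then (\<lambda>_. 1) else (\<lambda>y. the_elem y i))" for j
    have "(\<Sum>j<2. \<phi> j a * \<psi> j b) = the_elem a i - the_elem b i" for a b
      by (simp add: \<phi>_def \<psi>_def numeral_2_eq_2)
    then have eq: "{(a, b). a \<in> ?pts \<and> b \<in> ?pts \<and> the_elem a i - the_elem b i \<noteq> 0} =
        {(a, b). a \<in> ?pts \<and> b \<in> ?pts \<and> (\<Sum>j<2. \<phi> j a * \<psi> j b) \<noteq> 0}" by simp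
    have "\<forall>j<2. \<phi> j \<in> regular ?Y ?pts \<and> \<psi> j \<in> regular ?Y ?pts"
      using coord[OF i] creg by (simp add: \<phi>_def \<psi>_def)
    then show ?thesis unfolding \<B>_def eq using opn by blast
  qed
  have "?pts \<times> ?pts = {(a, b). a \<in> ?pts \<and> b \<in> ?pts \<and> (\<Sum>j<(1::nat). (\<lambda>_ _. 1) j a * (\<lambda>_ _. 1) j b) \<noteq> (0::'k)}"
    by (auto simp: One_nat_def)
  also have "\<dots> \<in> \<B>"
    unfolding \<B>_def using opn creg
    by (intro CollectI exI[of _ ?pts] exI[of _ 1] exI[of _ "\<lambda>_ _. 1"]) auto
  finally have full: "?pts \<times> ?pts \<in> \<B>" .
  have "\<Union>\<B> \<subseteq> ?pts \<times> ?pts"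
    unfolding \<B>_def using openin_subset[of "topol ?Y"] by (auto simp: pts)
  with full have top: "\<Union>\<B> = ?pts \<times> ?pts" by blast
  have "openin (topology_generated_by \<B>) (?pts \<times> ?pts - {(x, x) | x. x \<in> ?pts})"
  proof -
    let ?G = "\<lambda>i. {(a, b). a \<in> ?pts \<and> b \<in> ?pts \<and> the_elem a i - the_elem b i \<noteq> (0::'k)}"
    have "?pts \<times> ?pts - {(x, x) | x. x \<in> ?pts} = (\<Union>i\<in>{1..k}. ?G i)"
    proof
      show "?pts \<times> ?pts - {(x, x) | x. x \<in> ?pts} \<subseteq> (\<Union>i\<in>{1..k}. ?G i)"
      proof
        fix z assume "z \<in> ?pts \<times> ?pts - {(x, x) | x. x \<in> ?pts}"
        then obtain v w where z: "z = ({v}, {w})" "v \<in> B" "w \<in> B" "v \<noteq> w" by auto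
        then obtain i where i: "v i \<noteq> w i" by (auto simp: fun_eq_iff)
        then have "i \<in> {1..k}" using z B affine_points_neq[of v "{1..k}" w i] by blast
        then show "z \<in> (\<Union>i\<in>{1..k}. ?G i)" using z i by auto
      qed
    qed auto
    moreover have "openin (topology_generated_by \<B>) (\<Union>i\<in>{1..k}. ?G i)"
      using G by (intro openin_Union) (auto intro: topology_generated_by_Basis)
    ultimately show ?thesis by simp
  qed
  then show ?thesis
    unfolding separated_def product_zariski_def \<B>_def[symmetric] closedin_def
    by (auto simp: topology_generated_by_topspace top pts)
qed

lemma regular_induced_whole:
  assumes "openin (topol X) V" "\<phi> \<in> regular X V"
  shows "\<phi> \<in> regular (induced_space X A) V"
  using assms by (auto simp: induced_space_def)

text \<open>The coordinate with index \<open>0\<close>, which jets do not use, records \<open>1 / c\<close>.\<close>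

lemma affine_variety_section:
  fixes R :: "(nat \<Rightarrow> 'k::field) set"
  assumes R: "closedin (zariski {1..k}) R" and c: "c \<in> polyfun {1..k}"
    and \<pi>: "\<And>i. (\<lambda>v. \<pi> v i) \<in> regular_off k R c"
    and \<pi>_in: "\<And>v. v \<in> R \<Longrightarrow> c v \<noteq> 0 \<Longrightarrow> \<pi> v \<in> affine_points {1..k}"
    and B: "B = {v \<in> R. c v \<noteq> 0 \<and> \<pi> v = v}"
  shows "affine_variety (induced_space (singleton_space k B) (points (singleton_space k B)))"
proof -
  let ?Y = "singleton_space k B" and ?I = "{..<Suc k}"
  let ?Y' = "induced_space ?Y (points ?Y)"
  have Rp: "R \<subseteq> affine_points {1..k}" by (rule closedin_zariski_subset[OF R])
  have Bp: "B \<subseteq> affine_points {1..k}" using Rp B by auto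
  have pts: "points ?Y = (\<lambda>v. {v}) ` B" by (rule points_singleton_space[OF Bp])
  have up: "q \<in> polyfun ?I" if "q \<in> polyfun {1..k}" for q :: "(nat \<Rightarrow> 'k) \<Rightarrow> 'k"
    by (rule polyfun_mono[OF _ that]) auto
  have prj: "q (x(0 := 0)) = q x" if "q \<in> polyfun {1..k}" for q :: "(nat \<Rightarrow> 'k) \<Rightarrow> 'k" and x
    by (rule polyfun_cong[OF that]) auto
  have prj_in: "x(0 := 0) \<in> affine_points {1..k}" if "x \<in> affine_points ?I" for x :: "nat \<Rightarrow> 'k"
    using that by (auto simp: affine_points_def)
  \<comment> \<open>This set is closed: where \<open>c\<close> is nonzero the fixed point condition
    becomes polynomial after multiplication by a power of \<open>c\<close>, and the equation for
    coordinate 0 ensures that \<open>c\<close> is nonzero.\<close>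
  define Z where "Z = {x \<in> affine_points ?I. x(0 := 0) \<in> R \<and> x 0 * c (x(0 := 0)) = 1 \<and> \<pi> (x(0 := 0)) = x(0 := 0)}"
  have Zp: "Z \<subseteq> affine_points ?I" by (auto simp: Z_def)
  have ZB: "x(0 := 0) \<in> B" if "x \<in> Z" for x using that by (auto simp: Z_def B)
  have closed: "closedin (zariski ?I) Z"
  proof -
    have "\<exists>q\<in>polyfun ?I. q x \<noteq> 0 \<and> (\<forall>z\<in>Z. q z = 0)" if x: "x \<in> affine_points ?I" "x \<notin> Z" for x
    proof (cases "x(0 := 0) \<in> R")
      case False
      obtain q where q: "q \<in> polyfun {1..k}" "q (x(0 := 0)) \<noteq> 0" "\<And>w. w \<in> R \<Longrightarrow> q w = 0"
        by (rule closedin_zariski_separate[OF R prj_in[OF x(1)] False]) blast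
      have "q z = 0" if "z \<in> Z" for z using q(3)[of "z(0 := 0)"] that prj[OF q(1)] by (auto simp: Z_def)
      then show ?thesis using up[OF q(1)] q(2) prj[OF q(1)] by auto
    next
      case xR: True
      show ?thesis
      proof (cases "x 0 * c (x(0 := 0)) = 1")
        case False
        have "(\<lambda>x. x 0 * c x - 1) \<in> polyfun ?I"
          by (intro polyfun_diff polyfun.mult polyfun.coord polyfun.const up[OF c]) auto
        then show ?thesis using False by (intro bexI[of _ "\<lambda>x. x 0 * c x - 1"]) (auto simp: Z_def prj[OF c])
      next
        case True
        then have cx: "c x \<noteq> 0" by (auto simp: prj[OF c])
        have "\<pi> (x(0 := 0)) \<noteq> x(0 := 0)" using x xR True by (auto simp: Z_def)
        then obtain i where i: "\<pi> (x(0 := 0)) i \<noteq> (x(0 := 0)) i" by (auto simp: fun_eq_iff)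
        have "\<pi> (x(0 := 0)) \<in> affine_points {1..k}" using \<pi>_in xR cx by (simp add: prj[OF c])
        then have ik: "i \<in> {1..k}" using i prj_in[OF x(1)] affine_points_neq by blast
        obtain q N where q: "q \<in> polyfun {1..k}" "\<And>v. v \<in> R \<Longrightarrow> c v \<noteq> 0 \<Longrightarrow> \<pi> v i * c v ^ N = q v"
          by (rule regular_offE[OF \<pi>[of i]]) blast
        have "(\<lambda>x. q x - x i * c x ^ N) \<in> polyfun ?I"
          using ik by (intro polyfun_diff polyfun.mult polyfun_power polyfun.coord up[OF c] up[OF q(1)]) auto
        moreover have "q x - x i * c x ^ N \<noteq> 0"
          using q(2)[OF xR] cx i ik by (auto simp: prj[OF c] prj[OF q(1)])
        moreover have "q z - z i * c z ^ N = 0" if z: "z \<in> Z" for z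
        proof -
          have z1: "z(0 := 0) \<in> R" "z 0 * c (z(0 := 0)) = 1" "\<pi> (z(0 := 0)) = z(0 := 0)"
            using z by (simp_all add: Z_def)
          have cz: "c (z(0 := 0)) \<noteq> 0" using z1(2) by auto
          have "\<pi> (z(0 := 0)) i = z i" using fun_cong[OF z1(3), of i] ik by simp
          then show ?thesis using q(2)[OF z1(1) cz] by (simp add: prj[OF c] prj[OF q(1)])
        qed
        ultimately show ?thesis by (intro bexI[of _ "\<lambda>x. q x - x i * c x ^ N"]) auto
      qed
    qed
    note sep = this
    have "openin (zariski ?I) (affine_points ?I - Z)"
      unfolding openin_zariski_iff
    proof (intro conjI ballI)
      fix x assume "x \<in> affine_points ?I - Z"
      then obtain q where q: "q \<in> polyfun ?I" "q x \<noteq> 0" "\<forall>z\<in>Z. q z = 0" using sep by blast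
      then have "{w \<in> affine_points ?I. q w \<noteq> 0} \<subseteq> affine_points ?I - Z" by blast
      then show "\<exists>q\<in>polyfun ?I. q x \<noteq> 0 \<and> {w \<in> affine_points ?I. q w \<noteq> 0} \<subseteq> affine_points ?I - Z"
        using q by blast
    qed auto
    then show ?thesis using Zp by (simp add: closedin_def)
  qed
  define P where "P y = (the_elem y)(0 := inverse (c (the_elem y)))" for y :: "(nat \<Rightarrow> 'k) set"
  define Q where "Q x = {x(0 := 0::'k)}" for x :: "nat \<Rightarrow> 'k"
  \<comment> \<open>Pulling a polynomial back along \<open>P\<close> introduces only powers of
    \<open>c\<close> as denominators.\<close>
  have P_pull: "\<exists>q'\<in>polyfun {1..k}. \<exists>N. \<forall>v\<in>B. q (P {v}) * c v ^ N = q' v" if "q \<in> polyfun ?I" for q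
  proof -
    have "(\<lambda>v. v i) \<in> regular_off k R c" if "i \<in> ?I" "i \<noteq> 0" for i
      by (intro regular_off_poly polyfun.coord) (use that in auto)
    then have "(\<lambda>v. q (\<lambda>i. (if i = 0 then (\<lambda>v. inverse (c v)) else (\<lambda>v. v i)) v)) \<in> regular_off k R c"
      by (intro polyfun_subst[OF fun_algebra_regular_off[OF c] that]) (auto intro: regular_off_inverse)
    then obtain q' N where q': "q' \<in> polyfun {1..k}"
      "\<And>v. v \<in> R \<Longrightarrow> c v \<noteq> 0 \<Longrightarrow> q (\<lambda>i. (if i = 0 then (\<lambda>v. inverse (c v)) else (\<lambda>v. v i)) v) * c v ^ N = q' v"
      by (rule regular_offE) blast
    have "P {v} = (\<lambda>i. (if i = 0 then (\<lambda>v. inverse (c v)) else (\<lambda>v. v i)) v)" for v by (auto simp: P_def)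
    then have "q (P {v}) * c v ^ N = q' v" if "v \<in> B" for v using q'(2)[of v] that by (simp add: B)
    then show ?thesis using q'(1) by blast
  qed
  have PZ: "P {v} \<in> Z" if v: "v \<in> B" for v
  proof -
    have "v 0 = 0" using v Bp affine_points_0 by blast
    then have "(P {v})(0 := 0) = v" by (auto simp: P_def)
    then show ?thesis using v Bp by (auto simp: Z_def B P_def affine_points_def)
  qed
  have QP: "Q (P y) = y" if "y \<in> points ?Y" for y
  proof -
    obtain v where v: "v \<in> B" "y = {v}" using \<open>y \<in> points ?Y\<close> pts by auto
    have "v 0 = 0" using v Bp affine_points_0 by blast
    then show ?thesis by (auto simp: P_def Q_def v)
  qed
  have PQ: "P (Q x) = x" if x: "x \<in> Z" for x
  proof -
    have "x 0 * c (x(0 := 0)) = 1" using x by (simp add: Z_def)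
    then have "x 0 = inverse (c (x(0 := 0)))" by (metis inverse_unique mult.commute)
    then show ?thesis by (auto simp: P_def Q_def)
  qed
  have topY: "topol ?Y' = topol ?Y" by (simp add: induced_space_def)
  have ptsZ: "points (induced_space (affine_space ?I) Z) = Z"
    using Zp by (auto simp: induced_space_def affine_space_def)
  have topZ: "topol (induced_space (affine_space ?I) Z) = subtopology (zariski ?I) Z"
    by (simp add: induced_space_def affine_space_def)
  have morP: "is_morphism ?Y' (induced_space (affine_space ?I) Z) P"
    unfolding is_morphism_def topY topZ
  proof (intro conjI allI impI ballI)
    have "continuous_map (topol ?Y) (zariski ?I) P"
    proof (rule continuous_map_zariskiI)
      show "P y \<in> affine_points ?I" if "y \<in> topspace (topol ?Y)" for y using that PZ Zp pts by auto
      fix q :: "(nat \<Rightarrow> 'k) \<Rightarrow> 'k" assume "q \<in> polyfun ?I"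
      then obtain q' N where q': "q' \<in> polyfun {1..k}" "\<forall>v\<in>B. q (P {v}) * c v ^ N = q' v"
        using P_pull by blast
      have "q (P {v}) \<noteq> 0 \<longleftrightarrow> q' v \<noteq> 0" if "v \<in> B" for v
        using q'(2)[rule_format, OF that] that by (auto simp: B)
      then have "{y \<in> topspace (topol ?Y). q (P y) \<noteq> 0} = (\<lambda>v. {v}) ` ({v \<in> affine_points {1..k}. q' v \<noteq> 0} \<inter> B)"
        unfolding pts using Bp by auto
      then show "openin (topol ?Y) {y \<in> topspace (topol ?Y). q (P y) \<noteq> 0}"
        unfolding openin_singleton_space using openin_zariski_nonzero[OF q'(1)] by blast
    qed
    then show "continuous_map (topol ?Y) (subtopology (zariski ?I) Z) P"
      using PZ pts by (auto simp: continuous_map_in_subtopology)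
    fix V \<phi> assume V: "openin (subtopology (zariski ?I) Z) V"
      and \<phi>: "\<phi> \<in> regular (induced_space (affine_space ?I) Z) V"
    let ?V = "{y \<in> points ?Y. P y \<in> V}"
    have oV: "openin (topol ?Y) ?V"
      using \<open>continuous_map (topol ?Y) (subtopology (zariski ?I) Z) P\<close> V by (simp add: continuous_map_def)
    have "\<phi> \<circ> P \<in> regular ?Y ?V"
    proof (rule regular_singleton_spaceI)
      fix v assume v: "{v} \<in> ?V"
      then have "P {v} \<in> V" by simp
      then obtain q r where qr: "q \<in> polyfun ?I" "r \<in> polyfun ?I" "r (P {v}) \<noteq> 0"
        "\<forall>w\<in>V. r w \<noteq> 0 \<longrightarrow> \<phi> w = q w / r w"
        using \<phi> unfolding regular_induced_affine_iff[OF V] by blast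
      obtain q' N where q': "q' \<in> polyfun {1..k}" "\<forall>v\<in>B. q (P {v}) * c v ^ N = q' v" using P_pull[OF qr(1)] by blast
      obtain r' M where r': "r' \<in> polyfun {1..k}" "\<forall>v\<in>B. r (P {v}) * c v ^ M = r' v" using P_pull[OF qr(2)] by blast
      have "r' v * c v ^ N \<noteq> 0" using r'(2) qr(3) v pts by (auto simp: B)
      moreover have "(\<phi> \<circ> P) {w} = (q' w * c w ^ M) / (r' w * c w ^ N)" if w: "{w} \<in> ?V" "r' w * c w ^ N \<noteq> 0" for w
      proof -
        have wB: "w \<in> B" "P {w} \<in> V" using w(1) pts by auto
        have "c w \<noteq> 0" using wB(1) by (simp add: B)
        have eqs: "r (P {w}) * c w ^ M = r' w" "q (P {w}) * c w ^ N = q' w" using r'(2) q'(2) wB(1) by blast+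
        then have "r (P {w}) \<noteq> 0" using w(2) by auto
        then have "\<phi> (P {w}) = q (P {w}) / r (P {w})" using qr(4) wB(2) by blast
        then show ?thesis unfolding eqs[symmetric] using \<open>c w \<noteq> 0\<close> by simp
      qed
      ultimately show "\<exists>q\<in>polyfun {1..k}. \<exists>r\<in>polyfun {1..k}. r v \<noteq> 0 \<and>
          (\<forall>w. {w} \<in> ?V \<and> r w \<noteq> 0 \<longrightarrow> (\<phi> \<circ> P) {w} = q w / r w)"
        by (intro bexI[OF _ polyfun.mult[OF q'(1) polyfun_power[OF c]]] bexI[OF _ polyfun.mult[OF r'(1) polyfun_power[OF c]]])
           auto
    qed
    then have "\<phi> \<circ> P \<in> regular ?Y' ?V" by (rule regular_induced_whole[OF oV])
    moreover have "points ?Y' = points ?Y" by (simp add: topY)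
    ultimately show "\<phi> \<circ> P \<in> regular ?Y' {x \<in> topspace (topol ?Y). P x \<in> V}" by simp
  qed
  have morQ: "is_morphism (induced_space (affine_space ?I) Z) ?Y' Q"
    unfolding is_morphism_def topY topZ
  proof (intro conjI allI impI ballI)
    have cont: "continuous_map (zariski ?I) (zariski {1..k}) (\<lambda>x. x(0 := 0 :: 'k))"
    proof (rule continuous_map_zariskiI)
      show "x(0 := 0) \<in> affine_points {1..k}" if "x \<in> topspace (zariski ?I)" for x :: "nat \<Rightarrow> 'k"
        using prj_in that by simp
      show "openin (zariski ?I) {x \<in> topspace (zariski ?I). q (x(0 := 0)) \<noteq> 0}" if "q \<in> polyfun {1..k}"
        for q :: "(nat \<Rightarrow> 'k) \<Rightarrow> 'k"
        using openin_zariski_nonzero[OF up[OF that]] by (simp add: prj[OF that])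
    qed
    show contQ: "continuous_map (subtopology (zariski ?I) Z) (topol ?Y) Q"
      unfolding continuous_map_def
    proof (intro conjI allI impI)
      show "Q \<in> topspace (subtopology (zariski ?I) Z) \<rightarrow> topspace (topol ?Y)"
        using ZB pts by (auto simp: Q_def)
      fix V assume "openin (topol ?Y) V"
      then obtain W where W: "openin (zariski {1..k}) W" "V = (\<lambda>v. {v}) ` (W \<inter> B)" unfolding openin_singleton_space by blast
      have "{x \<in> topspace (subtopology (zariski ?I) Z). Q x \<in> V} = {x \<in> topspace (zariski ?I). x(0 := 0) \<in> W} \<inter> Z"
        using ZB by (auto simp: Q_def W(2))
      moreover have "openin (zariski ?I) {x \<in> topspace (zariski ?I). x(0 := 0) \<in> W}"
        using cont W(1) by (simp add: continuous_map_def)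
      ultimately show "openin (subtopology (zariski ?I) Z) {x \<in> topspace (subtopology (zariski ?I) Z). Q x \<in> V}"
        by (auto simp: openin_subtopology)
    qed
    fix V \<phi> assume V: "openin (topol ?Y) V" and \<phi>: "\<phi> \<in> regular ?Y' V"
    let ?V = "{x \<in> topspace (subtopology (zariski ?I) Z). Q x \<in> V}"
    have oV: "openin (subtopology (zariski ?I) Z) ?V"
      using contQ V unfolding continuous_map_def by blast
    show "\<phi> \<circ> Q \<in> regular (induced_space (affine_space ?I) Z) ?V"
      unfolding regular_induced_affine_iff[OF oV]
    proof
      fix x assume x: "x \<in> ?V"
      then have xV: "{x(0 := 0)} \<in> V" by (simp add: Q_def)
      obtain W \<psi> where W: "openin (topol ?Y) W" "{x(0 := 0)} \<in> W" "\<psi> \<in> regular ?Y W"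
        "\<forall>w\<in>W \<inter> points ?Y. \<phi> w = \<psi> w"
        using \<phi> xV by (auto simp: induced_space_def)
      obtain q r where qr: "q \<in> polyfun {1..k}" "r \<in> polyfun {1..k}" "r (x(0 := 0)) \<noteq> 0"
        "\<forall>w. {w} \<in> W \<and> r w \<noteq> 0 \<longrightarrow> \<psi> {w} = q w / r w"
        by (rule regular_singleton_spaceE[OF W(3,2)]) blast
      obtain s where s: "s \<in> polyfun {1..k}" "s (x(0 := 0)) \<noteq> 0"
        "\<And>w. w \<in> B \<Longrightarrow> w \<in> affine_points {1..k} \<Longrightarrow> s w \<noteq> 0 \<Longrightarrow> {w} \<in> W"
        by (rule openin_singleton_spaceE[OF W(1,2)]) blast
      have "(\<phi> \<circ> Q) z = (q z * s z) / (r z * s z)" if z: "z \<in> ?V" "r z * s z \<noteq> 0" for z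
      proof -
        have zB: "z(0 := 0) \<in> B" using z(1) ZB by simp
        have "{z(0 := 0)} \<in> W" using s(3)[OF zB] zB Bp z(2) prj[OF s(1)] by auto
        then have "\<phi> {z(0 := 0)} = \<psi> {z(0 := 0)}" using W(4) zB pts by blast
        also have "\<dots> = q (z(0 := 0)) / r (z(0 := 0))"
          using qr(4) \<open>{z(0 := 0)} \<in> W\<close> z(2) prj[OF qr(2)] by auto
        finally show ?thesis using z(2) by (simp add: Q_def prj[OF qr(1)] prj[OF qr(2)])
      qed
      moreover have "r x * s x \<noteq> 0" using qr(3) s(2) by (simp add: prj[OF qr(2)] prj[OF s(1)])
      ultimately show "\<exists>q\<in>polyfun ?I. \<exists>r\<in>polyfun ?I. r x \<noteq> 0 \<and> (\<forall>w\<in>?V. r w \<noteq> 0 \<longrightarrow> (\<phi> \<circ> Q) w = q w / r w)"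
        by (intro bexI[OF _ up[OF polyfun.mult[OF qr(1) s(1)]]] bexI[OF _ up[OF polyfun.mult[OF qr(2) s(1)]]]) auto
    qed
  qed
  have "isomorphic_spaces ?Y' (induced_space (affine_space ?I) Z)"
    unfolding isomorphic_spaces_def
    using morP morQ QP PQ ptsZ topY by (intro exI[of _ P] exI[of _ Q]) auto
  then show ?thesis unfolding affine_variety_def using closed by blast
qed

text \<open>\<open>\<pi>\<close> retracts \<open>A\<close> onto its fixed set \<open>B\<close>,
  which contains exactly one point of each orbit. Hence invariant functions descend by restriction
  to \<open>B\<close>.\<close>

lemma section_geometric_quotient:
  fixes R :: "(nat \<Rightarrow> 'k::field) set"
  assumes R: "closedin (zariski {1..k}) R" and c: "c \<in> polyfun {1..k}"
    and A: "A = {v \<in> R. c v \<noteq> 0}" "jet_invariant k A" and \<pi>: "jet_section k R c \<pi>"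
  defines "B \<equiv> {v \<in> R. c v \<noteq> 0 \<and> \<pi> v = v}"
  shows "variety (singleton_space k B)"
    and "geometric_quotient (jet_group k) (jet_action k) (induced_space (jet_space k) A)
           (singleton_space k B) (\<lambda>v. {\<pi> v})"
proof -
  let ?Y = "singleton_space k B" and ?X = "induced_space (jet_space k) A" and ?p = "\<lambda>v. {\<pi> v}"
  have Ap: "A \<subseteq> affine_points {1..k}" using A(2) by (auto simp: jet_invariant_def)
  have Bp: "B \<subseteq> affine_points {1..k}" using Ap A(1) by (auto simp: B_def)
  have \<pi>_orbit: "\<pi> v \<in> jet_orbit k v" if "v \<in> A" for v using \<pi> that A(1) by (simp add: jet_section_def)
  have \<pi>_inv: "\<pi> (jet_subst k \<phi> v) = \<pi> v" if "v \<in> A" "coord_change \<phi>" for v \<phi>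
    using \<pi> that A(1) by (simp add: jet_section_def)
  have orbit_A: "w \<in> A" if "v \<in> A" "w \<in> jet_orbit k v" for v w
    using that jet_invariantD(1)[OF A(2)] by (auto simp: jet_orbit_def)
  have \<pi>_orbit_eq: "\<pi> w = \<pi> v" if "v \<in> A" "w \<in> jet_orbit k v" for v w
    using that \<pi>_inv by (auto simp: jet_orbit_def)
  have \<pi>B: "\<pi> v \<in> B" if "v \<in> A" for v
    using orbit_A[OF that \<pi>_orbit[OF that]] \<pi>_orbit_eq[OF that \<pi>_orbit[OF that]] A(1) by (auto simp: B_def)
  have BA: "b \<in> A" "\<pi> b = b" if "b \<in> B" for b using that A(1) by (auto simp: B_def)
  have pts: "points ?Y = (\<lambda>v. {v}) ` B" by (rule points_singleton_space[OF Bp])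
  have topX: "topol ?X = subtopology (zariski {1..k}) A"
    by (simp add: induced_space_def jet_space_def affine_space_def)
  have ptsX: "points ?X = A" using Ap by (auto simp: topX)
  have regX: "\<psi> \<in> regular ?X U \<longleftrightarrow> (\<forall>a\<in>U. \<exists>q\<in>polyfun {1..k}. \<exists>r\<in>polyfun {1..k}. r a \<noteq> 0 \<and>
      (\<forall>w\<in>U. r w \<noteq> 0 \<longrightarrow> \<psi> w = q w / r w))"
    if "openin (subtopology (zariski {1..k}) A) U" for \<psi> U
    unfolding jet_space_def by (rule regular_induced_affine_iff[OF that])
  have pull: "\<exists>q'\<in>polyfun {1..k}. \<exists>N. \<forall>v\<in>A. q (\<pi> v) * c v ^ N = q' v" if "q \<in> polyfun {1..k}" for q
  proof -
    have "(\<lambda>v. q (\<lambda>i. \<pi> v i)) \<in> regular_off k R c"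
      by (rule polyfun_subst[OF fun_algebra_regular_off[OF c] that]) (use \<pi> in \<open>simp add: jet_section_def\<close>)
    then obtain q' N where "q' \<in> polyfun {1..k}" "\<And>v. v \<in> R \<Longrightarrow> c v \<noteq> 0 \<Longrightarrow> q (\<lambda>i. \<pi> v i) * c v ^ N = q' v"
      by (rule regular_offE) blast
    then show ?thesis by (intro bexI[of _ q'] exI[of _ N]) (auto simp: A(1))
  qed

  show "variety ?Y"
    unfolding variety_def
  proof (intro conjI exI[of _ "{points ?Y}"])
    have aff: "affine_variety (induced_space ?Y (points ?Y))"
      by (rule affine_variety_section[OF R c, of \<pi>])
         (use \<pi> \<pi>_orbit A(1) in \<open>auto simp: jet_section_def jet_orbit_def B_def\<close>)
    then show "\<forall>V\<in>{points ?Y}. openin (topol ?Y) V \<and> affine_variety (induced_space ?Y V)" by simp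
  qed (simp_all add: sheaf_singleton_space[OF Bp] separated_singleton_space[OF Bp])

  have cont\<pi>: "continuous_map (subtopology (zariski {1..k}) A) (zariski {1..k}) \<pi>"
  proof (rule continuous_map_zariskiI)
    show "\<pi> x \<in> affine_points {1..k}" if "x \<in> topspace (subtopology (zariski {1..k}) A)" for x
      using that \<pi>B Bp by auto
    fix q :: "(nat \<Rightarrow> 'k) \<Rightarrow> 'k" assume "q \<in> polyfun {1..k}"
    then obtain q' N where q': "q' \<in> polyfun {1..k}" "\<forall>v\<in>A. q (\<pi> v) * c v ^ N = q' v" using pull by blast
    have "q (\<pi> v) \<noteq> 0 \<longleftrightarrow> q' v \<noteq> 0" if "v \<in> A" for v
      using q'(2)[rule_format, OF that] that by (auto simp: A(1))
    then have "{x \<in> topspace (subtopology (zariski {1..k}) A). q (\<pi> x) \<noteq> 0} = {v \<in> affine_points {1..k}. q' v \<noteq> 0} \<inter> A"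
      using Ap by auto
    then show "openin (subtopology (zariski {1..k}) A) {x \<in> topspace (subtopology (zariski {1..k}) A). q (\<pi> x) \<noteq> 0}"
      using openin_zariski_nonzero[OF q'(1)] openin_subtopology by blast
  qed
  have cont: "continuous_map (topol ?X) (topol ?Y) ?p"
    unfolding continuous_map_def
  proof (intro conjI allI impI)
    show "?p \<in> topspace (topol ?X) \<rightarrow> topspace (topol ?Y)" using \<pi>B by (auto simp: ptsX pts)
    fix V assume "openin (topol ?Y) V"
    then obtain W where W: "openin (zariski {1..k}) W" "V = (\<lambda>v. {v}) ` (W \<inter> B)" unfolding openin_singleton_space by blast
    have "{x \<in> topspace (topol ?X). ?p x \<in> V} = {x \<in> topspace (subtopology (zariski {1..k}) A). \<pi> x \<in> W}"
      using \<pi>B unfolding topX W(2) by auto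
    then show "openin (topol ?X) {x \<in> topspace (topol ?X). ?p x \<in> V}"
      using cont\<pi> W(1) by (simp add: continuous_map_def topX)
  qed

  show "geometric_quotient (jet_group k) (jet_action k) ?X ?Y ?p"
    unfolding geometric_quotient_def is_morphism_def
  proof (intro conjI)
    show "continuous_map (topol ?X) (topol ?Y) ?p" by (rule cont)
  next
    show "\<forall>V. openin (topol ?Y) V \<longrightarrow> (\<forall>\<phi>\<in>regular ?Y V. \<phi> \<circ> ?p \<in> regular ?X {x \<in> points ?X. ?p x \<in> V})"
    proof (intro allI impI ballI)
      fix V \<phi> assume V: "openin (topol ?Y) V" and \<phi>: "\<phi> \<in> regular ?Y V"
      let ?V = "{x \<in> points ?X. ?p x \<in> V}"
      have oV: "openin (subtopology (zariski {1..k}) A) ?V"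
        using cont V unfolding continuous_map_def topX by blast
      have "\<forall>a\<in>?V. \<exists>q\<in>polyfun {1..k}. \<exists>r\<in>polyfun {1..k}. r a \<noteq> 0 \<and> (\<forall>w\<in>?V. r w \<noteq> 0 \<longrightarrow> (\<phi> \<circ> ?p) w = q w / r w)"
      proof
        fix a assume a: "a \<in> ?V"
        then have aV: "{\<pi> a} \<in> V" and aA: "a \<in> A" by (auto simp: ptsX)
        obtain q r where qr: "q \<in> polyfun {1..k}" "r \<in> polyfun {1..k}" "r (\<pi> a) \<noteq> 0"
          "\<forall>w. {w} \<in> V \<and> r w \<noteq> 0 \<longrightarrow> \<phi> {w} = q w / r w"
          by (rule regular_singleton_spaceE[OF \<phi> aV]) blast
        obtain q' N where q': "q' \<in> polyfun {1..k}" "\<forall>v\<in>A. q (\<pi> v) * c v ^ N = q' v" using pull[OF qr(1)] by blast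
        obtain r' M where r': "r' \<in> polyfun {1..k}" "\<forall>v\<in>A. r (\<pi> v) * c v ^ M = r' v" using pull[OF qr(2)] by blast
        have "r' a * c a ^ N \<noteq> 0" using r'(2) qr(3) aA A(1) by auto
        moreover have "(\<phi> \<circ> ?p) w = (q' w * c w ^ M) / (r' w * c w ^ N)" if w: "w \<in> ?V" "r' w * c w ^ N \<noteq> 0" for w
        proof -
          have wA: "w \<in> A" "{\<pi> w} \<in> V" "c w \<noteq> 0" using w(1) ptsX A(1) by auto
          have eqs: "r (\<pi> w) * c w ^ M = r' w" "q (\<pi> w) * c w ^ N = q' w" using r'(2) q'(2) wA(1) by blast+
          then have "r (\<pi> w) \<noteq> 0" using w(2) by auto
          then have "\<phi> {\<pi> w} = q (\<pi> w) / r (\<pi> w)" using qr(4) wA(2) by blast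
          then show ?thesis unfolding eqs[symmetric] using wA(3) by simp
        qed
        ultimately show "\<exists>q\<in>polyfun {1..k}. \<exists>r\<in>polyfun {1..k}. r a \<noteq> 0 \<and> (\<forall>w\<in>?V. r w \<noteq> 0 \<longrightarrow> (\<phi> \<circ> ?p) w = q w / r w)"
          by (intro bexI[OF _ polyfun.mult[OF q'(1) polyfun_power[OF c]]] bexI[OF _ polyfun.mult[OF r'(1) polyfun_power[OF c]]])
             auto
      qed
      then show "\<phi> \<circ> ?p \<in> regular ?X ?V" by (simp only: regX[OF oV])
    qed
  next
    show "?p ` points ?X = points ?Y"
    proof
      show "?p ` points ?X \<subseteq> points ?Y" using \<pi>B by (auto simp: ptsX pts)
      show "points ?Y \<subseteq> ?p ` points ?X"
      proof
        fix y assume "y \<in> points ?Y"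
        then obtain b where b: "b \<in> B" "y = {b}" using pts by auto
        then have "y = ?p b" using BA by simp
        then show "y \<in> ?p ` points ?X" using BA[OF b(1)] ptsX by blast
      qed
    qed
  next
    show "open_map (topol ?X) (topol ?Y) ?p"
      unfolding open_map_def
    proof (intro allI impI)
      fix U assume "openin (topol ?X) U"
      then obtain W where W: "openin (zariski {1..k}) W" "U = W \<inter> A" by (auto simp: topX openin_subtopology)
      \<comment> \<open>The union of the translates of \<open>W\<close>; as \<open>\<pi>\<close>
        moves points within their orbits, the image of \<open>U\<close> is the trace of this open
        set on \<open>B\<close>.\<close>
      define W' where "W' = (\<Union>\<phi>\<in>Collect coord_change. {v \<in> affine_points {1..k}. jet_subst k \<phi> v \<in> W})"
      have W': "openin (zariski {1..k}) W'"
        unfolding W'_def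
      proof (intro openin_Union ballI, clarify)
        fix \<phi> :: "'k fps"
        show "openin (zariski {1..k}) {v \<in> affine_points {1..k}. jet_subst k \<phi> v \<in> W}"
          using continuous_map_jet_subst[of k \<phi>] W(1) by (auto simp: continuous_map_def)
      qed
      have "\<pi> ` U = W' \<inter> B"
      proof
        show "\<pi> ` U \<subseteq> W' \<inter> B"
        proof
          fix b assume "b \<in> \<pi> ` U"
          then obtain v where v: "v \<in> W" "v \<in> A" "b = \<pi> v" using W(2) by blast
          then have "v \<in> jet_orbit k b" using jet_orbit_sym[OF _ \<pi>_orbit] Ap by blast
          then show "b \<in> W' \<inter> B" using v \<pi>B Bp by (auto simp: W'_def jet_orbit_def)
        qed
        show "W' \<inter> B \<subseteq> \<pi> ` U"
        proof
          fix b assume b: "b \<in> W' \<inter> B"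
          then obtain \<phi> where \<phi>: "coord_change \<phi>" "jet_subst k \<phi> b \<in> W" by (auto simp: W'_def)
          have "b \<in> A" "\<pi> b = b" using BA b by auto
          then have "jet_subst k \<phi> b \<in> U" "\<pi> (jet_subst k \<phi> b) = b"
            using \<phi> W(2) jet_invariantD(1)[OF A(2)] \<pi>_inv by auto
          then show "b \<in> \<pi> ` U" by (metis imageI)
        qed
      qed
      then have "?p ` U = (\<lambda>v. {v}) ` (W' \<inter> B)" by (metis (no_types, lifting) image_cong image_image)
      then show "openin (topol ?Y) (?p ` U)" unfolding openin_singleton_space using W' by blast
    qed
  next
    show "\<forall>x\<in>points ?X. \<forall>y\<in>points ?X. ?p x = ?p y \<longleftrightarrow> (\<exists>h\<in>jet_group k. y = jet_action k h x)"
    proof (intro ballI)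
      fix x y assume "x \<in> points ?X" "y \<in> points ?X"
      then have x: "x \<in> A" "x \<in> affine_points {1..k}" and y: "y \<in> A" "y \<in> affine_points {1..k}" using ptsX Ap by auto
      have "\<pi> x = \<pi> y \<longleftrightarrow> y \<in> jet_orbit k x"
      proof
        assume eq: "\<pi> x = \<pi> y"
        have "y \<in> jet_orbit k (\<pi> y)" by (rule jet_orbit_sym[OF y(2) \<pi>_orbit[OF y(1)]])
        then show "y \<in> jet_orbit k x" using jet_orbit_trans[OF x(2) \<pi>_orbit[OF x(1)]] eq by simp
      next
        assume "y \<in> jet_orbit k x"
        then show "\<pi> x = \<pi> y" using \<pi>_orbit_eq[OF x(1)] by simp
      qed
      then show "?p x = ?p y \<longleftrightarrow> (\<exists>h\<in>jet_group k. y = jet_action k h x)"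
        using jet_group_orbit_iff[OF x(2)] by simp
    qed
  next
    show "\<forall>V. openin (topol ?Y) V \<longrightarrow>
        (\<forall>\<psi>\<in>regular ?X {x \<in> points ?X. ?p x \<in> V}.
           (\<forall>h\<in>jet_group k. \<forall>x\<in>points ?X. ?p x \<in> V \<longrightarrow> \<psi> (jet_action k h x) = \<psi> x) \<longrightarrow>
           (\<exists>\<phi>\<in>regular ?Y V. \<forall>x\<in>points ?X. ?p x \<in> V \<longrightarrow> \<psi> x = \<phi> (?p x)))"
    proof (intro allI impI ballI)
      fix V \<psi> assume V: "openin (topol ?Y) V" and \<psi>: "\<psi> \<in> regular ?X {x \<in> points ?X. ?p x \<in> V}"
        and inv: "\<forall>h\<in>jet_group k. \<forall>x\<in>points ?X. ?p x \<in> V \<longrightarrow> \<psi> (jet_action k h x) = \<psi> x"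
      let ?V = "{x \<in> points ?X. ?p x \<in> V}"
      have oV: "openin (subtopology (zariski {1..k}) A) ?V"
        using cont V unfolding continuous_map_def topX by blast
      have \<psi>': "\<forall>a\<in>?V. \<exists>q\<in>polyfun {1..k}. \<exists>r\<in>polyfun {1..k}. r a \<noteq> 0 \<and> (\<forall>w\<in>?V. r w \<noteq> 0 \<longrightarrow> \<psi> w = q w / r w)"
        using \<psi> by (simp only: regX[OF oV])
      have BV: "w \<in> ?V" if "{w} \<in> V" for w
        using openin_subset[OF V] that BA by (auto simp: pts ptsX)
      have "(\<lambda>y. \<psi> (the_elem y)) \<in> regular ?Y V"
      proof (rule regular_singleton_spaceI)
        fix v assume "{v} \<in> V"
        then obtain q r where "q \<in> polyfun {1..k}" "r \<in> polyfun {1..k}" "r v \<noteq> 0" "\<forall>w\<in>?V. r w \<noteq> 0 \<longrightarrow> \<psi> w = q w / r w"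
          using bspec[OF \<psi>' BV] by blast
        then show "\<exists>q\<in>polyfun {1..k}. \<exists>r\<in>polyfun {1..k}. r v \<noteq> 0 \<and>
            (\<forall>w. {w} \<in> V \<and> r w \<noteq> 0 \<longrightarrow> \<psi> (the_elem {w}) = q w / r w)"
          using BV by (intro bexI[of _ q] bexI[of _ r]) auto
      qed
      moreover have "\<psi> x = \<psi> (the_elem (?p x))" if x: "x \<in> points ?X" "?p x \<in> V" for x
      proof -
        have xA: "x \<in> A" "x \<in> affine_points {1..k}" using x ptsX Ap by auto
        have "\<exists>h\<in>jet_group k. \<pi> x = jet_action k h x"
          using \<pi>_orbit[OF xA(1)] jet_group_orbit_iff[OF xA(2)] by blast
        then show ?thesis using inv x by auto
      qed
      ultimately show "\<exists>\<phi>\<in>regular ?Y V. \<forall>x\<in>points ?X. ?p x \<in> V \<longrightarrow> \<psi> x = \<phi> (?p x)" by (rule_tac bexI) auto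
    qed
  qed
qed

text \<open>Noetherian induction over closed invariant sets: a dense stratum with a section is split
  off, and its complement is again closed and invariant.\<close>

theorem rosenlicht_stratification_exists:
  assumes p: "CHAR('k::alg_closed_field) = p" "prime p"
  shows "\<exists>S :: (nat \<Rightarrow> 'k, (nat \<Rightarrow> 'k) set, 'k) stratum list.
    rosenlicht_stratification (jet_group k) (jet_action k) (jet_space k) S"
proof -
  let ?T = "zariski {1..k} :: (nat \<Rightarrow> 'k) topology"
  let ?stratum = "\<lambda>R (A, Y, p). (\<forall>h\<in>jet_group k. \<forall>x\<in>A. jet_action k h x \<in> A) \<and>
         locally_closed_in ?T A \<and> openin (subtopology ?T R) A \<and> subtopology ?T R closure_of A = R \<and>
         variety Y \<and> geometric_quotient (jet_group k) (jet_action k) (induced_space (jet_space k) A) Y p"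
  define strat :: "(nat \<Rightarrow> 'k) set \<Rightarrow> (nat \<Rightarrow> 'k, (nat \<Rightarrow> 'k) set, 'k) stratum list \<Rightarrow> bool" where
    "strat R S \<longleftrightarrow> (\<Union>(A, Y, p)\<in>set S. A) = R \<and>
     (\<forall>i<length S. \<forall>j<length S. i \<noteq> j \<longrightarrow> fst (S ! i) \<inter> fst (S ! j) = {}) \<and>
     (\<forall>i<length S. ?stratum (R - (\<Union>j<i. fst (S ! j))) (S ! i))" for R S
  let ?W = "{(A, B). closedin ?T A \<and> closedin ?T B \<and> A \<subset> B}"
  have wf: "wf ?W" by (rule wf_closedin_zariski) simp
  have "closedin ?T R \<Longrightarrow> jet_invariant k R \<Longrightarrow> \<exists>S. strat R S" for R
    using wf
  proof (induction R rule: wf_induct_rule)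
    case (less R)
    note R = less.prems
    have Rp: "R \<subseteq> affine_points {1..k}" by (rule closedin_zariski_subset[OF R(1)])
    show ?case
    proof (cases "R = {}")
      case True
      then show ?thesis by (intro exI[of _ "[]"]) (simp add: strat_def)
    next
      case False
      obtain A where A: "sectioned k R A" "subtopology ?T R closure_of A = R"
        using dense_sectioned_exists[OF p R(2,1)] by blast
      then obtain c \<pi> where c: "c \<in> polyfun {1..k}" "A = {v \<in> R. c v \<noteq> 0}" "jet_section k R c \<pi>" and Ai: "jet_invariant k A"
        unfolding sectioned_def by blast
      have AR: "A \<subseteq> R" using c(2) by auto
      have opn: "openin (subtopology ?T R) A" by (rule sectioned_openin[OF A(1) Rp])
      define B where "B = {v \<in> R. c v \<noteq> 0 \<and> \<pi> v = v}"
      define s where "s = (A, singleton_space k B, \<lambda>v. {\<pi> v})"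
      have s: "?stratum R s"
        unfolding s_def prod.case
      proof (intro conjI)
        show "\<forall>h\<in>jet_group k. \<forall>x\<in>A. jet_action k h x \<in> A"
          using jet_invariantD[OF Ai] by (auto simp: jet_group_eq jet_action_eq)
        obtain W where "openin ?T W" "A = W \<inter> R" using opn by (auto simp: openin_subtopology)
        then show "locally_closed_in ?T A" using R(1) unfolding locally_closed_in_def by blast
      qed (use opn A(2) section_geometric_quotient[OF R(1) c(1,2) Ai c(3)] in \<open>auto simp: B_def\<close>)
      have "A \<noteq> {}" using A(2) False by auto
      have RA: "closedin ?T (R - A)"
        using closedin_diff[OF closedin_topspace opn] R(1) Rp
        by (auto simp: closedin_closed_subtopology inf_absorb2)
      moreover have "R - A \<subset> R" using AR \<open>A \<noteq> {}\<close> by blast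
      ultimately obtain S where S: "strat (R - A) S"
        using less.IH[of "R - A"] R jet_invariant_Diff[OF R(2) Ai] by blast
      have sub: "fst x \<subseteq> R - A" if "x \<in> set S" for x
      proof -
        have "(\<Union>(A, Y, p)\<in>set S. A) = R - A" using S unfolding strat_def by (rule conjunct1)
        then have "(\<Union>x\<in>set S. fst x) = R - A" by (simp only: case_prod_unfold)
        then show ?thesis using that by blast
      qed
      have "strat R (s # S)"
        unfolding strat_def
      proof (intro conjI allI impI)
        have "(\<Union>(A, Y, p)\<in>set S. A) = R - A" using S by (simp add: strat_def)
        then show "(\<Union>(A, Y, p)\<in>set (s # S). A) = R" using AR by (simp add: s_def Un_absorb1)
      next
        fix i j assume ij: "i < length (s # S)" "j < length (s # S)" "i \<noteq> j"
        have disj: "fst (S ! i) \<inter> fst (S ! j) = {}" if "i < length S" "j < length S" "i \<noteq> j" for i j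
        proof -
          have "\<forall>i<length S. \<forall>j<length S. i \<noteq> j \<longrightarrow> fst (S ! i) \<inter> fst (S ! j) = {}"
            using S unfolding strat_def by (elim conjE)
          then show ?thesis using that by blast
        qed
        have "A \<inter> fst (S ! i) = {}" if "i < length S" for i using sub[OF nth_mem[OF that]] by blast
        then show "fst ((s # S) ! i) \<inter> fst ((s # S) ! j) = {}"
          using ij disj by (cases i; cases j) (auto simp: s_def Int_commute)
      next
        fix i assume i: "i < length (s # S)"
        show "?stratum (R - (\<Union>j<i. fst ((s # S) ! j))) ((s # S) ! i)"
        proof (cases i)
          case 0
          then show ?thesis using s by simp
        next
          case (Suc l)
          have "(\<Union>j<i. fst ((s # S) ! j)) = A \<union> (\<Union>j<l. fst (S ! j))"
            unfolding Suc lessThan_Suc_eq_insert_0 by (simp add: s_def)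
          then have "R - (\<Union>j<i. fst ((s # S) ! j)) = (R - A) - (\<Union>j<l. fst (S ! j))" by blast
          moreover have "?stratum ((R - A) - (\<Union>j<l. fst (S ! j))) (S ! l)"
            using S i Suc unfolding strat_def by simp
          ultimately show ?thesis using Suc by simp
        qed
      qed
      then show ?thesis by blast
    qed
  qed
  from this[of "affine_points {1..k}"] obtain S where S: "strat (affine_points {1..k}) S"
    using closedin_topspace[of ?T] jet_invariant_points by auto
  have "topol (jet_space k) = ?T" by (simp add: jet_space_def affine_space_def)
  then have "rosenlicht_stratification (jet_group k) (jet_action k) (jet_space k) S"
    using S unfolding rosenlicht_stratification_def strat_def Let_def by simp
  then show ?thesis by blast
qed

section \<open>Algebraic dependence\<close>

text \<open>Gaussian elimination: row \<open>r0\<close> is the pivot that clears column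
  \<open>c\<close> from the remaining rows.\<close>

lemma linear_dependence:
  fixes M :: "'r \<Rightarrow> 'c \<Rightarrow> 'k::field"
  assumes "finite C" "finite R" "card C < card R"
  shows "\<exists>x. (\<exists>r\<in>R. x r \<noteq> 0) \<and> (\<forall>c\<in>C. (\<Sum>r\<in>R. x r * M r c) = 0)"
  using assms
proof (induction C arbitrary: R M rule: finite_induct)
  case empty
  then obtain r where "r \<in> R" by (metis card.empty less_irrefl ex_in_conv)
  then show ?case by (intro exI[of _ "\<lambda>_. 1"]) auto
next
  case (insert c C)
  show ?case
  proof (cases "\<forall>r\<in>R. M r c = 0")
    case True
    have "card C < card R" using insert by simp
    with insert.IH[of R M] insert.prems obtain x where
      x: "\<exists>r\<in>R. x r \<noteq> 0" "\<forall>c\<in>C. (\<Sum>r\<in>R. x r * M r c) = 0" by auto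
    then show ?thesis using True by (intro exI[of _ x]) auto
  next
    case False
    then obtain r0 where r0: "r0 \<in> R" "M r0 c \<noteq> 0" by blast
    define M' where "M' r d = M r d - M r c / M r0 c * M r0 d" for r d
    have "card C < card (R - {r0})" using insert r0 by simp
    with insert.IH[of "R - {r0}" M'] insert.prems obtain x where
      x: "\<exists>r\<in>R-{r0}. x r \<noteq> 0" "\<forall>d\<in>C. (\<Sum>r\<in>R-{r0}. x r * M' r d) = 0" by auto
    define y where "y r = (if r = r0 then - (\<Sum>r\<in>R-{r0}. x r * M r c) / M r0 c else x r)" for r
    have sum: "(\<Sum>r\<in>R. y r * M r d) = (\<Sum>r\<in>R-{r0}. x r * M' r d)" for d
    proof -
      have "(\<Sum>r\<in>R. y r * M r d) = y r0 * M r0 d + (\<Sum>r\<in>R-{r0}. y r * M r d)"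
        using insert.prems(1) r0(1) by (rule sum.remove)
      also have "(\<Sum>r\<in>R-{r0}. y r * M r d) = (\<Sum>r\<in>R-{r0}. x r * M r d)"
        by (intro sum.cong) (auto simp: y_def)
      also have "y r0 * M r0 d = - (\<Sum>r\<in>R-{r0}. x r * (M r c / M r0 c * M r0 d))"
        by (simp add: y_def sum_distrib_right sum_divide_distrib mult.assoc)
      finally show ?thesis by (simp add: M'_def sum_subtractf algebra_simps)
    qed
    have "M' r c = 0" for r using r0 by (simp add: M'_def)
    then have "\<forall>d\<in>insert c C. (\<Sum>r\<in>R. y r * M r d) = 0" using x(2) by (simp add: sum)
    moreover have "\<exists>r\<in>R. y r \<noteq> 0" using x(1) by (auto simp: y_def)
    ultimately show ?thesis by blast
  qed
qed

text \<open>The degree is bounded in each variable separately, so that (d + 1)^(card J) monomials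
  span.\<close>

definition bounded_polyfun :: "nat set \<Rightarrow> nat \<Rightarrow> ((nat \<Rightarrow> 'k::field) \<Rightarrow> 'k) set" where
  "bounded_polyfun J d = {f. \<exists>c. f = (\<lambda>v. \<Sum>e\<in>J \<rightarrow>\<^sub>E {..d}. c e * (\<Prod>j\<in>J. v j ^ e j))}"

lemma bounded_polyfun_zero: "(\<lambda>_. 0) \<in> bounded_polyfun J d"
  unfolding bounded_polyfun_def by (auto intro!: exI[of _ "\<lambda>_. 0"])

lemma bounded_polyfun_add:
  "f \<in> bounded_polyfun J d \<Longrightarrow> g \<in> bounded_polyfun J d \<Longrightarrow> (\<lambda>v. f v + g v) \<in> bounded_polyfun J d"
  unfolding bounded_polyfun_def
  by (auto simp: sum.distrib[symmetric] distrib_right[symmetric])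

lemma bounded_polyfun_cmult:
  "f \<in> bounded_polyfun J d \<Longrightarrow> (\<lambda>v. a * f v) \<in> bounded_polyfun J d"
  unfolding bounded_polyfun_def
  by (auto simp: sum_distrib_left mult.assoc[symmetric])

lemma bounded_polyfun_sum:
  "(\<And>i. i \<in> S \<Longrightarrow> f i \<in> bounded_polyfun J d) \<Longrightarrow> (\<lambda>v. \<Sum>i\<in>S. f i v) \<in> bounded_polyfun J d"
  by (induction S rule: infinite_finite_induct) (auto intro: bounded_polyfun_zero bounded_polyfun_add)

lemma bounded_polyfun_monomial:
  assumes J: "finite J" and e: "\<And>j. j \<in> J \<Longrightarrow> e j \<le> d"
  shows "(\<lambda>v. \<Prod>j\<in>J. v j ^ e j) \<in> bounded_polyfun J d"
proof -
  have mem: "restrict e J \<in> J \<rightarrow>\<^sub>E {..d}" using e by auto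
  have fin: "finite (J \<rightarrow>\<^sub>E {..d})" using J by (intro finite_PiE) auto
  have "(\<Prod>j\<in>J. v j ^ e j) = (\<Sum>e'\<in>J \<rightarrow>\<^sub>E {..d}. (if e' = restrict e J then 1 else 0) * (\<Prod>j\<in>J. v j ^ e' j))" for v :: "nat \<Rightarrow> 'a"
  proof -
    have "(\<Sum>e'\<in>J \<rightarrow>\<^sub>E {..d}. (if e' = restrict e J then 1 else 0) * (\<Prod>j\<in>J. v j ^ e' j)) =
        (\<Sum>e'\<in>J \<rightarrow>\<^sub>E {..d}. if e' = restrict e J then (\<Prod>j\<in>J. v j ^ e j) else 0)"
      by (intro sum.cong) auto
    then show ?thesis using fin mem by simp
  qed
  then have "(\<lambda>v. \<Prod>j\<in>J. v j ^ e j) =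
      (\<lambda>v :: nat \<Rightarrow> 'a. \<Sum>e'\<in>J \<rightarrow>\<^sub>E {..d}. (if e' = restrict e J then 1 else 0) * (\<Prod>j\<in>J. v j ^ e' j))"
    by (rule ext)
  then show ?thesis unfolding bounded_polyfun_def
    by (intro CollectI exI[of _ "\<lambda>e'. if e' = restrict e J then 1 else 0"])
qed

lemma bounded_polyfun_mult:
  assumes J: "finite J" and f: "f \<in> bounded_polyfun J a" and g: "g \<in> bounded_polyfun J b"
  shows "(\<lambda>v. f v * g v) \<in> bounded_polyfun J (a + b)"
proof -
  from f obtain c where c: "f = (\<lambda>v. \<Sum>e\<in>J \<rightarrow>\<^sub>E {..a}. c e * (\<Prod>j\<in>J. v j ^ e j))" unfolding bounded_polyfun_def by blast
  from g obtain c' where c': "g = (\<lambda>v. \<Sum>e\<in>J \<rightarrow>\<^sub>E {..b}. c' e * (\<Prod>j\<in>J. v j ^ e j))" unfolding bounded_polyfun_def by blast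
  have "f v * g v = (\<Sum>e\<in>J \<rightarrow>\<^sub>E {..a}. \<Sum>e'\<in>J \<rightarrow>\<^sub>E {..b}. (c e * c' e') * (\<Prod>j\<in>J. v j ^ (e j + e' j)))" for v
    unfolding c c' sum_product by (intro sum.cong refl) (simp add: power_add prod.distrib mult_ac)
  moreover have "(\<lambda>v. \<Sum>e\<in>J \<rightarrow>\<^sub>E {..a}. \<Sum>e'\<in>J \<rightarrow>\<^sub>E {..b}. (c e * c' e') * (\<Prod>j\<in>J. v j ^ (e j + e' j))) \<in> bounded_polyfun J (a + b)"
    by (intro bounded_polyfun_sum bounded_polyfun_cmult bounded_polyfun_monomial J) (auto intro!: add_mono dest: PiE_mem)
  ultimately show ?thesis by simp
qed

lemma bounded_polyfun_const: "finite J \<Longrightarrow> (\<lambda>_. c) \<in> bounded_polyfun J d"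
  using bounded_polyfun_cmult[OF bounded_polyfun_monomial[of J "\<lambda>_. 0" d], of c] by simp

lemma bounded_polyfun_mono:
  assumes "finite J" "f \<in> bounded_polyfun J a" "a \<le> b" shows "f \<in> bounded_polyfun J b"
  using bounded_polyfun_mult[OF assms(1,2) bounded_polyfun_const[OF assms(1), of 1 "b - a"]] assms(3) by simp

lemma bounded_polyfun_power:
  assumes "finite J" "f \<in> bounded_polyfun J a" shows "(\<lambda>v. f v ^ n) \<in> bounded_polyfun J (a * n)"
  by (induction n) (use assms bounded_polyfun_const bounded_polyfun_mult in auto)

lemma bounded_polyfun_prod:
  assumes J: "finite J" and S: "finite S" and f: "\<And>i. i \<in> S \<Longrightarrow> f i \<in> bounded_polyfun J (a i)"
  shows "(\<lambda>v. \<Prod>i\<in>S. f i v) \<in> bounded_polyfun J (\<Sum>i\<in>S. a i)"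
  using S f by (induction S) (auto intro: bounded_polyfun_const[OF J] bounded_polyfun_mult[OF J])

lemma polyfun_bounded:
  assumes J: "finite J" and q: "q \<in> polyfun J"
  obtains d where "q \<in> bounded_polyfun J d"
proof -
  have "\<exists>d. q \<in> bounded_polyfun J d"
    using q
  proof induction
    case (const c)
    then show ?case using bounded_polyfun_const[OF J] by blast
  next
    case (coord i)
    have "(\<lambda>v :: nat \<Rightarrow> 'a. \<Prod>j\<in>J. v j ^ (if j = i then 1 else 0)) \<in> bounded_polyfun J 1"
      by (intro bounded_polyfun_monomial J) auto
    moreover have "(\<Prod>j\<in>J. v j ^ (if j = i then 1 else 0)) = v i" for v :: "nat \<Rightarrow> 'a"
      using J coord by (subst prod.cong[OF refl, of _ _ "\<lambda>j. if j = i then v j else 1"]) auto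
    ultimately have "(\<lambda>v :: nat \<Rightarrow> 'a. v i) \<in> bounded_polyfun J 1" by (simp only:)
    then show ?case by blast
  next
    case (add f g)
    then obtain a b where "f \<in> bounded_polyfun J a" "g \<in> bounded_polyfun J b" by blast
    then show ?case using bounded_polyfun_mono[OF J, of _ _ "max a b"] bounded_polyfun_add
      by (metis max.cobounded1 max.cobounded2)
  next
    case (mult f g)
    then show ?case using bounded_polyfun_mult[OF J] by blast
  qed
  then show ?thesis using that by blast
qed

lemma digits_sum: "(\<Sum>i<n. ((a div D ^ i) mod D) * D ^ i) = a mod D ^ n" for a D :: nat
proof (induction n)
  case (Suc n)
  have "a mod (D ^ n * D) = D ^ n * (a div D ^ n mod D) + a mod D ^ n" by (rule mod_mult2_eq)
  then show ?case using Suc by (simp add: mult.commute)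
qed simp

text \<open>Counting monomials: the \<open>D\<^sup>M\<close> monomials in \<open>M\<close> rational functions with exponents below \<open>D\<close>
  lie, after clearing denominators, in a space of dimension \<open>O(D\<^sup>N)\<close>.\<close>

lemma algebraic_dependence:
  fixes q :: "nat \<Rightarrow> (nat \<Rightarrow> 'k::alg_closed_field) \<Rightarrow> 'k"
  assumes J: "finite J" "card J < M" and q: "\<And>i. i < M \<Longrightarrow> q i \<in> polyfun J" and r: "r \<in> polyfun J"
  obtains Q where "Q \<in> polyfun {..<M}" "\<exists>v. Q v \<noteq> 0"
    "\<And>v. r v \<noteq> 0 \<Longrightarrow> Q (\<lambda>i. q i v / r v) = 0"
proof -
  define N where "N = card J"
  have "\<exists>d. f \<in> bounded_polyfun J d" if "f \<in> polyfun J" for f :: "(nat \<Rightarrow> 'k) \<Rightarrow> 'k"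
    using polyfun_bounded[OF J(1) that] by blast
  then obtain dg where dg: "\<And>f :: (nat \<Rightarrow> 'k) \<Rightarrow> 'k. f \<in> polyfun J \<Longrightarrow> f \<in> bounded_polyfun J (dg f)" by metis
  define \<delta> where "\<delta> = dg r + (\<Sum>i<M. dg (q i))"
  have "dg (q i) \<le> \<delta>" if "i < M" for i
    unfolding \<delta>_def using that member_le_sum[of i "{..<M}" "\<lambda>i. dg (q i)"] by auto
  then have q\<delta>: "q i \<in> bounded_polyfun J \<delta>" if "i < M" for i
    using bounded_polyfun_mono[OF J(1) dg[OF q[OF that]]] that by blast
  have r\<delta>: "r \<in> bounded_polyfun J \<delta>" using bounded_polyfun_mono[OF J(1) dg[OF r]] by (simp add: \<delta>_def)
  \<comment> \<open>Chosen so that the number of monomials is at most (C D)^N = C^N D^N, which is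
    below D^(N+1) because D exceeds C^N.\<close>
  define C where "C = \<delta> * M + 1"
  define D where "D = C ^ N + 1"
  have D: "D \<ge> 1" by (simp add: D_def)
  \<comment> \<open>Exponent vectors with entries below D are enumerated by the base-D digits of the
    numbers below D^M.\<close>
  define E where "E a i = (a div D ^ i) mod D" for a i :: nat
  have E: "E a i < D" for a i unfolding E_def using D by simp
  define mon where "mon a v = (\<Prod>i<M. q i v ^ E a i * r v ^ (D - E a i))" for a v
  have "mon a \<in> bounded_polyfun J (\<delta> * D * M)" for a
  proof -
    have "(\<lambda>v. q i v ^ E a i * r v ^ (D - E a i)) \<in> bounded_polyfun J (\<delta> * D)" if "i < M" for i
      using bounded_polyfun_mult[OF J(1) bounded_polyfun_power[OF J(1) q\<delta>[OF that], of "E a i"]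
          bounded_polyfun_power[OF J(1) r\<delta>, of "D - E a i"]] E[of a i]
      by (simp add: add_mult_distrib2[symmetric])
    then have "(\<lambda>v. \<Prod>i<M. q i v ^ E a i * r v ^ (D - E a i)) \<in> bounded_polyfun J (\<Sum>i<M. \<delta> * D)"
      by (intro bounded_polyfun_prod J) auto
    then show ?thesis by (simp add: mon_def[abs_def] mult.commute)
  qed
  then have "\<forall>a. \<exists>c. mon a = (\<lambda>v. \<Sum>e\<in>J \<rightarrow>\<^sub>E {..\<delta> * D * M}. c e * (\<Prod>j\<in>J. v j ^ e j))"
    unfolding bounded_polyfun_def by simp
  from choice[OF this] obtain c where
    c_all: "\<forall>a. mon a = (\<lambda>v. \<Sum>e\<in>J \<rightarrow>\<^sub>E {..\<delta> * D * M}. c a e * (\<Prod>j\<in>J. v j ^ e j))" ..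
  note c = spec[OF c_all]
  have fin: "finite (J \<rightarrow>\<^sub>E {..\<delta> * D * M})" using J by (intro finite_PiE) auto
  have "card (J \<rightarrow>\<^sub>E {..\<delta> * D * M}) = (\<delta> * D * M + 1) ^ N"
    using J by (simp add: card_PiE N_def Suc_eq_plus1)
  also have "\<dots> \<le> (C * D) ^ N"
    by (intro power_mono) (use D in \<open>simp_all add: C_def algebra_simps\<close>)
  also have "\<dots> < D ^ Suc N" using D by (simp add: power_mult_distrib D_def)
  also have "\<dots> \<le> D ^ M" using J(2) D by (intro power_increasing) (auto simp: N_def)
  finally have "card (J \<rightarrow>\<^sub>E {..\<delta> * D * M}) < card {..<D ^ M}" by simp
  then obtain x where x: "\<exists>a\<in>{..<D ^ M}. x a \<noteq> 0"
    "\<forall>e\<in>J \<rightarrow>\<^sub>E {..\<delta> * D * M}. (\<Sum>a\<in>{..<D ^ M}. x a * c a e) = 0"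
    using linear_dependence[OF fin _, of "{..<D ^ M}" c] by auto
  define Q where "Q v = (\<Sum>a<D ^ M. x a * (\<Prod>i<M. v i ^ E a i))" for v :: "nat \<Rightarrow> 'k"
  have "Q \<in> polyfun {..<M}" unfolding Q_def
    by (intro polyfun_sum polyfun_cmult polyfun_prod polyfun_power polyfun.coord) auto
  moreover have "\<exists>v. Q v \<noteq> 0"
  proof (rule ccontr)
    assume "\<nexists>v. Q v \<noteq> 0"
    then have Q0: "Q v = 0" for v by blast
    \<comment> \<open>Kronecker's substitution v_i = s^(D^i) sends distinct monomials to distinct
      powers of s, so a vanishing \<open>Q\<close> would have zero coefficients.\<close>
    define h where "h = (\<Sum>a<D ^ M. monom (x a) a)"
    have "poly h s = 0" for s
    proof -
      have "(\<Prod>i<M. (s ^ (D ^ i)) ^ E a i) = s ^ a" if "a < D ^ M" for a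
      proof -
        have "(\<Prod>i<M. (s ^ (D ^ i)) ^ E a i) = s ^ (\<Sum>i<M. E a i * D ^ i)"
          by (simp add: power_sum power_mult[symmetric] mult.commute)
        then show ?thesis using digits_sum[of a D M] that by (simp add: E_def)
      qed
      then have "poly h s = Q (\<lambda>i. s ^ (D ^ i))"
        unfolding h_def Q_def poly_sum poly_monom by (intro sum.cong) auto
      then show ?thesis using Q0 by simp
    qed
    then have "h = 0" using poly_eq_cofinite[of "{}" h 0] by simp
    moreover have "coeff h a = x a" if "a < D ^ M" for a
      unfolding h_def coeff_sum coeff_monom using that by (simp add: if_distrib)
    ultimately show False using x(1) by auto
  qed
  moreover have "Q (\<lambda>i. q i v / r v) = 0" if rv: "r v \<noteq> 0" for v
  proof -
    have "r v ^ (D * M) * (\<Prod>i<M. (q i v / r v) ^ E a i) = mon a v" for a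
    proof -
      have "r v ^ (D * M) = (\<Prod>i<M. r v ^ D)" by (simp add: power_mult)
      then have "r v ^ (D * M) * (\<Prod>i<M. (q i v / r v) ^ E a i) = (\<Prod>i<M. r v ^ D * (q i v / r v) ^ E a i)"
        by (simp add: prod.distrib)
      also have "\<dots> = mon a v" unfolding mon_def
      proof (intro prod.cong refl)
        fix i
        have "r v ^ D = r v ^ E a i * r v ^ (D - E a i)" using E[of a i] by (simp add: power_add[symmetric])
        then show "r v ^ D * (q i v / r v) ^ E a i = q i v ^ E a i * r v ^ (D - E a i)"
          using rv by (simp add: power_divide)
      qed
      finally show ?thesis .
    qed
    then have "r v ^ (D * M) * Q (\<lambda>i. q i v / r v) = (\<Sum>a<D ^ M. x a * mon a v)"
      unfolding Q_def sum_distrib_left by (intro sum.cong refl) (metis mult.left_commute)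
    also have "\<dots> = (\<Sum>a<D ^ M. \<Sum>e\<in>J \<rightarrow>\<^sub>E {..\<delta> * D * M}. x a * c a e * (\<Prod>j\<in>J. v j ^ e j))"
      unfolding c by (simp add: sum_distrib_left mult.assoc)
    also have "\<dots> = (\<Sum>e\<in>J \<rightarrow>\<^sub>E {..\<delta> * D * M}. (\<Sum>a<D ^ M. x a * c a e) * (\<Prod>j\<in>J. v j ^ e j))"
      by (subst sum.swap) (simp add: sum_distrib_right)
    also have "\<dots> = 0" using x(2) by simp
    finally show ?thesis using rv by simp
  qed
  ultimately show ?thesis using that by blast
qed

definition alg_indep :: "nat \<Rightarrow> (nat \<Rightarrow> 'x \<Rightarrow> 'k::field) \<Rightarrow> 'x set \<Rightarrow> bool" where
  "alg_indep n F X \<longleftrightarrow> (\<forall>Q\<in>polyfun {..<n}. (\<forall>x\<in>X. Q (\<lambda>i. F i x) = 0) \<longrightarrow> (\<forall>v. Q v = 0))"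

text \<open>At each step a function \<open>g\<close> that vanishes on the smaller set but not on the
  larger one is adjoined. A relation is divided by the highest power of its last variable, which
  irreducibility of the larger set permits; restricted to the smaller set, it becomes a relation
  among the earlier functions.\<close>

lemma chain_alg_indep:
  fixes X :: "nat \<Rightarrow> (nat \<Rightarrow> 'k::alg_closed_field) set"
  assumes ne: "X 0 \<noteq> {}"
    and irr: "\<And>i f g. i \<le> n \<Longrightarrow> f \<in> polyfun J \<Longrightarrow> g \<in> polyfun J \<Longrightarrow> \<forall>x\<in>X i. f x * g x = 0 \<Longrightarrow>
               (\<forall>x\<in>X i. f x = 0) \<or> (\<forall>x\<in>X i. g x = 0)"
    and sub: "\<And>i. i < n \<Longrightarrow> X i \<subseteq> X (Suc i)"
    and strict: "\<And>i. i < n \<Longrightarrow> \<exists>g\<in>polyfun J. (\<forall>x\<in>X i. g x = 0) \<and> (\<exists>x\<in>X (Suc i). g x \<noteq> 0)"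
  shows "\<exists>F. (\<forall>i. F i \<in> polyfun J) \<and> alg_indep n F (X n)"
  using irr sub strict
proof (induction n)
  case 0
  have "alg_indep 0 (\<lambda>_ _. 0 :: 'k) (X 0)"
    unfolding alg_indep_def
  proof (intro ballI impI allI)
    fix Q :: "(nat \<Rightarrow> 'k) \<Rightarrow> 'k" and v assume Q: "Q \<in> polyfun {..<0}" "\<forall>x\<in>X 0. Q (\<lambda>i. 0) = 0"
    then show "Q v = 0" using ne polyfun_cong[OF Q(1), of v "\<lambda>_. 0"] by auto
  qed
  then show ?case by (intro exI[of _ "\<lambda>_ _. 0"]) (simp add: polyfun.const)
next
  case (Suc n)
  have "\<exists>F. (\<forall>i. F i \<in> polyfun J) \<and> alg_indep n F (X n)"
    by (rule Suc.IH) (use Suc.prems in \<open>auto simp del: split_paired_Ex\<close>)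
  then obtain F where F: "\<And>i. F i \<in> polyfun J" "alg_indep n F (X n)" by blast
  obtain g where g: "g \<in> polyfun J" "\<forall>x\<in>X n. g x = 0" "\<exists>x\<in>X (Suc n). g x \<noteq> 0"
    using Suc.prems(3)[of n] by auto
  define F' where "F' = F(n := g)"
  have "alg_indep (Suc n) F' (X (Suc n))"
    unfolding alg_indep_def
  proof (intro ballI impI allI, rule ccontr)
    fix Q v0 assume Q: "Q \<in> polyfun {..<Suc n}" "\<forall>x\<in>X (Suc n). Q (\<lambda>i. F' i x) = 0" and v0: "Q v0 \<noteq> 0"
    obtain H where H: "H \<in> poly_family (polyfun {..<n})" "\<And>v. poly (H v) (v n) = Q v"
      using polyfun_insert_decomp[of Q n "{..<n}"] Q(1) by (auto simp: lessThan_Suc)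
    have H_cong: "H v = H w" if "\<And>i. i < n \<Longrightarrow> v i = w i" for v w
      by (rule poly_eqI) (rule polyfun_cong[OF poly_family_coeff[OF H(1)]], use that in auto)
    obtain N where N: "\<And>v. degree (H v) \<le> N" using poly_family_degree[OF H(1)] by blast
    \<comment> \<open>The lowest power of the last variable that occurs; after division by it the
      constant term in this variable is a nonzero polynomial.\<close>
    define l where "l = (LEAST l. \<exists>v. coeff (H v) l \<noteq> 0)"
    have "H v0 \<noteq> 0" using H(2)[of v0] v0 by auto
    then have "\<exists>v. coeff (H v) (degree (H v0)) \<noteq> 0" by (intro exI[of _ v0]) simp
    then have l: "\<exists>v. coeff (H v) l \<noteq> 0" unfolding l_def by (rule LeastI)
    have l_min: "coeff (H v) i = 0" if "i < l" for v i
      using not_less_Least[of i "\<lambda>l. \<exists>v. coeff (H v) l \<noteq> 0"] that unfolding l_def by blast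
    define G where "G v = (\<Sum>i\<le>N. coeff (H v) (l + i) * v n ^ i)" for v
    have QG: "Q v = v n ^ l * G v" for v
    proof -
      have "Q v = (\<Sum>i\<le>l+N. coeff (H v) i * v n ^ i)"
        unfolding H(2)[symmetric] poly_altdef using N[of v]
        by (intro sum.mono_neutral_left) (auto simp: coeff_eq_0)
      also have "\<dots> = (\<Sum>i\<in>{l..l+N}. coeff (H v) i * v n ^ i)"
        by (intro sum.mono_neutral_right) (auto simp: l_min)
      also have "\<dots> = (\<Sum>i\<in>{0..N}. coeff (H v) (i + l) * v n ^ (i + l))"
        using sum.shift_bounds_cl_nat_ivl[of "\<lambda>i. coeff (H v) i * v n ^ i" 0 l N] by (simp add: add.commute)
      also have "\<dots> = v n ^ l * G v"
        unfolding G_def sum_distrib_left atMost_atLeast0 by (intro sum.cong) (auto simp: power_add add.commute mult_ac)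
      finally show ?thesis .
    qed
    have F'J: "F' i \<in> polyfun J" for i using F(1) g(1) by (simp add: F'_def)
    have GJ: "(\<lambda>x. G (\<lambda>i. F' i x)) \<in> polyfun J"
      unfolding G_def
      by (intro polyfun_sum polyfun.mult polyfun_power F'J
          polyfun_subst[OF fun_algebra_polyfun poly_family_coeff[OF H(1)]])
    have gl: "(\<lambda>x. g x ^ l) \<in> polyfun J" by (intro polyfun_power g)
    have "\<forall>x\<in>X (Suc n). g x ^ l * G (\<lambda>i. F' i x) = 0" using Q(2) by (simp add: QG F'_def)
    then have "(\<forall>x\<in>X (Suc n). g x ^ l = 0) \<or> (\<forall>x\<in>X (Suc n). G (\<lambda>i. F' i x) = 0)"
      using Suc.prems(1)[OF _ gl GJ] by blast
    then have G0: "\<forall>x\<in>X (Suc n). G (\<lambda>i. F' i x) = 0" using g(3) by auto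
    have "coeff (H (\<lambda>i. F i x)) l = 0" if x: "x \<in> X n" for x
    proof -
      have "G (\<lambda>i. F' i x) = 0" using G0 Suc.prems(2)[of n] x by auto
      moreover have "G (\<lambda>i. F' i x) = (\<Sum>i\<le>N. if i = 0 then coeff (H (\<lambda>i. F' i x)) l else 0)"
        unfolding G_def using g(2) x by (intro sum.cong) (auto simp: F'_def power_0_left)
      moreover have "H (\<lambda>i. F' i x) = H (\<lambda>i. F i x)" by (rule H_cong) (simp add: F'_def)
      ultimately show ?thesis by simp
    qed
    then have "\<forall>v. coeff (H v) l = 0"
      using bspec[OF F(2)[unfolded alg_indep_def] poly_family_coeff[OF H(1), of l]] by simp
    then show False using l by blast
  qed
  moreover have "F' i \<in> polyfun J" for i using F(1) g(1) by (simp add: F'_def)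
  ultimately show ?case by blast
qed

text \<open>Consider the form of lowest degree in the Taylor expansion at \<open>z\<close>.\<close>

lemma polyfun_zero_on_curves:
  fixes Q :: "(nat \<Rightarrow> 'k::alg_closed_field) \<Rightarrow> 'k"
  assumes Q: "Q \<in> polyfun I"
    and curve: "\<And>w. \<exists>r E. finite E \<and> (\<forall>s. s \<notin> E \<longrightarrow> Q (\<lambda>i. z i + s * w i + s\<^sup>2 * poly (r i) s) = 0)"
  shows "Q v = 0"
proof -
  have "(\<lambda>y. [:z i, (y::nat\<Rightarrow>'k) i:]) \<in> poly_family (polyfun I)" if "i \<in> I" for i
  proof -
    have "(\<lambda>y::nat\<Rightarrow>'k. coeff [:z i, y i:] j) \<in> polyfun I" for j
      using that by (cases j; cases "j - 1") (auto simp: polyfun.const coeff_pCons intro: polyfun.coord split: nat.split)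
    then show ?thesis by (auto simp: poly_family_def intro!: exI[of _ 1])
  qed
  then obtain G where G: "G \<in> poly_family (polyfun I)"
    "\<And>y s. poly (G y) s = Q (\<lambda>i. poly [:z i, y i:] s)"
    using polyfun_poly_family[OF fun_algebra_polyfun[of I] Q, where F = "\<lambda>i y. [:z i, y i:]"] by blast
  obtain N where N: "\<And>y. degree (G y) \<le> N" using poly_family_degree[OF G(1)] by blast
  have zero: "coeff (G w) d = 0" for w d
  proof (induction d arbitrary: w rule: less_induct)
    case (less d)
    obtain r E where E: "finite E" "\<And>s. s \<notin> E \<Longrightarrow> Q (\<lambda>i. z i + s * w i + s\<^sup>2 * poly (r i) s) = 0"
      using curve[of w] by blast
    \<comment> \<open>The curve is z + s y(s) with y(0) = w, so that the coefficient of index d of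
      \<open>G (y s)\<close> is the form of degree d evaluated at y(s).\<close>
    define y where "y s = (\<lambda>i. poly ([:w i:] + [:0, 1:] * r i) s)" for s
    have "\<exists>h. \<forall>s. poly h s = coeff (G (y s)) j" for j
      unfolding y_def
      using polyfun_along_curve[OF poly_family_coeff[OF G(1), of j], of "\<lambda>i. [:w i:] + [:0, 1:] * r i"] by metis
    then obtain h where h: "\<And>j s. poly (h j) s = coeff (G (y s)) j" by metis
    define H where "H = (\<Sum>j\<le>N. h (d + j) * monom 1 j)"
    have "poly H s = 0" if s: "s \<notin> insert 0 E" for s
    proof -
      have "Q (\<lambda>i. poly [:z i, y s i:] s) = Q (\<lambda>i. z i + s * w i + s\<^sup>2 * poly (r i) s)"
        by (intro arg_cong[of _ _ Q] ext) (simp add: y_def algebra_simps power2_eq_square)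
      then have "poly (G (y s)) s = 0" using E(2)[of s] s by (simp add: G(2))
      moreover have "poly (G (y s)) s = (\<Sum>i\<le>d+N. coeff (G (y s)) i * s ^ i)"
        unfolding poly_altdef using N[of "y s"] by (intro sum.mono_neutral_left) (auto simp: coeff_eq_0)
      moreover have "\<dots> = (\<Sum>i\<in>{d..d+N}. coeff (G (y s)) i * s ^ i)"
        by (intro sum.mono_neutral_right) (auto simp: less)
      moreover have "\<dots> = (\<Sum>i\<in>{0..N}. coeff (G (y s)) (i + d) * s ^ (i + d))"
        using sum.shift_bounds_cl_nat_ivl[of "\<lambda>i. coeff (G (y s)) i * s ^ i" 0 d N] by (simp add: add.commute)
      moreover have "\<dots> = s ^ d * poly H s"
        unfolding H_def poly_sum sum_distrib_left atMost_atLeast0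
        by (intro sum.cong) (auto simp: h poly_monom power_add add.commute mult_ac)
      ultimately show ?thesis using s by simp
    qed
    \<comment> \<open>After division by s^d, the value at s = 0 is the form of degree d at the
      arbitrary vector \<open>w\<close>.\<close>
    then have "H = 0" using poly_eq_cofinite[of "insert 0 E" H 0] E(1) by simp
    then have "0 = poly H 0" by simp
    also have "\<dots> = (\<Sum>j\<le>N. if j = 0 then poly (h d) 0 else 0)"
      unfolding H_def poly_sum by (intro sum.cong) (auto simp: poly_monom power_0_left)
    also have "\<dots> = coeff (G (y 0)) d" by (simp add: h)
    also have "y 0 = w" by (simp add: y_def)
    finally show ?case by simp
  qed
  have "G y = 0" for y using zero by (simp add: poly_eq_iff)
  then have "Q (\<lambda>i. poly [:z i, v i - z i:] 1) = 0" using G(2)[of "\<lambda>i. v i - z i" 1] by simp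
  then show ?thesis by simp
qed

section \<open>Upper bound for the dimension of the quotients\<close>

text \<open>The jets of the series whose derivative has order at least \<open>m\<close>.\<close>

definition flat_jets :: "nat \<Rightarrow> nat \<Rightarrow> (nat \<Rightarrow> 'k::field) set" where
  "flat_jets k m = {v \<in> affine_points {1..k}. \<forall>i\<le>m. of_nat i * v i = 0}"

lemma deriv_order_iff: "(\<forall>j<m. fps_deriv g $ j = 0) \<longleftrightarrow> (\<forall>i\<le>m. of_nat i * g $ i = (0::'k::field))"
proof -
  have "fps_deriv g $ j = of_nat (Suc j) * g $ Suc j" for j
    by (simp only: fps_deriv_nth Suc_eq_plus1)
  then have "(\<forall>j<m. fps_deriv g $ j = 0) \<longleftrightarrow> (\<forall>j<m. of_nat (Suc j) * g $ Suc j = 0)" by simp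
  also have "\<dots> \<longleftrightarrow> (\<forall>i\<le>m. of_nat i * g $ i = 0)"
  proof (intro iffI allI impI)
    fix i assume "\<forall>j<m. of_nat (Suc j) * g $ Suc j = 0" "i \<le> m"
    then show "of_nat i * g $ i = 0" by (cases i) auto
  qed (simp add: Suc_leI del: of_nat_Suc)
  finally show ?thesis .
qed

text \<open>Chain rule: the derivative of g o \<open>\<phi>\<close> contains the factor
  \<open>\<phi> ^ m\<close>, and \<open>\<phi>\<close> is divisible by x.\<close>

lemma deriv_order_compose:
  fixes g :: "'k::field fps"
  assumes g: "\<forall>i\<le>m. of_nat i * g $ i = 0" and \<phi>: "\<phi> $ 0 = 0"
  shows "\<forall>i\<le>m. of_nat i * (g oo \<phi>) $ i = 0"
proof -
  have "\<forall>j<m. fps_deriv g $ j = 0" using g deriv_order_iff by blast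
  then obtain h where h: "fps_deriv g = fps_X ^ m * h" using X_power_dvd_iff[of m "fps_deriv g"] by (auto simp: dvd_def)
  have "fps_deriv (g oo \<phi>) = (fps_deriv g oo \<phi>) * fps_deriv \<phi>" using \<phi> by (rule fps_compose_deriv)
  also have "fps_deriv g oo \<phi> = \<phi> ^ m * (h oo \<phi>)"
    using \<phi> by (simp add: h fps_compose_mult_distrib fps_compose_power[symmetric] fps_X_fps_compose_startby0)
  finally have eq: "fps_deriv (g oo \<phi>) = \<phi> ^ m * ((h oo \<phi>) * fps_deriv \<phi>)" by (simp add: mult.assoc)
  have "fps_X dvd \<phi>" using \<phi> by (simp add: X_dvd_iff)
  then have "fps_X ^ m dvd fps_deriv (g oo \<phi>)" unfolding eq by (intro dvd_mult2 dvd_power_same)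
  then have "\<forall>j<m. fps_deriv (g oo \<phi>) $ j = 0" by (simp only: X_power_dvd_iff)
  then show ?thesis by (simp only: deriv_order_iff)
qed

lemma jet_invariant_flat_jets: "jet_invariant k (flat_jets k m :: (nat \<Rightarrow> 'k::field) set)"
  unfolding jet_invariant_def
proof (intro conjI ballI allI impI)
  fix v :: "nat \<Rightarrow> 'k" and \<phi> :: "'k fps" assume v: "v \<in> flat_jets k m" and \<phi>: "coord_change \<phi>"
  have "\<forall>i\<le>m. of_nat i * (Abs_fps v oo \<phi>) $ i = 0"
    using v \<phi> by (intro deriv_order_compose) (auto simp: flat_jets_def coord_changeD)
  then show "jet_subst k \<phi> v \<in> flat_jets k m"
    by (simp add: flat_jets_def jet_subst_def) (simp add: jet_def)
qed (auto simp: flat_jets_def)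

lemma closedin_flat_jets: "closedin (zariski {1..k}) (flat_jets k m :: (nat \<Rightarrow> 'k::field) set)"
proof -
  have "flat_jets k m = (\<Inter>i\<in>{0..m}. {v \<in> affine_points {1..k}. of_nat i * v i = (0::'k)})"
    by (auto simp: flat_jets_def)
  moreover have "closedin (zariski {1..k}) {v \<in> affine_points {1..k}. of_nat i * v i = (0::'k)}" for i
  proof (cases "i \<in> {1..k}")
    case True
    then show ?thesis by (intro closedin_zariski_zero polyfun_cmult polyfun.coord)
  next
    case False
    then have "{v \<in> affine_points {1..k}. of_nat i * v i = (0::'k)} = topspace (zariski {1..k})"
      by (auto simp: affine_points_def)
    then show ?thesis by (simp only: closedin_topspace)
  qed
  ultimately show ?thesis by (auto intro!: closedin_INT)
qed

text \<open>Since \<open>g(x + s \<eta>) = g + s g' \<eta> + s\<^sup>2(\<dots>)\<close> and \<open>g'\<close> has order \<open>m\<close>, the orbit of \<open>g\<close> contains curves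
  with any prescribed velocity in the coordinates of index larger than \<open>m\<close>.\<close>

lemma orbit_curve:
  fixes v w :: "nat \<Rightarrow> 'k::field"
  assumes v: "v \<in> flat_jets k m" and m: "m < k" "of_nat (Suc m) * v (Suc m) \<noteq> 0"
  obtains \<eta> \<rho> where "\<eta> $ 0 = 0"
    "\<And>s n. n \<in> {Suc m..k} \<Longrightarrow> jet_subst k (fps_X + fps_const s * \<eta>) v n = v n + s * w n + s\<^sup>2 * poly (\<rho> n) s"
proof -
  define g where "g = Abs_fps v"
  have "\<forall>j<m. fps_deriv g $ j = 0" unfolding deriv_order_iff using v by (simp add: flat_jets_def g_def)
  then obtain u where u: "fps_deriv g = fps_X ^ m * u" using X_power_dvd_iff[of m "fps_deriv g"] by (auto simp: dvd_def)
  have "u $ 0 = fps_deriv g $ m" by (simp add: u fps_X_power_mult_nth)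
  also have "\<dots> = of_nat (Suc m) * v (Suc m)" by (simp only: fps_deriv_nth g_def fps_nth_Abs_fps Suc_eq_plus1)
  finally have u0: "u $ 0 \<noteq> 0" using m(2) by simp
  \<comment> \<open>With g' = x^m u, dividing by the unit u makes g' \<open>\<eta>\<close> = x^m W,
    whose coefficients of index above m are those of \<open>w\<close>.\<close>
  define W where "W = Abs_fps (\<lambda>i. if i = 0 then 0 else w (m + i))"
  define \<eta> where "\<eta> = W * inverse u"
  have \<eta>0: "\<eta> $ 0 = 0" by (simp add: \<eta>_def W_def)
  have g'\<eta>: "(fps_deriv g * \<eta>) $ n = w n" if "n \<ge> Suc m" for n
  proof -
    have "fps_deriv g * \<eta> = fps_X ^ m * W * (u * inverse u)" by (simp add: u \<eta>_def mult_ac)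
    also have "u * inverse u = 1" using u0 by (rule inverse_mult_eq_1')
    finally show ?thesis using that by (simp add: fps_X_power_mult_nth W_def)
  qed
  define q where "q j n = (\<Sum>l\<le>j. monom (of_nat (j choose l) * (\<eta> ^ l * fps_X ^ (j - l)) $ n) l)" for j n
  have q: "poly (q j n) s = ((fps_X + fps_const s * \<eta>) ^ j) $ n" for j n s
  proof -
    have "(fps_const s * \<eta> + fps_X) ^ j = (\<Sum>l\<le>j. of_nat (j choose l) * (fps_const s * \<eta>) ^ l * fps_X ^ (j - l))"
      by (rule binomial_ring)
    also have "\<dots> = (\<Sum>l\<le>j. fps_const (of_nat (j choose l) * s ^ l) * (\<eta> ^ l * fps_X ^ (j - l)))"
      by (intro sum.cong refl) (simp add: power_mult_distrib fps_const_power fps_of_nat[symmetric] mult_ac flip: fps_const_mult)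
    finally have "((fps_X + fps_const s * \<eta>) ^ j) $ n = (\<Sum>l\<le>j. (of_nat (j choose l) * s ^ l) * (\<eta> ^ l * fps_X ^ (j - l)) $ n)"
      by (simp only: add.commute[of fps_X] fps_sum_nth fps_mult_left_const_nth)
    then show ?thesis by (simp add: q_def poly_sum poly_monom mult_ac)
  qed
  have q0: "coeff (q j n) 0 = (if n = j then 1 else 0)" for j n
    using q[of j n 0] by (simp add: poly_0_coeff_0 fps_X_power_nth)
  have q1: "coeff (q j n) 1 = of_nat j * (\<eta> * fps_X ^ (j - 1)) $ n" for j n
  proof -
    have "coeff (q j n) 1 = (\<Sum>l\<le>j. if l = 1 then of_nat j * (\<eta> * fps_X ^ (j - 1)) $ n else 0)"
      unfolding q_def coeff_sum by (intro sum.cong) (auto simp: One_nat_def)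
    then show ?thesis by (cases j) auto
  qed
  define r where "r n = (\<Sum>j=0..n. smult (v j) (q j n))" for n
  have r: "poly (r n) s = jet_subst k (fps_X + fps_const s * \<eta>) v n" if "n \<in> {1..k}" for n s
    by (simp add: r_def poly_sum q jet_subst_nth[OF that])
  have r0: "coeff (r n) 0 = v n" for n
    unfolding r_def coeff_sum coeff_smult q0 by (simp add: if_distrib cong: if_cong)
  \<comment> \<open>The part linear in s of g(x + s \<open>\<eta>\<close>) is g'
    \<open>\<eta>\<close>, obtained here as a convolution of coefficients.\<close>
  have r1: "coeff (r n) 1 = w n" if n: "n \<ge> Suc m" for n
  proof -
    have n0: "n = Suc (n - 1)" using n by simp
    have "coeff (r n) 1 = (\<Sum>j=0..n. v j * (of_nat j * (\<eta> * fps_X ^ (j - 1)) $ n))"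
      unfolding r_def coeff_sum coeff_smult q1 ..
    also have "\<dots> = (\<Sum>j=Suc 0..Suc (n - 1). v j * (of_nat j * (\<eta> * fps_X ^ (j - 1)) $ n))"
      using n0 by (subst sum.atLeast_Suc_atMost) auto
    also have "\<dots> = (\<Sum>i=0..n - 1. v (Suc i) * (of_nat (Suc i) * (\<eta> * fps_X ^ i) $ n))"
      by (subst sum.shift_bounds_cl_Suc_ivl) simp
    also have "\<dots> = (\<Sum>i=0..n - 1. fps_deriv g $ i * \<eta> $ (n - i))"
    proof (intro sum.cong refl)
      fix i assume i: "i \<in> {0..n - 1}"
      have "fps_deriv g $ i = of_nat (Suc i) * v (Suc i)"
        by (simp only: fps_deriv_nth g_def fps_nth_Abs_fps Suc_eq_plus1)
      moreover have "(\<eta> * fps_X ^ i) $ n = \<eta> $ (n - i)"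
        using i n0 by (simp add: fps_X_power_mult_right_nth)
      ultimately show "v (Suc i) * (of_nat (Suc i) * (\<eta> * fps_X ^ i) $ n) = fps_deriv g $ i * \<eta> $ (n - i)"
        by (simp only: mult_ac)
    qed
    also have "\<dots> = (fps_deriv g * \<eta>) $ n"
      unfolding fps_mult_nth using n0 \<eta>0 by (subst (2) n0, subst sum.atLeast0_atMost_Suc) simp
    finally show ?thesis using g'\<eta>[OF n] by simp
  qed
  have split: "\<exists>\<rho>. \<forall>s. poly f s = coeff f 0 + s * coeff f 1 + s\<^sup>2 * poly \<rho> s" for f :: "'k poly"
  proof -
    obtain a f1 where f: "f = pCons a f1" by (cases f)
    obtain b f2 where f1: "f1 = pCons b f2" by (cases f1)
    show ?thesis by (rule exI[of _ f2]) (simp add: f f1 One_nat_def power2_eq_square algebra_simps)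
  qed
  have "\<forall>n. \<exists>\<rho>. \<forall>s. poly (r n) s = coeff (r n) 0 + s * coeff (r n) 1 + s\<^sup>2 * poly \<rho> s"
    using split by blast
  from choice[OF this] obtain \<rho> where
    \<rho>: "\<forall>n. \<forall>s. poly (r n) s = coeff (r n) 0 + s * coeff (r n) 1 + s\<^sup>2 * poly (\<rho> n) s" ..
  show ?thesis
  proof (rule that[OF \<eta>0, of \<rho>])
    fix s n assume n: "n \<in> {Suc m..k}"
    then have "n \<in> {1..k}" by simp
    from r[OF this, of s] show "jet_subst k (fps_X + fps_const s * \<eta>) v n = v n + s * w n + s\<^sup>2 * poly (\<rho> n) s"
      using spec[OF spec[OF \<rho>], of n s] r0[of n] r1[of n] n by simp
  qed
qed

lemma irreducible_closed_meet:
  assumes Z: "irreducible_closed T Z" and U: "openin T U" "U \<inter> Z \<noteq> {}" and V: "openin T V" "V \<inter> Z \<noteq> {}"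
  shows "U \<inter> V \<inter> Z \<noteq> {}"
proof
  assume "U \<inter> V \<inter> Z = {}"
  then have "Z = (Z - U) \<union> (Z - V)" by blast
  moreover have "closedin T Z" using Z by (simp add: irreducible_closed_def)
  then have "closedin T (Z - U)" "closedin T (Z - V)" using U V by (auto intro: closedin_diff)
  ultimately have "Z = Z - U \<or> Z = Z - V" using Z unfolding irreducible_closed_def by blast
  then show False using U V by blast
qed

text \<open>For an arbitrary quotient nothing is known but its universal properties and affine
  charts; pulled back to jets, chart functions become fractions of polynomials near each
  point.\<close>

lemma quotient_locally_rational:
  fixes A :: "(nat \<Rightarrow> 'k::field) set"
  assumes A: "A \<subseteq> affine_points {1..k}"
    and gq: "geometric_quotient H act (induced_space (jet_space k) A) Y pr"
    and V: "openin (topol Y) V"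
    and P: "is_morphism (induced_space Y V) (induced_space (affine_space I) C) P"
    and C: "C \<subseteq> affine_points I"
    and f: "f \<in> polyfun I" and x: "x \<in> A" "pr x \<in> V"
  obtains q r G where "q \<in> polyfun {1..k}" "r \<in> polyfun {1..k}" "openin (zariski {1..k}) G" "x \<in> G"
    "\<And>w. w \<in> G \<Longrightarrow> w \<in> A \<Longrightarrow> pr w \<in> V \<and> r w \<noteq> 0 \<and> f (P (pr w)) = q w / r w"
proof -
  let ?X = "induced_space (jet_space k) A"
  have topX: "topol ?X = subtopology (zariski {1..k}) A"
    by (simp add: induced_space_def jet_space_def affine_space_def)
  have ptsX: "points ?X = A" using A by (auto simp: topX)
  have topC: "topol (induced_space (affine_space I) C) = subtopology (zariski I) C"
    by (simp add: induced_space_def affine_space_def)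
  have topV: "topol (induced_space Y V) = subtopology (topol Y) V" by (simp add: induced_space_def)
  have VY: "V \<subseteq> points Y" by (rule openin_subset[OF V])
  have "topspace (subtopology (zariski I) C) = C" using C by (auto simp: inf_absorb2)
  then have oC: "openin (subtopology (zariski I) C) C" by (metis openin_topspace)
  have "f \<in> regular (induced_space (affine_space I) C) C"
    unfolding regular_induced_affine_iff[OF oC]
    using f by (intro ballI bexI[of _ f] bexI[of _ "\<lambda>_. 1"]) (auto intro: polyfun.const)
  moreover have "{y \<in> points (induced_space Y V). P y \<in> C} = V"
  proof -
    have "P \<in> topspace (subtopology (topol Y) V) \<rightarrow> topspace (subtopology (zariski I) C)"
      using P unfolding is_morphism_def topC topV continuous_map_def by blast
    then show ?thesis using VY by (auto simp: topV)
  qed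
  ultimately have fP: "f \<circ> P \<in> regular (induced_space Y V) V"
    using P oC unfolding is_morphism_def topC by (metis (no_types, lifting))
  then obtain W \<psi> where W: "openin (topol Y) W" "pr x \<in> W" "\<psi> \<in> regular Y W" "\<forall>y\<in>W \<inter> V. (f \<circ> P) y = \<psi> y"
    using x(2) by (auto simp: induced_space_def)
  have mor: "is_morphism ?X Y pr" using gq by (simp add: geometric_quotient_def)
  let ?W = "{z \<in> points ?X. pr z \<in> W}" and ?V = "{z \<in> points ?X. pr z \<in> V}"
  have oW: "openin (subtopology (zariski {1..k}) A) ?W" "openin (subtopology (zariski {1..k}) A) ?V"
    using mor W(1) V unfolding is_morphism_def continuous_map_def topX by blast+
  have "\<psi> \<circ> pr \<in> regular ?X ?W" using mor W(1,3) unfolding is_morphism_def by blast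
  then have "\<forall>a\<in>?W. \<exists>q\<in>polyfun {1..k}. \<exists>r\<in>polyfun {1..k}. r a \<noteq> 0 \<and> (\<forall>w\<in>?W. r w \<noteq> 0 \<longrightarrow> (\<psi> \<circ> pr) w = q w / r w)"
    unfolding jet_space_def regular_induced_affine_iff[OF oW(1)[unfolded jet_space_def]] .
  moreover have "x \<in> ?W" using x W(2) ptsX by simp
  ultimately obtain q r where qr: "q \<in> polyfun {1..k}" "r \<in> polyfun {1..k}" "r x \<noteq> 0"
    "\<forall>w\<in>?W. r w \<noteq> 0 \<longrightarrow> (\<psi> \<circ> pr) w = q w / r w" by blast
  obtain G1 where G1: "openin (zariski {1..k}) G1" "?W = G1 \<inter> A" using oW(1) by (auto simp: openin_subtopology)
  obtain G2 where G2: "openin (zariski {1..k}) G2" "?V = G2 \<inter> A" using oW(2) by (auto simp: openin_subtopology)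
  define G where "G = G1 \<inter> G2 \<inter> {w \<in> affine_points {1..k}. r w \<noteq> 0}"
  have "openin (zariski {1..k}) G" unfolding G_def by (intro openin_Int G1 G2 openin_zariski_nonzero qr)
  moreover have "x \<in> G" using x W(2) qr(3) A ptsX G1(2) G2(2) unfolding G_def by blast
  moreover have "pr w \<in> V \<and> r w \<noteq> 0 \<and> f (P (pr w)) = q w / r w" if w: "w \<in> G" "w \<in> A" for w
  proof -
    have "w \<in> ?W" "w \<in> ?V" "r w \<noteq> 0" using w G1(2) G2(2) unfolding G_def by blast+
    then show ?thesis using W(4) qr(4) by auto
  qed
  ultimately show ?thesis using that qr(1,2) by blast
qed

text \<open>The set indexes the coordinates that are free on \<open>flat_jets k m\<close> in
  characteristic \<open>p\<close>, so the number is the dimension of this space.\<close>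

lemma card_flat_coordinates:
  assumes "p > 0" "m \<le> k"
  shows "card ({1..k} - {i. i \<le> m \<and> \<not> p dvd i}) = (k - m) + m div p"
proof -
  have "{1..k} - {i. i \<le> m \<and> \<not> p dvd i} = {m<..k} \<union> (\<lambda>j. j * p) ` {1..m div p}"
  proof (intro equalityI subsetI)
    fix i assume i: "i \<in> {1..k} - {i. i \<le> m \<and> \<not> p dvd i}"
    show "i \<in> {m<..k} \<union> (\<lambda>j. j * p) ` {1..m div p}"
    proof (cases "i \<le> m")
      case True
      then have "p dvd i" using i by auto
      then obtain j where j: "i = j * p" by (metis dvdE mult.commute)
      then have "j \<le> m div p" using True assms by (simp add: less_eq_div_iff_mult_less_eq)
      moreover have "j \<ge> 1" using i j by (cases j) auto
      ultimately show ?thesis using j by auto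
    qed (use i in auto)
  next
    fix i assume "i \<in> {m<..k} \<union> (\<lambda>j. j * p) ` {1..m div p}"
    then show "i \<in> {1..k} - {i. i \<le> m \<and> \<not> p dvd i}"
    proof
      assume "i \<in> (\<lambda>j. j * p) ` {1..m div p}"
      then obtain j where "i = j * p" "j \<in> {1..m div p}" by blast
      then have j: "i = j * p" "1 \<le> j" "j \<le> m div p" by simp_all
      then have "i \<le> m" using assms by (simp add: less_eq_div_iff_mult_less_eq)
      moreover have "i \<ge> 1" using j assms by (cases i) auto
      ultimately show ?thesis using j assms by auto
    qed auto
  qed
  moreover have "{m<..k} \<inter> (\<lambda>j. j * p) ` {1..m div p} = {}"
    using assms by (auto simp: less_eq_div_iff_mult_less_eq)
  moreover have "card ((\<lambda>j. j * p) ` {1..m div p}) = m div p"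
    using assms by (subst card_image) (auto intro: inj_onI)
  ultimately show ?thesis by (simp add: card_Un_disjoint)
qed

text \<open>Polynomials in \<open>n\<close> independent functions of the quotient and in the coordinates of index larger
  than \<open>m\<close> do not vanish on an open part of a set of jets \<open>v\<close> with \<open>\<mu>(v) = m\<close>, so \<open>n\<close> is at most the
  number of the other coordinates.\<close>

lemma invariant_functions_bound:
  fixes A :: "(nat \<Rightarrow> 'k::alg_closed_field) set" and F :: "nat \<Rightarrow> (nat \<Rightarrow> 'k) \<Rightarrow> 'k"
  assumes p: "CHAR('k) = p" "prime p"
    and A: "jet_invariant k A" "A \<subseteq> flat_jets k m" and m: "m < k"
    and x: "x \<in> A" "of_nat (Suc m) * x (Suc m) \<noteq> 0"
    and G: "openin (zariski {1..k}) G" "x \<in> G"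
    and qr: "\<And>i. i < n \<Longrightarrow> q i \<in> polyfun {1..k}" "r \<in> polyfun {1..k}"
    and F: "\<And>w i. w \<in> G \<Longrightarrow> w \<in> A \<Longrightarrow> i < n \<Longrightarrow> r w \<noteq> 0 \<and> F i w = q i w / r w"
    and F_inv: "\<And>i w \<phi>. w \<in> A \<Longrightarrow> coord_change \<phi> \<Longrightarrow> F i (jet_subst k \<phi> w) = F i w"
    and r: "\<And>w. w \<in> G \<Longrightarrow> w \<in> A \<Longrightarrow> r w \<noteq> 0"
    and indep: "alg_indep n F {w \<in> A. w \<in> G \<and> of_nat (Suc m) * w (Suc m) \<noteq> 0}"
  shows "n \<le> m div p"
proof (rule ccontr)
  assume "\<not> n \<le> m div p"
  define J where "J = {1..k} - {i. i \<le> m \<and> \<not> p dvd i}"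
  define M where "M = n + (k - m)"
  have J: "finite J" by (simp add: J_def)
  have "p > 0" using p(2) by (simp add: prime_gt_0_nat)
  then have "card J = (k - m) + m div p" unfolding J_def using m by (intro card_flat_coordinates) auto
  then have JM: "card J < M" using \<open>\<not> n \<le> m div p\<close> by (simp add: M_def)
  \<comment> \<open>Setting the coordinates that vanish on \<open>A\<close> to zero leaves functions
    of the coordinates in \<open>J\<close> only, which lowers the number of variables in the
    count.\<close>
  define res where "res f v = f (\<lambda>i. if i \<in> J then v i else 0)" for f :: "(nat \<Rightarrow> 'k) \<Rightarrow> 'k" and v
  have res_poly: "res f \<in> polyfun J" if "f \<in> polyfun {1..k}" for f
  proof -
    have "(\<lambda>v. f (\<lambda>i. (if i \<in> J then (\<lambda>v. v i) else (\<lambda>_. 0)) v)) \<in> polyfun J"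
      by (rule polyfun_subst[OF fun_algebra_polyfun that]) (auto intro: polyfun.intros)
    moreover have "res f = (\<lambda>v. f (\<lambda>i. (if i \<in> J then (\<lambda>v. v i) else (\<lambda>_. 0)) v))"
      unfolding res_def by (intro ext arg_cong[of _ _ f]) auto
    ultimately show ?thesis by simp
  qed
  have res_eq: "res f v = f v" if "v \<in> A" for f v
  proof -
    have v: "v \<in> affine_points {1..k}" "\<forall>i\<le>m. of_nat i * v i = 0" using that A(2) by (auto simp: flat_jets_def)
    have "(\<lambda>i. if i \<in> J then v i else 0) = v"
    proof
      fix i
      show "(if i \<in> J then v i else 0) = v i"
        using v p(1) by (auto simp: J_def affine_points_def of_nat_eq_0_iff_char_dvd)
    qed
    then show ?thesis by (simp add: res_def)
  qed
  \<comment> \<open>The \<open>n\<close> invariant functions and the k - m coordinates of index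
    above m, written over the common denominator \<open>r\<close>.\<close>
  define q' where "q' i = (if i < n then q i else (\<lambda>v. v (Suc m + (i - n)) * r v))" for i
  have q'_poly: "q' i \<in> polyfun {1..k}" if "i < M" for i
    using that m by (auto simp: q'_def M_def intro!: qr polyfun.mult polyfun.coord)
  obtain Q where Q: "Q \<in> polyfun {..<M}" "\<exists>v. Q v \<noteq> 0"
    "\<And>v. res r v \<noteq> 0 \<Longrightarrow> Q (\<lambda>i. res (q' i) v / res r v) = 0"
    using algebraic_dependence[OF J JM, of "\<lambda>i. res (q' i)" "res r"] res_poly q'_poly qr(2) by metis
  define mix where "mix y z = (\<lambda>i. if i < n then y i else z (Suc m + (i - n)))" for y z :: "nat \<Rightarrow> 'k"
  have Q_rel: "Q (mix (\<lambda>i. F i w) w) = 0" if w: "w \<in> A" "w \<in> G" for w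
  proof -
    have rw: "r w \<noteq> 0" using r w by blast
    have "Q (\<lambda>i. q' i w / r w) = 0" using Q(3)[of w] rw by (simp add: res_eq[OF w(1)])
    moreover have "q' i w / r w = mix (\<lambda>i. F i w) w i" for i
      using F[OF w(2,1)] rw by (simp add: q'_def mix_def)
    ultimately show ?thesis by simp
  qed
  \<comment> \<open>Along an orbit the \<open>F i\<close> stay constant while the high coordinates
    move in every direction, so the relation holds with the latter replaced by independent
    variables.\<close>
  have mixz: "Q (mix (\<lambda>i. F i w) z) = 0" if w: "w \<in> A" "w \<in> G" "of_nat (Suc m) * w (Suc m) \<noteq> 0" for w z
  proof -
    have wf: "w \<in> flat_jets k m" using w(1) A(2) by blast
    have Qz: "(\<lambda>z. Q (mix (\<lambda>i. F i w) z)) \<in> polyfun {Suc m..k}"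
    proof -
      have "(\<lambda>z. Q (\<lambda>i. (if i < n then (\<lambda>_. F i w) else (\<lambda>z. z (Suc m + (i - n)))) z)) \<in> polyfun {Suc m..k}"
        by (rule polyfun_subst[OF fun_algebra_polyfun Q(1)]) (auto simp: M_def intro!: polyfun.intros)
      moreover have "mix (\<lambda>i. F i w) z = (\<lambda>i. (if i < n then (\<lambda>_. F i w) else (\<lambda>z. z (Suc m + (i - n)))) z)" for z
        by (auto simp: mix_def)
      ultimately show ?thesis by simp
    qed
    obtain g where g: "g \<in> polyfun {1..k}" "g w \<noteq> 0" "{v \<in> affine_points {1..k}. g v \<noteq> 0} \<subseteq> G"
      using G(1) w(2) by (rule openin_zariskiE)
    have wp: "w \<in> affine_points {1..k}" using jet_invariantD(2)[OF A(1) w(1)] .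
    show ?thesis
    proof (rule polyfun_zero_on_curves[OF Qz, of w])
      fix u :: "nat \<Rightarrow> 'k"
      obtain \<eta> \<rho> where \<eta>: "\<eta> $ 0 = 0"
        "\<And>s n. n \<in> {Suc m..k} \<Longrightarrow> jet_subst k (fps_X + fps_const s * \<eta>) w n = w n + s * u n + s\<^sup>2 * poly (\<rho> n) s"
        by (rule orbit_curve[OF wf m w(3), of u]) blast
      obtain H where H: "H \<in> poly_family (polyfun {1..k})"
        "\<And>v t. v \<in> affine_points {1..k} \<Longrightarrow> poly (H v) t = g (jet_subst k (fps_X + fps_const t * \<eta>) v)"
        by (rule polyfun_jet_subst_family[OF g(1), of fps_X \<eta>]) blast
      define E where "E = {s. poly (H w) s = 0} \<union> {s. poly [:1, \<eta> $ 1:] s = 0}"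
      have "poly (H w) 0 \<noteq> 0" using H(2)[OF wp, of 0] g(2) wp by simp
      then have "H w \<noteq> 0" by auto
      then have "finite E" unfolding E_def by (intro finite_UnI poly_roots_finite) auto
      moreover have "Q (mix (\<lambda>i. F i w) (\<lambda>i. w i + s * u i + s\<^sup>2 * poly (\<rho> i) s)) = 0" if s: "s \<notin> E" for s
      proof -
        let ?\<phi> = "fps_X + fps_const s * \<eta>"
        have \<phi>: "coord_change ?\<phi>" using s \<eta>(1) by (simp add: coord_change_def E_def)
        let ?w = "jet_subst k ?\<phi> w"
        have wA: "?w \<in> A" by (rule jet_invariantD(1)[OF A(1) w(1) \<phi>])
        have "g ?w \<noteq> 0" using s H(2)[OF wp, of s] by (simp add: E_def)
        then have wG: "?w \<in> G" using g(3) by auto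
        have "mix (\<lambda>i. F i ?w) ?w i = mix (\<lambda>i. F i w) (\<lambda>i. w i + s * u i + s\<^sup>2 * poly (\<rho> i) s) i" if "i < M" for i
        proof (cases "i < n")
          case True
          then show ?thesis using F_inv[OF w(1) \<phi>] by (simp add: mix_def)
        next
          case False
          then have j: "Suc m + (i - n) \<in> {Suc m..k}" using that m by (auto simp: M_def)
          show ?thesis unfolding mix_def \<eta>(2)[OF j] using False by simp
        qed
        then have "Q (mix (\<lambda>i. F i ?w) ?w) = Q (mix (\<lambda>i. F i w) (\<lambda>i. w i + s * u i + s\<^sup>2 * poly (\<rho> i) s))"
          by (intro polyfun_cong[OF Q(1)]) auto
        then show ?thesis using Q_rel[OF wA wG] by simp
      qed
      ultimately show "\<exists>\<rho> E. finite E \<and> (\<forall>s. s \<notin> E \<longrightarrow> Q (mix (\<lambda>i. F i w) (\<lambda>i. w i + s * u i + s\<^sup>2 * poly (\<rho> i) s)) = 0)"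
        by blast
    qed
  qed
  \<comment> \<open>With the high coordinates fixed, a relation among the \<open>F i\<close> alone
    remains, and independence kills it.\<close>
  have "Q (mix y z) = 0" for y z
  proof -
    have Qy: "(\<lambda>y. Q (mix y z)) \<in> polyfun {..<n}"
    proof -
      have "(\<lambda>y. Q (\<lambda>i. (if i < n then (\<lambda>y. y i) else (\<lambda>_. z (Suc m + (i - n)))) y)) \<in> polyfun {..<n}"
        by (rule polyfun_subst[OF fun_algebra_polyfun Q(1)]) (auto intro!: polyfun.intros)
      moreover have "mix y z = (\<lambda>i. (if i < n then (\<lambda>y. y i) else (\<lambda>_. z (Suc m + (i - n)))) y)" for y
        by (auto simp: mix_def)
      ultimately show ?thesis by simp
    qed
    have "\<forall>w\<in>{w \<in> A. w \<in> G \<and> of_nat (Suc m) * w (Suc m) \<noteq> 0}. Q (mix (\<lambda>i. F i w) z) = 0"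
      using mixz by blast
    then have "\<forall>y. Q (mix y z) = 0" using bspec[OF indep[unfolded alg_indep_def] Qy] by blast
    then show ?thesis by blast
  qed
  moreover have "v = mix v (\<lambda>i. v (i - Suc m + n))" for v by (auto simp: mix_def)
  ultimately show False using Q(2) by metis
qed

lemma geometric_quotient_jets:
  assumes A: "jet_invariant k A"
    and gq: "geometric_quotient (jet_group k) (jet_action k) (induced_space (jet_space k) A) Y pr"
  shows "continuous_map (subtopology (zariski {1..k}) A) (topol Y) pr"
    and "open_map (subtopology (zariski {1..k}) A) (topol Y) pr"
    and "x \<in> A \<Longrightarrow> y \<in> A \<Longrightarrow> pr x = pr y \<longleftrightarrow> y \<in> jet_orbit k x"
proof -
  let ?X = "induced_space (jet_space k) A"
  have Ap: "A \<subseteq> affine_points {1..k}" using A by (auto simp: jet_invariant_def)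
  have topX: "topol ?X = subtopology (zariski {1..k}) A" by (simp add: induced_space_def jet_space_def affine_space_def)
  then have ptsX: "points ?X = A" using Ap by auto
  show "continuous_map (subtopology (zariski {1..k}) A) (topol Y) pr"
    using gq by (simp add: geometric_quotient_def is_morphism_def topX)
  show "open_map (subtopology (zariski {1..k}) A) (topol Y) pr" using gq by (simp add: geometric_quotient_def topX)
  show "pr x = pr y \<longleftrightarrow> y \<in> jet_orbit k x" if "x \<in> A" "y \<in> A"
    using gq that Ap jet_group_orbit_iff[of x k y] by (auto simp: geometric_quotient_def ptsX)
qed

text \<open>A chain of irreducible closed sets is examined in an affine chart that meets its
  smallest member, hence all members. Its length yields as many independent chart functions, which
  become invariant fractions on the jets above the largest member.\<close>

theorem quotient_dim_le:
  fixes A :: "(nat \<Rightarrow> 'k::alg_closed_field) set" and Y :: "('y, 'k) fun_space"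
  assumes p: "CHAR('k) = p" "prime p" and \<mu>: "\<mu> < k"
    and A: "jet_invariant k A" and Y: "variety Y"
    and gq: "geometric_quotient (jet_group k) (jet_action k) (induced_space (jet_space k) A) Y pr"
  defines "U \<equiv> affine_points {1..k} - flat_jets k (Suc \<mu>)"
  shows "krull_dim (topol Y) (pr ` (U \<inter> A)) \<le> enat (\<mu> div p)"
proof -
  let ?X = "induced_space (jet_space k) A" and ?T = "zariski {1..k} :: (nat \<Rightarrow> 'k) topology"
  have Ap: "A \<subseteq> affine_points {1..k}" using A by (auto simp: jet_invariant_def)
  note cont = geometric_quotient_jets(1)[OF A gq] and opn = geometric_quotient_jets(2)[OF A gq]
    and fibre = geometric_quotient_jets(3)[OF A gq]
  have pr_inv: "pr (jet_subst k \<phi> w) = pr w" if "w \<in> A" "coord_change \<phi>" for w \<phi>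
    using fibre[OF that(1) jet_invariantD(1)[OF A that]] that(2) by (auto simp: jet_orbit_def)
  have image_open: "openin (topol Y) (pr ` (G \<inter> A))" if "openin ?T G" for G
    using opn that unfolding open_map_def by (auto simp: openin_subtopology)
  have Ui: "jet_invariant k U"
    unfolding U_def by (intro jet_invariant_Diff jet_invariant_points jet_invariant_flat_jets)
  have Uo: "openin ?T U"
    unfolding U_def using openin_diff[OF openin_topspace closedin_flat_jets[of k "Suc \<mu>"]] by simp
  define B where "B = pr ` (U \<inter> A)"
  have Bo: "openin (topol Y) B" unfolding B_def by (rule image_open[OF Uo])
  have BU: "x \<in> U" if "x \<in> A" "pr x \<in> B" for x
  proof -
    obtain u where u: "u \<in> U" "u \<in> A" "pr x = pr u" using \<open>pr x \<in> B\<close> by (auto simp: B_def)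
    then have "x \<in> jet_orbit k u" using fibre[of u x] that by simp
    then show ?thesis using u(1) jet_invariantD(1)[OF Ui] by (auto simp: jet_orbit_def)
  qed
  have "n \<le> \<mu> div p"
    if Z: "\<forall>i\<le>n. irreducible_closed (subtopology (topol Y) B) (Z i)" "\<forall>i<n. Z i \<subset> Z (Suc i)" for n and Z :: "nat \<Rightarrow> 'y set"
  proof -
    have ZB: "Z i \<subseteq> B" if "i \<le> n" for i
      using Z(1) that closedin_subset[of "subtopology (topol Y) B" "Z i"] by (auto simp: irreducible_closed_def)
    have opB: "openin (subtopology (topol Y) B) (O' \<inter> B)" if "openin (topol Y) O'" for O'
      using that openin_subtopology by blast
    have meet: "O1 \<inter> O2 \<inter> Z i \<noteq> {}"
      if "i \<le> n" "openin (topol Y) O1" "openin (topol Y) O2" "O1 \<inter> Z i \<noteq> {}" "O2 \<inter> Z i \<noteq> {}" for i O1 O2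
      using irreducible_closed_meet[OF Z(1)[rule_format, OF that(1)] opB[OF that(2)] _ opB[OF that(3)]] that ZB[OF that(1)]
      by blast
    have Zmono: "Z 0 \<subseteq> Z i" if "i \<le> n" for i
      using that by (induction i) (use Z(2) in \<open>auto simp: Suc_le_eq\<close>)
    have "Z 0 \<noteq> {}" using Z(1) by (auto simp: irreducible_closed_def)
    then obtain y0 where y0: "y0 \<in> Z 0" by blast
    have "B \<subseteq> points Y" by (rule openin_subset[OF Bo])
    then have "y0 \<in> points Y" using y0 ZB[of 0] by auto
    then obtain V where V: "y0 \<in> V" "openin (topol Y) V" "affine_variety (induced_space Y V)"
      using Y unfolding variety_def by (metis UnionE)
    obtain N C P Q where C: "closedin (zariski {..<N}) C"
      and P: "is_morphism (induced_space Y V) (induced_space (affine_space {..<N}) C) P"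
      and Q: "is_morphism (induced_space (affine_space {..<N}) C) (induced_space Y V) Q"
      and QP: "\<forall>x\<in>points (induced_space Y V). Q (P x) = x"
      using V(3) unfolding affine_variety_def isomorphic_spaces_def by blast
    have VY: "V \<subseteq> points Y" by (rule openin_subset[OF V(2)])
    have topV: "topol (induced_space Y V) = subtopology (topol Y) V" by (simp add: induced_space_def)
    have ptsV: "points (induced_space Y V) = V" using VY by (auto simp: topV)
    have topC: "topol (induced_space (affine_space {..<N}) C) = subtopology (zariski {..<N}) C"
      by (simp add: induced_space_def affine_space_def)
    have Cp: "C \<subseteq> affine_points {..<N}" by (rule closedin_zariski_subset[OF C])
    have contP: "continuous_map (subtopology (topol Y) V) (subtopology (zariski {..<N}) C) P"
      using P by (simp add: is_morphism_def topV topC)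
    have contQ: "continuous_map (subtopology (zariski {..<N}) C) (subtopology (topol Y) V) Q"
      using Q by (simp add: is_morphism_def topV topC)
    have PC: "P y \<in> C" if "y \<in> V" for y using contP that VY by (auto simp: continuous_map_def)
    have nonzero_open: "openin (topol Y) {y \<in> V. f (P y) \<noteq> 0}" if "f \<in> polyfun {..<N}" for f
    proof -
      have "openin (subtopology (zariski {..<N}) C) ({x \<in> affine_points {..<N}. f x \<noteq> 0} \<inter> C)"
        using openin_zariski_nonzero[OF that] openin_subtopology by blast
      then have "openin (subtopology (topol Y) V) {y \<in> V. P y \<in> {x \<in> affine_points {..<N}. f x \<noteq> 0} \<inter> C}"
        using contP VY unfolding continuous_map_def by (auto simp: inf_absorb2)
      moreover have "{y \<in> V. P y \<in> {x \<in> affine_points {..<N}. f x \<noteq> 0} \<inter> C} = {y \<in> V. f (P y) \<noteq> 0}"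
        using PC Cp by auto
      ultimately show ?thesis using openin_trans_full[OF _ V(2)] by simp
    qed
    define X where "X i = P ` (Z i \<inter> V)" for i
    have X0: "X 0 \<noteq> {}" using y0 V(1) by (auto simp: X_def)
    have "\<exists>F. (\<forall>i. F i \<in> polyfun {..<N}) \<and> alg_indep n F (X n)"
    proof (rule chain_alg_indep[where X = X, OF X0])
      fix i f g assume i: "i \<le> n" and f: "f \<in> polyfun {..<N}" and g: "g \<in> polyfun {..<N}"
        and fg: "\<forall>x\<in>X i. f x * g x = 0"
      show "(\<forall>x\<in>X i. f x = 0) \<or> (\<forall>x\<in>X i. g x = 0)"
      proof (rule ccontr)
        assume "\<not> ?thesis"
        then obtain y1 y2 where "y1 \<in> Z i \<inter> V" "f (P y1) \<noteq> 0" "y2 \<in> Z i \<inter> V" "g (P y2) \<noteq> 0" by (auto simp: X_def)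
        then have "{y \<in> V. f (P y) \<noteq> 0} \<inter> {y \<in> V. g (P y) \<noteq> 0} \<inter> Z i \<noteq> {}"
          by (intro meet[OF i nonzero_open[OF f] nonzero_open[OF g]]) auto
        then obtain y where "y \<in> Z i" "y \<in> V" "f (P y) \<noteq> 0" "g (P y) \<noteq> 0" by blast
        then show False using fg by (auto simp: X_def)
      qed
    next
      fix i assume i: "i < n"
      then show "X i \<subseteq> X (Suc i)" using Z(2) by (auto simp: X_def)
      have "closedin (subtopology (topol Y) B) (Z i)" using Z(1) i by (auto simp: irreducible_closed_def)
      then obtain K where K: "closedin (topol Y) K" "Z i = K \<inter> B" by (auto simp: closedin_subtopology)
      define O' where "O' = points Y - K"
      have O': "openin (topol Y) O'" using K(1) by (simp add: O'_def closedin_def)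
      have ZO: "O' \<inter> Z i = {}" using K(2) by (auto simp: O'_def)
      have "V \<inter> Z (Suc i) \<noteq> {}" using y0 V(1) Zmono[of "Suc i"] i by auto
      moreover have "O' \<inter> Z (Suc i) \<noteq> {}"
      proof -
        obtain z where z: "z \<in> Z (Suc i)" "z \<notin> Z i" using Z(2) i by blast
        then have "z \<in> B" using ZB[of "Suc i"] i by auto
        then show ?thesis using z K(2) \<open>B \<subseteq> points Y\<close> by (auto simp: O'_def)
      qed
      ultimately have "V \<inter> O' \<inter> Z (Suc i) \<noteq> {}" using i by (intro meet[OF _ V(2) O']) auto
      then obtain y where y: "y \<in> V" "y \<in> O'" "y \<in> Z (Suc i)" by blast
      have "openin (subtopology (zariski {..<N}) C) {x \<in> topspace (subtopology (zariski {..<N}) C). Q x \<in> O' \<inter> V}"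
        using contQ O' unfolding continuous_map_def openin_subtopology by blast
      then obtain W where W: "openin (zariski {..<N}) W" "{x \<in> topspace (subtopology (zariski {..<N}) C). Q x \<in> O' \<inter> V} = W \<inter> C"
        by (auto simp: openin_subtopology)
      have "P y \<in> W"
        using W(2) PC[OF y(1)] Cp QP y by (auto simp: ptsV)
      with W(1) obtain g where g: "g \<in> polyfun {..<N}" "g (P y) \<noteq> 0" "{x \<in> affine_points {..<N}. g x \<noteq> 0} \<subseteq> W"
        by (rule openin_zariskiE)
      have "g x = 0" if x: "x \<in> X i" for x
      proof (rule ccontr)
        assume gx: "g x \<noteq> 0"
        obtain y' where y': "y' \<in> Z i" "y' \<in> V" "x = P y'" using x by (auto simp: X_def)
        then have "x \<in> C" using PC by simp
        then have "x \<in> W \<inter> C" using g(3) gx Cp by auto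
        then have "Q x \<in> O'" using W(2) by blast
        then show False using y' QP ptsV ZO by auto
      qed
      then show "\<exists>g\<in>polyfun {..<N}. (\<forall>x\<in>X i. g x = 0) \<and> (\<exists>x\<in>X (Suc i). g x \<noteq> 0)"
        using g(1,2) y by (intro bexI[of _ g]) (auto simp: X_def)
    qed
    then obtain F where F: "\<And>i. F i \<in> polyfun {..<N}" "alg_indep n F (X n)" by blast
    define A' where "A' = {x \<in> A. pr x \<in> Z n}"
    have A': "jet_invariant k A'"
      using A pr_inv jet_invariantD(1)[OF A] by (auto simp: jet_invariant_def A'_def)
    have A'U: "A' \<subseteq> U" using BU ZB[of n] by (auto simp: A'_def)
    \<comment> \<open>The least element is the generic order of the derivative on the jets above the
      largest member of the chain; it is at most \<open>\<mu>\<close> because these jets lie in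
      \<open>U\<close>.\<close>
    define S where "S = {m. \<exists>x\<in>A'. pr x \<in> V \<and> of_nat (Suc m) * x (Suc m) \<noteq> 0}"
    have "y0 \<in> B" using y0 ZB[of 0] by auto
    then obtain x0 where x0: "x0 \<in> A" "x0 \<in> U" "pr x0 = y0" by (auto simp: B_def)
    then have x0A': "x0 \<in> A'" using y0 Zmono[of n] by (auto simp: A'_def)
    have "\<exists>j\<le>\<mu>. of_nat (Suc j) * x0 (Suc j) \<noteq> 0"
    proof -
      obtain i where i: "i \<le> Suc \<mu>" "of_nat i * x0 i \<noteq> 0"
        using x0 Ap by (auto simp: U_def flat_jets_def)
      then have "i \<noteq> 0" by (intro notI) simp
      then obtain j where "i = Suc j" by (cases i) auto
      then show ?thesis using i by auto
    qed
    then obtain j where j: "j \<le> \<mu>" "j \<in> S" using x0A' x0 V(1) by (auto simp: S_def)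
    define m where "m = (LEAST m. m \<in> S)"
    have mS: "m \<in> S" unfolding m_def using j(2) by (rule LeastI)
    have m\<mu>: "m \<le> \<mu>" unfolding m_def using j Least_le[of "\<lambda>m. m \<in> S" j] by simp
    obtain x1 where x1: "x1 \<in> A'" "pr x1 \<in> V" "of_nat (Suc m) * x1 (Suc m) \<noteq> 0" using mS by (auto simp: S_def)
    have x1A: "x1 \<in> A" using x1 by (simp add: A'_def)
    define A'' where "A'' = {x \<in> A'. pr x \<in> V}"
    have A'': "jet_invariant k A''"
      using A' pr_inv by (auto simp: jet_invariant_def A'_def A''_def)
    have flat: "A'' \<subseteq> flat_jets k m"
    proof
      fix x assume x: "x \<in> A''"
      have "of_nat i * x i = 0" if "i \<le> m" for i
      proof (cases i)
        case (Suc l)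
        then have "l \<notin> S" using that not_less_Least[of l "\<lambda>m. m \<in> S"] by (simp add: m_def)
        then show ?thesis using x Suc by (auto simp: S_def A''_def)
      qed simp
      then show "x \<in> flat_jets k m" using x jet_invariantD(2)[OF A''] by (simp add: flat_jets_def)
    qed
    have "\<exists>q r G. q \<in> polyfun {1..k} \<and> r \<in> polyfun {1..k} \<and> openin ?T G \<and> x1 \<in> G \<and>
        (\<forall>w\<in>G \<inter> A. pr w \<in> V \<and> r w \<noteq> 0 \<and> F i (P (pr w)) = q w / r w)" for i
      by (rule quotient_locally_rational[OF Ap gq V(2) P Cp F(1)[of i] x1A x1(2)]) blast
    then obtain q r G where qrG: "\<And>i. q i \<in> polyfun {1..k}" "\<And>i. r i \<in> polyfun {1..k}" "\<And>i. openin ?T (G i)" "\<And>i. x1 \<in> G i"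
      "\<And>i w. w \<in> G i \<Longrightarrow> w \<in> A \<Longrightarrow> pr w \<in> V \<and> r i w \<noteq> 0 \<and> F i (P (pr w)) = q i w / r i w"
      by (metis IntI)
    \<comment> \<open>A common denominator for the \<open>n\<close> locally defined
      fractions.\<close>
    define r' where "r' w = (\<Prod>i<n. r i w)" for w
    define q' where "q' i w = q i w * (\<Prod>l\<in>{..<n}-{i}. r l w)" for i w
    define G' where "G' = affine_points {1..k} \<inter> (\<Inter>i<n. G i)"
    have G': "openin ?T G'"
    proof -
      have "openin ?T (\<Inter>i\<in>{..<n}. G i \<inter> affine_points {1..k} )" if "n > 0"
        using that qrG(3) openin_topspace[of ?T] by (intro openin_INT2) auto
      moreover have "G' = (if n = 0 then affine_points {1..k} else (\<Inter>i\<in>{..<n}. G i \<inter> affine_points {1..k}))"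
        by (auto simp: G'_def)
      ultimately show ?thesis using openin_topspace[of ?T] by auto
    qed
    have x1G': "x1 \<in> G'" using qrG(4) x1A Ap by (auto simp: G'_def)
    define F' where "F' i w = F i (P (pr w))" for i w
    have r'_poly: "r' \<in> polyfun {1..k}" unfolding r'_def by (intro polyfun_prod qrG)
    have q'_poly: "q' i \<in> polyfun {1..k}" for i unfolding q'_def by (intro polyfun.mult polyfun_prod qrG)
    have r'_nz: "r' w \<noteq> 0" if "w \<in> G'" "w \<in> A''" for w
      using qrG(5) that by (auto simp: r'_def G'_def A''_def A'_def)
    have F'_eq: "r' w \<noteq> 0 \<and> F' i w = q' i w / r' w" if w: "w \<in> G'" "w \<in> A''" and i: "i < n" for w i
    proof -
      have "F' i w = q i w / r i w" using qrG(5)[of w i] w i by (auto simp: F'_def G'_def A''_def A'_def)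
      moreover have "r' w = r i w * (\<Prod>l\<in>{..<n}-{i}. r l w)"
        unfolding r'_def using i by (intro prod.remove) auto
      ultimately show ?thesis using r'_nz[OF w] by (auto simp: q'_def)
    qed
    have F'_inv: "F' i (jet_subst k \<phi> w) = F' i w" if "w \<in> A''" "coord_change \<phi>" for i w \<phi>
      using pr_inv[of w \<phi>] that by (simp add: F'_def A''_def A'_def)
    have indep: "alg_indep n F' {w \<in> A''. w \<in> G' \<and> of_nat (Suc m) * w (Suc m) \<noteq> 0}" (is "alg_indep n F' ?W")
      unfolding alg_indep_def
    proof (intro ballI impI)
      fix R assume R: "R \<in> polyfun {..<n}" and R0: "\<forall>x\<in>?W. R (\<lambda>i. F' i x) = 0"
      have RF: "(\<lambda>x. R (\<lambda>i. F i x)) \<in> polyfun {..<N}" by (rule polyfun_subst[OF fun_algebra_polyfun R]) (rule F(1))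
      define D where "D = G' \<inter> {w \<in> affine_points {1..k}. of_nat (Suc m) * w (Suc m) \<noteq> 0}"
      have D: "openin ?T D"
      proof -
        have "(\<lambda>w. of_nat (Suc m) * w (Suc m)) \<in> polyfun {1..k}"
          using m\<mu> \<mu> by (intro polyfun_cmult polyfun.coord) auto
        then show ?thesis unfolding D_def by (intro openin_Int G' openin_zariski_nonzero)
      qed
      have "R (\<lambda>i. F i x) = 0" if x: "x \<in> X n" for x
      proof (rule ccontr)
        assume ne: "R (\<lambda>i. F i x) \<noteq> 0"
        obtain y where y: "y \<in> Z n" "y \<in> V" "x = P y" using x by (auto simp: X_def)
        \<comment> \<open>Independence survives the passage to a small open set: \<open>pr\<close>
          is open and \<open>Z n\<close> is irreducible, so the image of the open set meets the
          locus where the relation fails.\<close>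
        have "pr ` (D \<inter> A) \<inter> {y \<in> V. R (\<lambda>i. F i (P y)) \<noteq> 0} \<inter> Z n \<noteq> {}"
        proof (rule meet[OF order_refl image_open[OF D] nonzero_open[OF RF]])
          have "x1 \<in> D \<inter> A" using x1G' x1(3) x1A Ap by (auto simp: D_def)
          then show "pr ` (D \<inter> A) \<inter> Z n \<noteq> {}" using x1(1) by (auto simp: A'_def)
          show "{y \<in> V. R (\<lambda>i. F i (P y)) \<noteq> 0} \<inter> Z n \<noteq> {}" using y ne by auto
        qed
        then obtain w where w: "w \<in> D" "w \<in> A" "pr w \<in> V" "R (\<lambda>i. F i (P (pr w))) \<noteq> 0" "pr w \<in> Z n" by blast
        then have "w \<in> ?W" by (auto simp: D_def A''_def A'_def)
        then show False using R0 w(4) by (auto simp: F'_def)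
      qed
      then show "\<forall>v. R v = 0" using bspec[OF F(2)[unfolded alg_indep_def] R] by blast
    qed
    have "n \<le> m div p"
    proof (rule invariant_functions_bound[OF p A'' flat _ _ x1(3) G' x1G' _ r'_poly F'_eq F'_inv r'_nz indep])
      show "m < k" using m\<mu> \<mu> by simp
      show "x1 \<in> A''" using x1 by (simp add: A''_def)
    qed (use q'_poly in auto)
    also have "m div p \<le> \<mu> div p" using m\<mu> by (rule div_le_mono)
    finally show ?thesis .
  qed
  then show ?thesis
    unfolding krull_dim_def B_def[symmetric] by (intro Sup_least) auto
qed

section \<open>Normal forms and the lower bound\<close>

lemma X_power_dvd_power_diff:
  fixes a b :: "'k::field fps"
  assumes "fps_X ^ d dvd a" "fps_X ^ d dvd b" "fps_X ^ s dvd a - b"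
  shows "fps_X ^ (s + d * j) dvd a ^ Suc j - b ^ Suc j"
proof (induction j)
  case (Suc j)
  have "fps_X ^ (d * Suc j) dvd a ^ Suc j" using dvd_power_same[OF assms(1), of "Suc j"] by (simp only: power_mult)
  then have "fps_X ^ (s + d * Suc j) dvd (a - b) * a ^ Suc j"
    unfolding power_add using assms(3) by (intro mult_dvd_mono)
  moreover have "fps_X ^ (s + d * Suc j) dvd b * (a ^ Suc j - b ^ Suc j)"
    using mult_dvd_mono[OF assms(2) Suc] by (simp add: power_add algebra_simps)
  moreover have "a ^ Suc (Suc j) - b ^ Suc (Suc j) = (a - b) * a ^ Suc j + b * (a ^ Suc j - b ^ Suc j)"
    by (simp add: algebra_simps)
  ultimately show ?case by (metis dvd_add)
qed (use assms in simp)

text \<open>Monomials of index i > m change from index i - 1 + e on, which is at least m + e. Up to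
  m only multiples of p occur, and (x + h)^(p j) = (x^p + h^p)^j changes from index e p + p (j - 1)
  on; so up to index e p only j = 1 matters.\<close>

lemma compose_shift_nth:
  fixes g h :: "'k::field fps"
  assumes p: "CHAR('k) = p" "prime p" "p \<le> m"
    and g: "\<forall>i\<le>m. of_nat i * g $ i = 0" and h: "fps_X ^ e dvd h" "e \<ge> 1"
    and n: "n < m + e" "n \<le> e * p"
  shows "(g oo (fps_X + h)) $ n = g $ n + (if n = e * p then g $ p * (h $ e) ^ p else 0)"
proof -
  have p0: "p > 0" using p(2) by (simp add: prime_gt_0_nat)
  have X: "fps_X dvd fps_X + h" using h by (simp add: X_power_dvd_iff X_dvd_iff)
  have zero: "f $ n = 0" if "fps_X ^ l dvd f" "n < l" for l and f :: "'k fps"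
    using that by (simp add: X_power_dvd_iff)
  have hp: "fps_X ^ (e * p) dvd h ^ p" using dvd_power_same[OF h(1), of p] by (simp add: power_mult)
  have hpn: "(h ^ p) $ n = (if n = e * p then (h $ e) ^ p else 0)"
  proof (cases "n = e * p")
    case True
    obtain h' where h': "h = fps_X ^ e * h'" using h(1) by (rule dvdE)
    then have "h ^ p = fps_X ^ (e * p) * h' ^ p" by (simp add: power_mult_distrib power_mult)
    then show ?thesis using True h' by (simp add: fps_X_power_mult_nth fps_power_zeroth)
  qed (use zero[OF hp] n(2) in simp)
  have summand: "g $ i * ((fps_X + h) ^ i) $ n =
      g $ i * (fps_X ^ i) $ n + (if i = p then g $ p * (h ^ p) $ n else 0)" for i
  proof (cases "i \<le> m \<and> p dvd i")
    case False
    show ?thesis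
    proof (cases "i \<le> m")
      case True
      then have "g $ i = 0" using g False p(1) by (auto simp: of_nat_eq_0_iff_char_dvd)
      then show ?thesis using False True by auto
    next
      case im: False
      then obtain j where j: "i = Suc j" "m \<le> j" by (cases i) auto
      have "fps_X ^ (e + 1 * j) dvd (fps_X + h) ^ Suc j - fps_X ^ Suc j"
        using X h(1) by (intro X_power_dvd_power_diff) auto
      then have "((fps_X + h) ^ i - fps_X ^ i) $ n = 0" using j n(1) by (intro zero[of "e + 1 * j"]) auto
      then show ?thesis using im p(3) by simp
    qed
  next
    case True
    then obtain j where j: "i = p * j" by auto
    have fr: "(fps_X + h) ^ p = fps_X ^ p + h ^ p"
      using freshmans_dream[where 'a = "'k fps"] p by simp
    consider "j = 0" | "j = 1" | l where "j = Suc (Suc l)" by (metis One_nat_def not0_implies_Suc)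
    then show ?thesis
    proof cases
      case (3 l)
      have "fps_X ^ p dvd (fps_X + h) ^ p" using X by (rule dvd_power_same)
      moreover have "fps_X ^ (e * p) dvd (fps_X + h) ^ p - fps_X ^ p" using hp by (simp add: fr)
      ultimately have "fps_X ^ (e * p + p * Suc l) dvd ((fps_X + h) ^ p) ^ j - (fps_X ^ p) ^ j"
        unfolding 3 by (intro X_power_dvd_power_diff) auto
      then have "(((fps_X + h) ^ p) ^ j - (fps_X ^ p) ^ j) $ n = 0"
        using n(2) p0 by (intro zero) auto
      moreover have "i \<noteq> p" using j 3 p0 by auto
      ultimately show ?thesis by (simp add: j power_mult)
    qed (use j p0 fr in \<open>auto simp: algebra_simps\<close>)
  qed
  have "(g oo (fps_X + h)) $ n = (\<Sum>i=0..n. g $ i * ((fps_X + h) ^ i) $ n)" by (simp add: fps_compose_nth)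
  also have "\<dots> = (\<Sum>i=0..n. g $ i * (fps_X ^ i) $ n) + (\<Sum>i=0..n. if i = p then g $ p * (h ^ p) $ n else 0)"
    by (simp only: summand sum.distrib)
  also have "(\<Sum>i=0..n. g $ i * (fps_X ^ i) $ n) = (g oo fps_X) $ n" by (simp only: fps_compose_nth)
  also have "(\<Sum>i=0..n. if i = p then g $ p * (h ^ p) $ n else 0) = (if n = e * p then g $ p * (h $ e) ^ p else 0)"
  proof (cases "p \<le> n")
    case False
    moreover have "p \<le> e * p" using h(2) by simp
    ultimately show ?thesis by auto
  qed (auto simp: hpn sum.delta)
  finally show ?thesis by simp
qed

text \<open>\<open>(p - 1) e < m\<close> is equivalent to \<open>e p < m + e\<close>: by the preceding lemma the first coefficient
  affected by a change of \<open>x\<close> in order \<open>e\<close> is then the one of index \<open>e p\<close>.\<close>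

definition normal_jet :: "nat \<Rightarrow> nat \<Rightarrow> (nat \<Rightarrow> 'k::field) \<Rightarrow> bool" where
  "normal_jet p m v \<longleftrightarrow> v p = 1 \<and> (\<forall>e\<ge>2. e * (p - 1) < m \<longrightarrow> v (e * p) = 0)"

text \<open>Normalising a jet takes iterated \<open>p\<close>-th roots of regular functions on \<open>v\<^sub>p \<noteq> 0\<close>.\<close>

definition root_functions :: "nat \<Rightarrow> nat \<Rightarrow> ((nat \<Rightarrow> 'k::field) \<Rightarrow> 'k) set" where
  "root_functions p k = {\<phi>. \<exists>N M. \<exists>Q\<in>polyfun {1..k}. \<forall>v. v p \<noteq> 0 \<longrightarrow> \<phi> v ^ (p ^ N) * v p ^ M = Q v}"

lemma root_functionsI:
  assumes "Q \<in> polyfun {1..k}" "\<And>v. v p \<noteq> 0 \<Longrightarrow> \<phi> v ^ (p ^ N) * v p ^ M = Q v"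
  shows "\<phi> \<in> root_functions p k"
  unfolding root_functions_def using assms by auto

lemma polyfun_root_functions: "Q \<in> polyfun {1..k} \<Longrightarrow> Q \<in> root_functions p k"
  unfolding root_functions_def by (auto intro!: exI[of _ 0])

lemma root_functions_root:
  assumes "(\<lambda>v. \<phi> v ^ p) \<in> root_functions p k" shows "\<phi> \<in> root_functions p k"
proof -
  obtain N M Q where "Q \<in> polyfun {1..k}" "\<And>v. v p \<noteq> 0 \<Longrightarrow> (\<phi> v ^ p) ^ (p ^ N) * v p ^ M = Q v"
    using assms by (auto simp: root_functions_def)
  then have "\<forall>v. v p \<noteq> 0 \<longrightarrow> \<phi> v ^ (p ^ Suc N) * v p ^ M = Q v" by (simp add: power_mult[symmetric])
  then show ?thesis unfolding root_functions_def using \<open>Q \<in> polyfun {1..k}\<close> by blast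
qed

text \<open>Sums are covered because raising to a p-power is additive in characteristic p, so both
  summands can be raised to a common such power.\<close>

lemma fun_algebra_root_functions:
  assumes p: "CHAR('k::field) = p" "prime p" "p \<le> k"
  shows "fun_algebra (root_functions p k :: ((nat \<Rightarrow> 'k) \<Rightarrow> 'k) set)"
  unfolding fun_algebra_def
proof (intro conjI allI ballI)
  fix \<phi> \<psi> :: "(nat \<Rightarrow> 'k) \<Rightarrow> 'k" assume "\<phi> \<in> root_functions p k" "\<psi> \<in> root_functions p k"
  then obtain N M Q N' M' Q' where Q: "Q \<in> polyfun {1..k}" "\<And>v. v p \<noteq> 0 \<Longrightarrow> \<phi> v ^ (p ^ N) * v p ^ M = Q v"
    and Q': "Q' \<in> polyfun {1..k}" "\<And>v. v p \<noteq> 0 \<Longrightarrow> \<psi> v ^ (p ^ N') * v p ^ M' = Q' v"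
    unfolding root_functions_def by blast
  have p1: "p \<in> {1..k}" using p(2,3) prime_ge_1_nat by auto
  define K where "K = M * p ^ N'"
  define K' where "K' = M' * p ^ N"
  have a: "\<phi> v ^ (p ^ (N + N')) * v p ^ K = Q v ^ (p ^ N')" if "v p \<noteq> 0" for v
    unfolding Q(2)[of v, OF that, symmetric] K_def by (simp add: power_mult_distrib power_mult power_add)
  have b: "\<psi> v ^ (p ^ (N + N')) * v p ^ K' = Q' v ^ (p ^ N)" if "v p \<noteq> 0" for v
    unfolding Q'(2)[of v, OF that, symmetric] K'_def by (subst add.commute) (simp add: power_mult_distrib power_mult power_add)
  have "(\<lambda>v. Q v ^ (p ^ N') * v p ^ K' + Q' v ^ (p ^ N) * v p ^ K) \<in> polyfun {1..k}"
    using p1 by (intro polyfun.add polyfun.mult polyfun_power polyfun.coord Q Q')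
  moreover have "(\<phi> v + \<psi> v) ^ (p ^ (N + N')) * v p ^ (K + K') =
      Q v ^ (p ^ N') * v p ^ K' + Q' v ^ (p ^ N) * v p ^ K" if "v p \<noteq> 0" for v
  proof -
    have "(\<phi> v + \<psi> v) ^ (p ^ (N + N')) = \<phi> v ^ (p ^ (N + N')) + \<psi> v ^ (p ^ (N + N'))"
      using freshmans_dream'[where 'a = 'k] p by blast
    then show ?thesis unfolding a[of v, OF that, symmetric] b[of v, OF that, symmetric] by (simp add: power_add algebra_simps)
  qed
  ultimately show "(\<lambda>v. \<phi> v + \<psi> v) \<in> root_functions p k" by (rule root_functionsI)
  have "(\<lambda>v. Q v ^ (p ^ N') * Q' v ^ (p ^ N)) \<in> polyfun {1..k}"
    by (intro polyfun.mult polyfun_power Q Q')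
  moreover have "(\<phi> v * \<psi> v) ^ (p ^ (N + N')) * v p ^ (K + K') = Q v ^ (p ^ N') * Q' v ^ (p ^ N)" if "v p \<noteq> 0" for v
    unfolding a[of v, OF that, symmetric] b[of v, OF that, symmetric] by (simp add: power_add power_mult_distrib algebra_simps)
  ultimately show "(\<lambda>v. \<phi> v * \<psi> v) \<in> root_functions p k" by (rule root_functionsI)
qed (rule polyfun_root_functions[OF polyfun.const])

lemma root_functions_jet_subst:
  assumes C: "fun_algebra C" and v: "\<And>i. (\<lambda>x. v x i) \<in> C" and \<phi>: "\<And>i. (\<lambda>x. \<phi> x $ i) \<in> C"
  shows "(\<lambda>x. jet_subst k (\<phi> x) (v x) i) \<in> C"
proof (cases "i \<in> {1..k}")
  case True
  have "(\<lambda>x. (\<phi> x ^ j) $ i) \<in> C" for i j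
  proof (induction j arbitrary: i)
    case 0
    then show ?case using fun_algebra_const[OF C] by simp
  next
    case (Suc j)
    then show ?case unfolding power_Suc fps_mult_nth by (intro fun_algebra_sum[OF C] fun_algebra_mult[OF C] \<phi>)
  qed
  then show ?thesis
    unfolding jet_subst_nth[OF True] by (intro fun_algebra_sum[OF C] fun_algebra_mult[OF C] v)
next
  case False
  then show ?thesis using fun_algebra_const[OF C, of 0] by (simp add: jet_subst_outside)
qed

lemma mult_eq_mult_pred_add: "0 < p \<Longrightarrow> e * p = e * (p - 1) + (e :: nat)"
  by (cases p) auto

lemma frobenius_inj:
  fixes x y :: "'k::field"
  assumes "CHAR('k) = p" "prime p" "x ^ p = y ^ p" shows "x = y"
proof -
  have "((x - y) + y) ^ p = (x - y) ^ p + y ^ p" using assms(1,2) by (intro freshmans_dream) auto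
  then show ?thesis using assms(3) by simp
qed

text \<open>A scaling makes the coefficient of index p equal to 1; the shears of order e = 2, 3, ...
  then cancel the coefficient of index e p, leaving those of smaller index that are already
  normalised.\<close>

lemma normal_form_exists:
  assumes p: "CHAR('k) = p" "prime p" "p \<le> m" and k: "m \<le> k"
  obtains \<nu> :: "(nat \<Rightarrow> 'k::alg_closed_field) \<Rightarrow> nat \<Rightarrow> 'k"
  where "\<And>i. (\<lambda>v. \<nu> v i) \<in> root_functions p k"
    and "\<And>v. v \<in> flat_jets k m \<Longrightarrow> v p \<noteq> 0 \<Longrightarrow> \<nu> v \<in> jet_orbit k v \<and> normal_jet p m (\<nu> v)"
proof -
  let ?C = "root_functions p k :: ((nat \<Rightarrow> 'k) \<Rightarrow> 'k) set"
  have p0: "p > 0" and p1: "p \<in> {1..k}" using p k prime_ge_1_nat[of p] by auto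
  have C: "fun_algebra ?C" using p k by (intro fun_algebra_root_functions) auto
  define r where "r x = (SOME y. y ^ p = x)" for x :: 'k
  have r: "r x ^ p = x" for x unfolding r_def by (rule someI_ex[OF nth_root_exists[OF p0]])
  have rC: "(\<lambda>v. r (\<phi> v)) \<in> ?C" if "\<phi> \<in> ?C" for \<phi> using that by (rule_tac root_functions_root) (simp add: r)
  have "\<exists>\<nu>. (\<forall>i. (\<lambda>v. \<nu> v i) \<in> ?C) \<and> (\<forall>v\<in>flat_jets k m. v p \<noteq> 0 \<longrightarrow> \<nu> v \<in> jet_orbit k v \<and> \<nu> v p = 1 \<and>
      (\<forall>l. 2 \<le> l \<and> l \<le> e \<and> l * (p - 1) < m \<longrightarrow> \<nu> v (l * p) = 0))" for e
  proof (induction e)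
    case 0
    let ?u = "\<lambda>v :: nat \<Rightarrow> 'k. r (1 / v p)"
    let ?\<nu> = "\<lambda>v. jet_subst k (fps_const (?u v) * fps_X) v"
    have "(\<lambda>v :: nat \<Rightarrow> 'k. 1 / v p) \<in> ?C"
      by (rule root_functionsI[of "\<lambda>_. 1" _ _ _ 0 1]) (auto intro: polyfun.const)
    then have u: "?u \<in> ?C" by (rule rC)
    have "(\<lambda>v. (fps_const (?u v) * fps_X) $ i) \<in> ?C" for i
      using u fun_algebra_const[OF C, of 0] by (cases "i = 1"; cases "i = 0") (auto simp: fps_const_def)
    \<comment> \<open>\<open>root_functions\<close> constrains all vectors, also those off the jet
      space, so entries outside {1..k} are cut off; on jets nothing changes.\<close>
    moreover have "(\<lambda>v :: nat \<Rightarrow> 'k. if i \<in> {1..k} then v i else 0) \<in> ?C" for i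
      using polyfun_root_functions[OF polyfun.coord[of i "{1..k}"]] fun_algebra_const[OF C, of 0]
      by (cases "i \<in> {1..k}") (simp_all del: atLeastAtMost_iff)
    ultimately have "(\<lambda>v. jet_subst k (fps_const (?u v) * fps_X) (\<lambda>i. if i \<in> {1..k} then v i else 0) i) \<in> ?C" for i
      by - (rule root_functions_jet_subst[OF C])
    moreover have "?\<nu> v \<in> jet_orbit k v \<and> ?\<nu> v p = 1" if v: "v \<in> flat_jets k m" "v p \<noteq> 0" for v
    proof -
      have u: "?u v ^ p * v p = 1" using v(2) by (simp add: r)
      then have "?u v \<noteq> 0" using p0 by (metis mult_zero_left power_0_left zero_neq_one not_gr_zero)
      then show ?thesis using u v(1) by (auto simp: jet_orbit_def jet_subst_scale flat_jets_def coord_change_scale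
            intro!: exI[of _ "fps_const (?u v) * fps_X"])
    qed
    moreover have "(\<lambda>i. if i \<in> {1..k} then v i else 0) = v" if "v \<in> flat_jets k m" for v :: "nat \<Rightarrow> 'k"
      using that by (auto simp: flat_jets_def affine_points_def)
    ultimately show ?case
      by (intro exI[of _ "\<lambda>v. jet_subst k (fps_const (?u v) * fps_X) (\<lambda>i. if i \<in> {1..k} then v i else 0)"]) auto
  next
    case (Suc e)
    then obtain \<nu> where \<nu>C: "\<And>i. (\<lambda>v. \<nu> v i) \<in> ?C"
      and \<nu>: "\<And>v. v \<in> flat_jets k m \<Longrightarrow> v p \<noteq> 0 \<Longrightarrow> \<nu> v \<in> jet_orbit k v \<and> \<nu> v p = 1 \<and>
        (\<forall>l. 2 \<le> l \<and> l \<le> e \<and> l * (p - 1) < m \<longrightarrow> \<nu> v (l * p) = 0)"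
      by metis
    show ?case
    proof (cases "2 \<le> Suc e \<and> Suc e * (p - 1) < m")
      case False
      then show ?thesis using \<nu>C \<nu> by (intro exI[of _ \<nu>]) (auto simp: le_Suc_eq)
    next
      case True
      let ?t = "\<lambda>v. r (- \<nu> v (Suc e * p))"
      let ?h = "\<lambda>v. fps_const (?t v) * fps_X ^ Suc e"
      let ?\<nu> = "\<lambda>v. jet_subst k (fps_X + ?h v) (\<nu> v)"
      have t: "?t \<in> ?C"
        using fun_algebra_cmult[OF C \<nu>C, of "-1" "Suc e * p"] by (intro rC) simp
      have "(\<lambda>v. (fps_X + ?h v) $ i) \<in> ?C" for i
      proof -
        have "(\<lambda>v. ?h v $ i) \<in> ?C" using t fun_algebra_const[OF C, of 0]
          by (cases "i = Suc e") (auto simp: fps_X_power_nth)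
        then show ?thesis using fun_algebra_add[OF C fun_algebra_const[OF C]] by simp
      qed
      then have "(\<lambda>v. ?\<nu> v i) \<in> ?C" for i by (intro root_functions_jet_subst[OF C] \<nu>C)
      moreover have "?\<nu> v \<in> jet_orbit k v \<and> ?\<nu> v p = 1 \<and>
          (\<forall>l. 2 \<le> l \<and> l \<le> Suc e \<and> l * (p - 1) < m \<longrightarrow> ?\<nu> v (l * p) = 0)"
        if v: "v \<in> flat_jets k m" "v p \<noteq> 0" for v
      proof -
        have vp: "v \<in> affine_points {1..k}" using v(1) by (simp add: flat_jets_def)
        have \<phi>: "coord_change (fps_X + ?h v)" using True by (auto simp: coord_change_def fps_X_power_nth)
        have orb: "\<nu> v \<in> jet_orbit k v" using \<nu>[OF v] by blast
        then obtain \<psi> where \<psi>: "coord_change \<psi>" "\<nu> v = jet_subst k \<psi> v" by (auto simp: jet_orbit_def)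
        have flat: "\<nu> v \<in> flat_jets k m"
          unfolding \<psi>(2) by (rule jet_invariantD(1)[OF jet_invariant_flat_jets v(1) \<psi>(1)])
        have "?\<nu> v \<in> jet_orbit k (\<nu> v)" using \<phi> by (auto simp: jet_orbit_def)
        then have orb': "?\<nu> v \<in> jet_orbit k v" by (rule jet_orbit_trans[OF vp orb])
        have nth: "?\<nu> v n = \<nu> v n + (if n = Suc e * p then ?t v ^ p else 0)"
          if "n \<in> {1..k}" "n < m + Suc e" "n \<le> Suc e * p" for n
        proof -
          have "(Abs_fps (\<nu> v) oo (fps_X + ?h v)) $ n =
              Abs_fps (\<nu> v) $ n + (if n = Suc e * p then Abs_fps (\<nu> v) $ p * (?h v $ Suc e) ^ p else 0)"
            using p flat that by (intro compose_shift_nth) (auto simp: flat_jets_def)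
          then show ?thesis using that \<nu>[OF v] by (simp add: jet_subst_def jet_nth fps_X_power_nth)
        qed
        have "1 * p < Suc e * p" using True p0 by (intro mult_less_mono1) auto
        then have "?\<nu> v p = 1" using nth[of p] \<nu>[OF v] p1 p(3) by (simp del: mult_Suc)
        moreover have "?\<nu> v (l * p) = 0" if l: "2 \<le> l" "l \<le> Suc e" "l * (p - 1) < m" for l
        proof (cases "l * p \<in> {1..k}")
          case False
          then show ?thesis by (rule jet_subst_outside)
        next
          case lk: True
          have "l * p = l * (p - 1) + l" using p0 by (rule mult_eq_mult_pred_add)
          then have lm: "l * p < m + Suc e" using l by simp
          have lp: "l * p \<le> Suc e * p" using l by (intro mult_le_mono1)
          show ?thesis
          proof (cases "l = Suc e")
            case True
            then show ?thesis using nth[OF lk lm lp] by (simp add: r)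
          next
            case False
            then have "l * p \<noteq> Suc e * p" "l \<le> e" using p0 l(2) by (auto simp: le_Suc_eq simp del: mult_Suc)
            then show ?thesis using nth[OF lk lm lp] \<nu>[OF v] l by (simp del: mult_Suc)
          qed
        qed
        ultimately show ?thesis using orb' by blast
      qed
      ultimately show ?thesis by (intro exI[of _ ?\<nu>]) blast
    qed
  qed
  \<comment> \<open>As p - 1 is at least 1, every order l with l (p - 1) < m is at most m, so m
    steps suffice.\<close>
  from this[of m] obtain \<nu> where \<nu>: "\<And>i. (\<lambda>v. \<nu> v i) \<in> ?C"
    "\<And>v. v \<in> flat_jets k m \<Longrightarrow> v p \<noteq> 0 \<Longrightarrow> \<nu> v \<in> jet_orbit k v \<and> \<nu> v p = 1 \<and>
      (\<forall>l. 2 \<le> l \<and> l \<le> m \<and> l * (p - 1) < m \<longrightarrow> \<nu> v (l * p) = 0)"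
    by metis
  have "l \<le> m" if "l * (p - 1) < m" for l
  proof -
    have "l * 1 \<le> l * (p - 1)" using prime_ge_2_nat[OF p(2)] by (intro mult_le_mono2) simp
    then show ?thesis using that by linarith
  qed
  then show ?thesis using \<nu> by (intro that[of \<nu>]) (auto simp: normal_jet_def)
qed

text \<open>Let h be the difference between the connecting coordinate change and x. Comparing the
  coefficients of index e p, which both jets have in common, forces h to vanish at order e as long
  as e (p - 1) < m, since p-th powers are injective. What is left of h acts only beyond index
  j.\<close>

lemma normal_jet_unique:
  fixes v w :: "nat \<Rightarrow> 'k::field"
  assumes p: "CHAR('k) = p" "prime p" "p \<le> m"
    and k: "\<And>e. e * (p - 1) < m \<Longrightarrow> e * p \<le> k"
    and v: "v \<in> flat_jets k m" "normal_jet p m v" and w: "w \<in> jet_orbit k v" "normal_jet p m w"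
    and j: "j \<in> {1..k}" "j * (p - 1) < m * p"
  shows "w j = v j"
proof -
  have p2: "p \<ge> 2" using p(2) by (rule prime_ge_2_nat)
  have pk: "p \<in> {1..k}" using k[of 1] p2 p(3) by simp
  have g: "\<forall>i\<le>m. of_nat i * Abs_fps v $ i = 0" using v(1) by (simp add: flat_jets_def)
  obtain \<phi> where \<phi>: "coord_change \<phi>" and w_eq: "w = jet_subst k \<phi> v" using w(1) by (auto simp: jet_orbit_def)
  define h where "h = \<phi> - fps_X"
  have \<phi>_eq: "\<phi> = fps_X + h" by (simp add: h_def)
  have nth: "w n = v n + (if n = e * p then (h $ e) ^ p else 0)"
    if "fps_X ^ e dvd h" "e \<ge> 1" "n \<in> {1..k}" "n < m + e" "n \<le> e * p" for n e
    using compose_shift_nth[OF p g that(1,2,4,5)] that(3) v(2)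
    by (simp add: w_eq jet_subst_def jet_nth \<phi>_eq normal_jet_def)
  have low: "v i = 0" if "i < p" for i
  proof (cases "i = 0")
    case True
    then show ?thesis using v(1) affine_points_0 by (auto simp: flat_jets_def)
  next
    case False
    then have "\<not> p dvd i" using that by (auto dest: dvd_imp_le)
    moreover have "i \<le> m" using that p(3) by simp
    ultimately show ?thesis using v(1) p(1) by (auto simp: flat_jets_def of_nat_eq_0_iff_char_dvd)
  qed
  \<comment> \<open>No coefficient of index below p is present, so the one of index p is just
    multiplied by the p-th power of the linear coefficient.\<close>
  have "w p = (\<Sum>i=0..p. v i * (\<phi> ^ i) $ p)" unfolding w_eq using pk by (rule jet_subst_nth)
  also have "\<dots> = (\<Sum>i=0..p. if i = p then v p * (\<phi> ^ p) $ p else 0)"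
    by (intro sum.cong) (auto simp: low)
  also have "\<dots> = v p * (\<phi> $ 1) ^ p"
    using startsby_zero_power_nth_same[of \<phi> p] coord_changeD(1)[OF \<phi>] by (simp add: sum.delta)
  finally have "(\<phi> $ 1) ^ p = 1 ^ p" using v(2) w(2) by (simp add: normal_jet_def)
  then have "\<phi> $ 1 = 1" by (rule frobenius_inj[OF p(1,2)])
  then have h2: "fps_X ^ 2 dvd h"
    using coord_changeD(1)[OF \<phi>] by (auto simp: X_power_dvd_iff h_def less_2_cases_iff One_nat_def)
  have dvd: "fps_X ^ Suc (Suc e) dvd h" if "Suc e * (p - 1) < m" for e
    using that
  proof (induction e)
    case 0
    then show ?case using h2 by (simp add: numeral_2_eq_2)
  next
    case (Suc e)
    let ?e = "Suc (Suc e)"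
    have d: "fps_X ^ ?e dvd h" using Suc.prems by (intro Suc.IH) (simp add: algebra_simps)
    have "?e * p = ?e * (p - 1) + ?e" using p2 mult_eq_mult_pred_add[of p "?e"] by simp
    then have lt: "?e * p < m + ?e" using Suc.prems by simp
    have "w (?e * p) = v (?e * p) + (h $ ?e) ^ p"
      using nth[OF d, of "?e * p"] k[OF Suc.prems] lt p2 by simp
    then have "h $ ?e = 0" using v(2) w(2) Suc.prems p2 by (simp add: normal_jet_def del: mult_Suc)
    then show ?case using d by (simp only: X_power_dvd_iff) (metis less_Suc_eq)
  qed
  \<comment> \<open>The first order that the comparison does not exclude. It is at least 2 because p
    is at most m.\<close>
  define e where "e = (LEAST e. m \<le> e * (p - 1))"
  have "m * 1 \<le> m * (p - 1)" using p2 by (intro mult_le_mono2) simp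
  then have "m \<le> m * (p - 1)" by linarith
  then have e: "m \<le> e * (p - 1)" unfolding e_def by (rule LeastI)
  have "e \<noteq> 0" using e p2 p(3) by (cases e) auto
  moreover have "e \<noteq> 1" using e p2 p(3) by (intro notI) simp
  ultimately obtain e' where e': "e = Suc (Suc e')" by (metis One_nat_def not0_implies_Suc)
  then have "Suc e' * (p - 1) < m" using not_less_Least[of "Suc e'" "\<lambda>e. m \<le> e * (p - 1)"] by (simp add: e_def[symmetric])
  then have d: "fps_X ^ e dvd h" unfolding e' by (rule dvd)
  have ep: "e * p = e * (p - 1) + e" using p2 mult_eq_mult_pred_add[of p "e"] by simp
  have "j < m + e"
  proof (rule ccontr)
    assume "\<not> j < m + e"
    then have "(m + e) * (p - 1) \<le> j * (p - 1)" by (intro mult_le_mono1) simp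
    moreover have "m * p = m * (p - 1) + m" using p2 mult_eq_mult_pred_add[of p "m"] by simp
    ultimately show False using j(2) e add_mult_distrib[of m e "p - 1"] by linarith
  qed
  then show ?thesis using nth[OF d _ j(1)] e ep e' by simp
qed

text \<open>Let E be the largest e with e (p - 1) < m. All E indices from m + 1 to m + E satisfy the
  inequality, and the multiples of p among them are i p with m div p < i and i at most E. Removing
  these leaves at least m div p indices.\<close>

lemma card_free_coordinates:
  fixes p m :: nat
  assumes "p \<ge> 2" "p \<le> m"
  defines "J \<equiv> {j. m < j \<and> j * (p - 1) < m * p \<and> \<not> p dvd j}"
  shows "finite J" "m div p \<le> card J"
proof -
  have "j \<le> m * p" if "j \<in> J" for j
  proof -
    have "j * 1 \<le> j * (p - 1)" using assms(1) by (intro mult_le_mono2) simp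
    moreover have "j * (p - 1) < m * p" using that by (simp add: J_def)
    ultimately show ?thesis by linarith
  qed
  then show fin: "finite J" unfolding finite_nat_set_iff_bounded_le by blast
  define E where "E = (m - 1) div (p - 1)"
  have E1: "E * (p - 1) \<le> m - 1" by (simp add: E_def)
  have E2: "m \<le> (E + 1) * (p - 1)"
    using dividend_less_div_times[of "p - 1" "m - 1"] assms add_mult_distrib[of E 1 "p - 1"]
    by (fold E_def) linarith
  have mp: "m * p = m * (p - 1) + m" using assms(1) mult_eq_mult_pred_add[of p "m"] by simp
  have "{m<..m + E} \<subseteq> J \<union> (\<lambda>i. i * p) ` {m div p<..E}"
  proof
    fix j assume j: "j \<in> {m<..m + E}"
    have "j * (p - 1) \<le> (m + E) * (p - 1)" using j by (intro mult_le_mono1) simp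
    then have lt: "j * (p - 1) < m * p" using E1 mp assms add_mult_distrib[of m E "p - 1"] by linarith
    show "j \<in> J \<union> (\<lambda>i. i * p) ` {m div p<..E}"
    proof (cases "p dvd j")
      case True
      then obtain i where i: "j = i * p" by (metis dvd_def mult.commute)
      have "m div p < i" using j i assms by (simp add: less_mult_imp_div_less)
      moreover have "i \<le> E"
      proof (rule ccontr)
        assume "\<not> i \<le> E"
        then have "(E + 1) * p \<le> i * p" by (intro mult_le_mono1) simp
        moreover have "(E + 1) * p = (E + 1) * (p - 1) + E + 1" using assms(1) mult_eq_mult_pred_add[of p "(E + 1)"] by simp
        ultimately show False using j i E2 by simp
      qed
      ultimately show ?thesis using i by auto
    qed (use j lt in \<open>auto simp: J_def\<close>)
  qed
  then have "card {m<..m + E} \<le> card (J \<union> (\<lambda>i. i * p) ` {m div p<..E})" using fin by (intro card_mono) auto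
  also have "\<dots> \<le> card J + card {m div p<..E}"
    using card_Un_le[of J "(\<lambda>i. i * p) ` {m div p<..E}"] card_image_le[of "{m div p<..E}" "\<lambda>i. i * p"] by simp
  finally have "E \<le> card J + (E - m div p)" by simp
  moreover have "m div p \<le> E"
  proof -
    have "m div p * (p - 1) + m div p = m div p * p" using assms(1) mult_eq_mult_pred_add[of p "m div p"] by simp
    also have "\<dots> \<le> m" by simp
    finally have "m div p * (p - 1) + m div p \<le> m" .
    moreover have "m div p > 0" using assms by (simp add: div_greater_zero_iff)
    ultimately have "m div p * (p - 1) \<le> m - 1" by linarith
    then show ?thesis using assms(1) by (simp add: E_def less_eq_div_iff_mult_less_eq)
  qed
  ultimately show "m div p \<le> card J" by simp
qed

section \<open>Chains of irreducible closed sets in a quotient\<close>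

lemma open_meet_on_line:
  fixes v w :: "nat \<Rightarrow> 'k::alg_closed_field"
  assumes "openin (zariski I) U" "openin (zariski I) V" "v \<in> U" "w \<in> V"
  obtains s where "(\<lambda>i. v i + s * (w i - v i)) \<in> U \<inter> V"
proof -
  have vw: "v \<in> affine_points I" "w \<in> affine_points I"
    using assms openin_subset[of "zariski I"] by auto
  have eq: "poly [:v i, w i - v i:] s = v i + s * (w i - v i)" for i s by (simp add: algebra_simps)
  obtain s where "(\<lambda>i. poly [:v i, w i - v i:] s) \<in> U" "(\<lambda>i. poly [:v i, w i - v i:] s) \<in> V"
    by (rule open_meet_on_curve[OF assms(1,2), of "\<lambda>i. [:v i, w i - v i:]" 0 1 "{}"])
      (use vw assms in \<open>auto simp: affine_points_def\<close>)
  then show ?thesis using that unfolding eq by blast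
qed

text \<open>The chain consists of the closures of the images of the first coordinate subspaces.\<close>

lemma krull_dim_ge_family:
  fixes \<tau> :: "(nat \<Rightarrow> 'k::alg_closed_field) \<Rightarrow> nat \<Rightarrow> 'k" and T :: "'y topology"
  assumes cont: "continuous_map (subtopology (zariski I) A) T pr"
    and opn: "open_map (subtopology (zariski I) A) T pr"
    and \<tau>: "\<And>i. i \<in> I \<Longrightarrow> (\<lambda>t. \<tau> t i) \<in> polyfun {..<q}" "\<And>t. \<tau> t \<in> affine_points I"
    and G0: "openin (zariski I) G0" "\<tau> (\<lambda>_. 0) \<in> G0" "\<And>t. \<tau> t \<in> G0 \<Longrightarrow> \<tau> t \<in> U \<inter> A"
    and sep: "\<And>j. j < q \<Longrightarrow> \<exists>G. openin (zariski I) G \<and> (\<forall>t. \<tau> t \<in> G0 \<longrightarrow> t j \<noteq> 0 \<longrightarrow> \<tau> t \<in> G) \<and>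
        (\<forall>t g. \<tau> t \<in> G0 \<longrightarrow> g \<in> G \<inter> A \<longrightarrow> pr g = pr (\<tau> t) \<longrightarrow> t j \<noteq> 0)"
  shows "enat q \<le> krull_dim T (pr ` (U \<inter> A))"
proof -
  define B where "B = pr ` (U \<inter> A)"
  let ?P = "zariski {..<q} :: (nat \<Rightarrow> 'k) topology"
  \<comment> \<open>Parameters supported on the first \<open>j\<close> coordinates, as far as the
    family stays in the open set \<open>G0\<close>: a nonempty open part of a linear space, hence
    irreducible.\<close>
  define W where "W j = {t \<in> affine_points {..<j}. \<tau> t \<in> G0}" for j
  define E where "E j = (\<lambda>t. pr (\<tau> t)) ` W j" for j
  define Z where "Z j = subtopology T B closure_of E j" for j
  have preimage: "openin ?P {t \<in> affine_points {..<q}. \<tau> t \<in> G}" if "openin (zariski I) G" for G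
  proof -
    have "continuous_map ?P (zariski I) \<tau>"
    proof (rule continuous_map_zariskiI)
      fix r :: "(nat \<Rightarrow> 'k) \<Rightarrow> 'k" assume "r \<in> polyfun I"
      then have "(\<lambda>t. r (\<lambda>i. \<tau> t i)) \<in> polyfun {..<q}" by (rule polyfun_subst[OF fun_algebra_polyfun _ \<tau>(1)])
      then show "openin ?P {x \<in> topspace ?P. r (\<tau> x) \<noteq> 0}" using openin_zariski_nonzero by fastforce
    qed (rule \<tau>(2))
    then show ?thesis using that by (simp add: continuous_map_def)
  qed
  have W_sub: "W j \<subseteq> affine_points {..<q}" if "j \<le> q" for j
    using that by (auto simp: W_def affine_points_def)
  have meet: "\<exists>t\<in>W j. t \<in> O1 \<and> t \<in> O2"
    if "openin ?P O1" "openin ?P O2" "t1 \<in> W j" "t1 \<in> O1" "t2 \<in> affine_points {..<j}" "t2 \<in> O2" "j \<le> q" for O1 O2 t1 t2 j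
  proof -
    note h = that
    let ?O = "O1 \<inter> {t \<in> affine_points {..<q}. \<tau> t \<in> G0}"
    have "t1 \<in> ?O" using that W_sub[OF \<open>j \<le> q\<close>] by (auto simp: W_def)
    then obtain s where s: "(\<lambda>i. t1 i + s * (t2 i - t1 i)) \<in> ?O \<inter> O2"
      by (rule open_meet_on_line[OF openin_Int[OF h(1) preimage[OF G0(1)]] h(2) _ h(6)])
    moreover have "(\<lambda>i. t1 i + s * (t2 i - t1 i)) \<in> affine_points {..<j}"
      using that by (auto simp: W_def affine_points_def)
    ultimately show ?thesis by (intro bexI[of _ "\<lambda>i. t1 i + s * (t2 i - t1 i)"]) (auto simp: W_def)
  qed
  have EB: "E j \<subseteq> B" for j using G0(3) by (auto simp: E_def W_def B_def)
  have "pr \<in> topspace (subtopology (zariski I) A) \<rightarrow> topspace T" using cont by (simp add: continuous_map_def)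
  moreover have "\<tau> t \<in> topspace (subtopology (zariski I) A)" if "\<tau> t \<in> G0" for t
    using G0(3)[OF that] \<tau>(2) by simp
  ultimately have EB: "E j \<subseteq> topspace (subtopology T B)" for j using EB[of j] by (auto simp: E_def W_def)
  have EZ: "E j \<subseteq> Z j" for j unfolding Z_def by (rule closure_of_subset[OF EB])
  have zero: "(\<lambda>_. 0) \<in> W j" for j using G0(2) by (simp add: W_def affine_points_def)
  have image_open: "openin T (pr ` (G \<inter> A))" if "openin (zariski I) G" for G
    using opn that unfolding open_map_def by (auto simp: openin_subtopology)
  have irr: "irreducible_closed (subtopology T B) (Z j)" if j: "j \<le> q" for j
    unfolding irreducible_closed_def
  proof (intro conjI allI impI)
    show "closedin (subtopology T B) (Z j)" by (simp add: Z_def)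
    show "Z j \<noteq> {}" using EZ[of j] zero[of j] by (auto simp: E_def)
    fix C D assume CD: "closedin (subtopology T B) C \<and> closedin (subtopology T B) D \<and> Z j = C \<union> D"
    have ex: "\<exists>G t. openin ?P G \<and> t \<in> W j \<and> t \<in> G \<and> (\<forall>t. t \<in> G \<longrightarrow> \<tau> t \<in> G0 \<longrightarrow> pr (\<tau> t) \<notin> K)"
      if K: "closedin (subtopology T B) K" "Z j \<noteq> K" "K \<subseteq> Z j" for K
    proof -
      have "\<not> E j \<subseteq> K" using K closure_of_minimal[of "E j" K "subtopology T B"] by (auto simp: Z_def)
      then obtain t where t: "t \<in> W j" "pr (\<tau> t) \<notin> K" by (auto simp: E_def)
      obtain K' where K': "closedin T K'" "K = K' \<inter> B" using K(1) by (auto simp: closedin_subtopology)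
      have "openin (subtopology (zariski I) A) {x \<in> topspace (subtopology (zariski I) A). pr x \<in> topspace T - K'}"
        using K'(1) by (intro openin_continuous_map_preimage[OF cont]) (simp add: closedin_def)
      then obtain G where G: "openin (zariski I) G"
        "{x \<in> topspace (subtopology (zariski I) A). pr x \<in> topspace T - K'} = G \<inter> A"
        by (auto simp: openin_subtopology)
      have iff: "\<tau> t \<in> G \<longleftrightarrow> pr (\<tau> t) \<notin> K" if "\<tau> t \<in> G0" for t
      proof -
        have "pr (\<tau> t) \<in> B" "\<tau> t \<in> A" using G0(3)[OF that] by (auto simp: B_def)
        moreover have "pr (\<tau> t) \<in> topspace T" using EB[of q] cont \<open>\<tau> t \<in> A\<close> \<tau>(2)[of t] by (auto simp: continuous_map_def)
        ultimately show ?thesis using G(2) \<tau>(2)[of t] K'(2) by auto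
      qed
      show ?thesis
        using preimage[OF G(1)] t iff W_sub[OF j]
        by (intro exI[of _ "{t \<in> affine_points {..<q}. \<tau> t \<in> G}"] exI[of _ t]) (auto simp: W_def)
    qed
    show "Z j = C \<or> Z j = D"
    proof (rule ccontr)
      assume "\<not> (Z j = C \<or> Z j = D)"
      then obtain G1 t1 G2 t2 where
        1: "openin ?P G1" "t1 \<in> W j" "t1 \<in> G1" "\<And>t. t \<in> G1 \<Longrightarrow> \<tau> t \<in> G0 \<Longrightarrow> pr (\<tau> t) \<notin> C" and
        2: "openin ?P G2" "t2 \<in> W j" "t2 \<in> G2" "\<And>t. t \<in> G2 \<Longrightarrow> \<tau> t \<in> G0 \<Longrightarrow> pr (\<tau> t) \<notin> D"
        using ex[of C] ex[of D] CD by (metis Un_upper1 Un_upper2)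
      have "t2 \<in> affine_points {..<j}" using 2(2) by (simp add: W_def)
      then obtain t where "t \<in> W j" "t \<in> G1" "t \<in> G2" using meet[OF 1(1) 2(1) 1(2,3) _ 2(3) j] by blast
      then have "pr (\<tau> t) \<notin> C \<union> D" "pr (\<tau> t) \<in> Z j" using 1(4) 2(4) EZ[of j] by (auto simp: W_def E_def)
      then show False using CD by simp
    qed
  qed
  have strict: "Z j \<subset> Z (Suc j)" if j: "j < q" for j
  proof -
    have "W j \<subseteq> W (Suc j)" by (auto simp: W_def affine_points_def)
    then have "Z j \<subseteq> Z (Suc j)" unfolding Z_def E_def by (intro closure_of_mono image_mono)
    moreover have "Z j \<noteq> Z (Suc j)"
    proof
      assume eq: "Z j = Z (Suc j)"
      let ?t = "\<lambda>i. if i = j then 1 else 0 :: 'k"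
      have Oj: "openin ?P {t \<in> affine_points {..<q}. t j \<noteq> 0}" using j by (intro openin_zariski_nonzero polyfun.coord) simp
      have t: "?t \<in> affine_points {..<Suc j}" "?t \<in> {t \<in> affine_points {..<q}. t j \<noteq> 0}"
        using j by (auto simp: affine_points_def)
      have zt: "(\<lambda>_. 0) \<in> topspace ?P" by (simp add: affine_points_def)
      obtain t where t: "t \<in> W (Suc j)" "t j \<noteq> 0"
        using meet[OF openin_topspace Oj zero zt t(1,2)] j by auto
      obtain G where G: "openin (zariski I) G" "\<And>t. \<tau> t \<in> G0 \<Longrightarrow> t j \<noteq> 0 \<Longrightarrow> \<tau> t \<in> G"
        "\<And>t g. \<tau> t \<in> G0 \<Longrightarrow> g \<in> G \<inter> A \<Longrightarrow> pr g = pr (\<tau> t) \<Longrightarrow> t j \<noteq> 0"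
        using sep[OF j] by blast
      have tG: "\<tau> t \<in> G0" using t(1) by (simp add: W_def)
      have "pr (\<tau> t) \<in> pr ` (G \<inter> A) \<inter> B" using G(2)[OF tG t(2)] G0(3)[OF tG] by (auto simp: B_def)
      moreover have "pr (\<tau> t) \<in> Z j" unfolding eq using EZ[of "Suc j"] t(1) by (auto simp: E_def)
      then have "\<forall>O'. pr (\<tau> t) \<in> O' \<and> openin (subtopology T B) O' \<longrightarrow> (\<exists>y. y \<in> E j \<and> y \<in> O')"
        by (simp add: Z_def in_closure_of)
      moreover have "openin (subtopology T B) (pr ` (G \<inter> A) \<inter> B)"
        using image_open[OF G(1)] openin_subtopology by blast
      ultimately have "\<exists>y. y \<in> E j \<and> y \<in> pr ` (G \<inter> A) \<inter> B" by (simp only:)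
      then obtain y where y: "y \<in> E j" "y \<in> pr ` (G \<inter> A)" by blast
      then obtain s g where s: "s \<in> W j" "g \<in> G \<inter> A" "pr g = pr (\<tau> s)" by (auto simp: E_def)
      then have "s j \<noteq> 0" using G(3)[of s g] by (simp add: W_def)
      then show False using s(1) by (simp add: W_def affine_points_def)
    qed
    ultimately show ?thesis by blast
  qed
  show ?thesis unfolding krull_dim_def B_def[symmetric] using irr strict by (intro Sup_upper) auto
qed

text \<open>\<open>flat_jets k m\<close> is a linear space, so a line joining two of its points
  stays inside; this is its irreducibility.\<close>

lemma flat_jets_meet:
  fixes v w :: "nat \<Rightarrow> 'k::alg_closed_field"
  assumes O: "openin (zariski {1..k}) O1" "openin (zariski {1..k}) O2"
    and v: "v \<in> flat_jets k m" "v \<in> O1" and w: "w \<in> flat_jets k m" "w \<in> O2"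
  shows "\<exists>v\<in>flat_jets k m. v \<in> O1 \<and> v \<in> O2"
proof -
  obtain s where s: "(\<lambda>i. v i + s * (w i - v i)) \<in> O1 \<inter> O2"
    by (rule open_meet_on_line[OF O v(2) w(2)])
  moreover have "of_nat i * (v i + s * (w i - v i)) = 0" if "i \<le> m" for i
  proof -
    have vw: "of_nat i * v i = 0" "of_nat i * w i = 0" using v w that by (auto simp: flat_jets_def)
    have "of_nat i * (v i + s * (w i - v i)) = of_nat i * v i + s * (of_nat i * w i - of_nat i * v i)"
      by (simp only: algebra_simps)
    then show ?thesis by (simp only: vw) simp
  qed
  then have "(\<lambda>i. v i + s * (w i - v i)) \<in> flat_jets k m" using v w by (auto simp: flat_jets_def affine_points_def)
  ultimately show ?thesis by blast
qed

lemma jet_stratum: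
  assumes S: "rosenlicht_stratification (jet_group k) (jet_action k) (jet_space k) S"
    and i: "i < length S" "S ! i = (A, Y, pr)"
  shows "jet_invariant k A" "variety Y"
    "geometric_quotient (jet_group k) (jet_action k) (induced_space (jet_space k) A) Y pr"
    "openin (subtopology (zariski {1..k}) (affine_points {1..k} - (\<Union>j<i. fst (S ! j)))) A"
proof -
  have top: "topol (jet_space k) = zariski {1..k}" by (simp add: jet_space_def affine_space_def)
  note * = mp[OF spec[OF conjunct2[OF conjunct2[OF S[unfolded rosenlicht_stratification_def]]], of i] i(1)]
  from * have *: "\<forall>h\<in>jet_group k. \<forall>x\<in>A. jet_action k h x \<in> A" "variety Y"
    "geometric_quotient (jet_group k) (jet_action k) (induced_space (jet_space k) A) Y pr"
    "openin (subtopology (zariski {1..k}) (affine_points {1..k} - (\<Union>j<i. fst (S ! j)))) A"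
    by (simp_all add: i(2) Let_def top)
  then show "variety Y" "geometric_quotient (jet_group k) (jet_action k) (induced_space (jet_space k) A) Y pr"
    "openin (subtopology (zariski {1..k}) (affine_points {1..k} - (\<Union>j<i. fst (S ! j)))) A"
    by blast+
  have A: "A \<subseteq> affine_points {1..k}" using openin_subset[OF *(4)] by auto
  have "jet_subst k \<phi> v \<in> A" if v: "v \<in> A" and \<phi>: "coord_change \<phi>" for v \<phi>
  proof -
    have "\<forall>h\<in>jet_group k. jet_action k h v \<in> A" using *(1) v by blast
    then show ?thesis using jet_group_ball_iff[of v k "\<lambda>w. w \<in> A"] A v \<phi> by blast
  qed
  then show "jet_invariant k A" using A by (simp add: jet_invariant_def)
qed

text \<open>The sections \<open>v\<^sub>0 + \<Sum> t\<^sub>j x\<^sup>j\<close> through a normal jet meet every orbit at most once, and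
  the values of the coefficients of the normal forms are separated by open sets.\<close>

theorem modality_open_ge:
  fixes S :: "(nat \<Rightarrow> 'k::alg_closed_field, 'y, 'k) stratum list"
  assumes p: "CHAR('k) = p" "prime p" and k: "m < k"
    and Jk: "\<And>j. m < j \<Longrightarrow> j * (p - 1) < m * p \<Longrightarrow> \<not> p dvd j \<Longrightarrow> j \<le> k"
    and S: "rosenlicht_stratification (jet_group k) (jet_action k) (jet_space k) S"
    and U: "openin (zariski {1..k}) U" "x \<in> U" "x \<in> flat_jets k m"
  shows "enat (m div p) \<le> modality_open_wrt S U"
proof (cases "m div p = 0")
  case True
  then show ?thesis by (simp add: zero_enat_def[symmetric])
next
  case False
  let ?T = "zariski {1..k} :: (nat \<Rightarrow> 'k) topology" and ?L = "flat_jets k m :: (nat \<Rightarrow> 'k) set"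
  define q where "q = m div p"
  have p2: "p \<ge> 2" using p(2) by (rule prime_ge_2_nat)
  have pm: "p \<le> m" using False by (meson div_less not_le_imp_less)
  have L: "?L \<subseteq> affine_points {1..k}" by (auto simp: flat_jets_def)
  have "x \<in> points (jet_space k)" using U(3) L by (auto simp: jet_space_def affine_space_def)
  then obtain A0 Y0 pr0 where "(A0, Y0, pr0) \<in> set S" "x \<in> A0"
    using S unfolding rosenlicht_stratification_def by blast
  then have ex: "\<exists>i. i < length S \<and> fst (S ! i) \<inter> ?L \<noteq> {}" using U(3) by (metis IntI empty_iff fst_conv in_set_conv_nth)
  \<comment> \<open>The first stratum that meets the linear space: earlier strata miss it, so the
    chosen one contains a nonempty open part of it.\<close>
  define i where "i = (LEAST i. i < length S \<and> fst (S ! i) \<inter> ?L \<noteq> {})"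
  have i: "i < length S" "fst (S ! i) \<inter> ?L \<noteq> {}" unfolding i_def using LeastI_ex[OF ex] by auto
  have before: "fst (S ! j) \<inter> ?L = {}" if "j < i" for j
    using not_less_Least[of j "\<lambda>i. i < length S \<and> fst (S ! i) \<inter> ?L \<noteq> {}"] that i(1) unfolding i_def by auto
  obtain A Y pr where Si: "S ! i = (A, Y, pr)" by (metis prod_cases3)
  note A = jet_stratum(1)[OF S i(1) Si] and gq = jet_stratum(3)[OF S i(1) Si]
  obtain W where W: "openin ?T W" "A = W \<inter> (affine_points {1..k} - (\<Union>j<i. fst (S ! j)))"
    using jet_stratum(4)[OF S i(1) Si] by (auto simp: openin_subtopology)
  have WL: "v \<in> W \<Longrightarrow> v \<in> ?L \<Longrightarrow> v \<in> A" for v using W(2) L before by auto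
  define D where "D = {v \<in> affine_points {1..k}. v p \<noteq> (0::'k)}"
  have p1k: "p \<in> {1..k}" using p2 pm k by simp
  have D: "openin ?T D" unfolding D_def using p1k by (intro openin_zariski_nonzero polyfun.coord)
  define G0 where "G0 = U \<inter> W \<inter> D"
  have G0: "openin ?T G0" unfolding G0_def by (intro openin_Int U W D)
  obtain w where "w \<in> W" "w \<in> ?L" using i(2) Si W(2) by auto
  then obtain x1 where x1: "x1 \<in> ?L" "x1 \<in> U \<inter> W" using flat_jets_meet[OF U(1) W(1) U(3,2)] by blast
  \<comment> \<open>The jet of x^p, whose derivative is zero, shows that the condition on coordinate
    p is met inside the linear space.\<close>
  let ?e = "\<lambda>i. if i = p then 1 else 0 :: 'k"
  have "?e \<in> ?L" "?e \<in> D" using p1k p(1) by (auto simp: flat_jets_def affine_points_def D_def)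
  then obtain g0 where g0: "g0 \<in> ?L" "g0 \<in> G0" using flat_jets_meet[OF openin_Int[OF U(1) W(1)] D x1] by (auto simp: G0_def)
  obtain \<nu> where \<nu>: "\<And>i. (\<lambda>v. \<nu> v i) \<in> root_functions p k"
    "\<And>v. v \<in> ?L \<Longrightarrow> v p \<noteq> 0 \<Longrightarrow> \<nu> v \<in> jet_orbit k v \<and> normal_jet p m (\<nu> v)"
    by (rule normal_form_exists[OF p pm less_imp_le[OF k]]) blast
  define n0 where "n0 = \<nu> g0"
  have "g0 p \<noteq> 0" using g0(2) by (simp add: G0_def D_def)
  then have n0: "n0 \<in> jet_orbit k g0" "normal_jet p m n0" using \<nu>(2)[OF g0(1)] by (auto simp: n0_def)
  have g0p: "g0 \<in> affine_points {1..k}" using g0(1) L by blast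
  have "g0 \<in> jet_orbit k n0" using jet_orbit_sym[OF g0p n0(1)] .
  then obtain \<psi> where \<psi>: "coord_change \<psi>" "g0 = jet_subst k \<psi> n0" by (auto simp: jet_orbit_def)
  have n0L: "n0 \<in> ?L"
    using n0(1) g0(1) jet_invariantD(1)[OF jet_invariant_flat_jets] by (auto simp: jet_orbit_def)
  let ?J = "{j. m < j \<and> j * (p - 1) < m * p \<and> \<not> p dvd j}"
  have "q \<le> card ?J" unfolding q_def by (rule card_free_coordinates(2)[OF p2 pm])
  then obtain J where J: "J \<subseteq> ?J" "card J = q" "finite J" by (rule obtain_subset_with_card_n)
  obtain a where a: "bij_betw a {..<q} J"
    using ex_bij_betw_nat_finite[OF J(3)] J(2) by (auto simp: atLeast0LessThan)
  have aJ: "m < a j" "a j * (p - 1) < m * p" "\<not> p dvd a j" "a j \<in> {1..k}" if "j < q" for j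
  proof -
    have "a j \<in> ?J" using a J(1) that by (auto simp: bij_betw_def)
    then show "m < a j" "a j * (p - 1) < m * p" "\<not> p dvd a j" "a j \<in> {1..k}" using Jk[of "a j"] by auto
  qed
  \<comment> \<open>For e at least 2, one of m + e and m + e - 1 is prime to p and satisfies the
    bound, hence is at most k; and e p is below m + e.\<close>
  have Ek: "e * p \<le> k" if e: "e * (p - 1) < m" for e
  proof (cases "e \<le> 1")
    case True
    then have "e * p \<le> 1 * p" by (rule mult_le_mono1)
    then show ?thesis using pm k by linarith
  next
    case False
    have ep: "e * p < m + e" using e mult_eq_mult_pred_add[of p e] p2 by simp
    have mp: "m * p = m * (p - 1) + m" using mult_eq_mult_pred_add[of p m] p2 by simp
    have lt: "j * (p - 1) < m * p" if "j \<le> m + e" for j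
      using mult_le_mono1[OF that, of "p - 1"] e mp add_mult_distrib[of m e "p - 1"] by linarith
    show ?thesis
    proof (cases "p dvd m + e")
      case True
      have "\<not> p dvd m + e - 1"
      proof
        assume "p dvd m + e - 1"
        then have "p dvd (m + e) - (m + e - 1)" using True by (rule dvd_diff_nat[rotated])
        then show False using False p2 by simp
      qed
      then have "m + e - 1 \<le> k" using lt[of "m + e - 1"] False by (intro Jk) auto
      then show ?thesis using ep by simp
    next
      case np: False
      then have "m + e \<le> k" using lt[of "m + e"] False by (intro Jk) auto
      then show ?thesis using ep by simp
    qed
  qed
  define base where "base t i = n0 i + (\<Sum>l<q. if a l = i then t l else 0)" for t :: "nat \<Rightarrow> 'k" and i
  have base_out: "base t i = n0 i" if "i \<notin> a ` {..<q}" for t i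
    using that by (auto simp: base_def intro!: sum.neutral)
  have base_a: "base t (a j) = n0 (a j) + t j" if "j < q" for t j
  proof -
    have "(\<Sum>l<q. if a l = a j then t l else 0) = (\<Sum>l<q. if l = j then t l else 0)"
      using a that by (intro sum.cong) (auto simp: bij_betw_def inj_on_def)
    then show ?thesis using that by (simp add: base_def)
  qed
  have baseL: "base t \<in> ?L" for t
    unfolding flat_jets_def affine_points_def
  proof (intro CollectI conjI allI impI)
    fix i assume "i \<notin> {1..k}"
    moreover from this have "i \<notin> a ` {..<q}" using aJ(4) by auto
    ultimately show "base t i = 0" using n0L by (simp add: base_out flat_jets_def affine_points_def)
  next
    fix i assume "i \<le> m"
    moreover from this have "i \<notin> a ` {..<q}" by (auto dest!: aJ(1))
    ultimately show "of_nat i * base t i = 0" using n0L by (simp add: base_out flat_jets_def)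
  qed
  have base_normal: "normal_jet p m (base t)" for t
  proof -
    have "e * p \<notin> a ` {..<q}" for e using aJ(3) by (metis dvd_triv_right imageE lessThan_iff)
    from this[of 1] this show ?thesis using n0(2) by (simp add: normal_jet_def base_out)
  qed
  \<comment> \<open>The family through the normal jet \<open>n0\<close> is carried back by
    \<open>\<psi>\<close>, so that its origin becomes \<open>g0\<close> and lies in the prescribed
    open set.\<close>
  define \<tau> where "\<tau> t = jet_subst k \<psi> (base t)" for t
  have \<tau>p: "\<tau> t \<in> affine_points {1..k}" for t by (simp add: \<tau>_def)
  have \<tau>L: "\<tau> t \<in> ?L" for t unfolding \<tau>_def by (rule jet_invariantD(1)[OF jet_invariant_flat_jets baseL \<psi>(1)])
  have \<tau>_orbit: "\<tau> t \<in> jet_orbit k (base t)" for t using \<psi>(1) by (auto simp: \<tau>_def jet_orbit_def)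
  have key: "\<nu> g (a j) = n0 (a j) + t j"
    if g: "g \<in> jet_orbit k (\<tau> t)" "g p \<noteq> 0" and j: "j < q" for g t j
  proof -
    have gL: "g \<in> ?L"
      using g(1) jet_invariantD(1)[OF jet_invariant_flat_jets \<tau>L] by (auto simp: jet_orbit_def)
    have bp: "base t \<in> affine_points {1..k}" using baseL L by blast
    have "\<nu> g \<in> jet_orbit k (base t)"
      using \<nu>(2)[OF gL g(2)] jet_orbit_trans[OF bp jet_orbit_trans[OF bp \<tau>_orbit g(1)]] by blast
    then have "\<nu> g (a j) = base t (a j)"
      using normal_jet_unique[OF p pm Ek baseL base_normal _ _ aJ(4,2)[OF j]] \<nu>(2)[OF gL g(2)] by blast
    then show ?thesis by (simp only: base_a[OF j])
  qed
  have "enat q \<le> krull_dim (topol Y) (pr ` (U \<inter> A))"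
  proof (rule krull_dim_ge_family[OF geometric_quotient_jets(1,2)[OF A gq], of \<tau> q G0])
    show "(\<lambda>t. \<tau> t i) \<in> polyfun {..<q}" if "i \<in> {1..k}" for i
    proof -
      have "(\<lambda>t. if a l = j then t l else 0 :: 'k) \<in> polyfun {..<q}" if "l < q" for l j
        using that by (cases "a l = j") (auto intro: polyfun.intros)
      then have "(\<lambda>t. \<Sum>j=0..i. base t j * (\<psi> ^ j) $ i) \<in> polyfun {..<q}"
        unfolding base_def by (intro polyfun_sum polyfun.mult polyfun.add polyfun.const) auto
      then show ?thesis by (simp only: \<tau>_def jet_subst_nth[OF that])
    qed
    show "\<tau> (\<lambda>_. 0) \<in> G0"
    proof -
      have "base (\<lambda>_. 0) = n0" by (simp add: base_def fun_eq_iff)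
      then show ?thesis using g0(2) \<psi>(2) by (simp add: \<tau>_def)
    qed
    show "\<tau> t \<in> U \<inter> A" if "\<tau> t \<in> G0" for t using that WL[OF _ \<tau>L] by (auto simp: G0_def)
    fix j assume j: "j < q"
    obtain N M Q where Q: "Q \<in> polyfun {1..k}" "\<And>v. v p \<noteq> 0 \<Longrightarrow> \<nu> v (a j) ^ (p ^ N) * v p ^ M = Q v"
      using \<nu>(1)[of "a j"] by (auto simp: root_functions_def)
    define c where "c = n0 (a j)"
    \<comment> \<open>On jets equivalent to \<open>\<tau> t\<close> the difference of p-powers
      equals \<open>t j\<close> to the same p-power, up to a power of \<open>g p\<close>: the
      iterated root is separated from \<open>c\<close> by a polynomial.\<close>
    define G where "G = G0 \<inter> {v \<in> affine_points {1..k}. Q v - c ^ (p ^ N) * v p ^ M \<noteq> 0}"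
    have "openin ?T G"
      unfolding G_def using p1k
      by (intro openin_Int G0 openin_zariski_nonzero polyfun_diff Q polyfun_cmult polyfun_power polyfun.coord)
    moreover have iff: "Q g - c ^ (p ^ N) * g p ^ M \<noteq> 0 \<longleftrightarrow> t j \<noteq> 0"
      if g: "g \<in> jet_orbit k (\<tau> t)" "g p \<noteq> 0" for g t
    proof -
      have "(c + t j) ^ (p ^ N) = c ^ (p ^ N) + t j ^ (p ^ N)"
        using freshmans_dream'[where 'a = 'k] p by blast
      then have "Q g - c ^ (p ^ N) * g p ^ M = t j ^ (p ^ N) * g p ^ M"
        unfolding Q(2)[of g, OF g(2), symmetric] key[OF g j] c_def[symmetric] by (simp add: algebra_simps)
      then show ?thesis using g(2) p2 by simp
    qed
    have nz: "v p \<noteq> 0" if "v \<in> G0" for v using that by (simp add: G0_def D_def)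
    have "\<tau> t \<in> G" if "\<tau> t \<in> G0" "t j \<noteq> 0" for t
      using iff[OF jet_orbit_refl[OF \<tau>p[of t]] nz[of "\<tau> t"]] that \<tau>p by (simp add: G_def)
    moreover have "t j \<noteq> 0" if "\<tau> t \<in> G0" "g \<in> G \<inter> A" "pr g = pr (\<tau> t)" for t g
    proof -
      have "\<tau> t \<in> A" using that(1) WL[OF _ \<tau>L] by (auto simp: G0_def)
      then have "g \<in> jet_orbit k (\<tau> t)" using geometric_quotient_jets(3)[OF A gq, of "\<tau> t" g] that by auto
      then show ?thesis using iff[of g t] nz[of g] that(2) by (simp add: G_def)
    qed
    ultimately show "\<exists>G. openin ?T G \<and> (\<forall>t. \<tau> t \<in> G0 \<longrightarrow> t j \<noteq> 0 \<longrightarrow> \<tau> t \<in> G) \<and>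
        (\<forall>t g. \<tau> t \<in> G0 \<longrightarrow> g \<in> G \<inter> A \<longrightarrow> pr g = pr (\<tau> t) \<longrightarrow> t j \<noteq> 0)" by blast
  qed (use \<tau>p G0 in auto)
  moreover have "(A, Y, pr) \<in> set S" using i(1) Si by (metis nth_mem)
  ultimately show ?thesis unfolding modality_open_wrt_def q_def
    by (intro order_trans[OF _ SUP_upper]) auto
qed

section \<open>Determinacy and the Milnor number\<close>

text \<open>The contraction principle for the x-adic topology; iteration starts at 0 and each step
  fixes one more coefficient.\<close>

lemma fps_fixed_point:
  fixes \<Phi> :: "'k::comm_ring_1 fps \<Rightarrow> 'k fps"
  assumes \<Phi>: "\<And>n y z. agree n y z \<Longrightarrow> agree (Suc n) (\<Phi> y) (\<Phi> z)"
  obtains y where "\<Phi> y = y"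
proof -
  define s where "s n = (\<Phi> ^^ n) 0" for n
  have s_agree: "agree n (s n) (s (n + l))" for n l
  proof (induction n)
    case 0
    then show ?case by (simp add: agree_def)
  next
    case (Suc n)
    then show ?case using \<Phi>[of n "s n" "s (n + l)"] by (simp add: s_def)
  qed
  define y where "y = Abs_fps (\<lambda>n. s (Suc n) $ n)"
  have y: "agree n y (s n)" for n
    unfolding agree_def
  proof (intro allI impI)
    fix i assume i: "i < n"
    then have "s (Suc i) $ i = s (Suc i + (n - Suc i)) $ i"
      using s_agree[of "Suc i" "n - Suc i"] unfolding agree_def by blast
    then show "y $ i = s n $ i" using i by (simp add: y_def)
  qed
  have "agree (Suc n) (\<Phi> y) y" for n
    using agree_trans[OF \<Phi>[OF y[of n]] agree_sym[OF y[of "Suc n", unfolded s_def, simplified], folded s_def]]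
    by (simp add: s_def)
  then have "\<Phi> y = y" by (auto simp: agree_def fps_eq_iff)
  then show ?thesis using that by blast
qed

definition taylor_rest :: "'k::comm_ring_1 fps \<Rightarrow> 'k fps \<Rightarrow> 'k fps" where
  "taylor_rest h y = (h oo (fps_X + y)) - h - fps_deriv h * y"

lemma X_power_dvd_mono: "m \<le> n \<Longrightarrow> fps_X ^ n dvd f \<Longrightarrow> fps_X ^ m dvd (f :: 'k::field fps)"
  by (auto simp: X_power_dvd_iff)

text \<open>The recursion R_(i+1)(y) = (x + y) R_i(y) + i x^(i-1) y^2 for the remainder of x^i gives
  the estimate by induction, without division by factorials.\<close>

lemma taylor_rest_X_power:
  fixes y z :: "'k::field fps"
  assumes "1 \<le> a" and y: "fps_X ^ a dvd y" and z: "fps_X ^ a dvd z" and yz: "fps_X ^ n dvd y - z"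
  shows "fps_X ^ a dvd taylor_rest (fps_X ^ i) z \<and>
    fps_X ^ (n + a) dvd taylor_rest (fps_X ^ i) y - taylor_rest (fps_X ^ i) z"
proof (induction i)
  case 0
  then show ?case by (simp add: taylor_rest_def)
next
  case (Suc i)
  let ?R = "\<lambda>y. taylor_rest (fps_X ^ i) y" and ?c = "of_nat i * fps_X ^ (i - 1) :: 'k fps"
  have X: "fps_X ^ i oo (fps_X + y) = (fps_X + y) ^ i" if "fps_X ^ a dvd y" for i and y :: "'k fps"
    using that assms(1) by (simp add: fps_compose_power[symmetric] fps_X_fps_compose_startby0 X_power_dvd_iff)
  have rec: "taylor_rest (fps_X ^ Suc i) y = (fps_X + y) * ?R y + ?c * y * y"
    if "fps_X ^ a dvd y" for y :: "'k fps"
  proof -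
    have "fps_X * ?c = of_nat i * fps_X ^ i" by (cases i) (simp_all add: mult.left_commute)
    moreover have "fps_deriv (fps_X ^ j :: 'k fps) = of_nat j * fps_X ^ (j - 1)" for j
      by (simp add: fps_deriv_power fps_of_nat[symmetric])
    ultimately show ?thesis unfolding taylor_rest_def X[OF that]
      by (simp add: algebra_simps)
  qed
  have z2: "fps_X ^ (n + a) dvd ?R y - ?R z" and z1: "fps_X ^ a dvd ?R z" using Suc by auto
  have "fps_X ^ a dvd ?c * z * z" using z by simp
  moreover have "fps_X ^ a dvd (fps_X + z) * ?R z" using z1 by simp
  ultimately have "fps_X ^ a dvd taylor_rest (fps_X ^ Suc i) z" unfolding rec[OF z] by simp
  moreover have "fps_X ^ (n + a) dvd taylor_rest (fps_X ^ Suc i) y - taylor_rest (fps_X ^ Suc i) z"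
  proof -
    have "taylor_rest (fps_X ^ Suc i) y - taylor_rest (fps_X ^ Suc i) z =
        (fps_X + y) * (?R y - ?R z) + (y - z) * ?R z + ?c * ((y - z) * (y + z))"
      unfolding rec[OF y] rec[OF z] by (simp add: algebra_simps)
    moreover have "fps_X ^ (n + a) dvd (y - z) * ?R z" "fps_X ^ (n + a) dvd (y - z) * (y + z)"
      unfolding power_add using yz z1 y z by (auto intro!: mult_dvd_mono)
    ultimately show ?thesis using z2 by simp
  qed
  ultimately show ?case by blast
qed

text \<open>Modulo x^(n+a) only finitely many monomials of \<open>h\<close> matter, so linearity
  reduces the estimate to powers of x.\<close>

lemma taylor_rest_diff:
  fixes h y z :: "'k::field fps"
  assumes a: "1 \<le> a" and y: "fps_X ^ a dvd y" and z: "fps_X ^ a dvd z" and yz: "fps_X ^ n dvd y - z"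
  shows "fps_X ^ (n + a) dvd taylor_rest h y - taylor_rest h z"
proof -
  define N where "N = n + a"
  define g where "g = (\<Sum>i\<le>N. fps_const (h $ i) * fps_X ^ i)"
  have gN: "agree (Suc N) h g"
    by (auto simp: agree_def g_def fps_sum_nth fps_X_power_nth if_distrib cong: if_cong)
  have "agree N (fps_deriv h) (fps_deriv g)" using gN by (simp add: agree_def)
  then have cong: "agree N (taylor_rest h y) (taylor_rest g y)" for y
    unfolding taylor_rest_def using agree_mono[OF gN, of N]
    by (intro agree_diff agree_mult agree_compose) auto
  have lin: "taylor_rest g y = (\<Sum>i\<le>N. fps_const (h $ i) * taylor_rest (fps_X ^ i) y)"
    if "fps_X ^ a dvd y" for y
  proof -
    have "y $ 0 = 0" using that a by (simp add: X_power_dvd_iff)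
    then have "g oo (fps_X + y) = (\<Sum>i\<le>N. fps_const (h $ i) * (fps_X ^ i oo (fps_X + y)))"
      by (simp add: g_def fps_compose_sum_distrib fps_compose_mult_distrib)
    moreover have "fps_deriv g * y = (\<Sum>i\<le>N. fps_const (h $ i) * (fps_deriv (fps_X ^ i) * y))"
      by (simp add: g_def fps_deriv_sum sum_distrib_right mult.assoc)
    ultimately show ?thesis
      unfolding taylor_rest_def right_diff_distrib sum_subtractf by (simp add: g_def)
  qed
  have "fps_X ^ N dvd taylor_rest g y - taylor_rest g z"
    unfolding lin[OF y] lin[OF z] sum_subtractf[symmetric] right_diff_distrib[symmetric]
    using taylor_rest_X_power[OF a y z yz] by (intro dvd_sum dvd_mult) (auto simp: N_def)
  then have "agree N (taylor_rest g y) (taylor_rest g z)" by (simp add: agree_iff_dvd)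
  then have "agree N (taylor_rest h y) (taylor_rest h z)"
    by (rule agree_trans[OF cong agree_trans[OF _ agree_sym[OF cong]]])
  then show ?thesis by (simp add: agree_iff_dvd N_def)
qed

text \<open>Let d, at most m, be the order of h'. The equation g = h(x + x^(m+1) z) is solved for z:
  dividing by x^(d+m+1) and by the unit part of h' turns it into a fixed point equation. It
  contracts because the quadratic remainder gains m + 1 orders a second time, more than the d lost
  to h'.\<close>

lemma right_equivalent_determinacy:
  fixes g h :: "'k::field fps"
  assumes m: "1 \<le> m" and d: "\<exists>i\<le>Suc m. of_nat i * h $ i \<noteq> 0" and gh: "agree (2 * m + 2) g h"
  shows "right_equivalent h g"
proof -
  have "\<exists>i<Suc m. fps_deriv h $ i \<noteq> 0" using d deriv_order_iff[of "Suc m" h] by blast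
  then have nz: "fps_deriv h \<noteq> 0" by (auto simp del: fps_deriv_nth)
  define d where "d = subdegree (fps_deriv h)"
  obtain i where "i < Suc m" "fps_deriv h $ i \<noteq> 0" using \<open>\<exists>i<Suc m. _\<close> by blast
  then have dm: "d \<le> m" using subdegree_leI[of "fps_deriv h" i] by (simp add: d_def del: fps_deriv_nth)
  define u where "u = fps_shift d (fps_deriv h)"
  have u: "fps_deriv h = fps_X ^ d * u"
    unfolding u_def d_def by (subst mult.commute) (rule subdegree_decompose)
  have u0: "u $ 0 \<noteq> 0"
    unfolding u_def fps_shift_nth add_0 d_def by (rule nth_subdegree_nonzero[OF nz])
  define a where "a = Suc m"
  define F where "F z = taylor_rest h (fps_X ^ a * z)" for z
  define s where "s = d + a"
  have F_diff: "fps_X ^ (n + s + 1) dvd F y - F z" if "fps_X ^ n dvd y - z" for n y z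
  proof -
    have "fps_X ^ (n + a + a) dvd F y - F z"
      unfolding F_def
    proof (rule taylor_rest_diff)
      show "fps_X ^ (n + a) dvd fps_X ^ a * y - fps_X ^ a * z"
        unfolding right_diff_distrib[symmetric] add.commute[of n] power_add by (intro mult_dvd_mono that dvd_refl)
    qed (simp_all add: a_def)
    then show ?thesis by (rule X_power_dvd_mono[rotated]) (use dm in \<open>simp add: s_def a_def\<close>)
  qed
  have gF: "fps_X ^ s dvd g - h - F z" for z
  proof -
    have "fps_X ^ (2 * m + 2) dvd g - h" using gh by (simp add: agree_iff_dvd)
    then have "fps_X ^ s dvd g - h" by (rule X_power_dvd_mono[rotated]) (use dm in \<open>simp add: s_def a_def\<close>)
    moreover have "F 0 = 0" by (simp add: F_def taylor_rest_def)
    then have "fps_X ^ s dvd F z"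
      using F_diff[of 0 z 0] X_power_dvd_mono[of s "0 + s + 1" "F z"] by simp
    ultimately show ?thesis by simp
  qed
  define \<Phi> where "\<Phi> z = inverse u * fps_shift s (g - h - F z)" for z
  have contr: "agree (Suc n) (\<Phi> y) (\<Phi> z)" if "agree n y z" for n y z
  proof -
    have "agree (Suc n) (fps_shift s (g - h - F y)) (fps_shift s (g - h - F z))"
      using F_diff[of n y z] that by (auto simp: agree_iff_dvd[symmetric]) (auto simp: agree_def)
    then show ?thesis unfolding \<Phi>_def by (intro agree_mult) auto
  qed
  obtain z where z: "\<Phi> z = z" by (rule fps_fixed_point[of \<Phi>, OF contr]) blast+
  have "fps_deriv h * (fps_X ^ a * z) = fps_X ^ s * (u * \<Phi> z)" by (simp add: u z s_def power_add algebra_simps)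
  also have "u * \<Phi> z = fps_shift s (g - h - F z)"
    using u0 by (simp add: \<Phi>_def mult.assoc[symmetric] inverse_mult_eq_1')
  also have "fps_X ^ s * fps_shift s (g - h - F z) = g - h - F z"
    using gF[of z] by (auto elim!: dvdE simp: fps_shift_times_fps_X_power mult.commute)
  finally have "g = h oo (fps_X + fps_X ^ a * z)" by (simp add: F_def taylor_rest_def algebra_simps)
  moreover have "coord_change (fps_X + fps_X ^ a * z)"
    using m by (simp add: coord_change_def fps_X_power_mult_nth a_def del: power_Suc)
  ultimately show ?thesis unfolding right_equivalent_iff by blast
qed

lemma right_determined_compose:
  fixes g :: "'k::field fps"
  assumes \<phi>: "coord_change \<phi>" and g: "right_determined k g" "g $ 0 = 0"
  shows "right_determined k (g oo \<phi>)"
  unfolding right_determined_def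
proof (intro allI impI)
  fix h assume h: "fps_X dvd h \<and> jet k h = jet k (g oo \<phi>)"
  obtain \<psi> where \<psi>: "coord_change \<psi>" "\<phi> oo \<psi> = fps_X" "\<psi> oo \<phi> = fps_X" using \<phi> by (rule coord_change_inverse)
  note 0 = coord_changeD(1)[OF \<phi>] coord_changeD(1)[OF \<psi>(1)]
  have h0: "h $ 0 = 0" using h by (simp add: X_dvd_iff)
  have "jet k (h oo \<psi>) = jet_subst k \<psi> (jet k h)" by (rule jet_subst_jet[symmetric, OF h0 0(2)])
  also have "\<dots> = jet k ((g oo \<phi>) oo \<psi>)" using h 0 g(2) by (simp add: jet_subst_jet)
  also have "(g oo \<phi>) oo \<psi> = g" using 0 by (simp add: fps_compose_assoc[symmetric] \<psi>(2))
  finally have "right_equivalent (h oo \<psi>) g" using g(1) h0 0 unfolding right_determined_def by (simp add: X_dvd_iff)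
  then obtain \<chi> where \<chi>: "coord_change \<chi>" "g = (h oo \<psi>) oo \<chi>" unfolding right_equivalent_iff by blast
  then have "g oo \<phi> = h oo (\<psi> oo (\<chi> oo \<phi>))"
    using 0 coord_changeD(1)[OF \<chi>(1)] by (simp add: fps_compose_assoc)
  then show "right_equivalent h (g oo \<phi>)"
    unfolding right_equivalent_iff using \<phi> \<psi>(1) \<chi>(1) by (blast intro: coord_change_compose)
qed

section \<open>The Milnor number as the order of the derivative\<close>

lemma fps_const_sum: "fps_const (\<Sum>i\<in>A. f i) = (\<Sum>i\<in>A. fps_const (f i :: 'k::field))"
  by (induction A rule: infinite_finite_induct) (simp_all flip: fps_const_add)

text \<open>With fewer than n classes, the reductions of 1, x, ..., x^(n-1) would be linearly
  dependent, giving a nonzero polynomial of degree below n that is divisible by x^n.\<close>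

lemma basis_modulo_card_ge:
  fixes W :: "'k::field fps set"
  assumes W: "\<And>h. h \<in> W \<Longrightarrow> fps_X ^ n dvd h" and B: "basis_modulo W B"
  shows "n \<le> card B"
proof (rule ccontr)
  assume "\<not> n \<le> card B"
  moreover have "finite B" using B by (simp add: basis_modulo_def)
  have "\<exists>c. h - (\<Sum>b\<in>B. fps_const (c b) * b) \<in> W" for h
    using B unfolding basis_modulo_def by blast
  then obtain c where c: "\<And>h. h - (\<Sum>b\<in>B. fps_const (c h b) * b) \<in> W" by metis
  ultimately obtain x where x: "\<exists>i<n. x i \<noteq> 0" "\<And>b. b \<in> B \<Longrightarrow> (\<Sum>i<n. x i * c (fps_X ^ i) b) = 0"
    using linear_dependence[OF \<open>finite B\<close>, of "{..<n}" "\<lambda>i. c (fps_X ^ i)"] by auto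
  let ?r = "\<lambda>i. fps_X ^ i - (\<Sum>b\<in>B. fps_const (c (fps_X ^ i) b) * b) :: 'k fps"
  have "(\<Sum>i<n. fps_const (x i) * (\<Sum>b\<in>B. fps_const (c (fps_X ^ i) b) * b)) =
      (\<Sum>b\<in>B. fps_const (\<Sum>i<n. x i * c (fps_X ^ i) b) * b)"
    unfolding sum_distrib_left by (subst sum.swap) (simp add: fps_const_sum sum_distrib_right mult.assoc[symmetric])
  also have "\<dots> = 0" by (simp add: x(2))
  finally have "(\<Sum>i<n. fps_const (x i) * ?r i) = (\<Sum>i<n. fps_const (x i) * fps_X ^ i)"
    by (simp add: right_diff_distrib sum_subtractf)
  moreover have "fps_X ^ n dvd (\<Sum>i<n. fps_const (x i) * ?r i)" using W[OF c] by (intro dvd_sum dvd_mult)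
  ultimately have "fps_X ^ n dvd (\<Sum>i<n. fps_const (x i) * fps_X ^ i)" by simp
  moreover have "(\<Sum>i<n. fps_const (x i) * fps_X ^ i) $ j = x j" if "j < n" for j
    using that by (simp add: fps_sum_nth fps_X_power_nth if_distrib cong: if_cong)
  ultimately have "x j = 0" if "j < n" for j using that by (simp add: X_power_dvd_iff)
  then show False using x(1) by blast
qed

lemma basis_modulo_X_power:
  "basis_modulo {h. fps_X ^ n dvd h} ((\<lambda>i. fps_X ^ i :: 'k::field fps) ` {..<n})"
  unfolding basis_modulo_def
proof (intro conjI allI)
  let ?B = "(\<lambda>i. fps_X ^ i :: 'k fps) ` {..<n}"
  have inj: "inj_on (\<lambda>i. fps_X ^ i :: 'k fps) {..<n}" by (intro inj_onI) (metis fps_X_power_subdegree)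
  have nth: "(\<Sum>b\<in>?B. fps_const (c b) * b) $ i = c (fps_X ^ i)" if "i < n" for c i
    using that by (simp add: sum.reindex[OF inj] fps_sum_nth fps_X_power_nth if_distrib cong: if_cong)
  have iff: "fps_X ^ n dvd h - (\<Sum>b\<in>?B. fps_const (c b) * b) \<longleftrightarrow> (\<forall>i<n. c (fps_X ^ i) = h $ i)" for h c
    by (auto simp: X_power_dvd_iff nth)
  fix h :: "'k fps"
  show "\<exists>!c. (\<forall>b. b \<notin> ?B \<longrightarrow> c b = 0) \<and> h - (\<Sum>b\<in>?B. fps_const (c b) * b) \<in> {h. fps_X ^ n dvd h}"
    unfolding mem_Collect_eq iff
  proof (rule ex1I)
    show "(\<forall>b. b \<notin> ?B \<longrightarrow> (if b \<in> ?B then h $ subdegree b else 0) = 0) \<and>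
        (\<forall>i<n. (if fps_X ^ i \<in> ?B then h $ subdegree (fps_X ^ i :: 'k fps) else 0) = h $ i)"
      by (auto simp: fps_X_power_subdegree)
    fix c assume c: "(\<forall>b. b \<notin> ?B \<longrightarrow> c b = 0) \<and> (\<forall>i<n. c (fps_X ^ i) = h $ i)"
    show "c = (\<lambda>b. if b \<in> ?B then h $ subdegree b else 0)"
      using c by (auto simp: fun_eq_iff fps_X_power_subdegree)
  qed
qed simp

text \<open>The ideal j(f) is generated by x^d with d the order of f', so the Milnor number is d;
  its finiteness excludes f' = 0.\<close>

lemma milnor_number_deriv:
  fixes f :: "'k::field fps"
  assumes "milnor_number f = enat \<mu>"
  shows "\<forall>i\<le>\<mu>. of_nat i * f $ i = 0" "of_nat (Suc \<mu>) * f $ Suc \<mu> \<noteq> 0"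
proof -
  have "\<exists>B. basis_modulo (jacobian_ideal f) B"
    using assms by (rule_tac ccontr) (simp add: milnor_number_def Inf_enat_def)
  then obtain B where B: "basis_modulo (jacobian_ideal f) B" by blast
  have nz: "fps_deriv f \<noteq> 0"
  proof
    assume "fps_deriv f = 0"
    \<comment> \<open>The zero ideal lies in every power of the maximal ideal, so the lower bound
      for the size of \<open>B\<close> would hold for every n.\<close>
    then have "Suc (card B) \<le> card B" by (intro basis_modulo_card_ge[OF _ B]) (auto simp: jacobian_ideal_def)
    then show False by simp
  qed
  define d where "d = subdegree (fps_deriv f)"
  have J: "jacobian_ideal f = {h. fps_X ^ d dvd h}"
  proof -
    have "fps_deriv f dvd h \<longleftrightarrow> fps_X ^ d dvd h" for h :: "'k fps"
      using nz by (cases "h = 0") (auto simp: fps_dvd_iff d_def)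
    moreover have "jacobian_ideal f = {h. fps_deriv f dvd h}" by (auto simp: jacobian_ideal_def dvd_def mult.commute)
    ultimately show ?thesis by simp
  qed
  have inj: "inj_on (\<lambda>i. fps_X ^ i :: 'k fps) {..<d}" by (intro inj_onI) (metis fps_X_power_subdegree)
  have "milnor_number f \<le> enat d"
    unfolding milnor_number_def J using basis_modulo_X_power[of d] card_image[OF inj]
    by (intro Inf_lower) force
  moreover have "enat d \<le> milnor_number f"
    unfolding milnor_number_def J by (intro Inf_greatest) (auto intro!: basis_modulo_card_ge[of "{h. fps_X ^ d dvd h}" d])
  ultimately have \<mu>: "\<mu> = subdegree (fps_deriv f)" using assms by (simp add: d_def)
  have "\<forall>j<\<mu>. fps_deriv f $ j = 0" "fps_deriv f $ \<mu> \<noteq> 0"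
    unfolding \<mu> using nth_less_subdegree_zero nth_subdegree_nonzero[OF nz] by blast+
  then show "\<forall>i\<le>\<mu>. of_nat i * f $ i = 0" "of_nat (Suc \<mu>) * f $ Suc \<mu> \<noteq> 0"
    using deriv_order_iff[of \<mu> f] unfolding fps_deriv_nth Suc_eq_plus1 by blast+
qed

text \<open>As n is invertible in K, the series (1 + x)^n - 1 has an inverse Q under composition,
  and 1 + Q is an n-th root of 1 + x. Substitution and a root of the constant term give the general
  case.\<close>

lemma fps_nth_root:
  fixes v :: "'k::alg_closed_field fps"
  assumes n: "of_nat n \<noteq> (0::'k)" and v: "v $ 0 \<noteq> 0"
  obtains w where "w ^ n = v" "w $ 0 \<noteq> 0"
proof -
  have n0: "n > 0" using n by (cases n) auto
  define P where "P = (1 + fps_X :: 'k fps) ^ n - 1"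
  have "fps_deriv P $ 0 = of_nat n" by (simp add: P_def fps_deriv_power fps_power_zeroth)
  then have "coord_change P" using n by (simp add: coord_change_def P_def fps_power_zeroth)
  then obtain Q where Q: "coord_change Q" "P oo Q = fps_X" by (rule coord_change_inverse)
  have Q0: "Q $ 0 = 0" using Q(1) by (rule coord_changeD)
  have "P oo Q = (1 + Q) ^ n - 1"
    unfolding P_def by (simp add: fps_compose_sub_distrib fps_compose_power[OF Q0, symmetric] fps_compose_add_distrib fps_X_fps_compose_startby0[OF Q0])
  then have Qn: "(1 + Q) ^ n = 1 + fps_X" using Q(2) by (simp add: algebra_simps)
  obtain c where c: "c ^ n = v $ 0" using nth_root_exists[OF n0] by blast
  define s where "s = fps_const (1 / v $ 0) * v - 1"
  have s0: "s $ 0 = 0" using v by (simp add: s_def)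
  have "(fps_const c * ((1 + Q) oo s)) ^ n = fps_const (v $ 0) * ((1 + Q) ^ n oo s)"
    by (simp add: power_mult_distrib fps_const_power c fps_compose_power[OF s0])
  also have "\<dots> = fps_const (v $ 0) * (1 + s)"
    by (simp add: Qn fps_compose_add_distrib fps_X_fps_compose_startby0[OF s0])
  also have "\<dots> = v" using v by (simp add: s_def mult.assoc[symmetric] fps_const_mult)
  finally show ?thesis using v that n0 by (metis fps_power_zeroth power_0_left not_gr_zero)
qed

text \<open>Write f = x^n v and extract an n-th root w of the unit v; then x w is the required
  coordinate.\<close>

lemma right_equivalent_X_power:
  fixes f :: "'k::alg_closed_field fps"
  assumes f: "\<forall>i<n. f $ i = 0" "f $ n \<noteq> 0" and n: "of_nat n \<noteq> (0::'k)"
  shows "right_equivalent f (fps_X ^ n)"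
proof -
  have "fps_X ^ n dvd f" using f(1) by (simp add: X_power_dvd_iff)
  then obtain v where v: "f = fps_X ^ n * v" by (rule dvdE)
  then have "v $ 0 \<noteq> 0" using f(2) by (simp add: fps_X_power_mult_nth)
  then obtain w where w: "w ^ n = v" "w $ 0 \<noteq> 0" by (rule fps_nth_root[OF n])
  have \<phi>: "coord_change (fps_X * w)" using w(2) by (simp add: coord_change_def)
  then have "fps_X ^ n oo (fps_X * w) = f"
    by (simp add: fps_compose_power[symmetric] fps_X_fps_compose_startby0 coord_changeD v w(1)[symmetric] power_mult_distrib)
  then have "right_equivalent (fps_X ^ n) f" using \<phi> unfolding right_equivalent_iff by blast
  then show ?thesis by (rule right_equivalent_sym)
qed

section \<open>The right modality\<close>

lemma jet_space_topology [simp]: "topol (jet_space k) = zariski {1..k}"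
  by (simp add: jet_space_def affine_space_def)

lemma jet_flat_iff:
  "m \<le> k \<Longrightarrow> jet k f \<in> flat_jets k m \<longleftrightarrow> (\<forall>i\<le>m. of_nat i * f $ i = (0::'k::field))"
proof -
  assume "m \<le> k"
  then have "of_nat i * jet k f i = of_nat i * f $ i" if "i \<le> m" for i
    using that by (cases "i = 0") (auto simp: jet_def)
  then have "(\<forall>i\<le>m. of_nat i * jet k f i = 0) \<longleftrightarrow> (\<forall>i\<le>m. of_nat i * f $ i = 0)" by metis
  then show ?thesis by (simp add: flat_jets_def)
qed

text \<open>The upper bound uses one neighbourhood, the jets whose derivative has order at most m;
  the lower bound holds for every neighbourhood. Both hold for each stratification, so the value is
  common to all.\<close>

lemma modality_jet:
  fixes f :: "'k::alg_closed_field fps"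
  assumes p: "CHAR('k) = p" "prime p" and k: "m < k"
    and Jk: "\<And>j. m < j \<Longrightarrow> j * (p - 1) < m * p \<Longrightarrow> \<not> p dvd j \<Longrightarrow> j \<le> k"
    and f: "\<forall>i\<le>m. of_nat i * f $ i = 0" "of_nat (Suc m) * f $ Suc m \<noteq> 0"
  shows "modality (jet_group k) (jet_action k) (jet_space k) (jet k f) = enat (m div p)"
proof -
  have flat: "jet k f \<in> flat_jets k m" using f(1) k by (simp add: jet_flat_iff)
  have not_flat: "jet k f \<notin> flat_jets k (Suc m)" using f(2) k jet_flat_iff[of "Suc m" k f] by auto
  have eq: "modality_point_wrt (jet_space k) S (jet k f) = enat (m div p)"
    if S: "rosenlicht_stratification (jet_group k) (jet_action k) (jet_space k) S"
    for S :: "(nat \<Rightarrow> 'k, (nat \<Rightarrow> 'k) set, 'k) stratum list"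
  proof (rule antisym)
    let ?U = "affine_points {1..k} - flat_jets k (Suc m) :: (nat \<Rightarrow> 'k) set"
    have "openin (zariski {1..k}) ?U"
      using openin_diff[OF openin_topspace closedin_flat_jets[of k "Suc m"]] by simp
    then have "modality_point_wrt (jet_space k) S (jet k f) \<le> modality_open_wrt S ?U"
      unfolding modality_point_wrt_def using not_flat by (intro INF_lower) simp
    also have "\<dots> \<le> enat (m div p)"
      unfolding modality_open_wrt_def
    proof (rule SUP_least)
      fix t assume "t \<in> set S"
      then obtain i A Y pr where i: "i < length S" "S ! i = (A, Y, pr)" "t = (A, Y, pr)"
        by (metis in_set_conv_nth prod_cases3)
      show "(case t of (A, Y, pr) \<Rightarrow> krull_dim (topol Y) (pr ` (?U \<inter> A))) \<le> enat (m div p)"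
        using quotient_dim_le[OF p k jet_stratum(1-3)[OF S i(1,2)]] by (simp add: i(3))
    qed
    finally show "modality_point_wrt (jet_space k) S (jet k f) \<le> enat (m div p)" .
    show "enat (m div p) \<le> modality_point_wrt (jet_space k) S (jet k f)"
      unfolding modality_point_wrt_def
    proof (rule INF_greatest)
      fix U assume "U \<in> {U. openin (topol (jet_space k)) U \<and> jet k f \<in> U}"
      then show "enat (m div p) \<le> modality_open_wrt S U"
        using modality_open_ge[OF p k Jk S _ _ flat, of U] by simp
    qed
  qed
  obtain S :: "(nat \<Rightarrow> 'k, (nat \<Rightarrow> 'k) set, 'k) stratum list"
    where "rosenlicht_stratification (jet_group k) (jet_action k) (jet_space k) S"
    using rosenlicht_stratification_exists[OF p] by blast
  then show ?thesis unfolding modality_def using eq by (intro the_equality) (metis, metis)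
qed

text \<open>If k were at most m, deleting the term of index m + 1 would not change the k-jet, yet it
  raises the order of the derivative, which is an invariant.\<close>

lemma sufficiently_large_gt:
  fixes f :: "'k::field fps"
  assumes f0: "f $ 0 = 0"
    and f: "\<forall>i\<le>m. of_nat i * f $ i = 0" "of_nat (Suc m) * f $ Suc m \<noteq> 0"
    and k: "sufficiently_large k f"
  shows "m < k"
proof (rule ccontr)
  assume km: "\<not> m < k"
  define h where "h = f - fps_const (f $ Suc m) * fps_X ^ Suc m"
  have h0: "h $ 0 = 0" using f0 by (simp add: h_def)
  have hn: "h $ i = (if i = Suc m then 0 else f $ i)" for i
    by (simp add: h_def fps_X_power_nth del: power_Suc)
  have "right_determined k f"
    using k f0 unfolding sufficiently_large_def by (auto simp: X_dvd_iff)
  moreover have "jet k h = jet k f" using km by (auto simp: jet_def hn fun_eq_iff)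
  ultimately have "right_equivalent h f" using h0 by (simp add: right_determined_def X_dvd_iff)
  then obtain \<phi> where \<phi>: "coord_change \<phi>" "f = h oo \<phi>" unfolding right_equivalent_iff by blast
  have "\<forall>i\<le>Suc m. of_nat i * h $ i = 0" using f(1) by (auto simp: hn le_Suc_eq)
  then have "\<forall>i\<le>Suc m. of_nat i * f $ i = 0"
    unfolding \<phi>(2) using coord_changeD(1)[OF \<phi>(1)] by (rule deriv_order_compose)
  then show False using f(2) by blast
qed

text \<open>Two normal jets that differ in the coefficient of index \<open>j\<close> are not equivalent.\<close>

lemma sufficiently_large_ge:
  fixes f :: "'k::alg_closed_field fps"
  assumes p: "CHAR('k) = p" "prime p" and f0: "f $ 0 = 0"
    and f: "\<forall>i\<le>m. of_nat i * f $ i = 0"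
    and k: "m < k" "sufficiently_large k f" and j: "m < j" "j * (p - 1) < m * p" "\<not> p dvd j"
  shows "j \<le> k"
proof (rule ccontr)
  assume jk: "\<not> j \<le> k"
  have p2: "p \<ge> 2" using p(2) by (rule prime_ge_2_nat)
  have "Suc m * (p - 1) \<le> j * (p - 1)" using j(1) by (intro mult_le_mono1) simp
  then have pm: "p \<le> m" using j(2) mult_eq_mult_pred_add[of p m] p2 by simp
  \<comment> \<open>An auxiliary jet order large enough for all indices in the uniqueness of normal
    jets, independent of the given \<open>k\<close>.\<close>
  define k' where "k' = m * p"
  have j_le: "i \<le> k'" if "i * (p - 1) < m * p" for i
  proof -
    have "i * 1 \<le> i * (p - 1)" using p2 by (intro mult_le_mono2) simp
    then show ?thesis using that unfolding k'_def by linarith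
  qed
  have jk': "j \<in> {1..k'}" using j_le[OF j(2)] j(1) by simp
  have kk': "k \<le> k'" using jk jk' by simp
  have Ek: "e * p \<le> k'" if "e * (p - 1) < m" for e
  proof -
    have "e * 1 \<le> e * (p - 1)" using p2 by (intro mult_le_mono2) simp
    then show ?thesis unfolding k'_def using that by (intro mult_le_mono1) linarith
  qed
  obtain U where U: "openin (zariski {1..k}) U" "jet k f \<in> U"
    "\<And>g. fps_X dvd g \<Longrightarrow> jet k g \<in> U \<Longrightarrow> right_determined k g"
    using k(2) unfolding sufficiently_large_def by auto
  have flat: "jet k f \<in> flat_jets k m" using f k(1) by (simp add: jet_flat_iff)
  let ?D = "{v \<in> affine_points {1..k}. v p \<noteq> (0::'k)}" and ?e = "\<lambda>i. if i = p then 1 else 0 :: 'k"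
  have D: "openin (zariski {1..k}) ?D" using p2 pm k(1) by (intro openin_zariski_nonzero polyfun.coord) simp
  have e: "?e \<in> flat_jets k m" "?e \<in> ?D"
    using p2 pm k(1) p(1) by (auto simp: flat_jets_def affine_points_def)
  \<comment> \<open>\<open>f\<close> itself may have vanishing coefficient of index p; determinacy
    in a whole neighbourhood allows passing to a nearby jet that can be normalised.\<close>
  obtain g where g: "g \<in> flat_jets k m" "g \<in> U" "g p \<noteq> 0" using flat_jets_meet[OF U(1) D flat U(2) e] by blast
  have gp: "g \<in> affine_points {1..k}" using g(1) by (simp add: flat_jets_def)
  have gp': "g \<in> affine_points {1..k'}" using gp kk' by (auto simp: affine_points_def)
  have g': "g \<in> flat_jets k' m" using g(1) gp' by (simp add: flat_jets_def)
  have g0: "g 0 = 0" using gp by (rule affine_points_0)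
  obtain \<nu> where \<nu>: "\<And>v. v \<in> flat_jets k' m \<Longrightarrow> v p \<noteq> 0 \<Longrightarrow> \<nu> v \<in> jet_orbit k' v \<and> normal_jet p m (\<nu> v :: nat \<Rightarrow> 'k)"
    by (rule normal_form_exists[OF p pm, of k']) (use k(1) kk' in auto)
  obtain \<phi> where \<phi>: "coord_change \<phi>" "\<nu> g = jet_subst k' \<phi> g" using \<nu>[OF g' g(3)] by (auto simp: jet_orbit_def)
  define G where "G = Abs_fps g oo \<phi>"
  have G0: "G $ 0 = 0" using g0 by (simp add: G_def)
  have jG: "jet k' G = \<nu> g" using \<phi>(2) by (simp add: G_def jet_subst_def)
  have G_flat: "jet k' G \<in> flat_jets k' m"
    unfolding jG \<phi>(2) by (rule jet_invariantD(1)[OF jet_invariant_flat_jets g' \<phi>(1)])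
  have "right_determined k (Abs_fps g)" using g0 g(2) by (intro U(3)) (auto simp: X_dvd_iff jet_Abs_fps[OF gp])
  then have "right_determined k G" unfolding G_def using g0 by (intro right_determined_compose \<phi>) auto
  moreover have "jet k (G + fps_X ^ j) = jet k G" using jk by (auto simp: jet_def fps_X_power_nth)
  moreover have "(G + fps_X ^ j) $ 0 = 0" using G0 j(1) by (simp add: fps_X_power_nth)
  ultimately have "right_equivalent (G + fps_X ^ j) G" by (simp add: right_determined_def X_dvd_iff)
  then have "right_equivalent G (G + fps_X ^ j)" by (rule right_equivalent_sym)
  then obtain \<psi> where \<psi>: "coord_change \<psi>" "G + fps_X ^ j = G oo \<psi>" unfolding right_equivalent_iff by blast
  have "jet k' (G + fps_X ^ j) = jet_subst k' \<psi> (jet k' G)"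
    unfolding \<psi>(2) using G0 coord_changeD(1)[OF \<psi>(1)] by (simp add: jet_subst_jet)
  then have orb: "jet k' (G + fps_X ^ j) \<in> jet_orbit k' (jet k' G)" using \<psi>(1) by (auto simp: jet_orbit_def)
  have nG: "normal_jet p m (jet k' G)" unfolding jG using \<nu>[OF g' g(3)] by blast
  have "jet k' (G + fps_X ^ j) i = jet k' G i" if "p dvd i" for i
    using that j(3) by (auto simp: jet_def fps_X_power_nth)
  then have "normal_jet p m (jet k' (G + fps_X ^ j))" using nG by (simp add: normal_jet_def)
  from normal_jet_unique[OF p pm Ek G_flat nG orb this jk' j(2)]
  have "(G + fps_X ^ j) $ j = G $ j" using jk' by (simp add: jet_nth)
  then show False by (simp add: fps_X_power_nth)
qed

text \<open>On the open set where the derivative has order at most m, agreement of (2m + 1)-jets is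
  agreement modulo x^(2m+2), as \<open>right_equivalent_determinacy\<close> requires.\<close>

lemma sufficiently_large_exists:
  fixes f :: "'k::field fps"
  assumes m: "1 \<le> m" and f: "of_nat (Suc m) * f $ Suc m \<noteq> 0"
  shows "sufficiently_large (2 * m + 1) f"
  unfolding sufficiently_large_def
proof (intro exI conjI allI impI)
  let ?k = "2 * m + 1"
  let ?U = "affine_points {1..?k} - flat_jets ?k (Suc m) :: (nat \<Rightarrow> 'k) set"
  show "openin (topol (jet_space ?k)) ?U"
    using openin_diff[OF openin_topspace closedin_flat_jets[of ?k "Suc m"]] by simp
  show "jet ?k f \<in> ?U"
    using f m jet_flat_iff[of "Suc m" ?k f] by auto
  fix g :: "'k fps" assume g: "fps_X dvd g \<and> jet ?k g \<in> ?U"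
  show "right_determined ?k g"
    unfolding right_determined_def
  proof (intro allI impI)
    fix h assume h: "fps_X dvd h \<and> jet ?k h = jet ?k g"
    then have "jet ?k h \<notin> flat_jets ?k (Suc m)" using g by simp
    then have "\<exists>i\<le>Suc m. of_nat i * h $ i \<noteq> 0" using m jet_flat_iff[of "Suc m" ?k h] by auto
    moreover have "agree (2 * m + 2) g h" using g h jet_eq_iff[of g h ?k] by (simp add: X_dvd_iff)
    ultimately show "right_equivalent h g" using m by (intro right_equivalent_determinacy)
  qed
qed

text \<open>Every sufficiently large \<open>k\<close> satisfies the assumptions of
  \<open>modality_jet\<close>, which makes the value independent of \<open>k\<close>.\<close>

lemma right_modality_eq:
  fixes f :: "'k::alg_closed_field fps"
  assumes p: "CHAR('k) = p" "prime p" and m: "1 \<le> m" and f0: "f $ 0 = 0"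
    and f: "\<forall>i\<le>m. of_nat i * f $ i = 0" "of_nat (Suc m) * f $ Suc m \<noteq> 0"
  shows "right_modality f = enat (m div p)"
proof -
  have "modality (jet_group k) (jet_action k) (jet_space k) (jet k f) = enat (m div p)"
    if k: "sufficiently_large k f" for k
    using sufficiently_large_ge[OF p f0 f(1) sufficiently_large_gt[OF f0 f k] k]
    by (intro modality_jet[OF p sufficiently_large_gt[OF f0 f k] _ f])
  then show ?thesis
    unfolding right_modality_def using sufficiently_large_exists[OF m f(2)] by (intro the_equality) (metis, metis)
qed

theorem theorem3p1:
  fixes f :: "'k::alg_closed_field fps" and p \<mu> :: nat
  assumes "CHAR('k) = p" and "p > 0"
    and "fps_X ^ 2 dvd f"
    and "milnor_number f = enat \<mu>"
  shows "right_modality f = enat (\<mu> div p) \<and>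
    (right_simple f \<longleftrightarrow> \<mu> < p) \<and>
    (\<mu> < p \<longrightarrow> right_equivalent f (fps_X ^ (\<mu> + 1)))"
proof -
  have p: "prime p" using prime_CHAR_semidom[where 'a = 'k] assms(1,2) by simp
  have f01: "f $ 0 = 0" "f $ 1 = 0" using assms(3) by (simp_all add: X_power_dvd_iff)
  note \<mu> = milnor_number_deriv[OF assms(4)]
  \<comment> \<open>For \<open>\<mu>\<close> = 0 the linear coefficient of \<open>f\<close> would be
    nonzero, against the divisibility by x^2.\<close>
  have "\<mu> \<noteq> 0" using \<mu>(2) f01(2) by (intro notI) (simp flip: One_nat_def)
  then have rm: "right_modality f = enat (\<mu> div p)" using f01 by (intro right_modality_eq[OF assms(1) p _ _ \<mu>]) auto
  then have "right_simple f \<longleftrightarrow> \<mu> < p"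
    using assms(2) by (simp add: right_simple_def zero_enat_def div_eq_0_iff)
  moreover have "right_equivalent f (fps_X ^ (\<mu> + 1))" if "\<mu> < p"
  proof (rule right_equivalent_X_power)
    show "f $ (\<mu> + 1) \<noteq> 0" "of_nat (\<mu> + 1) \<noteq> (0::'k)" using \<mu>(2) unfolding Suc_eq_plus1 by auto
    \<comment> \<open>All positive indices up to \<open>\<mu>\<close> are below p and hence
      invertible in K, so the vanishing of i f_i gives that of f_i.\<close>
    show "\<forall>i<\<mu> + 1. f $ i = 0"
    proof (intro allI impI)
      fix i assume i: "i < \<mu> + 1"
      show "f $ i = 0"
      proof (cases "i = 0")
        case False
        then have "\<not> p dvd i" using i that by (auto dest: dvd_imp_le)
        moreover have "i \<le> \<mu>" using i by simp
        ultimately show ?thesis using \<mu>(1) assms(1) by (auto simp: of_nat_eq_0_iff_char_dvd)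
      qed (simp add: f01)
    qed
  qed
  ultimately show ?thesis using rm by blast
qed

end
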